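(* Let $(M,g)$ be a complete, non-compact Riemannian manifold, let $p\ge q>1$ and $s>p-1$, and let $V\in L^1(M)$ with $V>0$ a.e. on $M$. For $z\in\{p,q\}$ put $$s_z=\frac{zs}{s-z+1},\qquad \bar k_z=\frac{z-1}{s-z+1}.$$ Assume that for each $z\in\{p,q\}$ there exist constants $C_0,C>0$ such that, for every $R$ large enough and every $\epsilon>0$ small enough, both $$\int_{B_R\setminus B_{R/2}}V^{-\bar k_z+\epsilon}\,d\mu\le C R^{s_z+C_0\epsilon}(\log R)^{\bar k_z}$$ and $$\int_{B_R\setminus B_{R/2}}V^{-\bar k_z-\epsilon}\,d\mu\le C R^{s_z+C_0\epsilon}(\log R)^{\bar k_z}$$ hold. Let $u\in W^{1,p}_{loc}(M)\cap L^s_{loc}(M)$ be a nonnegative weak solution of $$\Delta_pu+\Delta_qu+V(x)u^s\le 0\quad\text{in } M.$$ Then $u\equiv 0$ a.e. on $M$.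
   Context: $\Delta_zu=\mathrm{div}(|\nabla u|^{z-2}\nabla u)$ for $z\in\{p,q\}$. $\mu$ is the Riemannian measure, $r(x)$ is the Riemannian distance from $x$ to a fixed point $x_0\in M$, and $B_R$ is the geodesic ball of radius $R$ centered at $x_0$. Weak solution: $u\in W^{1,p}_{loc}(M)\cap L^s_{loc}(M)$ is a nonnegative weak solution of $\Delta_pu+\Delta_qu+V(x)u^s\le0$ if $u\ge0$ and, for every $0\le\psi\in W^{1,p}(M)\cap L^\infty(M)$ with compact support, $$-\int_M|\nabla u|^{p-2}\langle\nabla u,\nabla\psi\rangle\,d\mu-\int_M|\nabla u|^{q-2}\langle\nabla u,\nabla\psi\rangle\,d\mu+\int_MVu^s\psi\,d\mu\le0.$$ *)

theory Defs
  imports "HOL-Analysis.Analysis"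
begin

section \<open>Smooth functions on open subsets of Euclidean space\<close>

text \<open>Only meant for open \<open>S\<close>, where it says that \<open>f\<close> is of class \<open>C\<^sup>k\<close> on \<open>S\<close>; partial
  derivatives are taken along the standard basis.\<close>

primrec Ck_on :: "nat \<Rightarrow> 'e::euclidean_space set \<Rightarrow> ('e \<Rightarrow> 'b::real_normed_vector) \<Rightarrow> bool" where
  "Ck_on 0 S f \<longleftrightarrow> continuous_on S f"
| "Ck_on (Suc k) S f \<longleftrightarrow> (\<forall>x\<in>S. f differentiable (at x)) \<and>
     (\<forall>b\<in>Basis. Ck_on k S (\<lambda>x. frechet_derivative f (at x) b))"

definition smooth_on :: "'e::euclidean_space set \<Rightarrow> ('e \<Rightarrow> 'b::real_normed_vector) \<Rightarrow> bool" where
  "smooth_on S f \<longleftrightarrow> (\<forall>k. Ck_on k S f)"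

definition test_function :: "'e::euclidean_space set \<Rightarrow> ('e \<Rightarrow> real) \<Rightarrow> bool" where
  "test_function \<Omega> \<phi> \<longleftrightarrow> smooth_on UNIV \<phi> \<and>
     compact (closure {y. \<phi> y \<noteq> 0}) \<and> closure {y. \<phi> y \<noteq> 0} \<subseteq> \<Omega>"

text \<open>\<open>h\<close> is the vector of weak partial derivatives of \<open>f\<close> on the open set \<open>\<Omega>\<close>.\<close>

definition weak_derivative ::
    "(real^'n) set \<Rightarrow> (real^'n \<Rightarrow> real) \<Rightarrow> (real^'n \<Rightarrow> real^'n) \<Rightarrow> bool" where
  "weak_derivative \<Omega> f h \<longleftrightarrow>
     (\<forall>K. compact K \<and> K \<subseteq> \<Omega> \<longrightarrow> set_integrable lborel K f \<and> set_integrable lborel K h) \<and>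
     (\<forall>\<phi> i. test_function \<Omega> \<phi> \<longrightarrow>
        (LINT y:\<Omega>|lborel. f y * frechet_derivative \<phi> (at y) (axis i 1))
          = - (LINT y:\<Omega>|lborel. (h y $ i) * \<phi> y))"


section \<open>Riemannian manifolds\<close>

text \<open>A manifold has the whole type \<open>'a\<close> as its point set and is given by an indexed atlas. The
  chart with index \<open>c\<close> is the restriction of \<open>cmap M c\<close> to the open set \<open>cdom M c\<close>, and
  \<open>metric M c x\<close> is the Gram matrix at \<open>x\<close> of the Riemannian metric with respect to the coordinate
  frame of that chart. Values outside \<open>cdom M c\<close> are irrelevant.\<close>

record ('i, 'a, 'n::finite) riem =
  charts :: "'i set"
  cdom :: "'i \<Rightarrow> 'a set"
  cmap :: "'i \<Rightarrow> 'a \<Rightarrow> real^'n"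
  metric :: "'i \<Rightarrow> 'a \<Rightarrow> real^'n^'n"

definition cinv :: "('i, 'a, 'n::finite) riem \<Rightarrow> 'i \<Rightarrow> real^'n \<Rightarrow> 'a" where
  "cinv M c = inv_into (cdom M c) (cmap M c)"

definition transition ::
    "('i, 'a, 'n::finite) riem \<Rightarrow> 'i \<Rightarrow> 'i \<Rightarrow> real^'n \<Rightarrow> real^'n" where
  "transition M c d = cmap M d \<circ> cinv M c"

definition jacobian ::
    "('i, 'a, 'n::finite) riem \<Rightarrow> 'i \<Rightarrow> 'i \<Rightarrow> 'a \<Rightarrow> real^'n^'n" where
  "jacobian M c d x = matrix (frechet_derivative (transition M c d) (at (cmap M c x)))"

text \<open>An arbitrary chart around \<open>x\<close>. It only serves to evaluate quantities that do not depend on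
  the chart.\<close>

definition chart_at :: "('i, 'a, 'n::finite) riem \<Rightarrow> 'a \<Rightarrow> 'i" where
  "chart_at M x = (SOME c. c \<in> charts M \<and> x \<in> cdom M c)"

subsection \<open>Curves and distance\<close>

definition C1_curve ::
    "('i, 'a::topological_space, 'n::finite) riem \<Rightarrow> real \<Rightarrow> real \<Rightarrow> (real \<Rightarrow> 'a) \<Rightarrow> bool" where
  "C1_curve M a b \<gamma> \<longleftrightarrow> continuous_on {a..b} \<gamma> \<and>
     (\<forall>c\<in>charts M. let T = {t\<in>{a..b}. \<gamma> t \<in> cdom M c} in
        \<exists>v. continuous_on T v \<and>
          (\<forall>t\<in>T. ((cmap M c \<circ> \<gamma>) has_vector_derivative v t) (at t within {a..b})))"

definition piecewise_C1_curve ::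
    "('i, 'a::topological_space, 'n::finite) riem \<Rightarrow> (real \<Rightarrow> 'a) \<Rightarrow> bool" where
  "piecewise_C1_curve M \<gamma> \<longleftrightarrow> continuous_on {0..1} \<gamma> \<and>
     (\<exists>P. finite P \<and>
        (\<forall>a b. 0 \<le> a \<and> a < b \<and> b \<le> 1 \<and> {a<..<b} \<inter> P = {} \<longrightarrow> C1_curve M a b \<gamma>))"

definition speed :: "('i, 'a, 'n::finite) riem \<Rightarrow> (real \<Rightarrow> 'a) \<Rightarrow> real \<Rightarrow> real" where
  "speed M \<gamma> t =
     (let c = chart_at M (\<gamma> t); v = vector_derivative (cmap M c \<circ> \<gamma>) (at t)
      in sqrt (v \<bullet> (metric M c (\<gamma> t) *v v)))"

definition curve_length :: "('i, 'a, 'n::finite) riem \<Rightarrow> (real \<Rightarrow> 'a) \<Rightarrow> real" where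
  "curve_length M \<gamma> = integral {0..1} (speed M \<gamma>)"

definition riem_dist ::
    "('i, 'a::topological_space, 'n::finite) riem \<Rightarrow> 'a \<Rightarrow> 'a \<Rightarrow> real" where
  "riem_dist M x y =
     Inf {curve_length M \<gamma> | \<gamma>. piecewise_C1_curve M \<gamma> \<and> \<gamma> 0 = x \<and> \<gamma> 1 = y}"

subsection \<open>The manifold structure\<close>

text \<open>Manifolds are connected and have no boundary. The last assumption says that the metric of the
  type \<open>'a\<close> is the geodesic distance. Since the geodesic distance of a connected Riemannian manifold
  always induces the manifold topology, this is no restriction; it makes \<open>dist\<close>, \<open>ball\<close> and
  \<open>complete\<close> the Riemannian notions.\<close>

locale riemannian_manifold =
  fixes M :: "('i, 'a::{metric_space, second_countable_topology}, 'n::finite) riem"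
  assumes charts_cover: "(\<Union>c\<in>charts M. cdom M c) = UNIV"
    and open_cdom: "\<And>c. c \<in> charts M \<Longrightarrow> open (cdom M c)"
    and open_cmap_image: "\<And>c. c \<in> charts M \<Longrightarrow> open (cmap M c ` cdom M c)"
    and chart_homeomorphism: "\<And>c. c \<in> charts M \<Longrightarrow>
      homeomorphism (cdom M c) (cmap M c ` cdom M c) (cmap M c) (cinv M c)"
    and smooth_transition: "\<And>c d. c \<in> charts M \<Longrightarrow> d \<in> charts M \<Longrightarrow>
      smooth_on (cmap M c ` (cdom M c \<inter> cdom M d)) (transition M c d)"
    and smooth_metric: "\<And>c. c \<in> charts M \<Longrightarrow>
      smooth_on (cmap M c ` cdom M c) (metric M c \<circ> cinv M c)"
    and metric_symmetric: "\<And>c x. c \<in> charts M \<Longrightarrow> x \<in> cdom M c \<Longrightarrow>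
      transpose (metric M c x) = metric M c x"
    and metric_positive: "\<And>c x v. c \<in> charts M \<Longrightarrow> x \<in> cdom M c \<Longrightarrow> v \<noteq> 0 \<Longrightarrow>
      v \<bullet> (metric M c x *v v) > 0"
    and metric_transition: "\<And>c d x. c \<in> charts M \<Longrightarrow> d \<in> charts M \<Longrightarrow>
      x \<in> cdom M c \<inter> cdom M d \<Longrightarrow>
      metric M c x = transpose (jacobian M c d x) ** metric M d x ** jacobian M c d x"
    and connected_space: "connected (UNIV :: 'a set)"
    and dist_eq_riem_dist: "\<And>x y. dist x y = riem_dist M x y"

text \<open>This condition determines \<open>\<mu>\<close>, because countably many charts cover the manifold.\<close>

definition riemannian_measure ::
    "('i, 'a::topological_space, 'n::finite) riem \<Rightarrow> 'a measure \<Rightarrow> bool" where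
  "riemannian_measure M \<mu> \<longleftrightarrow> sets \<mu> = sets borel \<and>
     (\<forall>c\<in>charts M. \<forall>A\<in>sets borel. A \<subseteq> cdom M c \<longrightarrow>
        emeasure \<mu> A =
          (\<integral>\<^sup>+y\<in>cmap M c ` A. ennreal (sqrt (det (metric M c (cinv M c y)))) \<partial>lborel))"

subsection \<open>Vector fields and weak gradients\<close>

text \<open>A vector field is given by its components \<open>X c x\<close> in every chart \<open>c\<close>, which are required to
  transform correctly at every point.\<close>

definition vector_field :: "('i, 'a, 'n::finite) riem \<Rightarrow> ('i \<Rightarrow> 'a \<Rightarrow> real^'n) \<Rightarrow> bool" where
  "vector_field M X \<longleftrightarrow> (\<forall>c\<in>charts M. \<forall>d\<in>charts M. \<forall>x\<in>cdom M c \<inter> cdom M d.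
     X d x = jacobian M c d x *v X c x)"

definition ginner ::
    "('i, 'a, 'n::finite) riem \<Rightarrow> ('i \<Rightarrow> 'a \<Rightarrow> real^'n) \<Rightarrow> ('i \<Rightarrow> 'a \<Rightarrow> real^'n) \<Rightarrow> 'a \<Rightarrow> real" where
  "ginner M X Y x = (let c = chart_at M x in X c x \<bullet> (metric M c x *v Y c x))"

definition gnorm :: "('i, 'a, 'n::finite) riem \<Rightarrow> ('i \<Rightarrow> 'a \<Rightarrow> real^'n) \<Rightarrow> 'a \<Rightarrow> real" where
  "gnorm M X x = sqrt (ginner M X X x)"

text \<open>\<open>X\<close> is the gradient of \<open>u\<close> if \<open>g(X, \<cdot>)\<close> is the weak differential of \<open>u\<close>. Weak gradients are
  unique up to null sets.\<close>

definition weak_gradient ::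
    "('i, 'a, 'n::finite) riem \<Rightarrow> ('a \<Rightarrow> real) \<Rightarrow> ('i \<Rightarrow> 'a \<Rightarrow> real^'n) \<Rightarrow> bool" where
  "weak_gradient M u X \<longleftrightarrow> vector_field M X \<and>
     (\<forall>c\<in>charts M. weak_derivative (cmap M c ` cdom M c)
        (u \<circ> cinv M c) ((\<lambda>x. metric M c x *v X c x) \<circ> cinv M c))"

subsection \<open>Function spaces\<close>

definition Lp :: "'a measure \<Rightarrow> real \<Rightarrow> ('a \<Rightarrow> real) \<Rightarrow> bool" where
  "Lp \<mu> p f \<longleftrightarrow> f \<in> borel_measurable \<mu> \<and> integrable \<mu> (\<lambda>x. \<bar>f x\<bar> powr p)"

definition Lp_loc :: "'a::topological_space measure \<Rightarrow> real \<Rightarrow> ('a \<Rightarrow> real) \<Rightarrow> bool" where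
  "Lp_loc \<mu> p f \<longleftrightarrow> f \<in> borel_measurable \<mu> \<and>
     (\<forall>K. compact K \<longrightarrow> set_integrable \<mu> K (\<lambda>x. \<bar>f x\<bar> powr p))"

definition L_infinity :: "'a measure \<Rightarrow> ('a \<Rightarrow> real) \<Rightarrow> bool" where
  "L_infinity \<mu> f \<longleftrightarrow> f \<in> borel_measurable \<mu> \<and> (\<exists>B. AE x in \<mu>. \<bar>f x\<bar> \<le> B)"

definition W1p :: "('i, 'a, 'n::finite) riem \<Rightarrow> 'a measure \<Rightarrow> real \<Rightarrow> ('a \<Rightarrow> real) \<Rightarrow> bool" where
  "W1p M \<mu> p f \<longleftrightarrow> Lp \<mu> p f \<and> (\<exists>X. weak_gradient M f X \<and> Lp \<mu> p (gnorm M X))"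

definition W1p_loc ::
    "('i, 'a::topological_space, 'n::finite) riem \<Rightarrow> 'a measure \<Rightarrow> real \<Rightarrow> ('a \<Rightarrow> real) \<Rightarrow> bool" where
  "W1p_loc M \<mu> p f \<longleftrightarrow> Lp_loc \<mu> p f \<and> (\<exists>X. weak_gradient M f X \<and> Lp_loc \<mu> p (gnorm M X))"

definition compactly_supported :: "'a::topological_space measure \<Rightarrow> ('a \<Rightarrow> real) \<Rightarrow> bool" where
  "compactly_supported \<mu> f \<longleftrightarrow> (\<exists>K. compact K \<and> (AE x in \<mu>. x \<notin> K \<longrightarrow> f x = 0))"


section \<open>Weak solutions of $\Delta_p u + \Delta_q u + V u^s \le 0$\<close>

text \<open>The integral of \<open>V u\<^sup>s \<psi> \<ge> 0\<close> always exists in \<open>[0,\<infinity>]\<close>, and the inequality forces it to be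
  finite, since the two gradient integrals are finite. As the Bochner integral of a non-integrable
  function is 0, this has to be demanded explicitly.\<close>

definition nonneg_weak_solution ::
    "('i, 'a::topological_space, 'n::finite) riem \<Rightarrow> 'a measure \<Rightarrow> real \<Rightarrow> real \<Rightarrow> real \<Rightarrow>
     ('a \<Rightarrow> real) \<Rightarrow> ('a \<Rightarrow> real) \<Rightarrow> bool" where
  "nonneg_weak_solution M \<mu> p q s V u \<longleftrightarrow>
     W1p_loc M \<mu> p u \<and> Lp_loc \<mu> s u \<and> (AE x in \<mu>. 0 \<le> u x) \<and>
     (\<forall>\<psi> X Y. W1p M \<mu> p \<psi> \<and> L_infinity \<mu> \<psi> \<and> compactly_supported \<mu> \<psi> \<and>
          (AE x in \<mu>. 0 \<le> \<psi> x) \<and> weak_gradient M u X \<and> weak_gradient M \<psi> Y \<longrightarrow>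
        integrable \<mu> (\<lambda>x. V x * u x powr s * \<psi> x) \<and>
        - (\<integral>x. gnorm M X x powr (p - 2) * ginner M X Y x \<partial>\<mu>)
        - (\<integral>x. gnorm M X x powr (q - 2) * ginner M X Y x \<partial>\<mu>)
        + (\<integral>x. V x * u x powr s * \<psi> x \<partial>\<mu>) \<le> 0)"


section \<open>The exponents $s_z$ and $\bar k_z$\<close>

definition s_exp :: "real \<Rightarrow> real \<Rightarrow> real" where
  "s_exp s z = z * s / (s - z + 1)"

definition k_exp :: "real \<Rightarrow> real \<Rightarrow> real" where
  "k_exp s z = (z - 1) / (s - z + 1)"

end

theory Submission
  imports Defs
begin

text \<open>
The inequality is tested with \<psi> = \<phi>^m (1 + u)^(-t), where \<phi> is a cutoff function with values in
[0, 1]. This function is admissible by the chain rule for weak derivatives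
(\<open>weak_derivative_chain\<close>, proved by mollification), and the test yields
(\<open>cutoff_energy_inequality\<close>), with the sums taken over z \<in> {p, q},

\<integral> V u^s (1 + u)^(-t) \<phi>^m + t \<Sum> \<integral> |\<nabla>u|^z (1 + u)^(-t-1) \<phi>^m
  \<le> m \<Sum> \<integral> \<phi>^(m-1) (1 + u)^(-t) |\<nabla>u|^(z-1) |\<nabla>\<phi>|.

Two applications of one form of Young's inequality (\<open>powr_interpolation\<close>) bound each flux term on the
right (\<open>flux_bound\<close>) by \<alpha> times a gradient term as on the left, plus \<eta> times an integral of
V (1 + u)^\<gamma> over the support of \<nabla>\<phi>, plus \<eta>^(-\<sigma>) \<integral> V^(-\<sigma>) (\<alpha>^(1-z) m^z |\<nabla>\<phi>|^z)^(1+\<sigma>),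
where \<alpha>, \<eta> > 0 are free and \<sigma> differs from k = (z-1)/(s-z+1) by O(1/N) for the parameters below, in
which \<alpha> is a multiple of 1/N.

The critical growth hypothesis makes the last integral bounded (\<open>weighted_slope_bounded\<close>).
Take for \<phi> a cutoff between the radii 2^N and 2^(2N) that is linear in log r up to smoothing. On the annulus of
outer radius R = 2^j its gradient is of order 1/(N R), so
(\<alpha>^(1-z) |\<nabla>\<phi>|^z)^(1+k) is of order N^(-1-k) R^(-z(1+k)). Since z(1+k) is the exponent s_z and
log R is of order N, each of the N annuli contributes O(1/N). The deviation of \<sigma> from k changes
this only by factors such as 2^(j c/N), which are bounded; its sign varies, whence the two growth conditions.

Two choices of the parameters finish the proof.
\<^item> With t = 1/N and \<alpha> = t/2 the gradient terms are absorbed into the left side. Hence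
  \<integral> V u^s is finite (\<open>energy_finite\<close>) and \<integral> |\<nabla>u|^z (1 + u)^(-t-1) \<phi>^m = O(N)
  (\<open>energy_bound\<close>). Integrability of V enters here, because (1 + u)^s replaces u^s.
\<^item> With t = 0 in the test function, but the gradient terms still weighted with t = 1/N and \<alpha> = \<kappa>/N, the
  first part of the flux bound is O(\<kappa>) by the previous step. The second part is \<eta> times the tail of a convergent
  integral, since \<nabla>\<phi> vanishes on the ball of radius 2^N. So N \<rightarrow> \<infinity>, then \<eta> \<rightarrow> \<infinity>, then
  \<kappa> \<rightarrow> 0 gives \<integral> V u^s = 0 (\<open>energy_small\<close>, \<open>vanishing\<close>), and u = 0 because V > 0.

The cutoffs come from the distance function. On a complete manifold closed balls are compact
(\<open>compact_cball_complete\<close>, after Hopf and Rinow), so finitely many coordinate patches cover such a ball,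
and the 1-Lipschitz distance can be mollified patch by patch to a C1 function of gradient at most 2
(\<open>smoothing\<close>), which is then composed with a logarithmic profile (\<open>log_cutoff_exists\<close>).
\<close>

section \<open>Functions of class C^k\<close>

lemma Ck_on_Suc_D: "Ck_on (Suc k) S f \<Longrightarrow> Ck_on k S f"
proof (induction k arbitrary: f)
  case 0
  then show ?case
    by simp (meson differentiable_at_withinI differentiable_imp_continuous_on differentiable_on_def)
next
  case (Suc k)
  then show ?case by simp
qed

lemma Ck_on_subset: "Ck_on k S f \<Longrightarrow> T \<subseteq> S \<Longrightarrow> Ck_on k T f"
  by (induction k arbitrary: f) (auto intro: continuous_on_subset)

lemma Ck_on_cong_imp:
  assumes "open S" "\<And>x. x \<in> S \<Longrightarrow> f x = g x" "Ck_on k S f"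
  shows "Ck_on k S g"
  using assms(2,3)
proof (induction k arbitrary: f g)
  case 0 then show ?case by (auto cong: continuous_on_cong)
next
  case (Suc k)
  have d: "(g has_derivative frechet_derivative f (at x)) (at x)" if "x \<in> S" for x
  proof -
    have "(f has_derivative frechet_derivative f (at x)) (at x)"
      using Suc.prems that by (simp add: frechet_derivative_works)
    then show ?thesis by (rule has_derivative_transform_within_open[OF _ assms(1) that]) (use Suc.prems in auto)
  qed
  then have eq: "frechet_derivative f (at x) = frechet_derivative g (at x)" if "x \<in> S" for x
    using frechet_derivative_at[OF d[OF that]] by simp
  have "Ck_on k S (\<lambda>x. frechet_derivative g (at x) b)" if "b \<in> Basis" for b
    by (rule Suc.IH[of "\<lambda>x. frechet_derivative f (at x) b"]) (use Suc.prems that eq in auto)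
  then show ?case using d by (auto simp: differentiable_def)
qed

lemma Ck_on_const: "Ck_on k S (\<lambda>_. c)"
  by (induction k arbitrary: c) auto

lemma Ck_on_add:
  assumes "open S" "Ck_on k S f" "Ck_on k S g"
  shows "Ck_on k S (\<lambda>x. f x + g x)"
  using assms(2,3)
proof (induction k arbitrary: f g)
  case 0 then show ?case by (auto intro: continuous_on_add)
next
  case (Suc k)
  have d: "((\<lambda>x. f x + g x) has_derivative (\<lambda>v. frechet_derivative f (at x) v + frechet_derivative g (at x) v)) (at x)" if "x \<in> S" for x
    using Suc.prems that by (intro has_derivative_add) (auto simp: frechet_derivative_works[symmetric])
  have "Ck_on k S (\<lambda>x. frechet_derivative (\<lambda>x. f x + g x) (at x) b)" if "b \<in> Basis" for b
    by (rule Ck_on_cong_imp[OF assms(1) _ Suc.IH[of "\<lambda>x. frechet_derivative f (at x) b" "\<lambda>x. frechet_derivative g (at x) b"]])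
       (use Suc.prems that frechet_derivative_at[OF d, symmetric] in auto)
  then show ?case using d by (auto simp: differentiable_def)
qed

lemma Ck_on_mult:
  fixes f g :: "'e::euclidean_space \<Rightarrow> real"
  assumes "open S" "Ck_on k S f" "Ck_on k S g"
  shows "Ck_on k S (\<lambda>x. f x * g x)"
  using assms(2,3)
proof (induction k arbitrary: f g)
  case 0 then show ?case by (auto intro: continuous_on_mult)
next
  case (Suc k)
  note fg = Ck_on_Suc_D[OF Suc.prems(1)] Ck_on_Suc_D[OF Suc.prems(2)]
  have d: "((\<lambda>x. f x * g x) has_derivative (\<lambda>v. f x * frechet_derivative g (at x) v + frechet_derivative f (at x) v * g x)) (at x)" if "x \<in> S" for x
    using Suc.prems that by (intro has_derivative_mult) (auto simp: frechet_derivative_works[symmetric])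
  have "Ck_on k S (\<lambda>x. frechet_derivative (\<lambda>x. f x * g x) (at x) b)" if "b \<in> Basis" for b
  proof (rule Ck_on_cong_imp[OF assms(1)])
    show "Ck_on k S (\<lambda>x. f x * frechet_derivative g (at x) b + frechet_derivative f (at x) b * g x)"
      using Suc.prems that by (intro Ck_on_add assms Suc.IH fg) auto
  qed (use frechet_derivative_at[OF d, symmetric] in auto)
  then show ?case using d by (auto simp: differentiable_def)
qed

text \<open>The chain rule turns \<phi> j into \<phi> (j + 1); carrying the whole sequence of successive derivatives is what
lets the induction on the order of differentiability go through.\<close>
lemma Ck_on_compose_real:
  fixes P :: "'e::euclidean_space \<Rightarrow> real" and \<phi> :: "nat \<Rightarrow> real \<Rightarrow> real"
  assumes "open S" and \<phi>: "\<And>i t. i < k \<Longrightarrow> (\<phi> (j + i) has_real_derivative \<phi> (j + Suc i) t) (at t)"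
    and cont: "continuous_on UNIV (\<phi> (j + k))" and P: "Ck_on k S P"
  shows "Ck_on k S (\<lambda>x. \<phi> j (P x))"
  using \<phi> cont P
proof (induction k arbitrary: j)
  case 0
  then show ?case by (auto intro: continuous_on_compose2)
next
  case (Suc k)
  have d: "((\<lambda>x. \<phi> j (P x)) has_derivative (\<lambda>v. frechet_derivative P (at x) v * \<phi> (Suc j) (P x))) (at x)" if "x \<in> S" for x
  proof -
    have "(P has_derivative frechet_derivative P (at x)) (at x)" 
      using Suc.prems(3) that by (simp add: frechet_derivative_works)
    then show ?thesis using DERIV_compose_FDERIV[of "\<phi> j" "\<phi> (Suc j) (P x)" P x _ UNIV] Suc.prems(1)[of 0 "P x"] by simp
  qed
  have "Ck_on k S (\<lambda>x. frechet_derivative (\<lambda>x. \<phi> j (P x)) (at x) b)" if "b \<in> Basis" for b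
  proof (rule Ck_on_cong_imp[OF assms(1)])
    show "Ck_on k S (\<lambda>x. frechet_derivative P (at x) b * \<phi> (Suc j) (P x))"
      using Suc.prems(1)[of "Suc _"] Suc.prems that by (intro Ck_on_mult assms Suc.IH Ck_on_Suc_D[OF Suc.prems(3)]) auto
  qed (use frechet_derivative_at[OF d, symmetric] in auto)
  then show ?case using d by (auto simp: differentiable_def)
qed

lemma Ck_on_inner: "Ck_on k S (\<lambda>y. c \<bullet> (y - a :: 'e::euclidean_space))"
proof (cases k)
  case 0 then show ?thesis by (auto intro!: continuous_intros)
next
  case (Suc k)
  have d: "((\<lambda>y. c \<bullet> (y - a)) has_derivative (\<lambda>v. c \<bullet> v)) (at x)" for x
    by (auto intro!: derivative_eq_intros)
  show ?thesis unfolding Suc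
    using frechet_derivative_at[OF d, symmetric] d by (auto simp: differentiable_def Ck_on_const)
qed

lemma Ck_on_norm_square: "Ck_on k S (\<lambda>y. (norm (y - a :: 'e::euclidean_space))\<^sup>2)"
proof (cases k)
  case 0 then show ?thesis by (auto intro!: continuous_intros)
next
  case (Suc k)
  have d: "((\<lambda>y. (norm (y - a))\<^sup>2) has_derivative (\<lambda>v. (2 *\<^sub>R v) \<bullet> (x - a))) (at x)" for x
    unfolding power2_norm_eq_inner by (auto intro!: derivative_eq_intros simp: inner_commute algebra_simps)
  show ?thesis unfolding Suc
    using frechet_derivative_at[OF d, symmetric] d by (auto simp: differentiable_def simp del: inner_scaleR_left intro: Ck_on_inner)
qed

section \<open>A smooth bump function\<close>

text \<open>For P = 1 this is exp(-1/t) on the positive half line, extended by zero. The factor P(1/t) makes the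
family closed under differentiation.\<close>
definition flat_exp :: "real poly \<Rightarrow> real \<Rightarrow> real" where
  "flat_exp P t = (if t > 0 then poly P (1 / t) * exp (- 1 / t) else 0)"

lemma poly_exp_decay: "((\<lambda>y. poly (P :: real poly) y * exp (- y)) \<longlongrightarrow> 0) at_top"
proof -
  have "((\<lambda>y. \<Sum>i\<le>degree P. coeff P i * (y ^ i / exp y)) \<longlongrightarrow> (\<Sum>i\<le>degree P. coeff P i * 0)) at_top"
    by (intro tendsto_sum tendsto_mult tendsto_const tendsto_power_div_exp_0)
  moreover have "(\<Sum>i\<le>degree P. coeff P i * (y ^ i / exp y)) = poly P y * exp (- y)" for y
    unfolding poly_altdef sum_distrib_right by (intro sum.cong) (auto simp: exp_minus divide_inverse)
  ultimately show ?thesis by simp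
qed

text \<open>The point t = 0 is the only delicate one: there the difference quotient from the right is again a polynomial in
1/t times exp(-1/t), which tends to zero.\<close>
lemma flat_exp_deriv:
  "(flat_exp P has_real_derivative flat_exp ([:0, 0, 1:] * (P - pderiv P)) t) (at t)"
proof -
  consider "t > 0" | "t < 0" | "t = 0" by linarith
  then show ?thesis
  proof cases
    case 1
    have "((\<lambda>t. poly P (1 / t) * exp (- 1 / t)) has_real_derivative
       (poly (pderiv P) (1 / t) * (- 1 / t\<^sup>2)) * exp (- 1 / t) + exp (- 1 / t) * (1 / t\<^sup>2) * poly P (1 / t)) (at t)"
      using 1 by (auto intro!: derivative_eq_intros DERIV_chain2[OF poly_DERIV] simp: power2_eq_square)
    moreover have "(poly (pderiv P) (1 / t) * (- 1 / t\<^sup>2)) * exp (- 1 / t) + exp (- 1 / t) * (1 / t\<^sup>2) * poly P (1 / t)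
       = flat_exp ([:0, 0, 1:] * (P - pderiv P)) t"
      using 1 by (simp add: flat_exp_def power2_eq_square algebra_simps)
    ultimately have "((\<lambda>t. poly P (1 / t) * exp (- 1 / t)) has_real_derivative flat_exp ([:0, 0, 1:] * (P - pderiv P)) t) (at t)" by simp
    then show ?thesis
      by (rule has_field_derivative_transform_within_open[where S="{0<..}"]) (use 1 in \<open>auto simp: flat_exp_def\<close>)
  next
    case 2
    have "((\<lambda>t. 0) has_real_derivative 0) (at t)" by simp
    then have "(flat_exp P has_real_derivative 0) (at t)"
      by (rule has_field_derivative_transform_within_open[where S="{..<0}"]) (use 2 in \<open>auto simp: flat_exp_def\<close>)
    then show ?thesis using 2 by (simp add: flat_exp_def)
  next
    case 3
    have r: "((\<lambda>h. flat_exp P h / h) \<longlongrightarrow> 0) (at_right 0)"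
    proof -
      have "((\<lambda>h. poly (pCons 0 P) (inverse h) * exp (- inverse h)) \<longlongrightarrow> 0) (at_right 0)"
        by (rule filterlim_compose[OF poly_exp_decay filterlim_inverse_at_top_right])
      then show ?thesis
        by (rule Lim_transform_eventually) (auto simp: eventually_at_right_field flat_exp_def divide_inverse intro!: exI[of _ 1])
    qed
    have l: "((\<lambda>h. flat_exp P h / h) \<longlongrightarrow> 0) (at_left 0)"
      by (rule Lim_transform_eventually[OF tendsto_const]) (auto simp: eventually_at_left_field flat_exp_def intro!: exI[of _ "-1"])
    have "((\<lambda>h. flat_exp P h / h) \<longlongrightarrow> 0) (at 0)" using filterlim_split_at[OF l r] .
    then show ?thesis using 3 by (simp add: DERIV_def flat_exp_def)
  qed
qed

text \<open>The polynomials for which \<open>flat_exp (flat_poly n)\<close> is the derivative of order n of \<open>flat_exp 1\<close>.\<close>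
fun flat_poly :: "nat \<Rightarrow> real poly" where
  "flat_poly 0 = 1"
| "flat_poly (Suc n) = [:0, 0, 1:] * (flat_poly n - pderiv (flat_poly n))"

lemma flat_exp_deriv_n: "(flat_exp (flat_poly n) has_real_derivative flat_exp (flat_poly (Suc n)) t) (at t)"
  using flat_exp_deriv[of "flat_poly n" t] by simp

lemma flat_exp_continuous: "continuous_on UNIV (flat_exp P)"
  using flat_exp_deriv by (intro continuous_at_imp_continuous_on) (blast intro: DERIV_isCont)

text \<open>The bump is not normalised; the mollifiers below divide by its integral.\<close>
definition bump :: "real \<Rightarrow> 'e::euclidean_space \<Rightarrow> real" where
  "bump \<epsilon> y = flat_exp 1 (1 - (norm y)\<^sup>2 / \<epsilon>\<^sup>2)"

definition bump_grad :: "real \<Rightarrow> 'e::euclidean_space \<Rightarrow> 'e" where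
  "bump_grad \<epsilon> y = (flat_exp (flat_poly 1) (1 - (norm y)\<^sup>2 / \<epsilon>\<^sup>2) * (- 2 / \<epsilon>\<^sup>2)) *\<^sub>R y"

lemma bump_nonneg: "0 \<le> bump \<epsilon> y" by (simp add: bump_def flat_exp_def)

lemma norm_ratio_ge_1: "0 < \<epsilon> \<Longrightarrow> (1 - (norm y)\<^sup>2 / \<epsilon>\<^sup>2 > 0) = (norm y < \<epsilon>)" for y :: "'e::euclidean_space"
  by (auto simp: field_simps power_mono_iff intro: power_less_imp_less_base power_strict_mono)

lemma bump_pos: "0 < \<epsilon> \<Longrightarrow> (bump \<epsilon> y \<noteq> 0) = (norm y < \<epsilon>)"
  unfolding bump_def flat_exp_def norm_ratio_ge_1 by simp

lemma bump_grad_zero: "0 < \<epsilon> \<Longrightarrow> norm y \<ge> \<epsilon> \<Longrightarrow> bump_grad \<epsilon> y = 0"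
  unfolding bump_grad_def flat_exp_def norm_ratio_ge_1 by simp

lemma bump_has_derivative: "(bump \<epsilon> has_derivative (\<lambda>v. bump_grad \<epsilon> y \<bullet> v)) (at y)"
proof -
  have d: "((\<lambda>y. 1 - (norm y)\<^sup>2 / \<epsilon>\<^sup>2) has_derivative (\<lambda>v. (- 2 / \<epsilon>\<^sup>2) * (y \<bullet> v))) (at y)"
    unfolding power2_norm_eq_inner divide_inverse
    by (auto intro!: derivative_eq_intros simp: inner_commute algebra_simps simp del: power_inverse)
  show ?thesis
    using DERIV_compose_FDERIV[OF flat_exp_deriv_n[of 0] d] unfolding bump_def[abs_def] bump_grad_def
    by (simp add: algebra_simps)
qed

lemma bump_continuous: "continuous_on UNIV (bump \<epsilon>)"
  using bump_has_derivative by (intro continuous_at_imp_continuous_on) (blast intro: has_derivative_continuous)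

lemma bump_grad_continuous: "continuous_on UNIV (bump_grad \<epsilon> :: 'e::euclidean_space \<Rightarrow> 'e)"
  unfolding bump_grad_def[abs_def] divide_inverse
  by (intro continuous_intros continuous_on_compose2[OF flat_exp_continuous]) auto

text \<open>A weak derivative may only be tested with smooth functions of compact support. Translated bumps are
such functions, and testing with them is mollification.\<close>
lemma bump_test_function:
  assumes "0 < \<epsilon>" "cball x \<epsilon> \<subseteq> \<Omega>"
  shows "test_function \<Omega> (\<lambda>y. bump \<epsilon> (y - x))"
proof -
  have "Ck_on k UNIV (\<lambda>y. flat_exp (flat_poly 0) (1 - (norm (y - x))\<^sup>2 / \<epsilon>\<^sup>2))" for k
  proof (rule Ck_on_compose_real[where \<phi>="\<lambda>n. flat_exp (flat_poly n)" and j=0])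
    show "Ck_on k UNIV (\<lambda>y. 1 - (norm (y - x))\<^sup>2 / \<epsilon>\<^sup>2)"
      using Ck_on_add[OF open_UNIV Ck_on_const[of k UNIV 1] Ck_on_mult[OF open_UNIV Ck_on_const[of k UNIV "-1 / \<epsilon>\<^sup>2"] Ck_on_norm_square[of k UNIV x]]]
      by simp
    show "(flat_exp (flat_poly (0 + i)) has_real_derivative flat_exp (flat_poly (0 + Suc i)) t) (at t)" for i t
      using flat_exp_deriv_n[of i t] by simp
    show "continuous_on UNIV (flat_exp (flat_poly (0 + k)))" by (rule flat_exp_continuous)
  qed simp
  moreover have sub: "{y. bump \<epsilon> (y - x) \<noteq> 0} \<subseteq> cball x \<epsilon>"
    using assms by (auto simp: bump_pos dist_norm norm_minus_commute)
  then have "closure {y. bump \<epsilon> (y - x) \<noteq> 0} \<subseteq> cball x \<epsilon>"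
    by (intro closure_minimal) auto
  moreover have "bounded {y. bump \<epsilon> (y - x) \<noteq> 0}"
    using sub bounded_subset bounded_cball by blast
  ultimately show ?thesis using assms(2)
    unfolding test_function_def smooth_on_def by (auto simp: bump_def compact_closure)
qed

section \<open>Mollification\<close>

lemma compact_support_uniformly_continuous:
  fixes h :: "'e::euclidean_space \<Rightarrow> 'b::real_normed_vector"
  assumes h: "continuous_on UNIV h" "\<And>x. norm x \<ge> r \<Longrightarrow> h x = 0"
  shows "uniformly_continuous_on UNIV h"
  unfolding uniformly_continuous_on_def
proof (intro allI impI)
  fix e :: real assume e: "0 < e"
  have "uniformly_continuous_on (cball 0 (r + 1)) h"
    using h(1) by (intro compact_uniformly_continuous) (auto intro: continuous_on_subset)
  then obtain d where d: "d > 0" "\<And>x y. x \<in> cball 0 (r + 1) \<Longrightarrow> y \<in> cball 0 (r + 1) \<Longrightarrow> dist y x < d \<Longrightarrow> dist (h y) (h x) < e"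
    using e unfolding uniformly_continuous_on_def by metis
  have "dist (h y) (h x) < e" if xy: "dist y x < min d 1" for x y
  proof (cases "norm x < r \<or> norm y < r")
    case True
    have "norm x \<le> norm y + dist y x" "norm y \<le> norm x + dist y x"
      using norm_triangle_ineq2[of x y] norm_triangle_ineq2[of y x] by (auto simp: dist_norm norm_minus_commute)
    then have "x \<in> cball 0 (r + 1)" "y \<in> cball 0 (r + 1)" using True xy by auto
    then show ?thesis using d(2) xy by auto
  next
    case False then show ?thesis using h(2)[of x] h(2)[of y] e by auto
  qed
  then show "\<exists>d>0. \<forall>x\<in>UNIV. \<forall>x'\<in>UNIV. dist x' x < d \<longrightarrow> dist (h x') (h x) < e"
    using d(1) by (intro exI[of _ "min d 1"]) auto
qed

lemma compact_support_bounded: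
  fixes h :: "'e::euclidean_space \<Rightarrow> 'b::real_normed_vector"
  assumes h: "continuous_on UNIV h" "\<And>x. norm x \<ge> r \<Longrightarrow> h x = 0"
  obtains B where "B \<ge> 0" "\<And>x. norm (h x) \<le> B"
proof -
  have "compact (h ` cball 0 r)"
    using h(1) by (intro compact_continuous_image) (auto intro: continuous_on_subset)
  then obtain B where B: "\<And>y. y \<in> h ` cball 0 r \<Longrightarrow> norm y \<le> B" using compact_imp_bounded bounded_iff by metis
  have "norm (h x) \<le> max 0 B" for x
    using B[of "h x"] h(2)[of x] by (cases "norm x \<ge> r") (auto simp: le_max_iff_disj)
  then show ?thesis by (intro that[of "max 0 B"]) auto
qed

definition mollify :: "real \<Rightarrow> ('e::euclidean_space \<Rightarrow> real) \<Rightarrow> 'e \<Rightarrow> real" where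
  "mollify \<epsilon> g x = (\<integral>y. g y * (bump \<epsilon> (y - x) / (\<integral>w. bump \<epsilon> (w :: 'e) \<partial>lborel)) \<partial>lborel)"

text \<open>The candidate for the gradient of the mollification. The minus sign comes from differentiating
\<open>bump \<epsilon> (y - x)\<close> in x.\<close>
definition mollify_grad :: "real \<Rightarrow> ('e::euclidean_space \<Rightarrow> real) \<Rightarrow> 'e \<Rightarrow> 'e" where
  "mollify_grad \<epsilon> g x = - (\<integral>y. (g y / (\<integral>w. bump \<epsilon> (w :: 'e) \<partial>lborel)) *\<^sub>R bump_grad \<epsilon> (y - x) \<partial>lborel)"

lemma bump_measurable[measurable]: "bump \<epsilon> \<in> borel_measurable borel"
  by (intro borel_measurable_continuous_onI bump_continuous)

lemma bump_grad_measurable[measurable]: "(bump_grad \<epsilon> :: 'e::euclidean_space \<Rightarrow> 'e) \<in> borel_measurable borel"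
  by (intro borel_measurable_continuous_onI bump_grad_continuous)

lemma integrable_compact_support:
  fixes h :: "'e::euclidean_space \<Rightarrow> 'b::{banach, second_countable_topology}"
  assumes "h \<in> borel_measurable borel" "\<And>x. norm (h x) \<le> B" "\<And>x. norm x > r \<Longrightarrow> h x = 0"
  shows "integrable lborel h"
proof (rule Bochner_Integration.integrable_bound)
  show "integrable lborel (\<lambda>x. B * indicator (cball 0 r) x :: real)"
    by (intro integrable_mult_right integrable_real_indicator) (use emeasure_lborel_cball_finite in \<open>auto simp: less_top\<close>)
  show "AE x in lborel. norm (h x) \<le> norm (B * indicator (cball 0 r) x :: real)"
  proof (rule AE_I2)
    fix x show "norm (h x) \<le> norm (B * indicator (cball 0 r) x :: real)"
      using assms(2)[of x] assms(3)[of x] by (cases "norm x > r") (auto simp: indicator_def)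
  qed
qed (use assms in auto)

lemma bump_zero: "0 < \<epsilon> \<Longrightarrow> \<epsilon> \<le> norm y \<Longrightarrow> bump \<epsilon> y = 0"
  using bump_pos[of \<epsilon> y] by auto

lemma bump_bounded:
  assumes "0 < \<epsilon>" obtains B where "0 \<le> B" "\<And>y :: 'e::euclidean_space. norm (bump \<epsilon> y) \<le> B"
  by (rule compact_support_bounded[OF bump_continuous bump_zero[OF assms]]) (auto intro: that)

lemma bump_grad_bounded:
  assumes "0 < \<epsilon>" obtains B where "0 \<le> B" "\<And>y :: 'e::euclidean_space. norm (bump_grad \<epsilon> y) \<le> B"
  by (rule compact_support_bounded[OF bump_grad_continuous bump_grad_zero[OF assms]]) (auto intro: that)

lemma bump_integrable: "0 < \<epsilon> \<Longrightarrow> integrable lborel (bump \<epsilon> :: 'e::euclidean_space \<Rightarrow> real)"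
proof -
  assume e: "0 < \<epsilon>"
  obtain B where B: "\<And>x :: 'e. norm (bump \<epsilon> x) \<le> B" using bump_bounded[OF e] by blast
  show ?thesis by (intro integrable_compact_support[where r=\<epsilon> and B=B] B) (auto intro: bump_zero[OF e])
qed

lemma bump_integral_pos: "0 < \<epsilon> \<Longrightarrow> 0 < (\<integral>w. bump \<epsilon> (w :: 'e::euclidean_space) \<partial>lborel)"
proof -
  assume e: "0 < \<epsilon>"
  have nn: "0 \<le> (\<integral>w. bump \<epsilon> (w :: 'e) \<partial>lborel)" by (intro Bochner_Integration.integral_nonneg bump_nonneg)
  have "(\<integral>w. bump \<epsilon> (w :: 'e) \<partial>lborel) \<noteq> 0"
  proof
    assume "(\<integral>w. bump \<epsilon> (w :: 'e) \<partial>lborel) = 0"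
    then have "AE w in lborel. bump \<epsilon> (w::'e) = 0"
      using integral_nonneg_eq_0_iff_AE[OF bump_integrable[OF e]] by (auto simp: bump_nonneg)
    then have "AE w in lborel. (w::'e) \<in> ball 0 \<epsilon> \<longrightarrow> w \<in> {}" by eventually_elim (use bump_pos[OF e] in force)
    then show False using e mem_closed_if_AE_lebesgue_open[of "ball (0::'e) \<epsilon>" "{}" 0] AE_completion by fastforce
  qed
  then show ?thesis using nn by simp
qed

lemma integrable_shift_mult:
  fixes g :: "'e::euclidean_space \<Rightarrow> real" and h :: "'e \<Rightarrow> 'b::euclidean_space"
  assumes g: "integrable lborel g" and h: "h \<in> borel_measurable borel" "\<And>y. norm (h y) \<le> B"
  shows "integrable lborel (\<lambda>y. g y *\<^sub>R h (y - x))"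
proof (rule Bochner_Integration.integrable_bound)
  show "integrable lborel (\<lambda>y. B * \<bar>g y\<bar>)" using g by simp
  show "AE y in lborel. norm (g y *\<^sub>R h (y - x)) \<le> norm (B * \<bar>g y\<bar>)"
  proof (rule AE_I2)
    fix y
    have "norm (g y *\<^sub>R h (y - x)) \<le> \<bar>g y\<bar> * B" using h(2) by (auto intro!: mult_left_mono)
    then show "norm (g y *\<^sub>R h (y - x)) \<le> norm (B * \<bar>g y\<bar>)" by (simp add: mult.commute)
  qed
  show "(\<lambda>y. g y *\<^sub>R h (y - x)) \<in> borel_measurable lborel" using g h(1) by measurable
qed

lemma shift_integral_continuous:
  fixes g :: "'e::euclidean_space \<Rightarrow> real" and h :: "'e \<Rightarrow> 'b::euclidean_space"
  assumes g: "integrable lborel g" and h: "continuous_on UNIV h" "\<And>y. norm (h y) \<le> B"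
  shows "continuous_on UNIV (\<lambda>x. \<integral>y. g y *\<^sub>R h (y - x) \<partial>lborel)"
proof (rule continuous_at_imp_continuous_on, rule ballI)
  have m: "h \<in> borel_measurable borel" using h by (intro borel_measurable_continuous_onI)
  fix x
  show "isCont (\<lambda>x. \<integral>y. g y *\<^sub>R h (y - x) \<partial>lborel) x"
    unfolding continuous_at_sequentially comp_def
  proof (intro allI impI)
    fix X assume X: "X \<longlonglongrightarrow> x"
    show "(\<lambda>n. \<integral>y. g y *\<^sub>R h (y - X n) \<partial>lborel) \<longlonglongrightarrow> (\<integral>y. g y *\<^sub>R h (y - x) \<partial>lborel)"
    proof (rule integral_dominated_convergence[where w="\<lambda>y. B * \<bar>g y\<bar>"])
      show "AE y in lborel. (\<lambda>n. g y *\<^sub>R h (y - X n)) \<longlonglongrightarrow> g y *\<^sub>R h (y - x)"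
        using h(1) X by (intro AE_I2 tendsto_scaleR tendsto_const continuous_on_tendsto_compose[OF h(1)] tendsto_diff) auto
      show "AE y in lborel. norm (g y *\<^sub>R h (y - X n)) \<le> B * \<bar>g y\<bar>" for n
        using h(2) by (intro AE_I2) (simp add: mult.commute[of B] mult_left_mono)
    qed (use g m in \<open>auto\<close>)
  qed
qed

text \<open>The gradient of the bump is uniformly continuous, so its difference quotients converge uniformly
in y, and the derivative may be taken under the integral for every integrable function.\<close>
lemma mollify_has_derivative:
  fixes g :: "'e::euclidean_space \<Rightarrow> real"
  assumes g: "integrable lborel g" and \<epsilon>: "0 < \<epsilon>"
  shows "(mollify \<epsilon> g has_derivative (\<lambda>v. mollify_grad \<epsilon> g x \<bullet> v)) (at x)"
proof -
  define c where "c = (\<integral>w. bump \<epsilon> (w :: 'e) \<partial>lborel)"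
  have c: "0 < c" unfolding c_def using \<epsilon> by (rule bump_integral_pos)
  let ?h = "bump_grad \<epsilon> :: 'e \<Rightarrow> 'e"
  obtain B where B: "0 \<le> B" "\<And>y. norm (?h y) \<le> B"
    using bump_grad_bounded[OF \<epsilon>] by blast
  obtain Bb where Bb: "0 \<le> Bb" "\<And>y::'e. norm (bump \<epsilon> y) \<le> Bb" using bump_bounded[OF \<epsilon>] by blast
  define I where "I = (\<integral>y. \<bar>g y\<bar> \<partial>lborel)"
  have I: "0 \<le> I" by (simp add: I_def)
  have int1: "integrable lborel (\<lambda>y. g y * bump \<epsilon> (y - x))" for x
    using integrable_shift_mult[OF g, of "bump \<epsilon>" Bb x] Bb by auto
  have int2: "integrable lborel (\<lambda>y. g y *\<^sub>R ?h (y - x))" for x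
    using integrable_shift_mult[OF g, of ?h B x] B by auto
  have mg: "mollify_grad \<epsilon> g x = - ((\<integral>y. g y *\<^sub>R ?h (y - x) \<partial>lborel) /\<^sub>R c)"
    unfolding mollify_grad_def c_def[symmetric] integral_scaleR_right[symmetric] by (simp add: divide_inverse mult.commute)
  have m: "mollify \<epsilon> g x = (\<integral>y. g y * bump \<epsilon> (y - x) \<partial>lborel) / c" for x
    unfolding mollify_def c_def[symmetric] integral_divide_zero[symmetric] by simp
  have uc: "uniformly_continuous_on UNIV ?h"
    by (rule compact_support_uniformly_continuous[OF bump_grad_continuous bump_grad_zero[OF \<epsilon>]])
  have "((\<lambda>x. \<integral>y. g y * bump \<epsilon> (y - x) \<partial>lborel) has_derivative (\<lambda>v. - (\<integral>y. g y *\<^sub>R ?h (y - x) \<partial>lborel) \<bullet> v)) (at x)"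
    unfolding has_derivative_at_alt
  proof (intro conjI allI impI)
    show "bounded_linear (\<lambda>v. - (\<integral>y. g y *\<^sub>R ?h (y - x) \<partial>lborel) \<bullet> v)" by (rule bounded_linear_inner_right)
    fix e :: real assume e: "0 < e"
    then have "0 < e / (I + 1)" using I by simp
    then obtain d where d: "d > 0" "\<And>y y'. dist y' y < d \<Longrightarrow> dist (?h y') (?h y) < e / (I + 1)"
      using uc unfolding uniformly_continuous_on_def by (metis UNIV_I)
    have "norm ((\<integral>y. g y * bump \<epsilon> (y - x') \<partial>lborel) - (\<integral>y. g y * bump \<epsilon> (y - x) \<partial>lborel)
        - (- (\<integral>y. g y *\<^sub>R ?h (y - x) \<partial>lborel) \<bullet> (x' - x))) \<le> e * norm (x' - x)" if x': "norm (x' - x) < d" for x'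
    proof -
      let ?v = "x' - x"
      have pt: "\<bar>bump \<epsilon> (y - x') - bump \<epsilon> (y - x) + ?h (y - x) \<bullet> ?v\<bar> \<le> e / (I + 1) * norm ?v" for y
      proof -
        let ?F = "\<lambda>z. bump \<epsilon> (y - z) + ?h (y - x) \<bullet> z"
        have "norm (?F x' - ?F x) \<le> e / (I + 1) * norm (x' - x)"
        proof (rule differentiable_bound[of "closed_segment x x'"])
          fix z assume z: "z \<in> closed_segment x x'"
          have "((\<lambda>z. bump \<epsilon> (y - z)) has_derivative (\<lambda>v. ?h (y - z) \<bullet> (- v))) (at z)"
            by (rule has_derivative_compose[OF _ bump_has_derivative]) (auto intro!: derivative_eq_intros)
          then show "(?F has_derivative (\<lambda>v. ?h (y - z) \<bullet> (- v) + ?h (y - x) \<bullet> v)) (at z within closed_segment x x')"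
            by (intro has_derivative_at_withinI[where s="closed_segment x x'"] has_derivative_add bounded_linear_imp_has_derivative bounded_linear_inner_right)
          have "norm (z - x) \<le> norm (x' - x)" using z by (metis dist_commute dist_in_closed_segment dist_norm)
          then have "dist (y - x) (y - z) < d" using x' by (simp add: dist_norm)
          then have "dist (?h (y - x)) (?h (y - z)) < e / (I + 1)" by (rule d)
          then have le: "norm (?h (y - x) - ?h (y - z)) \<le> e / (I + 1)" by (simp add: dist_norm)
          show "onorm (\<lambda>v. ?h (y - z) \<bullet> (- v) + ?h (y - x) \<bullet> v) \<le> e / (I + 1)"
          proof (rule onorm_le)
            fix v
            have "norm (?h (y - z) \<bullet> (- v) + ?h (y - x) \<bullet> v) = \<bar>(?h (y - x) - ?h (y - z)) \<bullet> v\<bar>"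
              by (simp add: inner_diff_left)
            also have "\<dots> \<le> norm (?h (y - x) - ?h (y - z)) * norm v" by (rule Cauchy_Schwarz_ineq2)
            also have "\<dots> \<le> e / (I + 1) * norm v" using le by (intro mult_right_mono) auto
            finally show "norm (?h (y - z) \<bullet> (- v) + ?h (y - x) \<bullet> v) \<le> e / (I + 1) * norm v" .
          qed
        qed auto
        then show ?thesis by (simp add: inner_diff_right algebra_simps)
      qed
      have int3: "integrable lborel (\<lambda>y. (g y *\<^sub>R ?h (y - x)) \<bullet> ?v)" using int2 by (rule integrable_inner_left)
      have "(\<integral>y. g y * bump \<epsilon> (y - x') \<partial>lborel) - (\<integral>y. g y * bump \<epsilon> (y - x) \<partial>lborel)
        - (- (\<integral>y. g y *\<^sub>R ?h (y - x) \<partial>lborel) \<bullet> ?v)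
        = (\<integral>y. g y * bump \<epsilon> (y - x') - g y * bump \<epsilon> (y - x) + (g y *\<^sub>R ?h (y - x)) \<bullet> ?v \<partial>lborel)"
        using int1 int2 int3 by (simp add: Bochner_Integration.integral_add Bochner_Integration.integral_diff integral_inner_left del: inner_scaleR_left)
      also have "norm \<dots> \<le> (\<integral>y. \<bar>g y\<bar> * (e / (I + 1) * norm ?v) \<partial>lborel)"
      proof (rule Bochner_Integration.integral_norm_bound_integral)
        show "integrable lborel (\<lambda>y. g y * bump \<epsilon> (y - x') - g y * bump \<epsilon> (y - x) + (g y *\<^sub>R ?h (y - x)) \<bullet> ?v)"
          using int1 int3 by (intro Bochner_Integration.integrable_add Bochner_Integration.integrable_diff)
        show "integrable lborel (\<lambda>y. \<bar>g y\<bar> * (e / (I + 1) * norm ?v))" using g by simp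
        fix y
        have "norm (g y * bump \<epsilon> (y - x') - g y * bump \<epsilon> (y - x) + (g y *\<^sub>R ?h (y - x)) \<bullet> ?v)
          = \<bar>g y\<bar> * \<bar>bump \<epsilon> (y - x') - bump \<epsilon> (y - x) + ?h (y - x) \<bullet> ?v\<bar>"
          unfolding abs_mult[symmetric] by (simp add: algebra_simps)
        also have "\<dots> \<le> \<bar>g y\<bar> * (e / (I + 1) * norm ?v)" using pt by (intro mult_left_mono) auto
        finally show "norm (g y * bump \<epsilon> (y - x') - g y * bump \<epsilon> (y - x) + (g y *\<^sub>R ?h (y - x)) \<bullet> ?v) \<le> \<bar>g y\<bar> * (e / (I + 1) * norm ?v)" .
      qed
      also have "\<dots> = (I / (I + 1)) * (e * norm ?v)" by (simp add: I_def)
      also have "\<dots> \<le> 1 * (e * norm ?v)" using I e by (intro mult_right_mono) auto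
      finally show ?thesis by simp
    qed
    then show "\<exists>d>0. \<forall>y. norm (y - x) < d \<longrightarrow> norm ((\<integral>ya. g ya * bump \<epsilon> (ya - y) \<partial>lborel) - (\<integral>y. g y * bump \<epsilon> (y - x) \<partial>lborel)
        - (- (\<integral>y. g y *\<^sub>R ?h (y - x) \<partial>lborel) \<bullet> (y - x))) \<le> e * norm (y - x)"
      using d(1) by blast
  qed
  then have "((\<lambda>x. inverse c * (\<integral>y. g y * bump \<epsilon> (y - x) \<partial>lborel)) has_derivative
      (\<lambda>v. inverse c * (- (\<integral>y. g y *\<^sub>R ?h (y - x) \<partial>lborel) \<bullet> v))) (at x)"
    by (rule has_derivative_mult_right)
  then show ?thesis unfolding mg m[abs_def] by (simp add: divide_inverse mult.commute)
qed

lemma mollify_grad_continuous: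
  fixes g :: "'e::euclidean_space \<Rightarrow> real"
  assumes g: "integrable lborel g" and \<epsilon>: "0 < \<epsilon>"
  shows "continuous_on UNIV (mollify_grad \<epsilon> g)"
proof -
  obtain B where B: "0 \<le> B" "\<And>y. norm (bump_grad \<epsilon> y :: 'e) \<le> B"
    using bump_grad_bounded[OF \<epsilon>] by blast
  show ?thesis unfolding mollify_grad_def[abs_def]
    using g B by (intro continuous_on_minus shift_integral_continuous[where B=B] bump_grad_continuous) auto
qed

lemma mollify_continuous: "integrable lborel g \<Longrightarrow> 0 < \<epsilon> \<Longrightarrow> continuous_on UNIV (mollify \<epsilon> g)"
  using mollify_has_derivative by (intro continuous_at_imp_continuous_on) (blast intro: has_derivative_continuous)

text \<open>A measurable function is almost everywhere a limit of continuous functions. Clipping these to the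
range of g and multiplying them with a cutoff keeps the limit and supplies a dominating function.\<close>
lemma continuous_dense_L1_bounded:
  fixes g :: "'e::euclidean_space \<Rightarrow> real"
  assumes g: "g \<in> borel_measurable borel" "\<And>x. \<bar>g x\<bar> \<le> b" "\<And>x. norm x > b \<Longrightarrow> g x = 0" and e: "0 < e"
  shows "\<exists>c r. continuous_on UNIV c \<and> (\<forall>x. norm x \<ge> r \<longrightarrow> c x = 0) \<and> (\<integral>x. \<bar>g x - c x\<bar> \<partial>lborel) < e"
proof -
  have b: "0 \<le> b" using g(2)[of 0] by simp
  have "g \<in> borel_measurable (lebesgue_on UNIV)" using g(1) by (simp add: measurable_completion lebesgue_on_UNIV_eq)
  then have "g measurable_on UNIV" by (simp add: measurable_on_iff_borel_measurable)
  then obtain Z G where Z: "negligible Z" and G: "\<And>n. continuous_on UNIV (G n)" "\<And>x. x \<notin> Z \<Longrightarrow> (\<lambda>n. G n x) \<longlonglongrightarrow> g x"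
    unfolding measurable_on_def by auto
  \<comment> \<open>A continuous cutoff that is 1 where g may be nonzero.\<close>
  define th where "th x = max 0 (min 1 (b + 1 - norm x))" for x :: 'e
  have th: "continuous_on UNIV th" unfolding th_def by (intro continuous_intros)
  define c where "c n x = max (- b) (min b (G n x)) * th x" for n x
  have c: "continuous_on UNIV (c n)" for n unfolding c_def by (intro continuous_intros G th)
  have c0: "c n x = 0" if "norm x \<ge> b + 1" for n x using that by (simp add: c_def th_def)
  have cb: "\<bar>c n x\<bar> \<le> b" for n x
  proof -
    have "\<bar>c n x\<bar> \<le> b * 1" unfolding c_def abs_mult using b by (intro mult_mono) (auto simp: th_def)
    then show ?thesis by simp
  qed
  have lim: "(\<lambda>n. c n x) \<longlonglongrightarrow> g x" if "x \<notin> Z" for x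
  proof -
    have "(\<lambda>n. c n x) \<longlonglongrightarrow> max (- b) (min b (g x)) * th x"
      unfolding c_def by (intro tendsto_intros G that)
    moreover have "max (- b) (min b (g x)) * th x = g x"
      using g(2)[of x] g(3)[of x] by (cases "norm x > b") (auto simp: th_def)
    ultimately show ?thesis by simp
  qed
  have Z0: "AE x in lborel. x \<notin> Z"
  proof -
    have "AE x in lebesgue. x \<notin> Z" using Z by (intro AE_not_in) (simp add: negligible_iff_null_sets)
    then show ?thesis by (simp add: AE_completion_iff)
  qed
  have meas: "c n \<in> borel_measurable borel" for n by (intro borel_measurable_continuous_onI c)
  have "(\<lambda>n. \<integral>x. \<bar>g x - c n x\<bar> \<partial>lborel) \<longlonglongrightarrow> (\<integral>x. 0 \<partial>(lborel :: 'e measure))"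
  proof (rule integral_dominated_convergence[where w="\<lambda>x. 2 * b * indicator (cball 0 (b + 1)) x"])
    show "AE x in lborel. (\<lambda>n. \<bar>g x - c n x\<bar>) \<longlonglongrightarrow> 0"
      using Z0
    proof eventually_elim
      case (elim x)
      have "(\<lambda>n. \<bar>g x - c n x\<bar>) \<longlonglongrightarrow> \<bar>g x - g x\<bar>" by (intro tendsto_intros lim elim)
      then show ?case by simp
    qed
    show "AE x in lborel. norm \<bar>g x - c n x\<bar> \<le> 2 * b * indicator (cball 0 (b + 1)) x" for n
    proof (rule AE_I2)
      fix x
      show "norm \<bar>g x - c n x\<bar> \<le> 2 * b * indicator (cball 0 (b + 1)) x"
        using g(2)[of x] cb[of n x] c0[of x n] g(3)[of x] by (cases "norm x > b + 1") (auto simp: indicator_def)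
    qed
    show "integrable lborel (\<lambda>x. 2 * b * indicator (cball 0 (b + 1)) (x::'e) :: real)"
      using emeasure_lborel_cball_finite[of "0::'e" "b + 1"] by (intro integrable_mult_right integrable_real_indicator) auto
  qed (use g meas in auto)
  then have "\<forall>\<^sub>F n in sequentially. (\<integral>x. \<bar>g x - c n x\<bar> \<partial>lborel) < e"
    using e by (intro order_tendstoD) auto
  then obtain n where "(\<integral>x. \<bar>g x - c n x\<bar> \<partial>lborel) < e" using eventually_happens by fastforce
  then show ?thesis using c c0 by blast
qed

text \<open>Truncation in the domain and in the range reduces the general case to the bounded one.\<close>
lemma continuous_dense_L1:
  fixes g :: "'e::euclidean_space \<Rightarrow> real"
  assumes g: "integrable lborel g" and e: "0 < e"
  shows "\<exists>c r. continuous_on UNIV c \<and> (\<forall>x. norm x \<ge> r \<longrightarrow> c x = 0) \<and> integrable lborel c \<and> (\<integral>x. \<bar>g x - c x\<bar> \<partial>lborel) < e"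
proof -
  have gm[measurable]: "g \<in> borel_measurable borel" using g by auto
  define t where "t n x = max (- real n) (min (real n) (g x)) * indicator (cball 0 (real n)) x" for n x
  have tm[measurable]: "t n \<in> borel_measurable borel" for n
  proof -
    have [measurable]: "cball (0::'e) (real n) \<in> sets borel" by simp
    show ?thesis unfolding t_def by measurable
  qed
  have tb: "\<bar>t n x\<bar> \<le> real n" "norm x > real n \<Longrightarrow> t n x = 0" "\<bar>t n x\<bar> \<le> \<bar>g x\<bar>" for n x
    by (auto simp: t_def indicator_def)
  have "(\<lambda>n. \<integral>x. \<bar>g x - t n x\<bar> \<partial>lborel) \<longlonglongrightarrow> (\<integral>x. 0 \<partial>(lborel :: 'e measure))"
  proof (rule integral_dominated_convergence[where w="\<lambda>x. 2 * \<bar>g x\<bar>"])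
    show "AE x in lborel. (\<lambda>n. \<bar>g x - t n x\<bar>) \<longlonglongrightarrow> 0"
    proof (rule AE_I2, rule tendsto_eventually)
      fix x
      show "\<forall>\<^sub>F n in sequentially. \<bar>g x - t n x\<bar> = 0"
        using eventually_ge_at_top[of "nat \<lceil>\<bar>g x\<bar> + norm x\<rceil>"]
      proof eventually_elim
        case (elim n)
        then have *: "\<bar>g x\<bar> + norm x \<le> real n" by linarith
        then have "norm x \<le> real n" using abs_ge_zero[of "g x"] by linarith
        moreover have "\<bar>g x\<bar> \<le> real n" using * norm_ge_zero[of x] by linarith
        ultimately show ?case by (auto simp: t_def)
      qed
    qed
    show "AE x in lborel. norm \<bar>g x - t n x\<bar> \<le> 2 * \<bar>g x\<bar>" for n
      using tb(3)[of n] by (intro AE_I2) (smt (verit) real_norm_def)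
  qed (use g in auto)
  then have "\<forall>\<^sub>F n in sequentially. (\<integral>x. \<bar>g x - t n x\<bar> \<partial>lborel) < e / 2"
    using e by (intro order_tendstoD) auto
  then obtain n where n: "(\<integral>x. \<bar>g x - t n x\<bar> \<partial>lborel) < e / 2" using eventually_happens by fastforce
  obtain c r where c: "continuous_on UNIV c" "\<And>x. norm x \<ge> r \<Longrightarrow> c x = 0" "(\<integral>x. \<bar>t n x - c x\<bar> \<partial>lborel) < e / 2"
    using continuous_dense_L1_bounded[OF tm tb(1,2), of n "e / 2"] e by auto
  have cm: "c \<in> borel_measurable borel" using c(1) by (intro borel_measurable_continuous_onI)
  obtain B where B: "\<And>x. norm (c x) \<le> B" using compact_support_bounded[OF c(1,2)] by blast
  have ci: "integrable lborel c" using c by (intro integrable_compact_support[OF cm B, of r]) auto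
  have ti: "integrable lborel (t n)"
    by (rule Bochner_Integration.integrable_bound[OF g]) (use tb(3) in auto)
  have "(\<integral>x. \<bar>g x - c x\<bar> \<partial>lborel) \<le> (\<integral>x. \<bar>g x - t n x\<bar> + \<bar>t n x - c x\<bar> \<partial>lborel)"
    using g ci ti by (intro integral_mono) auto
  also have "\<dots> = (\<integral>x. \<bar>g x - t n x\<bar> \<partial>lborel) + (\<integral>x. \<bar>t n x - c x\<bar> \<partial>lborel)"
    using g ci ti by (intro Bochner_Integration.integral_add) auto
  also have "\<dots> < e" using n c(3) by linarith
  finally show ?thesis using c ci by blast
qed

lemma integral_translate:
  fixes g :: "'e::euclidean_space \<Rightarrow> real"
  assumes "g \<in> borel_measurable borel"
  shows "(\<integral>x. g (x + w) \<partial>lborel) = (\<integral>x. g x \<partial>lborel)" "integrable lborel g \<Longrightarrow> integrable lborel (\<lambda>x. g (x + w))"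
proof -
  have d: "lborel = distr lborel borel ((+) w)" by (simp add: lborel_distr_plus)
  show "(\<integral>x. g (x + w) \<partial>lborel) = (\<integral>x. g x \<partial>lborel)"
    by (subst (2) d, subst integral_distr) (use assms in \<open>auto simp: add.commute\<close>)
  assume "integrable lborel g"
  then have "integrable (distr lborel borel ((+) w)) g" using d by simp
  then show "integrable lborel (\<lambda>x. g (x + w))"
    by (subst (asm) integrable_distr_eq) (use assms in \<open>auto simp: add.commute\<close>)
qed

text \<open>For continuous functions of compact support this is uniform continuity; density transfers
it to all integrable functions.\<close>
lemma translation_continuous_L1:
  fixes g :: "'e::euclidean_space \<Rightarrow> real"
  assumes g: "integrable lborel g" and e: "0 < e"
  shows "\<exists>d>0. \<forall>w. norm w < d \<longrightarrow> (\<integral>x. \<bar>g (x + w) - g x\<bar> \<partial>lborel) \<le> e"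
proof -
  have gm[measurable]: "g \<in> borel_measurable borel" using g by auto
  obtain c r where c: "continuous_on UNIV c" "\<And>x. norm x \<ge> r \<Longrightarrow> c x = 0" "integrable lborel c" and ce: "(\<integral>x. \<bar>g x - c x\<bar> \<partial>lborel) < e / 4"
    using continuous_dense_L1[OF g, of "e / 4"] e by auto
  have cm[measurable]: "c \<in> borel_measurable borel" using c(1) by (intro borel_measurable_continuous_onI)
  define m where "m = measure lborel (cball (0::'e) (\<bar>r\<bar> + 1))"
  have m0: "0 \<le> m" by (simp add: m_def)
  have "uniformly_continuous_on UNIV c" by (rule compact_support_uniformly_continuous[OF c(1,2)])
  moreover have "0 < e / (4 * (m + 1))" using e m0 by simp
  ultimately obtain d where d: "d > 0" "\<And>x y. dist y x < d \<Longrightarrow> dist (c y) (c x) < e / (4 * (m + 1))"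
    unfolding uniformly_continuous_on_def by (metis UNIV_I)
  have "(\<integral>x. \<bar>g (x + w) - g x\<bar> \<partial>lborel) \<le> e" if w: "norm w < min d 1" for w
  proof -
    have i1: "integrable lborel (\<lambda>x. \<bar>g (x + w) - c (x + w)\<bar>)"
      using integral_translate(2)[of "\<lambda>x. \<bar>g x - c x\<bar>" w] g c(3) by auto
    have i2: "integrable lborel (\<lambda>x. \<bar>c (x + w) - c x\<bar>)"
      using integral_translate(2)[of c w] c(3) by auto
    have i3: "integrable lborel (\<lambda>x. \<bar>c x - g x\<bar>)" using g c(3) by auto
    have i4: "integrable lborel (\<lambda>x. \<bar>g (x + w) - g x\<bar>)" using integral_translate(2)[of g w] g by auto
    have "(\<integral>x. \<bar>g (x + w) - g x\<bar> \<partial>lborel) \<le> (\<integral>x. \<bar>g (x + w) - c (x + w)\<bar> + \<bar>c (x + w) - c x\<bar> + \<bar>c x - g x\<bar> \<partial>lborel)"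
      using i1 i2 i3 i4 by (intro integral_mono Bochner_Integration.integrable_add) auto
    also have "\<dots> = (\<integral>x. \<bar>g (x + w) - c (x + w)\<bar> \<partial>lborel) + (\<integral>x. \<bar>c (x + w) - c x\<bar> \<partial>lborel) + (\<integral>x. \<bar>c x - g x\<bar> \<partial>lborel)"
      using i1 i2 i3 by (simp add: Bochner_Integration.integral_add)
    also have "(\<integral>x. \<bar>g (x + w) - c (x + w)\<bar> \<partial>lborel) = (\<integral>x. \<bar>g x - c x\<bar> \<partial>lborel)"
      by (rule integral_translate(1)[of "\<lambda>x. \<bar>g x - c x\<bar>"]) measurable
    also have "(\<integral>x. \<bar>c x - g x\<bar> \<partial>lborel) = (\<integral>x. \<bar>g x - c x\<bar> \<partial>lborel)" by (simp add: abs_minus_commute)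
    also have "(\<integral>x. \<bar>c (x + w) - c x\<bar> \<partial>lborel) \<le> (\<integral>x. e / (4 * (m + 1)) * indicator (cball 0 (\<bar>r\<bar> + 1)) x \<partial>(lborel :: 'e measure))"
    proof (rule integral_mono[OF i2])
      show "integrable lborel (\<lambda>x. e / (4 * (m + 1)) * indicator (cball 0 (\<bar>r\<bar> + 1)) (x::'e) :: real)"
        using emeasure_lborel_cball_finite[of "0::'e"] by (intro integrable_mult_right integrable_real_indicator) auto
      fix x :: 'e
      show "\<bar>c (x + w) - c x\<bar> \<le> e / (4 * (m + 1)) * indicator (cball 0 (\<bar>r\<bar> + 1)) x"
      proof (cases "norm x \<le> \<bar>r\<bar> + 1")
        case True
        have "dist (x + w) x < d" using w by (simp add: dist_norm)
        then have "dist (c (x + w)) (c x) < e / (4 * (m + 1))" by (rule d)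
        then show ?thesis using True by (simp add: dist_norm)
      next
        case False
        have "norm x \<le> norm (x + w) + norm w" by (metis add_diff_cancel_right' norm_triangle_ineq4)
        then have "norm (x + w) \<ge> r" "norm x \<ge> r" using False w by auto
        then show ?thesis using c(2) False by simp
      qed
    qed
    also have "\<dots> = e / (4 * (m + 1)) * m" by (simp add: m_def)
    also have "\<dots> \<le> e / 4"
    proof -
      have "e / (4 * (m + 1)) * m = e / 4 * (m / (m + 1))" using m0 by (simp add: field_simps)
      also have "\<dots> \<le> e / 4 * 1" using e m0 by (intro mult_left_mono) auto
      finally show ?thesis by simp
    qed
    finally show ?thesis using ce e by simp
  qed
  then show ?thesis using d(1) by (intro exI[of _ "min d 1"]) auto
qed

definition bump_kernel :: "real \<Rightarrow> 'e::euclidean_space \<Rightarrow> real" where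
  "bump_kernel \<epsilon> w = bump \<epsilon> w / (\<integral>w. bump \<epsilon> (w :: 'e) \<partial>lborel)"

lemma mollify_shift:
  fixes g :: "'e::euclidean_space \<Rightarrow> real"
  assumes g: "integrable lborel g" and \<epsilon>: "0 < \<epsilon>"
  shows "mollify \<epsilon> g x = (\<integral>w. g (x + w) * bump_kernel \<epsilon> w \<partial>lborel)"
    "integrable lborel (\<lambda>w. g (x + w) * bump_kernel \<epsilon> w)"
proof -
  have gm[measurable]: "g \<in> borel_measurable borel" using g by auto
  have km[measurable]: "bump_kernel \<epsilon> \<in> borel_measurable borel" unfolding bump_kernel_def[abs_def] by measurable
  show "mollify \<epsilon> g x = (\<integral>w. g (x + w) * bump_kernel \<epsilon> w \<partial>lborel)"
    unfolding mollify_def bump_kernel_def[symmetric]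
    using integral_translate(1)[of "\<lambda>y. g y * bump_kernel \<epsilon> (y - x)" x] by (simp add: add.commute)
  obtain B where B: "\<And>y :: 'e. norm (bump \<epsilon> y) \<le> B" using bump_bounded[OF \<epsilon>] by blast
  have "integrable lborel (\<lambda>y. g y *\<^sub>R bump \<epsilon> (y - x))" by (rule integrable_shift_mult[OF g _ B]) measurable
  then have "integrable lborel (\<lambda>y. g y * bump_kernel \<epsilon> (y - x))" unfolding bump_kernel_def by simp
  from integral_translate(2)[OF _ this, of x] show "integrable lborel (\<lambda>w. g (x + w) * bump_kernel \<epsilon> w)"
    by (simp add: add.commute)
qed

lemma bump_kernel_facts:
  assumes \<epsilon>: "0 < \<epsilon>"
  shows "0 \<le> bump_kernel \<epsilon> (w :: 'e::euclidean_space)" "integrable lborel (bump_kernel \<epsilon> :: 'e \<Rightarrow> real)"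
    "(\<integral>w. bump_kernel \<epsilon> (w::'e) \<partial>lborel) = 1" "norm w \<ge> \<epsilon> \<Longrightarrow> bump_kernel \<epsilon> w = 0"
  using bump_integral_pos[OF \<epsilon>, where 'e='e] bump_integrable[OF \<epsilon>, where 'e='e]
  by (auto simp: bump_kernel_def[abs_def] bump_nonneg intro: bump_zero[OF \<epsilon>])

text \<open>A mollification is an average of translates, so Fubini bounds its distance from g by an average of
distances between g and its translates.\<close>
lemma mollify_L1:
  fixes g :: "'e::euclidean_space \<Rightarrow> real"
  assumes g: "integrable lborel g" and e: "0 < e"
  shows "\<exists>d>0. \<forall>\<epsilon>. 0 < \<epsilon> \<and> \<epsilon> < d \<longrightarrow> integrable lborel (mollify \<epsilon> g) \<and> (\<integral>x. \<bar>mollify \<epsilon> g x - g x\<bar> \<partial>lborel) \<le> e"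
proof -
  have gm[measurable]: "g \<in> borel_measurable borel" using g by auto
  obtain d where d: "d > 0" "\<And>w. norm w < d \<Longrightarrow> (\<integral>x. \<bar>g (x + w) - g x\<bar> \<partial>lborel) \<le> e"
    using translation_continuous_L1[OF g e] by auto
  have "integrable lborel (mollify \<epsilon> g) \<and> (\<integral>x. \<bar>mollify \<epsilon> g x - g x\<bar> \<partial>lborel) \<le> e" if \<epsilon>: "0 < \<epsilon>" "\<epsilon> < d" for \<epsilon>
  proof -
    define k where "k = (bump_kernel \<epsilon> :: 'e \<Rightarrow> real)"
    have k0: "0 \<le> k w" and ki: "integrable lborel k" and k1: "(\<integral>w. k w \<partial>lborel) = 1"
      and kz: "norm w \<ge> \<epsilon> \<Longrightarrow> k w = 0" for w
      unfolding k_def by (fact bump_kernel_facts[OF \<epsilon>(1)])+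
    have km[measurable]: "k \<in> borel_measurable borel" using ki by auto
    have m: "mollify \<epsilon> g x = (\<integral>w. g (x + w) * k w \<partial>lborel)"
      and gki: "integrable lborel (\<lambda>w. g (x + w) * k w)" for x
      unfolding k_def by (fact mollify_shift[OF g \<epsilon>(1)])+
    have mm[measurable]: "mollify \<epsilon> g \<in> borel_measurable borel"
      by (intro borel_measurable_continuous_onI mollify_continuous g \<epsilon>)
    have "(\<integral>\<^sup>+x. ennreal \<bar>mollify \<epsilon> g x - g x\<bar> \<partial>lborel) \<le> (\<integral>\<^sup>+x. (\<integral>\<^sup>+w. ennreal (k w * \<bar>g (x + w) - g x\<bar>) \<partial>lborel) \<partial>lborel)"
    proof (rule nn_integral_mono)
      fix x
      have "mollify \<epsilon> g x - g x = (\<integral>w. g (x + w) * k w \<partial>lborel) - (\<integral>w. g x * k w \<partial>lborel)" using k1 by (simp add: m)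
      also have "\<dots> = (\<integral>w. g (x + w) * k w - g x * k w \<partial>lborel)"
        using gki ki by (intro Bochner_Integration.integral_diff[symmetric]) auto
      finally have "ennreal \<bar>mollify \<epsilon> g x - g x\<bar> = ennreal (norm (\<integral>w. g (x + w) * k w - g x * k w \<partial>lborel))" by simp
      also have "\<dots> \<le> (\<integral>\<^sup>+w. ennreal (norm (g (x + w) * k w - g x * k w)) \<partial>lborel)"
        using gki ki by (intro integral_norm_bound_ennreal) auto
      also have "\<dots> = (\<integral>\<^sup>+w. ennreal (k w * \<bar>g (x + w) - g x\<bar>) \<partial>lborel)"
      proof (intro nn_integral_cong arg_cong[where f=ennreal])
        fix w
        have "g (x + w) * k w - g x * k w = k w * (g (x + w) - g x)" by (simp add: algebra_simps)
        then show "norm (g (x + w) * k w - g x * k w) = k w * \<bar>g (x + w) - g x\<bar>" by (simp add: abs_mult k0)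
      qed
      finally show "ennreal \<bar>mollify \<epsilon> g x - g x\<bar> \<le> (\<integral>\<^sup>+w. ennreal (k w * \<bar>g (x + w) - g x\<bar>) \<partial>lborel)" .
    qed
    also have "\<dots> = (\<integral>\<^sup>+w. (\<integral>\<^sup>+x. ennreal (k w * \<bar>g (x + w) - g x\<bar>) \<partial>lborel) \<partial>lborel)"
      by (rule lborel_pair.Fubini') measurable
    also have "\<dots> \<le> (\<integral>\<^sup>+w. ennreal (k w * e) \<partial>lborel)"
    proof (rule nn_integral_mono)
      fix w :: 'e
      have i: "integrable lborel (\<lambda>x. k w * \<bar>g (x + w) - g x\<bar>)" using integral_translate(2)[of g w] g by auto
      have "(\<integral>\<^sup>+x. ennreal (k w * \<bar>g (x + w) - g x\<bar>) \<partial>lborel) = ennreal (k w * (\<integral>x. \<bar>g (x + w) - g x\<bar> \<partial>lborel))"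
        using i k0 by (subst nn_integral_eq_integral) auto
      also have "\<dots> \<le> ennreal (k w * e)"
      proof (cases "norm w < d")
        case True then show ?thesis using d(2) k0 by (intro ennreal_leI mult_left_mono) auto
      next
        case False then show ?thesis using kz[of w] \<epsilon> by simp
      qed
      finally show "(\<integral>\<^sup>+x. ennreal (k w * \<bar>g (x + w) - g x\<bar>) \<partial>lborel) \<le> ennreal (k w * e)" .
    qed
    also have "\<dots> = ennreal (\<integral>w. k w * e \<partial>lborel)" using ki k0 e by (subst nn_integral_eq_integral) auto
    also have "\<dots> = ennreal e" using k1 by simp
    finally have le: "(\<integral>\<^sup>+x. ennreal \<bar>mollify \<epsilon> g x - g x\<bar> \<partial>lborel) \<le> ennreal e" .
    have i: "integrable lborel (\<lambda>x. mollify \<epsilon> g x - g x)"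
      using le by (intro integrableI_bounded) (auto intro: le_less_trans)
    then have "integrable lborel (\<lambda>x. (mollify \<epsilon> g x - g x) + g x)" using g by (rule Bochner_Integration.integrable_add)
    moreover have "(\<integral>x. \<bar>mollify \<epsilon> g x - g x\<bar> \<partial>lborel) \<le> e"
      using le e by (subst integral_eq_nn_integral) (auto simp: enn2real_leI)
    ultimately show ?thesis by simp
  qed
  then show ?thesis using d(1) by blast
qed

section \<open>The chain rule for weak derivatives\<close>

text \<open>The difference quotients of W in the direction b have integral zero by translation invariance, and
they converge dominatedly to the directional derivative.\<close>
lemma integral_derivative_zero:
  fixes W :: "'e::euclidean_space \<Rightarrow> real"
  assumes W: "\<And>x. (W has_derivative W' x) (at x)" and cont: "continuous_on UNIV (\<lambda>x. W' x b)"
    and supp: "\<And>x. norm x \<ge> r \<Longrightarrow> W x = 0"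
  shows "(\<integral>x. W' x b \<partial>lborel) = 0"
proof -
  have supp': "W' x b = 0" if "norm x \<ge> r + 1" for x
  proof -
    have "((\<lambda>x. 0) has_derivative (\<lambda>v. 0)) (at x)" by simp
    then have "(W has_derivative (\<lambda>v. 0)) (at x)"
      by (rule has_derivative_transform_within_open[where s="{x. r < norm x}"])
         (use that in \<open>auto simp: supp intro!: open_Collect_less continuous_intros\<close>)
    then have "W' x = (\<lambda>v. 0)" using W has_derivative_unique by blast
    then show ?thesis by simp
  qed
  obtain B where B: "0 \<le> B" "\<And>x. norm (W' x b) \<le> B"
    by (rule compact_support_bounded[OF cont supp']) (auto intro: that)
  define R where "R = \<bar>r\<bar> + norm b + 1"
  define D where "D n x = (W (x + (1 / real (Suc n)) *\<^sub>R b) - W x) * real (Suc n)" for n x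
  have Wc: "continuous_on UNIV W" using W by (intro continuous_at_imp_continuous_on) (blast intro: has_derivative_continuous)
  have Wm[measurable]: "W \<in> borel_measurable borel" using Wc by (intro borel_measurable_continuous_onI)
  obtain BW where BW: "\<And>x. norm (W x) \<le> BW" using compact_support_bounded[OF Wc supp] by blast
  have Wi: "integrable lborel W" using supp by (intro integrable_compact_support[OF Wm BW, of r]) auto
  have line: "((\<lambda>s. W (x + s *\<^sub>R b)) has_real_derivative W' (x + s *\<^sub>R b) b) (at s)" for x s
  proof -
    have "((\<lambda>s. W (x + s *\<^sub>R b)) has_derivative (\<lambda>h. W' (x + s *\<^sub>R b) (h *\<^sub>R b))) (at s)"
      by (rule has_derivative_compose[OF _ W]) (auto intro!: derivative_eq_intros)
    moreover have "W' (x + s *\<^sub>R b) (h *\<^sub>R b) = W' (x + s *\<^sub>R b) b * h" for h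
      using linear_scale[OF has_derivative_linear[OF W]] by (simp add: mult.commute)
    ultimately show ?thesis by (simp add: has_field_derivative_def)
  qed
  have DB: "\<bar>D n x\<bar> \<le> B" for n x
  proof -
    obtain z where "W (x + (1 / real (Suc n)) *\<^sub>R b) - W (x + 0 *\<^sub>R b) = (1 / real (Suc n) - 0) * W' (x + z *\<^sub>R b) b"
      using MVT2[of 0 "1 / real (Suc n)" "\<lambda>s. W (x + s *\<^sub>R b)" "\<lambda>s. W' (x + s *\<^sub>R b) b"] line by auto
    then have "D n x = W' (x + z *\<^sub>R b) b" by (simp add: D_def del: of_nat_Suc)
    then show ?thesis using B(2) by simp
  qed
  have D0: "D n x = 0" if "norm x > R" for n x
  proof -
    have "norm ((1 / real (Suc n)) *\<^sub>R b) \<le> 1 * norm b" unfolding norm_scaleR by (intro mult_right_mono) auto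
    then have "norm (x + (1 / real (Suc n)) *\<^sub>R b) \<ge> r"
      using that norm_diff_ineq[of x "(1 / real (Suc n)) *\<^sub>R b"] unfolding R_def by linarith
    moreover have "norm x \<ge> r" using that norm_ge_zero[of b] unfolding R_def by linarith
    ultimately show ?thesis by (simp add: D_def supp)
  qed
  have "(\<lambda>n. \<integral>x. D n x \<partial>lborel) \<longlonglongrightarrow> (\<integral>x. W' x b \<partial>lborel)"
  proof (rule integral_dominated_convergence[where w="\<lambda>x. B * indicator (cball 0 R) x"])
    show "AE x in lborel. (\<lambda>n. D n x) \<longlonglongrightarrow> W' x b"
    proof (rule AE_I2)
      fix x
      have "((\<lambda>s. (W (x + s *\<^sub>R b) - W x) / s) \<longlongrightarrow> W' x b) (at 0)"
        using line[of x 0] by (simp add: DERIV_def)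
      then have "(\<lambda>n. (W (x + (1 / real (Suc n)) *\<^sub>R b) - W x) / (1 / real (Suc n))) \<longlonglongrightarrow> W' x b"
      proof (rule filterlim_compose)
        have "(\<lambda>n. 1 / real (Suc n)) \<longlonglongrightarrow> 0" by (rule LIMSEQ_Suc[OF lim_1_over_n])
        then show "filterlim (\<lambda>n. 1 / real (Suc n)) (at 0) sequentially"
          by (simp add: filterlim_at del: of_nat_Suc)
      qed
      then show "(\<lambda>n. D n x) \<longlonglongrightarrow> W' x b" by (simp add: D_def del: of_nat_Suc)
    qed
    show "AE x in lborel. norm (D n x) \<le> B * indicator (cball 0 R) x" for n
      using DB[of n] D0[where n=n] by (intro AE_I2) (auto simp: indicator_def not_le)
    show "integrable lborel (\<lambda>x. B * indicator (cball 0 R) (x::'e) :: real)"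
      using emeasure_lborel_cball_finite[of "0::'e" R] by (intro integrable_mult_right integrable_real_indicator) auto
    show "(\<lambda>x. W' x b) \<in> borel_measurable lborel" using cont by (auto intro: borel_measurable_continuous_onI)
    show "D n \<in> borel_measurable lborel" for n unfolding D_def by measurable
  qed
  moreover have "(\<integral>x. D n x \<partial>lborel) = 0" for n
  proof -
    have "(\<integral>x. D n x \<partial>lborel) = ((\<integral>x. W (x + (1 / real (Suc n)) *\<^sub>R b) \<partial>lborel) - (\<integral>x. W x \<partial>lborel)) * real (Suc n)"
      unfolding D_def using integral_translate(2)[OF Wm Wi] Wi
      by (subst integral_mult_left_zero, subst Bochner_Integration.integral_diff) auto
    then show ?thesis using integral_translate(1)[OF Wm] by simp
  qed
  ultimately show ?thesis by (simp add: LIMSEQ_const_iff)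
qed

text \<open>A function with bounded derivative grows at most linearly.\<close>
lemma integrable_compose_weight:
  fixes h :: "'e::euclidean_space \<Rightarrow> real" and F F' :: "real \<Rightarrow> real"
  assumes h: "integrable lborel h" and F1: "\<And>y. (F has_real_derivative F' y) (at y)" and F3: "\<And>y. \<bar>F' y\<bar> \<le> L"
    and A[measurable]: "A \<in> borel_measurable borel" and Ab: "\<And>x. \<bar>A x\<bar> \<le> C" "\<And>x. norm x > r \<Longrightarrow> A x = 0"
  shows "integrable lborel (\<lambda>x. A x * F (h x))"
proof -
  have C0: "0 \<le> C" using order_trans[OF abs_ge_zero Ab(1)] .
  have L0: "0 \<le> L" using order_trans[OF abs_ge_zero F3] .
  have Fm[measurable]: "F \<in> borel_measurable borel"
    using F1 by (intro borel_measurable_continuous_onI continuous_at_imp_continuous_on) (blast intro: DERIV_isCont)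
  have Lip: "\<bar>F a - F b\<bar> \<le> L * \<bar>a - b\<bar>" for a b
    using field_differentiable_bound[of UNIV F F' L a b] F1 F3 by (auto intro: has_field_derivative_at_within)
  show ?thesis
  proof (rule Bochner_Integration.integrable_bound)
    show "integrable lborel (\<lambda>x. C * \<bar>F 0\<bar> * indicator (cball 0 r) x + C * (L * \<bar>h x\<bar>))"
      using emeasure_lborel_cball_finite[of "0::'e" r] h
      by (intro Bochner_Integration.integrable_add integrable_mult_right integrable_real_indicator) auto
    have [measurable]: "h \<in> borel_measurable borel" using h by auto
    show "(\<lambda>x. A x * F (h x)) \<in> borel_measurable lborel" by measurable
    show "AE x in lborel. norm (A x * F (h x)) \<le> norm (C * \<bar>F 0\<bar> * indicator (cball 0 r) x + C * (L * \<bar>h x\<bar>))"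
    proof (rule AE_I2)
      fix x
      show "norm (A x * F (h x)) \<le> norm (C * \<bar>F 0\<bar> * indicator (cball 0 r) x + C * (L * \<bar>h x\<bar>))"
      proof (cases "norm x > r")
        case True then show ?thesis using Ab(2) C0 L0 by simp
      next
        case False
        have "\<bar>F (h x)\<bar> \<le> \<bar>F 0\<bar> + L * \<bar>h x\<bar>" using Lip[of "h x" 0] by simp
        then have "\<bar>A x\<bar> * \<bar>F (h x)\<bar> \<le> C * (\<bar>F 0\<bar> + L * \<bar>h x\<bar>)" using Ab(1)[of x] C0 by (intro mult_mono) auto
        then show ?thesis using False C0 L0 by (simp add: abs_mult algebra_simps)
      qed
    qed
  qed
qed

text \<open>Convergence in the mean suffices to pass to the limit in the chain rule. The problematic product is
F'(fn) gn: along a subsequence fn converges almost everywhere, so F'(fn) converges boundedly, and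
the integrable limit g dominates.\<close>
lemma chain_rule_limit:
  fixes f g :: "'e::euclidean_space \<Rightarrow> real" and fn gn :: "nat \<Rightarrow> 'e \<Rightarrow> real" and F F' :: "real \<Rightarrow> real"
  assumes f: "integrable lborel f" "\<And>n. integrable lborel (fn n)" "(\<lambda>n. \<integral>x. \<bar>fn n x - f x\<bar> \<partial>lborel) \<longlonglongrightarrow> 0"
    and g: "integrable lborel g" "\<And>n. integrable lborel (gn n)" "(\<lambda>n. \<integral>x. \<bar>gn n x - g x\<bar> \<partial>lborel) \<longlonglongrightarrow> 0"
    and F: "\<And>y. (F has_real_derivative F' y) (at y)" "continuous_on UNIV F'" "\<And>y. \<bar>F' y\<bar> \<le> L"
    and A[measurable]: "A \<in> borel_measurable borel" and Ab: "\<And>x. \<bar>A x\<bar> \<le> C" "\<And>x. norm x > r \<Longrightarrow> A x = 0"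
    and B[measurable]: "B \<in> borel_measurable borel" and Bb: "\<And>x. \<bar>B x\<bar> \<le> C"
    and zero: "\<And>n. (\<integral>x. A x * F (fn n x) + B x * F' (fn n x) * gn n x \<partial>lborel) = 0"
  shows "(\<integral>x. A x * F (f x) + B x * F' (f x) * g x \<partial>lborel) = 0"
    and "integrable lborel (\<lambda>x. A x * F (f x))" and "integrable lborel (\<lambda>x. B x * F' (f x) * g x)"
proof -
  have C0: "0 \<le> C" using Ab(1)[of 0] by simp
  have L0: "0 \<le> L" using F(3)[of 0] by simp
  have Fm[measurable]: "F \<in> borel_measurable borel"
    using F(1) by (intro borel_measurable_continuous_onI continuous_at_imp_continuous_on) (blast intro: DERIV_isCont)
  have F'm[measurable]: "F' \<in> borel_measurable borel" using F(2) by (rule borel_measurable_continuous_onI)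
  have fm[measurable]: "f \<in> borel_measurable borel" "fn n \<in> borel_measurable borel" 
    "g \<in> borel_measurable borel" "gn n \<in> borel_measurable borel" for n
    using f g by (auto dest: borel_measurable_integrable)
  have Lip: "\<bar>F a - F b\<bar> \<le> L * \<bar>a - b\<bar>" for a b
    using field_differentiable_bound[of UNIV F F' L a b] F by (auto intro: has_field_derivative_at_within)
  have intAF: "integrable lborel (\<lambda>x. A x * F (h x))" if "integrable lborel h" for h
    using that by (rule integrable_compose_weight[OF _ F(1,3) A Ab])
  have intBF: "integrable lborel (\<lambda>x. B x * F' (h x) * k x)" if k: "integrable lborel k" and [measurable]: "h \<in> borel_measurable borel" for h k
  proof (rule Bochner_Integration.integrable_bound)
    show "integrable lborel (\<lambda>x. C * L * \<bar>k x\<bar>)" using k by simp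
    have [measurable]: "k \<in> borel_measurable borel" using k by auto
    show "(\<lambda>x. B x * F' (h x) * k x) \<in> borel_measurable lborel" by measurable
    show "AE x in lborel. norm (B x * F' (h x) * k x) \<le> norm (C * L * \<bar>k x\<bar>)"
      using C0 L0 Bb F(3) by (intro AE_I2) (auto simp: abs_mult intro!: mult_right_mono mult_mono)
  qed
  show iA: "integrable lborel (\<lambda>x. A x * F (f x))" by (rule intAF[OF f(1)])
  show iB: "integrable lborel (\<lambda>x. B x * F' (f x) * g x)" by (rule intBF[OF g(1)]) measurable
  have "\<exists>\<rho>::nat \<Rightarrow> nat. strict_mono \<rho> \<and> (AE x in lborel. (\<lambda>n. fn (\<rho> n) x - f x) \<longlonglongrightarrow> 0)"
    using f by (intro tendsto_L1_AE_subseq) auto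
  then obtain \<rho> :: "nat \<Rightarrow> nat" where \<rho>: "strict_mono \<rho>" and AE: "AE x in lborel. (\<lambda>n. fn (\<rho> n) x - f x) \<longlonglongrightarrow> 0" by blast
  define X where "X n = (\<integral>x. \<bar>A x * F (fn (\<rho> n) x) + B x * F' (fn (\<rho> n) x) * gn (\<rho> n) x - (A x * F (f x) + B x * F' (f x) * g x)\<bar> \<partial>lborel)" for n
  define I where "I = (\<integral>x. A x * F (f x) + B x * F' (f x) * g x \<partial>lborel)"
  have iI: "integrable lborel (\<lambda>x. A x * F (f x) + B x * F' (f x) * g x)" using iA iB by (rule Bochner_Integration.integrable_add)
  have iIn: "integrable lborel (\<lambda>x. A x * F (fn (\<rho> n) x) + B x * F' (fn (\<rho> n) x) * gn (\<rho> n) x)" for n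
    by (intro Bochner_Integration.integrable_add intAF intBF f g) measurable
  \<comment> \<open>The integral for the approximation vanishes, so the limit integral is at most the mean error.\<close>
  have IX: "\<bar>I\<bar> \<le> X n" for n
  proof -
    have "- I = (\<integral>x. A x * F (fn (\<rho> n) x) + B x * F' (fn (\<rho> n) x) * gn (\<rho> n) x - (A x * F (f x) + B x * F' (f x) * g x) \<partial>lborel)"
      unfolding Bochner_Integration.integral_diff[OF iIn iI] using zero[of "\<rho> n"] by (simp add: I_def)
    then have "\<bar>- I\<bar> \<le> X n" unfolding X_def by (simp only: integral_abs_bound)
    then show ?thesis by simp
  qed
  have T3: "(\<lambda>n. \<integral>x. C * (\<bar>F' (fn (\<rho> n) x) - F' (f x)\<bar> * \<bar>g x\<bar>) \<partial>lborel) \<longlonglongrightarrow> (\<integral>x. 0 \<partial>(lborel :: 'e measure))"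
  proof (rule integral_dominated_convergence[where w="\<lambda>x. C * (2 * L * \<bar>g x\<bar>)"])
    show "AE x in lborel. (\<lambda>n. C * (\<bar>F' (fn (\<rho> n) x) - F' (f x)\<bar> * \<bar>g x\<bar>)) \<longlonglongrightarrow> 0"
      using AE
    proof eventually_elim
      case (elim x)
      then have "(\<lambda>n. fn (\<rho> n) x) \<longlonglongrightarrow> f x" by (simp add: LIM_zero_iff)
      then have "(\<lambda>n. F' (fn (\<rho> n) x)) \<longlonglongrightarrow> F' (f x)" by (rule continuous_on_tendsto_compose[OF F(2)]) auto
      then have "(\<lambda>n. C * (\<bar>F' (fn (\<rho> n) x) - F' (f x)\<bar> * \<bar>g x\<bar>)) \<longlonglongrightarrow> C * (\<bar>F' (f x) - F' (f x)\<bar> * \<bar>g x\<bar>)"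
        by (intro tendsto_intros)
      then show ?case by simp
    qed
    show "AE x in lborel. norm (C * (\<bar>F' (fn (\<rho> n) x) - F' (f x)\<bar> * \<bar>g x\<bar>)) \<le> C * (2 * L * \<bar>g x\<bar>)" for n
    proof (rule AE_I2)
      fix x
      have "\<bar>F' (fn (\<rho> n) x) - F' (f x)\<bar> \<le> 2 * L" using F(3)[of "fn (\<rho> n) x"] F(3)[of "f x"] by linarith
      then show "norm (C * (\<bar>F' (fn (\<rho> n) x) - F' (f x)\<bar> * \<bar>g x\<bar>)) \<le> C * (2 * L * \<bar>g x\<bar>)"
        using C0 by (simp add: abs_mult mult_left_mono mult_right_mono)
    qed
  qed (use g in \<open>auto\<close>)
  have "X n \<le> C * L * (\<integral>x. \<bar>fn (\<rho> n) x - f x\<bar> \<partial>lborel) + C * L * (\<integral>x. \<bar>gn (\<rho> n) x - g x\<bar> \<partial>lborel)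
     + (\<integral>x. C * (\<bar>F' (fn (\<rho> n) x) - F' (f x)\<bar> * \<bar>g x\<bar>) \<partial>lborel)" for n
  proof -
    have i3: "integrable lborel (\<lambda>x. C * (\<bar>F' (fn (\<rho> n) x) - F' (f x)\<bar> * \<bar>g x\<bar>))"
    proof (rule Bochner_Integration.integrable_bound)
      show "integrable lborel (\<lambda>x. C * (2 * L * \<bar>g x\<bar>))" using g by simp
      show "AE x in lborel. norm (C * (\<bar>F' (fn (\<rho> n) x) - F' (f x)\<bar> * \<bar>g x\<bar>)) \<le> norm (C * (2 * L * \<bar>g x\<bar>))"
      proof (rule AE_I2)
        fix x
        have "\<bar>F' (fn (\<rho> n) x) - F' (f x)\<bar> \<le> 2 * L" using F(3)[of "fn (\<rho> n) x"] F(3)[of "f x"] by linarith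
        then show "norm (C * (\<bar>F' (fn (\<rho> n) x) - F' (f x)\<bar> * \<bar>g x\<bar>)) \<le> norm (C * (2 * L * \<bar>g x\<bar>))"
          using C0 L0 by (simp add: abs_mult mult_left_mono mult_right_mono)
      qed
    qed measurable
    have "X n \<le> (\<integral>x. C * L * \<bar>fn (\<rho> n) x - f x\<bar> + C * L * \<bar>gn (\<rho> n) x - g x\<bar> + C * (\<bar>F' (fn (\<rho> n) x) - F' (f x)\<bar> * \<bar>g x\<bar>) \<partial>lborel)"
      unfolding X_def
    proof (rule integral_mono)
      show "integrable lborel (\<lambda>x. \<bar>A x * F (fn (\<rho> n) x) + B x * F' (fn (\<rho> n) x) * gn (\<rho> n) x - (A x * F (f x) + B x * F' (f x) * g x)\<bar>)"
        using iIn iI by auto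
      show "integrable lborel (\<lambda>x. C * L * \<bar>fn (\<rho> n) x - f x\<bar> + C * L * \<bar>gn (\<rho> n) x - g x\<bar> + C * (\<bar>F' (fn (\<rho> n) x) - F' (f x)\<bar> * \<bar>g x\<bar>))"
        using f g i3 by auto
      fix x
      let ?a = "fn (\<rho> n) x" and ?b = "gn (\<rho> n) x"
      have eq: "A x * F ?a + B x * F' ?a * ?b - (A x * F (f x) + B x * F' (f x) * g x)
        = A x * (F ?a - F (f x)) + B x * F' ?a * (?b - g x) + B x * ((F' ?a - F' (f x)) * g x)" by (simp add: algebra_simps)
      have t1: "\<bar>A x * (F ?a - F (f x))\<bar> \<le> C * (L * \<bar>?a - f x\<bar>)"
        unfolding abs_mult using Ab(1) C0 Lip by (intro mult_mono) auto
      have t2: "\<bar>B x * F' ?a * (?b - g x)\<bar> \<le> C * L * \<bar>?b - g x\<bar>"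
        unfolding abs_mult using Bb C0 L0 F(3) by (intro mult_right_mono mult_mono) auto
      have t3: "\<bar>B x * ((F' ?a - F' (f x)) * g x)\<bar> \<le> C * (\<bar>F' ?a - F' (f x)\<bar> * \<bar>g x\<bar>)"
        unfolding abs_mult using Bb by (intro mult_right_mono) auto
      show "\<bar>A x * F ?a + B x * F' ?a * ?b - (A x * F (f x) + B x * F' (f x) * g x)\<bar>
         \<le> C * L * \<bar>?a - f x\<bar> + C * L * \<bar>?b - g x\<bar> + C * (\<bar>F' ?a - F' (f x)\<bar> * \<bar>g x\<bar>)"
        unfolding eq mult.assoc[of C L "\<bar>?a - f x\<bar>"]
        by (rule order_trans[OF abs_triangle_ineq add_mono[OF order_trans[OF abs_triangle_ineq add_mono[OF t1 t2]] t3]])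
    qed
    also have "\<dots> = C * L * (\<integral>x. \<bar>fn (\<rho> n) x - f x\<bar> \<partial>lborel) + C * L * (\<integral>x. \<bar>gn (\<rho> n) x - g x\<bar> \<partial>lborel)
     + (\<integral>x. C * (\<bar>F' (fn (\<rho> n) x) - F' (f x)\<bar> * \<bar>g x\<bar>) \<partial>lborel)"
    proof -
      have "integrable lborel (\<lambda>x. C * L * \<bar>fn (\<rho> n) x - f x\<bar>)" "integrable lborel (\<lambda>x. C * L * \<bar>gn (\<rho> n) x - g x\<bar>)"
        using f g by auto
      then show ?thesis using i3 by (simp add: Bochner_Integration.integral_add)
    qed
    finally show ?thesis .
  qed
  then have le: "\<bar>I\<bar> \<le> C * L * (\<integral>x. \<bar>fn (\<rho> n) x - f x\<bar> \<partial>lborel) + C * L * (\<integral>x. \<bar>gn (\<rho> n) x - g x\<bar> \<partial>lborel)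
     + (\<integral>x. C * (\<bar>F' (fn (\<rho> n) x) - F' (f x)\<bar> * \<bar>g x\<bar>) \<partial>lborel)" for n
    using IX order_trans by blast
  have "(\<lambda>n. C * L * (\<integral>x. \<bar>fn (\<rho> n) x - f x\<bar> \<partial>lborel) + C * L * (\<integral>x. \<bar>gn (\<rho> n) x - g x\<bar> \<partial>lborel)
     + (\<integral>x. C * (\<bar>F' (fn (\<rho> n) x) - F' (f x)\<bar> * \<bar>g x\<bar>) \<partial>lborel)) \<longlonglongrightarrow> C * L * 0 + C * L * 0 + (\<integral>x. 0 \<partial>(lborel :: 'e measure))"
    by (intro tendsto_add tendsto_mult tendsto_const T3 LIMSEQ_subseq_LIMSEQ[OF f(3) \<rho>, unfolded comp_def] LIMSEQ_subseq_LIMSEQ[OF g(3) \<rho>, unfolded comp_def])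
  then have "\<bar>I\<bar> \<le> C * L * 0 + C * L * 0 + (\<integral>x. 0 \<partial>(lborel :: 'e measure))"
    by (rule tendsto_lowerbound) (use le in auto)
  then have "I = 0" by simp
  then show "(\<integral>x. A x * F (f x) + B x * F' (f x) * g x \<partial>lborel) = 0" by (simp add: I_def)
qed

lemma bump_frechet: "frechet_derivative (\<lambda>y. bump \<epsilon> (y - x)) (at y) = (\<lambda>v. bump_grad \<epsilon> (y - x) \<bullet> v)"
proof -
  have "((\<lambda>y. bump \<epsilon> (y - x)) has_derivative (\<lambda>v. bump_grad \<epsilon> (y - x) \<bullet> v)) (at y)"
    by (rule has_derivative_compose[OF _ bump_has_derivative, of "\<lambda>y. y - x" "\<lambda>v. v"]) (auto intro!: derivative_eq_intros)
  then show ?thesis by (rule frechet_derivative_at[symmetric])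
qed

text \<open>Weak differentiation commutes with mollification, because the translated bump is a
test function. The indicator of K2 makes both functions integrable on the whole space without being seen by the bump.\<close>
lemma weak_derivative_mollify:
  fixes f :: "real^'n \<Rightarrow> real"
  assumes wd: "weak_derivative \<Omega> f h" and K2: "compact K2" "K2 \<subseteq> \<Omega>" and sub: "cball x \<epsilon> \<subseteq> K2" and \<epsilon>: "0 < \<epsilon>"
  shows "mollify_grad \<epsilon> (\<lambda>y. indicator K2 y * f y) x \<bullet> axis i 1 = mollify \<epsilon> (\<lambda>y. indicator K2 y * (h y $ i)) x"
proof -
  define c where "c = (\<integral>w. bump \<epsilon> (w :: real^'n) \<partial>lborel)"
  let ?f = "\<lambda>y. indicator K2 y * f y"
  have fi: "integrable lborel ?f" using wd K2 by (auto simp: weak_derivative_def set_integrable_def)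
  obtain B where B: "\<And>y :: real^'n. norm (bump_grad \<epsilon> y) \<le> B" using bump_grad_bounded[OF \<epsilon>] by blast
  have int: "integrable lborel (\<lambda>y. (?f y / c) *\<^sub>R bump_grad \<epsilon> (y - x))"
    using fi by (intro integrable_shift_mult[OF _ _ B]) auto
  have test: "test_function \<Omega> (\<lambda>y. bump \<epsilon> (y - x))" using \<epsilon> sub K2 by (intro bump_test_function) auto
  have in2: "bump_grad \<epsilon> (y - x) = 0" "bump \<epsilon> (y - x) = 0" if "y \<notin> K2" for y
  proof -
    have "y \<notin> cball x \<epsilon>" using sub that by auto
    then have "norm (y - x) \<ge> \<epsilon>" by (simp add: dist_norm norm_minus_commute)
    then show "bump_grad \<epsilon> (y - x) = 0" "bump \<epsilon> (y - x) = 0" using bump_grad_zero[OF \<epsilon>] bump_zero[OF \<epsilon>] by auto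
  qed
  have in3: "indicator \<Omega> y = (1::real)" if "y \<in> K2" for y using that K2 by auto
  have "mollify_grad \<epsilon> ?f x \<bullet> axis i 1 = - (\<integral>y. ((?f y / c) *\<^sub>R bump_grad \<epsilon> (y - x)) \<bullet> axis i 1 \<partial>lborel)"
    unfolding mollify_grad_def c_def[symmetric] inner_minus_left integral_inner_left[OF int] ..
  also have "(\<integral>y. ((?f y / c) *\<^sub>R bump_grad \<epsilon> (y - x)) \<bullet> axis i 1 \<partial>lborel)
     = (\<integral>y. inverse c * (indicator \<Omega> y *\<^sub>R (f y * frechet_derivative (\<lambda>y. bump \<epsilon> (y - x)) (at y) (axis i 1))) \<partial>lborel)"
  proof (rule Bochner_Integration.integral_cong[OF refl])
    fix y
    show "((?f y / c) *\<^sub>R bump_grad \<epsilon> (y - x)) \<bullet> axis i 1 = inverse c * (indicator \<Omega> y *\<^sub>R (f y * frechet_derivative (\<lambda>y. bump \<epsilon> (y - x)) (at y) (axis i 1)))"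
      unfolding bump_frechet using in2[of y] in3[of y] by (cases "y \<in> K2") (auto simp: divide_inverse)
  qed
  also have "\<dots> = inverse c * (LINT y:\<Omega>|lborel. f y * frechet_derivative (\<lambda>y. bump \<epsilon> (y - x)) (at y) (axis i 1))"
    by (simp add: set_lebesgue_integral_def)
  also have "(LINT y:\<Omega>|lborel. f y * frechet_derivative (\<lambda>y. bump \<epsilon> (y - x)) (at y) (axis i 1)) = - (LINT y:\<Omega>|lborel. (h y $ i) * bump \<epsilon> (y - x))"
    using wd test unfolding weak_derivative_def by blast
  also have "- (inverse c * - (LINT y:\<Omega>|lborel. (h y $ i) * bump \<epsilon> (y - x))) = (\<integral>y. inverse c * (indicator \<Omega> y *\<^sub>R ((h y $ i) * bump \<epsilon> (y - x))) \<partial>lborel)"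
    by (simp add: set_lebesgue_integral_def)
  also have "\<dots> = mollify \<epsilon> (\<lambda>y. indicator K2 y * (h y $ i)) x" unfolding mollify_def c_def[symmetric]
  proof (rule Bochner_Integration.integral_cong[OF refl])
    fix y
    show "inverse c * (indicator \<Omega> y *\<^sub>R ((h y $ i) * bump \<epsilon> (y - x))) = indicator K2 y * (h y $ i) * (bump \<epsilon> (y - x) / c)"
      using in2[of y] in3[of y] by (cases "y \<in> K2") (auto simp: divide_inverse)
  qed
  finally show ?thesis .
qed

text \<open>For the mollifications of f the identity says that the classical derivative of w F(f) \<tau> has integral zero;
it survives the limit in the mean. The functions are multiplied with the indicator of a compact
neighbourhood K2 of the support of \<tau>, on which f and h are integrable.\<close>
lemma weak_derivative_chain_test:
  fixes f :: "real^'n \<Rightarrow> real"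
  assumes \<Omega>: "open \<Omega>" and wd: "weak_derivative \<Omega> f h" and w: "Ck_on 1 \<Omega> w"
    and F: "\<And>y. (F has_real_derivative F' y) (at y)" "continuous_on UNIV F'" "\<And>y. \<bar>F' y\<bar> \<le> L"
    and test: "test_function \<Omega> \<tau>"
  shows "(LINT y:\<Omega>|lborel. (w y * F (f y)) * frechet_derivative \<tau> (at y) (axis i 1))
    = - (LINT y:\<Omega>|lborel. (F (f y) * frechet_derivative w (at y) (axis i 1) + (w y * F' (f y)) * (h y $ i)) * \<tau> y)"
proof -
  define e where "e = (axis i 1 :: real^'n)"
  have e: "e \<in> Basis" by (simp add: e_def axis_in_Basis_iff)
  define K where "K = closure {y. \<tau> y \<noteq> 0}"
  have K: "compact K" "K \<subseteq> \<Omega>" using test by (auto simp: test_function_def K_def)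
  have Kc: "closed K" by (simp add: K_def)
  obtain \<rho> where \<rho>: "\<rho> > 0" "(\<Union>x\<in>K. cball x \<rho>) \<subseteq> \<Omega>"
    using compact_subset_open_imp_cball_epsilon_subset[OF K(1) \<Omega> K(2)] by blast
  define K2 where "K2 = (\<Union>x\<in>K. cball x \<rho>)"
  have K2: "compact K2" "K2 \<subseteq> \<Omega>"
  proof -
    have "K2 = {x + y |x y. x \<in> K \<and> y \<in> cball 0 \<rho>}"
    proof (intro equalityI subsetI)
      fix z assume "z \<in> K2"
      then obtain x where "x \<in> K" "dist x z \<le> \<rho>" by (auto simp: K2_def)
      then show "z \<in> {x + y |x y. x \<in> K \<and> y \<in> cball 0 \<rho>}"
        by (intro CollectI exI[of _ x] exI[of _ "z - x"]) (auto simp: dist_norm norm_minus_commute)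
    next
      fix z assume "z \<in> {x + y |x y. x \<in> K \<and> y \<in> cball 0 \<rho>}"
      then show "z \<in> K2" by (auto simp: K2_def dist_norm intro!: bexI)
    qed
    then show "compact K2" by (simp only: compact_sums[OF K(1) compact_cball])
  qed (use \<rho> in \<open>simp add: K2_def\<close>)
  have KK2: "K \<subseteq> K2" using \<rho>(1) by (force simp: K2_def)
  define f' where "f' y = indicator K2 y * f y" for y
  define g where "g y = indicator K2 y * (h y $ i)" for y
  have f'i: "integrable lborel f'" using wd K2 by (auto simp: weak_derivative_def set_integrable_def f'_def[abs_def])
  have gi: "integrable lborel g"
  proof -
    have "integrable lborel (\<lambda>y. indicator K2 y *\<^sub>R h y)" using wd K2 by (auto simp: weak_derivative_def set_integrable_def)
    from integrable_inner_left[OF this, of e] show ?thesis by (simp add: g_def[abs_def] e_def inner_axis)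
  qed
  have wD: "(w has_derivative frechet_derivative w (at x)) (at x)" if "x \<in> \<Omega>" for x
    using w that by (simp add: frechet_derivative_works)
  have wc: "continuous_on \<Omega> w" using Ck_on_Suc_D[of 0 \<Omega> w] w by simp
  have wDc: "continuous_on \<Omega> (\<lambda>x. frechet_derivative w (at x) e)" using w e by simp
  have t1: "Ck_on 1 UNIV \<tau>" using test by (simp add: test_function_def smooth_on_def del: Ck_on.simps One_nat_def)
  have tD: "(\<tau> has_derivative frechet_derivative \<tau> (at x)) (at x)" for x
    using t1 by (simp add: frechet_derivative_works)
  have tc: "continuous_on UNIV \<tau>" using Ck_on_Suc_D[of 0 UNIV \<tau>] t1 by simp
  have tDc: "continuous_on UNIV (\<lambda>x. frechet_derivative \<tau> (at x) e)" using t1 e by simp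
  have t0: "\<tau> x = 0" if "x \<notin> K" for x
    using that closure_subset[of "{y. \<tau> y \<noteq> 0}"] unfolding K_def by auto
  have tD0: "frechet_derivative \<tau> (at x) = (\<lambda>v. 0)" if "x \<notin> K" for x
  proof -
    have "((\<lambda>x. 0) has_derivative (\<lambda>v. 0)) (at x)" by simp
    then have "(\<tau> has_derivative (\<lambda>v. 0)) (at x)"
      by (rule has_derivative_transform_within_open[where s="- K"]) (use that Kc t0 in auto)
    then show ?thesis using tD has_derivative_unique by blast
  qed
  define A where "A x = indicator K x *\<^sub>R (w x * frechet_derivative \<tau> (at x) e + frechet_derivative w (at x) e * \<tau> x)" for x
  define B where "B x = indicator K x *\<^sub>R (w x * \<tau> x)" for x
  have cA: "continuous_on K (\<lambda>x. w x * frechet_derivative \<tau> (at x) e + frechet_derivative w (at x) e * \<tau> x)"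
    using K(2) by (intro continuous_intros continuous_on_subset[OF wc] continuous_on_subset[OF wDc] continuous_on_subset[OF tc] continuous_on_subset[OF tDc]) auto
  have cB: "continuous_on K (\<lambda>x. w x * \<tau> x)"
    using K(2) by (intro continuous_intros continuous_on_subset[OF wc] continuous_on_subset[OF tc]) auto
  have Am: "A \<in> borel_measurable borel" "B \<in> borel_measurable borel"
    unfolding A_def B_def using Kc by (intro borel_measurable_continuous_on_indicator cA cB; simp)+
  obtain C where C: "\<And>x. \<bar>A x\<bar> \<le> C" "\<And>x. \<bar>B x\<bar> \<le> C"
  proof -
    have bA: "bounded ((\<lambda>x. w x * frechet_derivative \<tau> (at x) e + frechet_derivative w (at x) e * \<tau> x) ` K)"
      by (intro compact_imp_bounded compact_continuous_image cA K)
    have bB: "bounded ((\<lambda>x. w x * \<tau> x) ` K)"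
      by (intro compact_imp_bounded compact_continuous_image cB K)
    obtain C1 where C1: "\<And>x. x \<in> K \<Longrightarrow> \<bar>w x * frechet_derivative \<tau> (at x) e + frechet_derivative w (at x) e * \<tau> x\<bar> \<le> C1"
      using bA unfolding bounded_iff by auto
    obtain C2 where C2: "\<And>x. x \<in> K \<Longrightarrow> \<bar>w x * \<tau> x\<bar> \<le> C2"
      using bB unfolding bounded_iff by auto
    show ?thesis
    proof (rule that[of "max 0 (max C1 C2)"])
      show "\<bar>A x\<bar> \<le> max 0 (max C1 C2)" for x using C1[of x] by (auto simp: A_def indicator_def le_max_iff_disj)
      show "\<bar>B x\<bar> \<le> max 0 (max C1 C2)" for x using C2[of x] by (auto simp: B_def indicator_def le_max_iff_disj)
    qed
  qed
  obtain r where r: "\<And>x. x \<in> K \<Longrightarrow> norm x \<le> r" using compact_imp_bounded[OF K(1)] bounded_iff by metis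
  have A0: "A x = 0" if "norm x > r" for x using r[of x] that by (auto simp: A_def indicator_def)
  have key: "(\<integral>x. A x * F (mollify \<epsilon> f' x) + B x * F' (mollify \<epsilon> f' x) * mollify \<epsilon> g x \<partial>lborel) = 0"
    if \<epsilon>: "0 < \<epsilon>" "\<epsilon> \<le> \<rho>" for \<epsilon>
  proof -
    let ?m = "mollify \<epsilon> f'" and ?G = "mollify_grad \<epsilon> f'"
    define W where "W x = (if x \<in> \<Omega> then w x * F (?m x) * \<tau> x else 0)" for x
    define W' where "W' x v = (if x \<in> \<Omega> then w x * F (?m x) * frechet_derivative \<tau> (at x) v
        + (w x * (?G x \<bullet> v * F' (?m x)) + frechet_derivative w (at x) v * F (?m x)) * \<tau> x else 0)" for x v
    have mD: "(?m has_derivative (\<lambda>v. ?G x \<bullet> v)) (at x)" for x by (rule mollify_has_derivative[OF f'i \<epsilon>(1)])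
    have mc: "continuous_on UNIV ?m" by (rule mollify_continuous[OF f'i \<epsilon>(1)])
    have Gc: "continuous_on UNIV ?G" by (rule mollify_grad_continuous[OF f'i \<epsilon>(1)])
    have Fc: "continuous_on UNIV F" using F(1) by (intro continuous_at_imp_continuous_on) (blast intro: DERIV_isCont)
    have off: "W x = 0" "W' x v = 0" if "x \<notin> K" for x v using t0[OF that] tD0[OF that] by (auto simp: W_def W'_def)
    have "(\<integral>x. W' x e \<partial>lborel) = 0"
    proof (rule integral_derivative_zero[where W=W and r="r + 1"])
      show "W x = 0" if "norm x \<ge> r + 1" for x using r[of x] that by (intro off) auto
      show "(W has_derivative W' x) (at x)" for x
      proof (cases "x \<in> \<Omega>")
        case True
        have "((\<lambda>x. F (?m x)) has_derivative (\<lambda>v. ?G x \<bullet> v * F' (?m x))) (at x)"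
          using DERIV_compose_FDERIV[OF F(1) mD] by simp
        from has_derivative_mult[OF has_derivative_mult[OF wD[OF True] this] tD]
        have "((\<lambda>x. w x * F (?m x) * \<tau> x) has_derivative W' x) (at x)" using True by (simp add: W'_def[abs_def])
        then show ?thesis by (rule has_derivative_transform_within_open[OF _ \<Omega> True]) (simp add: W_def)
      next
        case False
        then have x: "x \<in> - K" using K by auto
        have "((\<lambda>x. 0) has_derivative (\<lambda>v. 0)) (at x)" by simp
        then have "(W has_derivative (\<lambda>v. 0)) (at x)"
          by (rule has_derivative_transform_within_open[where s="- K"]) (use x Kc off in auto)
        then show ?thesis using False by (simp add: W'_def[abs_def])
      qed
      have "continuous_on (\<Omega> \<union> - K) (\<lambda>x. W' x e)"
      proof (rule continuous_on_open_Un[OF \<Omega>])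
        show "open (- K)" using Kc by auto
        have "continuous_on \<Omega> (\<lambda>x. w x * F (?m x) * frechet_derivative \<tau> (at x) e
          + (w x * (?G x \<bullet> e * F' (?m x)) + frechet_derivative w (at x) e * F (?m x)) * \<tau> x)"
          by (intro continuous_intros wc wDc continuous_on_subset[OF tc] continuous_on_subset[OF tDc] continuous_on_subset[OF Gc]
              continuous_on_compose2[OF Fc] continuous_on_compose2[OF F(2)] continuous_on_subset[OF mc]) auto
        then show "continuous_on \<Omega> (\<lambda>x. W' x e)" by (rule continuous_on_eq) (simp add: W'_def)
        show "continuous_on (- K) (\<lambda>x. W' x e)" by (rule continuous_on_eq[OF continuous_on_const]) (simp add: off)
      qed
      moreover have "\<Omega> \<union> - K = UNIV" using K by auto
      ultimately show "continuous_on UNIV (\<lambda>x. W' x e)" by simp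
    qed
    moreover have "W' x e = A x * F (?m x) + B x * F' (?m x) * mollify \<epsilon> g x" for x
    proof (cases "x \<in> K")
      case True
      have "cball x \<epsilon> \<subseteq> K2" using True \<epsilon> by (force simp: K2_def)
      from weak_derivative_mollify[OF wd K2 this \<epsilon>(1), of i]
      have "?G x \<bullet> e = mollify \<epsilon> g x" unfolding f'_def[abs_def] g_def[abs_def] e_def .
      then show ?thesis using True K(2) by (auto simp: W'_def A_def B_def algebra_simps)
    next
      case False then show ?thesis using off by (simp add: A_def B_def)
    qed
    ultimately show ?thesis by simp
  qed
  have "\<exists>\<epsilon>>0. \<epsilon> \<le> \<rho> \<and> integrable lborel (mollify \<epsilon> f') \<and> (\<integral>x. \<bar>mollify \<epsilon> f' x - f' x\<bar> \<partial>lborel) \<le> 1 / real (Suc n)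
     \<and> integrable lborel (mollify \<epsilon> g) \<and> (\<integral>x. \<bar>mollify \<epsilon> g x - g x\<bar> \<partial>lborel) \<le> 1 / real (Suc n)" for n
  proof -
    have "0 < 1 / real (Suc n)" by simp
    obtain d1 where d1: "d1 > 0" "\<And>\<epsilon>. 0 < \<epsilon> \<Longrightarrow> \<epsilon> < d1 \<Longrightarrow> integrable lborel (mollify \<epsilon> f') \<and> (\<integral>x. \<bar>mollify \<epsilon> f' x - f' x\<bar> \<partial>lborel) \<le> 1 / real (Suc n)"
      using mollify_L1[OF f'i \<open>0 < 1 / real (Suc n)\<close>] by blast
    obtain d2 where d2: "d2 > 0" "\<And>\<epsilon>. 0 < \<epsilon> \<Longrightarrow> \<epsilon> < d2 \<Longrightarrow> integrable lborel (mollify \<epsilon> g) \<and> (\<integral>x. \<bar>mollify \<epsilon> g x - g x\<bar> \<partial>lborel) \<le> 1 / real (Suc n)"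
      using mollify_L1[OF gi \<open>0 < 1 / real (Suc n)\<close>] by blast
    define \<epsilon> where "\<epsilon> = min (min d1 d2) \<rho> / 2"
    have "0 < \<epsilon>" "\<epsilon> < d1" "\<epsilon> < d2" "\<epsilon> \<le> \<rho>" using d1(1) d2(1) \<rho>(1) by (auto simp: \<epsilon>_def min_def)
    then show ?thesis using d1(2)[of \<epsilon>] d2(2)[of \<epsilon>] by blast
  qed
  then have "\<forall>n. \<exists>\<epsilon>>0. \<epsilon> \<le> \<rho> \<and> integrable lborel (mollify \<epsilon> f') \<and> (\<integral>x. \<bar>mollify \<epsilon> f' x - f' x\<bar> \<partial>lborel) \<le> 1 / real (Suc n)
     \<and> integrable lborel (mollify \<epsilon> g) \<and> (\<integral>x. \<bar>mollify \<epsilon> g x - g x\<bar> \<partial>lborel) \<le> 1 / real (Suc n)" ..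
  from choice[OF this] obtain \<epsilon> where E: "\<forall>n. \<epsilon> n > 0 \<and> \<epsilon> n \<le> \<rho> \<and> integrable lborel (mollify (\<epsilon> n) f')
     \<and> (\<integral>x. \<bar>mollify (\<epsilon> n) f' x - f' x\<bar> \<partial>lborel) \<le> 1 / real (Suc n)
     \<and> integrable lborel (mollify (\<epsilon> n) g) \<and> (\<integral>x. \<bar>mollify (\<epsilon> n) g x - g x\<bar> \<partial>lborel) \<le> 1 / real (Suc n)" by (elim exE)
  have \<epsilon>: "\<And>n. 0 < \<epsilon> n" "\<And>n. \<epsilon> n \<le> \<rho>" and fi: "\<And>n. integrable lborel (mollify (\<epsilon> n) f')"
      "\<And>n. (\<integral>x. \<bar>mollify (\<epsilon> n) f' x - f' x\<bar> \<partial>lborel) \<le> 1 / real (Suc n)"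
    and gi': "\<And>n. integrable lborel (mollify (\<epsilon> n) g)" "\<And>n. (\<integral>x. \<bar>mollify (\<epsilon> n) g x - g x\<bar> \<partial>lborel) \<le> 1 / real (Suc n)"
    using E by simp_all
  have lim: "X \<longlonglongrightarrow> 0" if "\<And>n. 0 \<le> X n" "\<And>n. X n \<le> 1 / real (Suc n)" for X :: "nat \<Rightarrow> real"
    by (rule tendsto_sandwich[OF _ _ tendsto_const LIMSEQ_Suc[OF lim_1_over_n]]) (use that in auto)
  have flim: "(\<lambda>n. \<integral>x. \<bar>mollify (\<epsilon> n) f' x - f' x\<bar> \<partial>lborel) \<longlonglongrightarrow> 0"
    by (rule lim) (use fi(2) in auto)
  have glim: "(\<lambda>n. \<integral>x. \<bar>mollify (\<epsilon> n) g x - g x\<bar> \<partial>lborel) \<longlonglongrightarrow> 0"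
    by (rule lim) (use gi'(2) in auto)
  note lim_facts = chain_rule_limit[OF f'i fi(1) flim gi gi'(1) glim F Am(1) C(1) A0 Am(2) C(2) key[OF \<epsilon>]]
  have wF: "(\<lambda>y. indicator \<Omega> y *\<^sub>R (w y * F (f y) * frechet_derivative \<tau> (at y) e)) =
     (\<lambda>y. indicator K y *\<^sub>R (w y * frechet_derivative \<tau> (at y) e) * F (f' y))"
    using K(2) KK2 tD0 by (intro ext) (auto simp: indicator_def f'_def)
  have wF2: "(\<lambda>y. indicator \<Omega> y *\<^sub>R ((F (f y) * frechet_derivative w (at y) e + w y * F' (f y) * (h y $ i)) * \<tau> y)) =
     (\<lambda>y. indicator K y *\<^sub>R (frechet_derivative w (at y) e * \<tau> y) * F (f' y) + B y * F' (f' y) * g y)"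
    using K(2) KK2 t0 by (intro ext) (auto simp: indicator_def f'_def g_def B_def algebra_simps)
  have cA1: "continuous_on K (\<lambda>x. w x * frechet_derivative \<tau> (at x) e)"
    using K(2) by (intro continuous_intros continuous_on_subset[OF wc] continuous_on_subset[OF tDc]) auto
  have i1: "integrable lborel (\<lambda>y. indicator K y *\<^sub>R (w y * frechet_derivative \<tau> (at y) e) * F (f' y))"
  proof -
    have m: "(\<lambda>y. indicator K y *\<^sub>R (w y * frechet_derivative \<tau> (at y) e)) \<in> borel_measurable borel"
      using Kc by (intro borel_measurable_continuous_on_indicator cA1) simp
    obtain C1 where C1: "\<And>x. x \<in> K \<Longrightarrow> \<bar>w x * frechet_derivative \<tau> (at x) e\<bar> \<le> C1"
      using compact_imp_bounded[OF compact_continuous_image[OF cA1 K(1)]] unfolding bounded_iff by auto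
    have b: "\<bar>indicator K x *\<^sub>R (w x * frechet_derivative \<tau> (at x) e)\<bar> \<le> max C1 C" for x
      using C1[of x] C(1)[of x] abs_ge_zero[of "A x"] by (auto simp: indicator_def le_max_iff_disj)
    have bB: "\<bar>B x\<bar> \<le> max C1 C" for x using C(2)[of x] by (simp add: le_max_iff_disj)
    have z: "indicator K x *\<^sub>R (w x * frechet_derivative \<tau> (at x) e) = 0" if "norm x > r" for x
      using r[of x] that by (auto simp: indicator_def)
    show ?thesis
      using integrable_compose_weight[OF f'i F(1) F(3) m b z] .
  qed
  have i2: "integrable lborel (\<lambda>y. indicator K y *\<^sub>R (frechet_derivative w (at y) e * \<tau> y) * F (f' y))"
  proof -
    have "integrable lborel (\<lambda>y. A y * F (f' y) - indicator K y *\<^sub>R (w y * frechet_derivative \<tau> (at y) e) * F (f' y))"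
      using lim_facts(2) i1 by (rule Bochner_Integration.integrable_diff)
    moreover have "(\<lambda>y. A y * F (f' y) - indicator K y *\<^sub>R (w y * frechet_derivative \<tau> (at y) e) * F (f' y))
       = (\<lambda>y. indicator K y *\<^sub>R (frechet_derivative w (at y) e * \<tau> y) * F (f' y))" by (auto simp: A_def algebra_simps)
    ultimately show ?thesis by simp
  qed
  have "(LINT y:\<Omega>|lborel. (w y * F (f y)) * frechet_derivative \<tau> (at y) e)
     + (LINT y:\<Omega>|lborel. (F (f y) * frechet_derivative w (at y) e + (w y * F' (f y)) * (h y $ i)) * \<tau> y)
     = (\<integral>y. A y * F (f' y) + B y * F' (f' y) * g y \<partial>lborel)"
    unfolding set_lebesgue_integral_def wF wF2
    using i1 i2 lim_facts(3)
    by (subst Bochner_Integration.integral_add[symmetric]) (auto simp: A_def algebra_simps)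
  also have "\<dots> = 0" by (rule lim_facts(1))
  finally show ?thesis unfolding e_def by simp
qed

text \<open>The weak gradient of w F(f) is F(f) \<nabla>w + w F'(f) \<nabla>f. The factor w is the C1 cutoff of the
test function, the factor F(f) its power of 1 + u.\<close>
lemma weak_derivative_chain:
  fixes f :: "real^'n \<Rightarrow> real"
  assumes \<Omega>: "open \<Omega>" and wd: "weak_derivative \<Omega> f h" and w: "Ck_on 1 \<Omega> w"
    and F: "\<And>y. (F has_real_derivative F' y) (at y)" "continuous_on UNIV F'" "\<And>y. \<bar>F' y\<bar> \<le> L"
  shows "weak_derivative \<Omega> (\<lambda>y. w y * F (f y))
     (\<lambda>y. F (f y) *\<^sub>R (\<chi> i. frechet_derivative w (at y) (axis i 1)) + (w y * F' (f y)) *\<^sub>R h y)"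
  unfolding weak_derivative_def
proof (intro conjI allI impI)
  fix K assume K: "compact K \<and> K \<subseteq> \<Omega>"
  then have Kc: "K \<in> sets borel" by (simp add: borel_closed compact_imp_closed)
  have wc: "continuous_on K w" using Ck_on_Suc_D[of 0 \<Omega> w] w K by (auto intro: continuous_on_subset)
  have Dc: "continuous_on K (\<lambda>y. \<chi> i. frechet_derivative w (at y) (axis i 1))"
    using w K by (intro continuous_on_vec_lambda) (auto intro: continuous_on_subset simp: axis_in_Basis_iff)
  let ?D = "\<lambda>y. \<chi> i. frechet_derivative w (at y) (axis i 1)"
  define f' where "f' y = indicator K y * f y" for y
  define h' where "h' y = indicator K y *\<^sub>R h y" for y
  have f'i: "integrable lborel f'" using wd K by (auto simp: weak_derivative_def set_integrable_def f'_def[abs_def])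
  have h'i: "integrable lborel h'" using wd K by (auto simp: weak_derivative_def set_integrable_def h'_def[abs_def])
  have [measurable]: "f' \<in> borel_measurable borel" "h' \<in> borel_measurable borel" using f'i h'i by auto
  have wm[measurable]: "(\<lambda>y. indicator K y *\<^sub>R w y) \<in> borel_measurable borel"
    by (intro borel_measurable_continuous_on_indicator wc Kc)
  have Dm[measurable]: "(\<lambda>y. indicator K y *\<^sub>R ?D y) \<in> borel_measurable borel"
    by (intro borel_measurable_continuous_on_indicator Dc Kc)
  have Fm[measurable]: "F \<in> borel_measurable borel"
    using F(1) by (intro borel_measurable_continuous_onI continuous_at_imp_continuous_on) (blast intro: DERIV_isCont)
  have F'm[measurable]: "F' \<in> borel_measurable borel" using F(2) by (rule borel_measurable_continuous_onI)
  obtain r where r: "\<And>x. x \<in> K \<Longrightarrow> norm x \<le> r" using compact_imp_bounded K bounded_iff by metis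
  obtain C1 where C1: "\<And>x. x \<in> K \<Longrightarrow> \<bar>w x\<bar> \<le> C1"
    using compact_imp_bounded[OF compact_continuous_image[OF wc]] K unfolding bounded_iff by auto
  obtain C2 where C2: "\<And>x. x \<in> K \<Longrightarrow> norm (?D x) \<le> C2"
    using compact_imp_bounded[OF compact_continuous_image[OF Dc]] K unfolding bounded_iff by auto
  have wb: "\<bar>indicator K x *\<^sub>R w x\<bar> \<le> max 0 C1" for x using C1[of x] by (auto simp: indicator_def le_max_iff_disj)
  have Db: "\<bar>indicator K x *\<^sub>R norm (?D x)\<bar> \<le> max 0 C2" for x using C2[of x] by (auto simp: indicator_def le_max_iff_disj)
  have i1: "integrable lborel (\<lambda>y. indicator K y *\<^sub>R w y * F (f' y))"
    by (rule integrable_compose_weight[OF f'i F(1) F(3) wm wb, of r]) (use r in \<open>fastforce simp: indicator_def\<close>)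
  have Dm': "(\<lambda>y. indicator K y *\<^sub>R norm (?D y)) \<in> borel_measurable borel"
  proof -
    have "(\<lambda>y. norm (indicator K y *\<^sub>R ?D y)) \<in> borel_measurable borel" by measurable
    moreover have "(\<lambda>y. norm (indicator K y *\<^sub>R ?D y)) = (\<lambda>y. indicator K y *\<^sub>R norm (?D y))" by (auto simp: indicator_def)
    ultimately show ?thesis by simp
  qed
  have i2: "integrable lborel (\<lambda>y. indicator K y *\<^sub>R norm (?D y) * F (f' y))"
    by (rule integrable_compose_weight[OF f'i F(1) F(3) Dm' Db, of r]) (use r in \<open>fastforce simp: indicator_def\<close>)
  show "set_integrable lborel K (\<lambda>y. w y * F (f y))"
  proof -
    have "(\<lambda>y. indicator K y *\<^sub>R w y * F (f' y)) = (\<lambda>y. indicator K y *\<^sub>R (w y * F (f y)))" by (auto simp: f'_def indicator_def)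
    then show ?thesis using i1 by (simp add: set_integrable_def)
  qed
  have eq: "indicator K y *\<^sub>R (F (f y) *\<^sub>R ?D y + (w y * F' (f y)) *\<^sub>R h y)
     = F (f' y) *\<^sub>R (indicator K y *\<^sub>R ?D y) + ((indicator K y *\<^sub>R w y) * F' (f' y)) *\<^sub>R h' y" for y
    by (auto simp: f'_def h'_def indicator_def)
  show "set_integrable lborel K (\<lambda>y. F (f y) *\<^sub>R ?D y + (w y * F' (f y)) *\<^sub>R h y)"
    unfolding set_integrable_def eq
  proof (rule Bochner_Integration.integrable_add)
    show "integrable lborel (\<lambda>y. F (f' y) *\<^sub>R (indicator K y *\<^sub>R ?D y))"
    proof (rule Bochner_Integration.integrable_bound[OF i2])
      show "(\<lambda>y. F (f' y) *\<^sub>R (indicator K y *\<^sub>R ?D y)) \<in> borel_measurable lborel" by measurable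
      show "AE y in lborel. norm (F (f' y) *\<^sub>R (indicator K y *\<^sub>R ?D y)) \<le> norm (indicator K y *\<^sub>R norm (?D y) * F (f' y))"
        by (intro AE_I2) (auto simp: indicator_def abs_mult)
    qed
    show "integrable lborel (\<lambda>y. ((indicator K y *\<^sub>R w y) * F' (f' y)) *\<^sub>R h' y)"
    proof (rule Bochner_Integration.integrable_bound)
      show "integrable lborel (\<lambda>y. max 0 C1 * L * norm (h' y))" using h'i by simp
      show "(\<lambda>y. ((indicator K y *\<^sub>R w y) * F' (f' y)) *\<^sub>R h' y) \<in> borel_measurable lborel" by measurable
      have L0: "0 \<le> L" using F(3)[of 0] by simp
      show "AE y in lborel. norm (((indicator K y *\<^sub>R w y) * F' (f' y)) *\<^sub>R h' y) \<le> norm (max 0 C1 * L * norm (h' y))"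
      proof (rule AE_I2)
        fix y
        have "\<bar>indicator K y *\<^sub>R w y\<bar> * \<bar>F' (f' y)\<bar> * norm (h' y) \<le> max 0 C1 * L * norm (h' y)"
          using wb[of y] F(3)[of "f' y"] L0 by (intro mult_right_mono mult_mono) auto
        then show "norm (((indicator K y *\<^sub>R w y) * F' (f' y)) *\<^sub>R h' y) \<le> norm (max 0 C1 * L * norm (h' y))"
          using L0 by (simp add: abs_mult)
      qed
    qed
  qed
next
  fix \<tau> i assume "test_function \<Omega> \<tau>"
  from weak_derivative_chain_test[OF \<Omega> wd w F this, of i]
  show "(LINT y:\<Omega>|lborel. w y * F (f y) * frechet_derivative \<tau> (at y) (axis i 1)) =
     - (LINT y:\<Omega>|lborel. (F (f y) *\<^sub>R (\<chi> i. frechet_derivative w (at y) (axis i 1)) + (w y * F' (f y)) *\<^sub>R h y) $ i * \<tau> y)"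
    by simp
qed

section \<open>Charts and the metric\<close>

context riemannian_manifold
begin

lemma chart_at: "chart_at M x \<in> charts M" "x \<in> cdom M (chart_at M x)"
proof -
  have "\<exists>c. c \<in> charts M \<and> x \<in> cdom M c" using charts_cover by blast
  from someI_ex[OF this] show "chart_at M x \<in> charts M" "x \<in> cdom M (chart_at M x)"
    by (auto simp: chart_at_def)
qed

lemma cinv_cmap [simp]: "c \<in> charts M \<Longrightarrow> x \<in> cdom M c \<Longrightarrow> cinv M c (cmap M c x) = x"
  using chart_homeomorphism by (auto simp: homeomorphism_def)

lemma cmap_cinv [simp]: "c \<in> charts M \<Longrightarrow> y \<in> cmap M c ` cdom M c \<Longrightarrow> cmap M c (cinv M c y) = y"
  using chart_homeomorphism by (auto simp: homeomorphism_def)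

lemma cinv_in: "c \<in> charts M \<Longrightarrow> y \<in> cmap M c ` cdom M c \<Longrightarrow> cinv M c y \<in> cdom M c"
  by auto

lemma continuous_cmap: "c \<in> charts M \<Longrightarrow> continuous_on (cdom M c) (cmap M c)"
  using chart_homeomorphism by (auto simp: homeomorphism_def)

lemma continuous_cinv: "c \<in> charts M \<Longrightarrow> continuous_on (cmap M c ` cdom M c) (cinv M c)"
  using chart_homeomorphism by (auto simp: homeomorphism_def)

lemma open_cmap_image_sub:
  assumes c: "c \<in> charts M" and U: "open U" "U \<subseteq> cdom M c"
  shows "open (cmap M c ` U)"
proof -
  have eq: "cmap M c ` U = cmap M c ` cdom M c \<inter> cinv M c -` U"
    using U c by (auto simp: image_iff) 
  have "openin (top_of_set (cmap M c ` cdom M c)) (cmap M c ` cdom M c \<inter> cinv M c -` U)"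
    by (rule continuous_openin_preimage_gen[OF continuous_cinv[OF c] U(1)])
  then show ?thesis using openin_open_trans[OF _ open_cmap_image[OF c]] eq by simp
qed

lemma open_cinv_image:
  assumes c: "c \<in> charts M" and U: "open U" "U \<subseteq> cmap M c ` cdom M c"
  shows "open (cinv M c ` U)"
proof -
  have eq: "cinv M c ` U = cdom M c \<inter> cmap M c -` U"
  proof (intro equalityI subsetI)
    fix x assume "x \<in> cinv M c ` U" then show "x \<in> cdom M c \<inter> cmap M c -` U" using U c by auto
  next
    fix x assume x: "x \<in> cdom M c \<inter> cmap M c -` U"
    then show "x \<in> cinv M c ` U" using c by (intro image_eqI[of _ _ "cmap M c x"]) auto
  qed
  have "openin (top_of_set (cdom M c)) (cdom M c \<inter> cmap M c -` U)"
    by (rule continuous_openin_preimage_gen[OF continuous_cmap[OF c] U(1)])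
  then show ?thesis using openin_open_trans[OF _ open_cdom[OF c]] eq by simp
qed

lemma transition_Ck1:
  assumes "c \<in> charts M" "d \<in> charts M"
  shows "Ck_on 1 (cmap M c ` (cdom M c \<inter> cdom M d)) (transition M c d)"
  using smooth_transition[OF assms] unfolding smooth_on_def by blast

lemma open_overlap: "c \<in> charts M \<Longrightarrow> d \<in> charts M \<Longrightarrow> open (cmap M c ` (cdom M c \<inter> cdom M d))"
  by (intro open_cmap_image_sub open_Int open_cdom) auto

lemma transition_has_derivative:
  assumes c: "c \<in> charts M" and d: "d \<in> charts M" and x: "x \<in> cdom M c" "x \<in> cdom M d"
  shows "(transition M c d has_derivative (\<lambda>v. jacobian M c d x *v v)) (at (cmap M c x))"
proof -
  have "transition M c d differentiable at (cmap M c x)"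
    using transition_Ck1[OF c d] x by auto
  then have D: "(transition M c d has_derivative frechet_derivative (transition M c d) (at (cmap M c x))) (at (cmap M c x))"
    by (simp add: frechet_derivative_works)
  then show ?thesis unfolding jacobian_def
    using D matrix_vector_mul(2)[OF has_derivative_linear[OF D]] by simp
qed

text \<open>The squared Riemannian length of the tangent vector at x with coordinates v in the chart c.\<close>
definition gform :: "'i \<Rightarrow> 'a \<Rightarrow> real^'n \<Rightarrow> real" where
  "gform c x v = v \<bullet> (metric M c x *v v)"

lemma gform_nonneg: "c \<in> charts M \<Longrightarrow> x \<in> cdom M c \<Longrightarrow> 0 \<le> gform c x v"
  using metric_positive[of c x v] by (cases "v = 0") (auto simp: gform_def less_imp_le)

lemma metric_pullback:
  assumes "c \<in> charts M" "d \<in> charts M" "x \<in> cdom M c" "x \<in> cdom M d"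
  shows "v \<bullet> (metric M c x *v w) = (jacobian M c d x *v v) \<bullet> (metric M d x *v (jacobian M c d x *v w))"
proof -
  have "metric M c x *v w = transpose (jacobian M c d x) *v (metric M d x *v (jacobian M c d x *v w))"
    using metric_transition[of c d x] assms by (simp add: matrix_vector_mul_assoc matrix_mul_assoc)
  then show ?thesis
    by (metis dot_lmul_matrix inner_commute transpose_matrix_vector)
qed

lemma gform_pullback:
  assumes "c \<in> charts M" "d \<in> charts M" "x \<in> cdom M c" "x \<in> cdom M d"
  shows "gform c x v = gform d x (jacobian M c d x *v v)"
  using metric_pullback[OF assms] by (simp add: gform_def)

lemma continuous_metric_cinv: "c \<in> charts M \<Longrightarrow> continuous_on (cmap M c ` cdom M c) (\<lambda>y. metric M c (cinv M c y))"
  using smooth_metric[of c] unfolding smooth_on_def comp_def by (metis Ck_on.simps(1))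

lemma continuous_metric: "c \<in> charts M \<Longrightarrow> continuous_on (cdom M c) (metric M c)"
proof -
  assume c: "c \<in> charts M"
  have "continuous_on (cdom M c) (\<lambda>x. metric M c (cinv M c (cmap M c x)))"
    by (rule continuous_on_compose2[OF continuous_metric_cinv[OF c] continuous_cmap[OF c]]) auto
  then show ?thesis using c by (simp cong: continuous_on_cong)
qed

lemma continuous_gform:
  assumes c: "c \<in> charts M" and g: "continuous_on T g" "g ` T \<subseteq> cdom M c" and v: "continuous_on T v"
  shows "continuous_on T (\<lambda>t. gform c (g t) (v t))"
proof -
  have "continuous_on T (\<lambda>t. metric M c (g t))"
    by (rule continuous_on_compose2[OF continuous_metric[OF c] g])
  then show ?thesis unfolding gform_def matrix_vector_mult_def by (intro continuous_intros v)
qed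

section \<open>Speed and length of curves\<close>

lemma C1_curveD:
  assumes "C1_curve M a b \<gamma>" "c \<in> charts M"
  obtains v where "continuous_on {t \<in> {a..b}. \<gamma> t \<in> cdom M c} v"
    "\<And>t. t \<in> {a..b} \<Longrightarrow> \<gamma> t \<in> cdom M c \<Longrightarrow> ((cmap M c \<circ> \<gamma>) has_vector_derivative v t) (at t within {a..b})"
  using assms unfolding C1_curve_def Let_def by (metis (mono_tags, lifting) mem_Collect_eq)

text \<open>The speed is defined in the chart chosen at the point; since the metric is pulled back by the
transition maps, any chart computes it.\<close>
lemma speed_in_chart:
  assumes \<gamma>: "continuous_on {a<..<b} \<gamma>" and t: "a < t" "t < b" and c: "c \<in> charts M" "\<gamma> t \<in> cdom M c"
    and v: "((cmap M c \<circ> \<gamma>) has_vector_derivative v) (at t)"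
  shows "speed M \<gamma> t = sqrt (gform c (\<gamma> t) v)"
proof -
  define d where "d = chart_at M (\<gamma> t)"
  have d: "d \<in> charts M" "\<gamma> t \<in> cdom M d" using chart_at by (auto simp: d_def)
  define U where "U = {a<..<b} \<inter> \<gamma> -` (cdom M c \<inter> cdom M d)"
  have "open U" unfolding U_def
    by (rule continuous_open_preimage[OF \<gamma> open_greaterThanLessThan]) (use c d open_cdom in auto)
  moreover have "t \<in> U" unfolding U_def using c d t by auto
  ultimately have U: "open U" "t \<in> U" by auto
  have "((transition M c d \<circ> (cmap M c \<circ> \<gamma>)) has_derivative (\<lambda>h. jacobian M c d (\<gamma> t) *v (h *\<^sub>R v))) (at t)"
    using diff_chain_at[of "cmap M c \<circ> \<gamma>" _ t "transition M c d"] v transition_has_derivative[OF c(1) d(1) c(2) d(2)]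
    by (fastforce simp: has_vector_derivative_def comp_def)
  then have "((cmap M d \<circ> \<gamma>) has_derivative (\<lambda>h. jacobian M c d (\<gamma> t) *v (h *\<^sub>R v))) (at t)"
    by (rule has_derivative_transform_within_open[OF _ U]) (use c in \<open>auto simp: U_def transition_def\<close>)
  then have "((cmap M d \<circ> \<gamma>) has_vector_derivative (jacobian M c d (\<gamma> t) *v v)) (at t)"
    by (simp add: has_vector_derivative_def matrix_vector_mult_scaleR)
  from vector_derivative_at[OF this]
  have "speed M \<gamma> t = sqrt (gform d (\<gamma> t) (jacobian M c d (\<gamma> t) *v v))"
    by (simp add: speed_def d_def[symmetric] gform_def Let_def)
  then show ?thesis using gform_pullback[OF c(1) d(1) c(2) d(2)] by simp
qed

lemma speed_nonneg: "0 \<le> speed M \<gamma> t"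
  unfolding speed_def Let_def using gform_nonneg[OF chart_at, of "\<gamma> t"] by (simp add: gform_def)

lemma C1_curve_subset:
  assumes "C1_curve M a b \<gamma>" "a \<le> a'" "b' \<le> b"
  shows "C1_curve M a' b' \<gamma>"
  unfolding C1_curve_def Let_def
proof (intro conjI ballI)
  have sub: "{a'..b'} \<subseteq> {a..b}" using assms by auto
  show "continuous_on {a'..b'} \<gamma>" using assms sub by (auto simp: C1_curve_def intro: continuous_on_subset)
  fix c assume c: "c \<in> charts M"
  obtain v where v: "continuous_on {t \<in> {a..b}. \<gamma> t \<in> cdom M c} v"
    "\<And>t. t \<in> {a..b} \<Longrightarrow> \<gamma> t \<in> cdom M c \<Longrightarrow> ((cmap M c \<circ> \<gamma>) has_vector_derivative v t) (at t within {a..b})"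
    using C1_curveD[OF assms(1) c] by blast
  show "\<exists>v. continuous_on {t \<in> {a'..b'}. \<gamma> t \<in> cdom M c} v \<and>
      (\<forall>t\<in>{t \<in> {a'..b'}. \<gamma> t \<in> cdom M c}. ((cmap M c \<circ> \<gamma>) has_vector_derivative v t) (at t within {a'..b'}))"
    using sub by (intro exI[of _ v] conjI continuous_on_subset[OF v(1)] ballI has_vector_derivative_within_subset[OF v(2)]) auto
qed

lemma C1_curve_cong:
  assumes "C1_curve M a b \<gamma>" "\<And>t. a \<le> t \<Longrightarrow> t \<le> b \<Longrightarrow> \<gamma> t = \<gamma>' t"
  shows "C1_curve M a b \<gamma>'"
  unfolding C1_curve_def Let_def
proof (intro conjI ballI)
  have "continuous_on {a..b} \<gamma>" using assms by (simp add: C1_curve_def)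
  then show "continuous_on {a..b} \<gamma>'" by (rule continuous_on_eq) (use assms(2) in auto)
  fix c assume c: "c \<in> charts M"
  have T: "{t \<in> {a..b}. \<gamma>' t \<in> cdom M c} = {t \<in> {a..b}. \<gamma> t \<in> cdom M c}" using assms(2) by auto
  obtain v where v: "continuous_on {t \<in> {a..b}. \<gamma> t \<in> cdom M c} v"
    "\<And>t. t \<in> {a..b} \<Longrightarrow> \<gamma> t \<in> cdom M c \<Longrightarrow> ((cmap M c \<circ> \<gamma>) has_vector_derivative v t) (at t within {a..b})"
    using C1_curveD[OF assms(1) c] by blast
  show "\<exists>v. continuous_on {t \<in> {a..b}. \<gamma>' t \<in> cdom M c} v \<and>
      (\<forall>t\<in>{t \<in> {a..b}. \<gamma>' t \<in> cdom M c}. ((cmap M c \<circ> \<gamma>') has_vector_derivative v t) (at t within {a..b}))"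
    unfolding T
  proof (intro exI[of _ v] conjI v(1) ballI)
    fix t assume t: "t \<in> {t \<in> {a..b}. \<gamma> t \<in> cdom M c}"
    then have "((cmap M c \<circ> \<gamma>) has_vector_derivative v t) (at t within {a..b})" using v(2) by auto
    then show "((cmap M c \<circ> \<gamma>') has_vector_derivative v t) (at t within {a..b})"
      by (rule has_vector_derivative_transform[rotated 2]) (use t assms(2) in auto)
  qed
qed

lemma C1_curve_affine:
  assumes "C1_curve M (k * a + l) (k * b + l) \<gamma>" and k: "0 < k"
  shows "C1_curve M a b (\<lambda>s. \<gamma> (k * s + l))"
  unfolding C1_curve_def Let_def
proof (intro conjI ballI)
  have img: "(\<lambda>s. k * s + l) ` {a..b} \<subseteq> {k * a + l..k * b + l}" using k by auto
  show "continuous_on {a..b} (\<lambda>s. \<gamma> (k * s + l))"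
    by (rule continuous_on_compose2[of "{k * a + l..k * b + l}" \<gamma>]) (use assms img in \<open>auto simp: C1_curve_def intro!: continuous_intros\<close>)
  fix c assume c: "c \<in> charts M"
  obtain v where v: "continuous_on {t \<in> {k * a + l..k * b + l}. \<gamma> t \<in> cdom M c} v"
    "\<And>t. t \<in> {k * a + l..k * b + l} \<Longrightarrow> \<gamma> t \<in> cdom M c \<Longrightarrow> ((cmap M c \<circ> \<gamma>) has_vector_derivative v t) (at t within {k * a + l..k * b + l})"
    using C1_curveD[OF assms(1) c] by blast
  show "\<exists>v. continuous_on {t \<in> {a..b}. \<gamma> (k * t + l) \<in> cdom M c} v \<and>
      (\<forall>t\<in>{t \<in> {a..b}. \<gamma> (k * t + l) \<in> cdom M c}. ((cmap M c \<circ> (\<lambda>s. \<gamma> (k * s + l))) has_vector_derivative v t) (at t within {a..b}))"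
  proof (intro exI[of _ "\<lambda>s. k *\<^sub>R v (k * s + l)"] conjI ballI)
    show "continuous_on {t \<in> {a..b}. \<gamma> (k * t + l) \<in> cdom M c} (\<lambda>s. k *\<^sub>R v (k * s + l))"
      by (intro continuous_intros continuous_on_compose2[OF v(1)]) (use k in auto)
    fix t assume t: "t \<in> {t \<in> {a..b}. \<gamma> (k * t + l) \<in> cdom M c}"
    have 1: "((\<lambda>s. k * s + l) has_derivative (\<lambda>h. k * h)) (at t within {a..b})"
      by (auto intro!: derivative_eq_intros)
    have "((cmap M c \<circ> \<gamma>) has_derivative (\<lambda>h. h *\<^sub>R v (k * t + l))) (at (k * t + l) within {k * a + l..k * b + l})"
      using v(2)[of "k * t + l"] t k by (auto simp: has_vector_derivative_def)
    then have 2: "((cmap M c \<circ> \<gamma>) has_derivative (\<lambda>h. h *\<^sub>R v (k * t + l))) (at (k * t + l) within (\<lambda>s. k * s + l) ` {a..b})"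
      by (rule has_derivative_subset[OF _ img])
    from diff_chain_within[OF 1 2]
    show "((cmap M c \<circ> (\<lambda>s. \<gamma> (k * s + l))) has_vector_derivative k *\<^sub>R v (k * t + l)) (at t within {a..b})"
      by (simp add: has_vector_derivative_def comp_def mult.commute)
  qed
qed

lemma speed_integrable_piece:
  assumes C1: "C1_curve M a b \<gamma>" and c: "c \<in> charts M" "\<And>t. a \<le> t \<Longrightarrow> t \<le> b \<Longrightarrow> \<gamma> t \<in> cdom M c"
  shows "speed M \<gamma> integrable_on {a..b}"
proof -
  obtain v where v: "continuous_on {t \<in> {a..b}. \<gamma> t \<in> cdom M c} v"
    "\<And>t. t \<in> {a..b} \<Longrightarrow> \<gamma> t \<in> cdom M c \<Longrightarrow> ((cmap M c \<circ> \<gamma>) has_vector_derivative v t) (at t within {a..b})"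
    using C1_curveD[OF C1 c(1)] by blast
  have T: "{t \<in> {a..b}. \<gamma> t \<in> cdom M c} = {a..b}" using c(2) by auto
  have \<gamma>: "continuous_on {a..b} \<gamma>" using C1 by (simp add: C1_curve_def)
  have "continuous_on {a..b} (\<lambda>t. sqrt (gform c (\<gamma> t) (v t)))"
    using v(1) c(2) unfolding T by (intro continuous_intros continuous_gform[OF c(1) \<gamma>]) auto
  then have int: "(\<lambda>t. sqrt (gform c (\<gamma> t) (v t))) integrable_on {a..b}" by (rule integrable_continuous_real)
  show ?thesis
  proof (rule integrable_spike_finite[of "{a, b}"])
    show "(\<lambda>t. sqrt (gform c (\<gamma> t) (v t))) integrable_on {a..b}" by (rule int)
    fix t assume t: "t \<in> {a..b} - {a, b}"
    then have t': "a < t" "t < b" by auto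
    have "((cmap M c \<circ> \<gamma>) has_vector_derivative v t) (at t within {a..b})" using v(2)[of t] c(2)[of t] t by auto
    then have "((cmap M c \<circ> \<gamma>) has_vector_derivative v t) (at t)"
      using t' by (metis at_within_Icc_at)
    then show "speed M \<gamma> t = sqrt (gform c (\<gamma> t) (v t))"
      using t' c by (intro speed_in_chart[where a=a and b=b] continuous_on_subset[OF \<gamma>]) auto
  qed auto
qed

text \<open>Integrability is local, and a short interval on either side of a point stays in one chart and
contains no break point in its interior. There the speed agrees, off the end points, with a continuous function.\<close>
lemma speed_integrable:
  assumes "piecewise_C1_curve M \<gamma>"
  shows "speed M \<gamma> integrable_on {0..1}"
proof -
  obtain P where P: "finite P" "\<And>a b. 0 \<le> a \<Longrightarrow> a < b \<Longrightarrow> b \<le> 1 \<Longrightarrow> {a<..<b} \<inter> P = {} \<Longrightarrow> C1_curve M a b \<gamma>"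
    and \<gamma>: "continuous_on {0..1} \<gamma>"
    using assms unfolding piecewise_C1_curve_def by metis
  have "speed M \<gamma> integrable_on cbox 0 1"
  proof (rule integrable_on_little_subintervals, rule ballI)
    fix t0 :: real assume t0: "t0 \<in> cbox 0 1"
    define c where "c = chart_at M (\<gamma> t0)"
    have c: "c \<in> charts M" "\<gamma> t0 \<in> cdom M c" using chart_at by (auto simp: c_def)
    have "openin (top_of_set {0..1}) ({0..1} \<inter> \<gamma> -` cdom M c)"
      by (rule continuous_openin_preimage_gen[OF \<gamma> open_cdom[OF c(1)]])
    moreover have "t0 \<in> {0..1} \<inter> \<gamma> -` cdom M c" using c t0 by auto
    ultimately obtain e where e: "e > 0" "ball t0 e \<inter> {0..1} \<subseteq> {0..1} \<inter> \<gamma> -` cdom M c"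
      unfolding openin_contains_ball by blast
    obtain e' where e': "e' > 0" "\<forall>p\<in>P. p \<noteq> t0 \<longrightarrow> e' \<le> dist t0 p" using finite_set_avoid[OF P(1)] by blast
    show "\<exists>d>0. \<forall>u v. t0 \<in> cbox u v \<and> cbox u v \<subseteq> ball t0 d \<and> cbox u v \<subseteq> cbox 0 1 \<longrightarrow> speed M \<gamma> integrable_on cbox u v"
    proof (intro exI[of _ "min e e'"] conjI allI impI)
      fix u v assume uv: "t0 \<in> cbox u v \<and> cbox u v \<subseteq> ball t0 (min e e') \<and> cbox u v \<subseteq> cbox 0 1"
      then have uv': "u \<le> t0" "t0 \<le> v" "{u..v} \<subseteq> ball t0 (min e e')" "{u..v} \<subseteq> {0..1}" by auto
      have u: "0 \<le> u" "v \<le> 1" using uv' by auto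
      have inc: "\<gamma> t \<in> cdom M c" if "u \<le> t" "t \<le> v" for t using e(2) uv' that by (auto simp: subset_iff)
      have noP: "p \<notin> P" if "u \<le> p" "p \<le> v" "p \<noteq> t0" for p
        using e'(2) uv' that by (fastforce simp: subset_iff)
      have 1: "speed M \<gamma> integrable_on {u..t0}"
      proof (cases "u < t0")
        case True
        have "C1_curve M u t0 \<gamma>" using u uv' True noP t0 by (intro P(2)) auto
        then show ?thesis using inc uv' by (intro speed_integrable_piece[OF _ c(1)]) auto
      qed (use uv' integrable_on_refl[of "speed M \<gamma>" t0] in auto)
      have 2: "speed M \<gamma> integrable_on {t0..v}"
      proof (cases "t0 < v")
        case True
        have "C1_curve M t0 v \<gamma>" using u uv' True noP t0 by (intro P(2)) auto
        then show ?thesis using inc uv' by (intro speed_integrable_piece[OF _ c(1)]) auto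
      qed (use uv' integrable_on_refl[of "speed M \<gamma>" t0] in auto)
      show "speed M \<gamma> integrable_on cbox u v"
        using Henstock_Kurzweil_Integration.integrable_combine[OF uv'(1,2) 1 2] by simp
    qed (use e(1) e'(1) in auto)
  qed
  then show ?thesis by simp
qed

lemma curve_length_nonneg: "0 \<le> curve_length M \<gamma>"
proof (cases "speed M \<gamma> integrable_on {0..1}")
  case True
  then show ?thesis unfolding curve_length_def
    by (rule Henstock_Kurzweil_Integration.integral_nonneg) (simp add: speed_nonneg)
next
  case False
  then show ?thesis by (simp add: curve_length_def not_integrable_integral)
qed

lemma dist_le_curve_length:
  assumes "piecewise_C1_curve M \<gamma>"
  shows "dist (\<gamma> 0) (\<gamma> 1) \<le> curve_length M \<gamma>"
  unfolding dist_eq_riem_dist riem_dist_def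
  by (rule cInf_lower) (use assms curve_length_nonneg in \<open>auto intro!: bdd_belowI[of _ 0]\<close>)

text \<open>Restricting a curve to a subinterval, rescaled to [0, 1], cuts its length accordingly. The
speed has to be compared off the break points and the end points only.\<close>
lemma piecewise_affine:
  assumes \<gamma>: "piecewise_C1_curve M \<gamma>" and k: "0 < k" "0 \<le> l" "k + l \<le> 1"
  shows "piecewise_C1_curve M (\<lambda>s. \<gamma> (k * s + l))"
    "curve_length M (\<lambda>s. \<gamma> (k * s + l)) = integral {l..k + l} (speed M \<gamma>)"
proof -
  obtain P where P: "finite P" "\<And>a b. 0 \<le> a \<Longrightarrow> a < b \<Longrightarrow> b \<le> 1 \<Longrightarrow> {a<..<b} \<inter> P = {} \<Longrightarrow> C1_curve M a b \<gamma>"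
    and \<gamma>c: "continuous_on {0..1} \<gamma>"
    using \<gamma> unfolding piecewise_C1_curve_def by metis
  define Q where "Q = (\<lambda>p. (p - l) / k) ` P"
  have img: "0 \<le> k * s + l" "k * s + l \<le> 1" if "0 \<le> s" "s \<le> 1" for s
  proof -
    have "k * s \<le> k" using that k by (simp add: mult_left_le)
    then show "k * s + l \<le> 1" using k by linarith
    show "0 \<le> k * s + l" using that k by simp
  qed
  show pc: "piecewise_C1_curve M (\<lambda>s. \<gamma> (k * s + l))"
    unfolding piecewise_C1_curve_def
  proof (intro conjI exI[of _ Q] allI impI)
    show "continuous_on {0..1} (\<lambda>s. \<gamma> (k * s + l))"
      by (rule continuous_on_compose2[OF \<gamma>c]) (use img in \<open>auto intro!: continuous_intros\<close>)
    show "finite Q" using P(1) by (simp add: Q_def)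
    fix a b assume ab: "0 \<le> a \<and> a < b \<and> b \<le> 1 \<and> {a<..<b} \<inter> Q = {}"
    have "C1_curve M (k * a + l) (k * b + l) \<gamma>"
    proof (rule P(2))
      show "{k * a + l<..<k * b + l} \<inter> P = {}"
      proof (rule ccontr)
        assume "{k * a + l<..<k * b + l} \<inter> P \<noteq> {}"
        then obtain p where p: "p \<in> P" "k * a + l < p" "p < k * b + l" by auto
        then have "(p - l) / k \<in> {a<..<b} \<inter> Q" using k by (auto simp: Q_def field_simps)
        then show False using ab by auto
      qed
    qed (use ab img[of a] img[of b] k in auto)
    then show "C1_curve M a b (\<lambda>s. \<gamma> (k * s + l))" by (rule C1_curve_affine[OF _ k(1)])
  qed
  have sp: "speed M (\<lambda>s. \<gamma> (k * s + l)) t = k * speed M \<gamma> (k * t + l)" if t: "0 < t" "t < 1" "t \<notin> Q" for t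
  proof -
    define c where "c = chart_at M (\<gamma> (k * t + l))"
    have c: "c \<in> charts M" "\<gamma> (k * t + l) \<in> cdom M c" using chart_at by (auto simp: c_def)
    have tP: "k * t + l \<notin> P"
    proof
      assume "k * t + l \<in> P"
      then have "(k * t + l - l) / k \<in> Q" unfolding Q_def by blast
      then show False using t k by simp
    qed
    obtain e where e: "e > 0" "\<forall>p\<in>P. p \<noteq> k * t + l \<longrightarrow> e \<le> dist (k * t + l) p" using finite_set_avoid[OF P(1)] by blast
    have s01: "0 < k * t + l" "k * t + l < 1"
    proof -
      have "k * t < k" using t k by simp
      then show "k * t + l < 1" using k by linarith
      have "0 < k * t" using t k by simp
      then show "0 < k * t + l" using k by linarith
    qed
    define a where "a = max 0 (k * t + l - e)"
    define b where "b = min 1 (k * t + l + e)"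
    have ab: "a < k * t + l" "k * t + l < b" "0 \<le> a" "b \<le> 1" using s01 e(1) by (auto simp: a_def b_def)
    have "{a<..<b} \<inter> P = {}"
      using e(2) tP unfolding a_def b_def by (fastforce simp: dist_real_def abs_le_iff)
    then have C1: "C1_curve M a b \<gamma>" using ab by (intro P(2)) auto
    have \<gamma>ab: "continuous_on {a..b} \<gamma>" using C1 by (simp add: C1_curve_def)
    obtain v where v: "((cmap M c \<circ> \<gamma>) has_vector_derivative v) (at (k * t + l) within {a..b})"
      using C1_curveD[OF C1 c(1)] ab c(2) by (metis atLeastAtMost_iff less_imp_le)
    then have v: "((cmap M c \<circ> \<gamma>) has_vector_derivative v) (at (k * t + l))"
      using ab by (metis at_within_Icc_at)
    have 1: "speed M \<gamma> (k * t + l) = sqrt (gform c (\<gamma> (k * t + l)) v)"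
      using ab c v by (intro speed_in_chart[where a=a and b=b] continuous_on_subset[OF \<gamma>ab]) auto
    have "((\<lambda>s. k * s + l) has_vector_derivative k) (at t)"
      by (auto intro!: derivative_eq_intros simp: has_vector_derivative_def)
    from vector_diff_chain_at[OF this v]
    have v2: "((cmap M c \<circ> (\<lambda>s. \<gamma> (k * s + l))) has_vector_derivative k *\<^sub>R v) (at t)" by (simp add: comp_def)
    have "continuous_on {0..1} (\<lambda>s. \<gamma> (k * s + l))" using pc by (simp add: piecewise_C1_curve_def)
    then have "speed M (\<lambda>s. \<gamma> (k * s + l)) t = sqrt (gform c (\<gamma> (k * t + l)) (k *\<^sub>R v))"
      using t c v2 by (intro speed_in_chart[where a=0 and b=1]) (auto intro: continuous_on_subset)
    also have "gform c (\<gamma> (k * t + l)) (k *\<^sub>R v) = k\<^sup>2 * gform c (\<gamma> (k * t + l)) v"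
      by (simp add: gform_def matrix_vector_mult_scaleR power2_eq_square)
    finally show ?thesis using 1 k by (simp add: real_sqrt_mult)
  qed
  have "speed M \<gamma> integrable_on {l..k + l}"
    by (rule integrable_subinterval_real[OF speed_integrable[OF \<gamma>]]) (use k in auto)
  then have "(speed M \<gamma> has_integral integral {l..k + l} (speed M \<gamma>)) (cbox l (k + l))" by (simp add: has_integral_integral)
  from has_integral_affinity[OF this, of k l]
  have "((\<lambda>t. speed M \<gamma> (k * t + l)) has_integral (1 / k) * integral {l..k + l} (speed M \<gamma>)) ((\<lambda>x. (1 / k) * x + - (l / k)) ` {l..k + l})"
    using k by (simp add: mult.commute)
  moreover have "(\<lambda>x. (1 / k) * x + - (l / k)) ` {l..k + l} = {0..1}"
    using k by (subst image_affinity_atLeastAtMost) (auto simp: field_simps)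
  ultimately have "((\<lambda>t. k * speed M \<gamma> (k * t + l)) has_integral k * ((1 / k) * integral {l..k + l} (speed M \<gamma>))) {0..1}"
    by (intro has_integral_mult_right) simp
  then have "((\<lambda>t. k * speed M \<gamma> (k * t + l)) has_integral integral {l..k + l} (speed M \<gamma>)) {0..1}" using k by simp
  then have "(speed M (\<lambda>s. \<gamma> (k * s + l)) has_integral integral {l..k + l} (speed M \<gamma>)) {0..1}"
    by (rule has_integral_spike_finite[of "Q \<union> {0, 1}", rotated 2]) (use P(1) sp in \<open>auto simp: Q_def\<close>)
  then show "curve_length M (\<lambda>s. \<gamma> (k * s + l)) = integral {l..k + l} (speed M \<gamma>)"
    unfolding curve_length_def by (rule integral_unique)
qed
end

context riemannian_manifold
begin

text \<open>Coordinate segments are admissible curves.\<close>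
lemma segment_curve:
  assumes c: "c \<in> charts M" and seg: "closed_segment a b \<subseteq> cmap M c ` cdom M c"
  shows "piecewise_C1_curve M (\<lambda>t. cinv M c ((1 - t) *\<^sub>R a + t *\<^sub>R b))"
proof -
  define l where "l t = (1 - t) *\<^sub>R a + t *\<^sub>R b" for t :: real
  define \<gamma> where "\<gamma> t = cinv M c (l t)" for t
  have lin: "l t \<in> cmap M c ` cdom M c" if "t \<in> {0..1}" for t
    using seg that by (auto simp: l_def closed_segment_def)
  have lc: "continuous_on T l" for T unfolding l_def by (intro continuous_intros)
  have \<gamma>c: "continuous_on {0..1} \<gamma>" unfolding \<gamma>_def
    by (rule continuous_on_compose2[OF continuous_cinv[OF c] lc]) (use lin in auto)
  have lD: "(l has_derivative (\<lambda>h. h *\<^sub>R (b - a))) (at t within T)" for t T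
    unfolding l_def by (auto intro!: derivative_eq_intros simp: algebra_simps)
  have C1: "C1_curve M 0 1 \<gamma>" unfolding C1_curve_def Let_def
  proof (intro conjI \<gamma>c ballI)
    fix d assume d: "d \<in> charts M"
    let ?T = "{t \<in> {0..1}. \<gamma> t \<in> cdom M d}"
    let ?O = "cmap M c ` (cdom M c \<inter> cdom M d)"
    have lO: "l t \<in> ?O" if "t \<in> ?T" for t
    proof -
      have "l t = cmap M c (\<gamma> t)" "\<gamma> t \<in> cdom M c" using lin[of t] that c by (auto simp: \<gamma>_def)
      then show ?thesis using that by auto
    qed
    let ?D = "\<lambda>y. frechet_derivative (transition M c d) (at y)"
    have TD: "(transition M c d has_derivative ?D y) (at y)" if "y \<in> ?O" for y
      using transition_Ck1[OF c d] that by (auto simp: frechet_derivative_works)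
    have "continuous_on ?O (\<lambda>y. \<Sum>e\<in>Basis. ((b - a) \<bullet> e) *\<^sub>R ?D y e)"
      using transition_Ck1[OF c d] by (intro continuous_intros) auto
    then have 1: "continuous_on ?T (\<lambda>t. \<Sum>e\<in>Basis. ((b - a) \<bullet> e) *\<^sub>R ?D (l t) e)"
      by (rule continuous_on_compose2[OF _ lc]) (use lO in auto)
    have eq: "(\<Sum>e\<in>Basis. ((b - a) \<bullet> e) *\<^sub>R ?D y e) = ?D y (b - a)" if "y \<in> ?O" for y
    proof -
      have lin: "linear (?D y)" using has_derivative_linear[OF TD[OF that]] .
      have "?D y (b - a) = ?D y (\<Sum>e\<in>Basis. ((b - a) \<bullet> e) *\<^sub>R e)" by (simp only: euclidean_representation)
      also have "\<dots> = (\<Sum>e\<in>Basis. ((b - a) \<bullet> e) *\<^sub>R ?D y e)"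
        by (simp only: linear_sum[OF lin] linear_scale[OF lin])
      finally show ?thesis by simp
    qed
    show "\<exists>v. continuous_on ?T v \<and> (\<forall>t\<in>?T. ((cmap M d \<circ> \<gamma>) has_vector_derivative v t) (at t within {0..1}))"
    proof (intro exI conjI ballI)
      show "continuous_on ?T (\<lambda>t. ?D (l t) (b - a))"
        by (rule continuous_on_eq[OF 1]) (use eq lO in auto)
      fix t assume t: "t \<in> ?T"
      have "((\<lambda>s. transition M c d (l s)) has_derivative (\<lambda>h. ?D (l t) (h *\<^sub>R (b - a)))) (at t within {0..1})"
        by (rule has_derivative_compose[OF lD TD[OF lO[OF t]]])
      moreover have "?D (l t) (h *\<^sub>R (b - a)) = h *\<^sub>R ?D (l t) (b - a)" for h
        using linear_scale[OF has_derivative_linear[OF TD[OF lO[OF t]]]] .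
      ultimately show "((cmap M d \<circ> \<gamma>) has_vector_derivative ?D (l t) (b - a)) (at t within {0..1})"
        by (simp add: has_vector_derivative_def transition_def \<gamma>_def comp_def)
    qed
  qed
  have "piecewise_C1_curve M \<gamma>" unfolding piecewise_C1_curve_def
    using \<gamma>c C1_curve_subset[OF C1] by (intro conjI exI[of _ "{}"]) auto
  then show ?thesis by (simp add: \<gamma>_def[abs_def] l_def)
qed

text \<open>The Riemannian distance is at most the length of the coordinate segment. This is how bounds on the metric in a chart
become bounds on the variation of the distance function.\<close>
lemma dist_segment_le:
  assumes c: "c \<in> charts M" and seg: "closed_segment a b \<subseteq> cmap M c ` cdom M c" and B: "0 \<le> B"
    and le: "\<And>y. y \<in> closed_segment a b \<Longrightarrow> gform c (cinv M c y) (b - a) \<le> B\<^sup>2"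
  shows "dist (cinv M c a) (cinv M c b) \<le> B"
proof -
  define l where "l t = (1 - t) *\<^sub>R a + t *\<^sub>R b" for t :: real
  define \<gamma> where "\<gamma> t = cinv M c (l t)" for t
  have pw: "piecewise_C1_curve M \<gamma>" using segment_curve[OF c seg] by (simp add: \<gamma>_def[abs_def] l_def)
  have ls: "l t \<in> closed_segment a b" if "t \<in> {0..1}" for t
    using that by (auto simp: l_def closed_segment_def)
  have lD: "(l has_vector_derivative (b - a)) (at t)" for t
    unfolding l_def has_vector_derivative_def by (auto intro!: derivative_eq_intros simp: algebra_simps)
  have sp: "speed M \<gamma> t \<le> B" if t: "0 < t" "t < 1" for t
  proof -
    have "(l has_derivative (\<lambda>h. h *\<^sub>R (b - a))) (at t)" using lD by (simp add: has_vector_derivative_def)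
    then have "((cmap M c \<circ> \<gamma>) has_derivative (\<lambda>h. h *\<^sub>R (b - a))) (at t)"
    proof (rule has_derivative_transform_within_open[where s="{0<..<1}"])
      fix s :: real assume "s \<in> {0<..<1}"
      then have "l s \<in> cmap M c ` cdom M c" using ls[of s] seg by auto
      then show "l s = (cmap M c \<circ> \<gamma>) s" using c by (simp add: \<gamma>_def)
    qed (use t in auto)
    then have v: "((cmap M c \<circ> \<gamma>) has_vector_derivative (b - a)) (at t)" by (simp add: has_vector_derivative_def)
    have lt: "l t \<in> closed_segment a b" using ls[of t] t by auto
    then have \<gamma>t: "\<gamma> t \<in> cdom M c" unfolding \<gamma>_def using seg c by (intro cinv_in) auto
    have "continuous_on {0..1} \<gamma>" using pw by (simp add: piecewise_C1_curve_def)
    then have "speed M \<gamma> t = sqrt (gform c (\<gamma> t) (b - a))"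
      using t c v \<gamma>t by (intro speed_in_chart[where a=0 and b=1]) (auto intro: continuous_on_subset)
    also have "\<dots> \<le> sqrt (B\<^sup>2)" using le[OF lt] by (simp add: \<gamma>_def del: real_sqrt_abs)
    finally show ?thesis using B by simp
  qed
  have "(speed M \<gamma> has_integral curve_length M \<gamma>) {0..1}"
    unfolding curve_length_def using speed_integrable[OF pw] by (rule integrable_integral)
  then have "((\<lambda>t. if t \<in> {0, 1} then 0 else speed M \<gamma> t) has_integral curve_length M \<gamma>) {0..1}"
    by (rule has_integral_spike_finite[of "{0, 1}", rotated 2]) auto
  moreover have "((\<lambda>t. B) has_integral B) {0..1::real}" using has_integral_const_real[of B 0 1] by simp
  ultimately have "curve_length M \<gamma> \<le> B"
    by (rule has_integral_le) (use sp B in auto)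
  moreover have "dist (\<gamma> 0) (\<gamma> 1) \<le> curve_length M \<gamma>" by (rule dist_le_curve_length[OF pw])
  ultimately show ?thesis by (simp add: \<gamma>_def l_def)
qed

lemma piecewise_join:
  assumes 1: "piecewise_C1_curve M g1" and 2: "piecewise_C1_curve M g2" and eq: "g1 1 = g2 0"
  shows "piecewise_C1_curve M (g1 +++ g2)"
proof -
  obtain P1 where P1: "finite P1" "\<And>a b. 0 \<le> a \<Longrightarrow> a < b \<Longrightarrow> b \<le> 1 \<Longrightarrow> {a<..<b} \<inter> P1 = {} \<Longrightarrow> C1_curve M a b g1"
    using 1 unfolding piecewise_C1_curve_def by metis
  obtain P2 where P2: "finite P2" "\<And>a b. 0 \<le> a \<Longrightarrow> a < b \<Longrightarrow> b \<le> 1 \<Longrightarrow> {a<..<b} \<inter> P2 = {} \<Longrightarrow> C1_curve M a b g2"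
    using 2 unfolding piecewise_C1_curve_def by metis
  define P where "P = insert (1/2) ((\<lambda>p. p / 2) ` P1 \<union> (\<lambda>p. (p + 1) / 2) ` P2)"
  show ?thesis unfolding piecewise_C1_curve_def
  proof (intro conjI exI[of _ P] allI impI)
    have "path (g1 +++ g2)"
      using 1 2 eq by (simp add: piecewise_C1_curve_def path_def[symmetric] pathstart_def pathfinish_def)
    then show "continuous_on {0..1} (g1 +++ g2)" by (simp add: path_def)
    show "finite P" using P1(1) P2(1) by (simp add: P_def)
    fix a b :: real assume ab: "0 \<le> a \<and> a < b \<and> b \<le> 1 \<and> {a<..<b} \<inter> P = {}"
    have "1/2 \<notin> {a<..<b}" using ab by (auto simp: P_def)
    then consider "b \<le> 1/2" | "1/2 \<le> a" by fastforce
    then show "C1_curve M a b (g1 +++ g2)"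
    proof cases
      case 1
      have "C1_curve M (2 * a + 0) (2 * b + 0) g1"
      proof (rule P1(2))
        show "{2 * a + 0<..<2 * b + 0} \<inter> P1 = {}"
        proof (rule ccontr)
          assume "{2 * a + 0<..<2 * b + 0} \<inter> P1 \<noteq> {}"
          then obtain p where "p \<in> P1" "2 * a < p" "p < 2 * b" by auto
          then have "p / 2 \<in> {a<..<b} \<inter> P" by (auto simp: P_def)
          then show False using ab by auto
        qed
      qed (use ab 1 in auto)
      then have "C1_curve M a b (\<lambda>s. g1 (2 * s + 0))" by (rule C1_curve_affine) simp
      then show ?thesis by (rule C1_curve_cong) (use 1 in \<open>auto simp: joinpaths_def\<close>)
    next
      case 2
      have "C1_curve M (2 * a + (-1)) (2 * b + (-1)) g2"
      proof (rule P2(2))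
        show "{2 * a + (-1)<..<2 * b + (-1)} \<inter> P2 = {}"
        proof (rule ccontr)
          assume "{2 * a + (-1)<..<2 * b + (-1)} \<inter> P2 \<noteq> {}"
          then obtain p where "p \<in> P2" "2 * a - 1 < p" "p < 2 * b - 1" by auto
          then have "(p + 1) / 2 \<in> {a<..<b} \<inter> P" by (auto simp: P_def)
          then show False using ab by auto
        qed
      qed (use ab 2 in auto)
      then have "C1_curve M a b (\<lambda>s. g2 (2 * s + (-1)))" by (rule C1_curve_affine) simp
      then show ?thesis
      proof (rule C1_curve_cong)
        fix t assume t: "a \<le> t" "t \<le> b"
        show "g2 (2 * t + (-1)) = (g1 +++ g2) t"
        proof (cases "t = 1/2")
          case True
          then have "2 * t + (-1) = 0" "2 * t = 1" by auto
          then show ?thesis unfolding joinpaths_def using eq by simp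
        qed (use t 2 in \<open>auto simp: joinpaths_def\<close>)
      qed
    qed
  qed
qed

lemma chart_ball:
  assumes c: "c \<in> charts M" and x: "x \<in> cdom M c"
  obtains e where "e > 0" "cball (cmap M c x) e \<subseteq> cmap M c ` cdom M c"
  using open_cmap_image[OF c] x unfolding open_contains_cball by blast

text \<open>Points in a common coordinate ball are joined by a segment, and the manifold is connected.\<close>
lemma curve_exists: "\<exists>\<gamma>. piecewise_C1_curve M \<gamma> \<and> \<gamma> 0 = x \<and> \<gamma> 1 = y"
proof (rule connected_equivalence_relation_gen[OF connected_space, of x y "\<lambda>_. True"])
  fix z :: 'a
  define c where "c = chart_at M z"
  have c: "c \<in> charts M" "z \<in> cdom M c" using chart_at by (auto simp: c_def)
  obtain e where e: "e > 0" "cball (cmap M c z) e \<subseteq> cmap M c ` cdom M c" using chart_ball[OF c] .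
  let ?B = "ball (cmap M c z) e"
  have sub: "?B \<subseteq> cmap M c ` cdom M c" using e by auto
  show "\<exists>T. openin (top_of_set UNIV) T \<and> z \<in> T \<and> (\<forall>x\<in>T. \<forall>y\<in>T. True \<and> True \<longrightarrow> (\<exists>\<gamma>. piecewise_C1_curve M \<gamma> \<and> \<gamma> 0 = x \<and> \<gamma> 1 = y))"
  proof (intro exI[of _ "cinv M c ` ?B"] conjI ballI impI)
    show "openin (top_of_set UNIV) (cinv M c ` ?B)" using open_cinv_image[OF c(1) open_ball sub] by simp
    show "z \<in> cinv M c ` ?B" using c e(1) by (intro image_eqI[of _ _ "cmap M c z"]) auto
    fix x y assume "x \<in> cinv M c ` ?B" "y \<in> cinv M c ` ?B"
    then obtain a b where ab: "a \<in> ?B" "b \<in> ?B" "x = cinv M c a" "y = cinv M c b" by blast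
    have "closed_segment a b \<subseteq> cmap M c ` cdom M c"
      using closed_segment_subset[OF ab(1,2) convex_ball] sub by blast
    from segment_curve[OF c(1) this]
    show "\<exists>\<gamma>. piecewise_C1_curve M \<gamma> \<and> \<gamma> 0 = x \<and> \<gamma> 1 = y"
      using ab by (intro exI[of _ "\<lambda>t. cinv M c ((1 - t) *\<^sub>R a + t *\<^sub>R b)"] conjI) simp_all
  qed
next
  fix x y z
  assume "\<exists>\<gamma>. piecewise_C1_curve M \<gamma> \<and> \<gamma> 0 = x \<and> \<gamma> 1 = y" "\<exists>\<gamma>. piecewise_C1_curve M \<gamma> \<and> \<gamma> 0 = y \<and> \<gamma> 1 = z"
  then obtain g1 g2 where "piecewise_C1_curve M g1" "g1 0 = x" "g1 1 = y" "piecewise_C1_curve M g2" "g2 0 = y" "g2 1 = z" by blast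
  then show "\<exists>\<gamma>. piecewise_C1_curve M \<gamma> \<and> \<gamma> 0 = x \<and> \<gamma> 1 = z"
    by (intro exI[of _ "g1 +++ g2"] conjI piecewise_join) (auto simp: joinpaths_def)
qed auto

lemma almost_shortest_curve:
  fixes x y :: 'a
  assumes "0 < \<epsilon>"
  obtains \<gamma> where "piecewise_C1_curve M \<gamma>" "\<gamma> 0 = x" "\<gamma> 1 = y" "curve_length M \<gamma> < dist x y + \<epsilon>"
proof -
  let ?S = "{curve_length M \<gamma> | \<gamma>. piecewise_C1_curve M \<gamma> \<and> \<gamma> 0 = x \<and> \<gamma> 1 = y}"
  have "Inf ?S < dist x y + \<epsilon>" using assms dist_eq_riem_dist[of x y] by (simp add: riem_dist_def)
  moreover have "?S \<noteq> {}" using curve_exists[of x y] by blast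
  ultimately obtain L where "L \<in> ?S" and L: "L < dist x y + \<epsilon>" using cInf_lessD by meson
  from \<open>L \<in> ?S\<close> obtain \<gamma> where "L = curve_length M \<gamma>" "piecewise_C1_curve M \<gamma>" "\<gamma> 0 = x" "\<gamma> 1 = y"
    unfolding mem_Collect_eq by (elim exE conjE)
  then show ?thesis using L by (intro that) auto
qed

text \<open>The distance is an infimum of lengths. On a curve that is short enough take the first part up to a
point at distance \<rho> from x: it has length at least \<rho>, so less than \<epsilon> remains for the second part.\<close>
lemma intermediate_point:
  fixes x y :: 'a
  assumes xy: "dist x y < \<rho> + \<epsilon>" and \<rho>: "0 \<le> \<rho>" and \<epsilon>: "0 < \<epsilon>"
  shows "\<exists>z. dist x z \<le> \<rho> \<and> dist z y < \<epsilon>"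
proof (cases "dist x y \<le> \<rho>")
  case True then show ?thesis using \<epsilon> by (intro exI[of _ y]) auto
next
  case False
  obtain \<gamma> where \<gamma>: "piecewise_C1_curve M \<gamma>" "\<gamma> 0 = x" "\<gamma> 1 = y" "curve_length M \<gamma> < dist x y + (\<rho> + \<epsilon> - dist x y)"
    using almost_shortest_curve[of "\<rho> + \<epsilon> - dist x y" x y] xy by auto
  have L: "integral {0..1} (speed M \<gamma>) < \<rho> + \<epsilon>" using \<gamma>(4) by (simp add: curve_length_def)
  have "continuous_on {0..1} (\<lambda>t. dist x (\<gamma> t))"
    using \<gamma>(1) by (intro continuous_intros) (simp add: piecewise_C1_curve_def)
  then obtain t where t: "0 \<le> t" "t \<le> 1" "dist x (\<gamma> t) = \<rho>"
    using IVT'[of "\<lambda>t. dist x (\<gamma> t)" 0 \<rho> 1] \<gamma> False \<rho> by auto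
  consider "t = 0" | "t = 1" | "0 < t" "t < 1" using t by linarith
  then have "dist (\<gamma> t) y < \<epsilon>"
  proof cases
    case 1
    then show ?thesis using t \<gamma> xy by simp
  next
    case 2 then show ?thesis using \<gamma> \<epsilon> by simp
  next
    case 3
    have a: "\<rho> \<le> integral {0..t} (speed M \<gamma>)"
    proof -
      have "piecewise_C1_curve M (\<lambda>s. \<gamma> (t * s + 0))" "curve_length M (\<lambda>s. \<gamma> (t * s + 0)) = integral {0..t + 0} (speed M \<gamma>)"
        using piecewise_affine[OF \<gamma>(1), of t 0] 3 by auto
      then show ?thesis using dist_le_curve_length[of "\<lambda>s. \<gamma> (t * s + 0)"] t \<gamma> by simp
    qed
    have b: "dist (\<gamma> t) y \<le> integral {t..1} (speed M \<gamma>)"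
    proof -
      have "piecewise_C1_curve M (\<lambda>s. \<gamma> ((1 - t) * s + t))" "curve_length M (\<lambda>s. \<gamma> ((1 - t) * s + t)) = integral {t..(1 - t) + t} (speed M \<gamma>)"
        using piecewise_affine[OF \<gamma>(1), of "1 - t" t] 3 by auto
      then show ?thesis using dist_le_curve_length[of "\<lambda>s. \<gamma> ((1 - t) * s + t)"] \<gamma> by simp
    qed
    have "integral {0..t} (speed M \<gamma>) + integral {t..1} (speed M \<gamma>) = integral {0..1} (speed M \<gamma>)"
      using t speed_integrable[OF \<gamma>(1)] by (intro Henstock_Kurzweil_Integration.integral_combine) auto
    then show ?thesis using a b L by linarith
  qed
  then show ?thesis using t by (intro exI[of _ "\<gamma> t"]) auto
qed

section \<open>Completeness and compact balls\<close>

lemma closed_subset_compact: "cball x a \<subseteq> K \<Longrightarrow> compact K \<Longrightarrow> compact (cball (x::'a) a)"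
  using compact_Int_closed[of K "cball x a"] by (simp add: inf_absorb2)

lemma small_compact_ball: "\<exists>e>0. compact (cball (x::'a) e)"
proof -
  define c where "c = chart_at M x"
  have c: "c \<in> charts M" "x \<in> cdom M c" using chart_at by (auto simp: c_def)
  obtain e where e: "e > 0" "cball (cmap M c x) e \<subseteq> cmap M c ` cdom M c" using chart_ball[OF c] .
  let ?K = "cinv M c ` cball (cmap M c x) e"
  have K: "compact ?K" by (intro compact_continuous_image continuous_on_subset[OF continuous_cinv[OF c(1)] e(2)] compact_cball)
  have op: "open (cinv M c ` ball (cmap M c x) e)" by (rule open_cinv_image[OF c(1) open_ball]) (use e in auto)
  have "x \<in> cinv M c ` ball (cmap M c x) e" using c e(1) by (intro image_eqI[of _ _ "cmap M c x"]) auto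
  then obtain r where r: "r > 0" "cball x r \<subseteq> cinv M c ` ball (cmap M c x) e" using op open_contains_cball by blast
  then have "cball x r \<subseteq> ?K" by auto
  then have "compact (cball x r)" using K by (rule closed_subset_compact)
  then show ?thesis using r by blast
qed

text \<open>One half of the Hopf-Rinow theorem. Let \<rho> be the supremum of the radii of compact balls around x.
The ball of radius \<rho> is complete, and totally bounded because by \<open>intermediate_point\<close> its points are close to
smaller balls; so it is compact. Covering it by finitely many small compact balls shows that a slightly
larger ball is compact as well, a contradiction.\<close>
lemma compact_cball_complete:
  assumes complete: "complete (UNIV :: 'a set)"
  shows "compact (cball (x::'a) r)"
proof (rule ccontr)
  assume nc: "\<not> compact (cball x r)"
  have mono: "compact (cball x a)" if "compact (cball x b)" "a \<le> b" for a b
  proof -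
    have "cball x a \<subseteq> cball x b" using that(2) by auto
    then show ?thesis using that(1) by (rule closed_subset_compact)
  qed
  define S where "S = {a. 0 \<le> a \<and> compact (cball x a)}"
  have ub: "a \<le> r" if "a \<in> S" for a using mono[of a r] that nc unfolding S_def by (cases "a \<le> r") auto
  have S0: "0 \<in> S" by (simp add: S_def)
  have bdd: "bdd_above S" by (rule bdd_aboveI[OF ub])
  define \<rho> where "\<rho> = Sup S"
  have \<rho>0: "0 \<le> \<rho>" unfolding \<rho>_def by (rule cSup_upper[OF S0 bdd])
  have below: "compact (cball x a)" if a: "a < \<rho>" for a
  proof -
    obtain b where "b \<in> S" "a < b" using less_cSupD[of S a] a S0 unfolding \<rho>_def by blast
    then show ?thesis using mono[of b a] by (simp add: S_def)
  qed
  have comp: "compact (cball x \<rho>)"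
    unfolding compact_eq_totally_bounded
  proof (intro conjI allI impI)
    show "complete (cball x \<rho>)"
      using complete by (rule complete_closed_subset[OF closed_cball subset_UNIV])
    fix e :: real assume e: "0 < e"
    define a where "a = max 0 (\<rho> - e / 4)"
    have a: "0 \<le> a" "\<rho> < a + e / 2" using e by (auto simp: a_def)
    have "compact (cball x a)"
    proof (cases "\<rho> - e / 4 \<le> 0")
      case True then show ?thesis by (simp add: a_def)
    next
      case False then show ?thesis using e by (intro below) (auto simp: a_def)
    qed
    then obtain k where k: "finite k" "cball x a \<subseteq> (\<Union>y\<in>k. ball y (e / 2))"
      using e unfolding compact_eq_totally_bounded by (meson half_gt_zero)
    have "cball x \<rho> \<subseteq> (\<Union>y\<in>k. ball y e)"
    proof
      fix w assume "w \<in> cball x \<rho>"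
      then have "dist x w < a + e / 2" using a by auto
      then obtain z where z: "dist x z \<le> a" "dist z w < e / 2" using intermediate_point[of x w a "e / 2"] a e by auto
      then obtain y where y: "y \<in> k" "dist y z < e / 2" using k(2) by (auto simp: subset_iff)
      then have "dist y w < e" using z dist_triangle_half_r[of z y e w] by (simp add: dist_commute)
      then show "w \<in> (\<Union>y\<in>k. ball y e)" using y by auto
    qed
    then show "\<exists>k. finite k \<and> cball x \<rho> \<subseteq> (\<Union>y\<in>k. ball y e)" using k by blast
  qed
  obtain \<delta> where \<delta>: "\<And>y::'a. \<delta> y > 0" "\<And>y. compact (cball y (\<delta> y))" using small_compact_ball by metis
  have cover: "cball x \<rho> \<subseteq> (\<Union>y\<in>cball x \<rho>. ball y (\<delta> y / 2))" using \<delta>(1) by force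
  obtain D where D: "D \<subseteq> cball x \<rho>" "finite D" "cball x \<rho> \<subseteq> (\<Union>y\<in>D. ball y (\<delta> y / 2))"
    by (rule compactE_image[OF comp _ cover]) auto
  define e where "e = Min ((\<lambda>y. \<delta> y / 2) ` D)"
  have Dne: "D \<noteq> {}" using D(3) \<rho>0 by force
  have e: "e > 0" using D(2) Dne \<delta>(1) by (simp add: e_def)
  have eD: "e \<le> \<delta> y / 2" if "y \<in> D" for y unfolding e_def using D(2) that by (intro Min_le) auto
  have "cball x (\<rho> + e / 2) \<subseteq> (\<Union>y\<in>D. cball y (\<delta> y))"
  proof
    fix w assume "w \<in> cball x (\<rho> + e / 2)"
    then have "dist x w < \<rho> + e" using e by auto
    then obtain z where z: "dist x z \<le> \<rho>" "dist z w < e" using intermediate_point[of x w \<rho> e] \<rho>0 e by auto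
    then obtain y where y: "y \<in> D" "dist y z < \<delta> y / 2" using D(3) by (auto simp: subset_iff)
    have "dist y w \<le> \<delta> y" using dist_triangle[of y w z] y z eD[OF y(1)] by linarith
    then show "w \<in> (\<Union>y\<in>D. cball y (\<delta> y))" using y by auto
  qed
  moreover have "compact (\<Union>y\<in>D. cball y (\<delta> y))" using D(2) \<delta>(2) by (intro compact_UN) auto
  ultimately have "compact (cball x (\<rho> + e / 2))" by (rule closed_subset_compact)
  then have "\<rho> + e / 2 \<in> S" using \<rho>0 e by (simp add: S_def)
  then have "\<rho> + e / 2 \<le> \<rho>" unfolding \<rho>_def by (rule cSup_upper[OF _ bdd])
  then show False using e by simp
qed
end

section \<open>Functions of class C1 on Euclidean spaces\<close>

lemma Ck1_Un:
  assumes "open S" "open T" "Ck_on 1 S f" "Ck_on 1 T f"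
  shows "Ck_on 1 (S \<union> T) f"
  using assms by (auto intro!: continuous_on_open_Un)

lemma Ck1_compose:
  fixes T :: "'e::euclidean_space \<Rightarrow> 'f::euclidean_space" and h :: "'f \<Rightarrow> real"
  assumes T: "Ck_on 1 S T" and TS: "T ` S \<subseteq> U" and h: "Ck_on 1 U h"
  shows "Ck_on 1 S (\<lambda>x. h (T x))"
proof -
  let ?DT = "\<lambda>x. frechet_derivative T (at x)" and ?Dh = "\<lambda>y. frechet_derivative h (at y)"
  have DT: "(T has_derivative ?DT x) (at x)" if "x \<in> S" for x using T that by (simp add: frechet_derivative_works)
  have Dh: "(h has_derivative ?Dh y) (at y)" if "y \<in> U" for y using h that by (simp add: frechet_derivative_works)
  have D: "((\<lambda>x. h (T x)) has_derivative (\<lambda>v. ?Dh (T x) (?DT x v))) (at x)" if "x \<in> S" for x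
    by (rule has_derivative_compose[OF DT[OF that] Dh]) (use that TS in auto)
  have Tc: "continuous_on S T" using Ck_on_Suc_D[of 0 S T] T by simp
  have eq: "?Dh (T x) (?DT x b) = (\<Sum>e\<in>Basis. (?DT x b \<bullet> e) * ?Dh (T x) e)" if "x \<in> S" for x b
  proof -
    have lin: "linear (?Dh (T x))" using Dh TS that by (intro has_derivative_linear) auto
    have "?Dh (T x) (?DT x b) = ?Dh (T x) (\<Sum>e\<in>Basis. (?DT x b \<bullet> e) *\<^sub>R e)" by (simp only: euclidean_representation)
    also have "\<dots> = (\<Sum>e\<in>Basis. (?DT x b \<bullet> e) * ?Dh (T x) e)"
      by (simp add: linear_sum[OF lin] linear_scale[OF lin])
    finally show ?thesis .
  qed
  have "continuous_on S (\<lambda>x. frechet_derivative (\<lambda>x. h (T x)) (at x) b)" if b: "b \<in> Basis" for b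
  proof -
    have 1: "continuous_on S (\<lambda>x. ?DT x b)" using T b by simp
    have "continuous_on S (\<lambda>x. \<Sum>e\<in>Basis. (?DT x b \<bullet> e) * ?Dh (T x) e)"
    proof (intro continuous_intros 1)
      fix e :: 'f assume "e \<in> Basis"
      then have "continuous_on U (\<lambda>y. ?Dh y e)" using h by simp
      then show "continuous_on S (\<lambda>x. ?Dh (T x) e)" by (rule continuous_on_compose2[OF _ Tc TS])
    qed
    then show ?thesis
      by (rule continuous_on_eq) (simp add: frechet_derivative_at[OF D, symmetric] eq)
  qed
  then show ?thesis using D by (auto simp: differentiable_def)
qed

definition C1_real :: "(real \<Rightarrow> real) \<Rightarrow> (real \<Rightarrow> real) \<Rightarrow> bool" where
  "C1_real F F' \<longleftrightarrow> (\<forall>y. (F has_real_derivative F' y) (at y)) \<and> continuous_on UNIV F'"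

lemma Ck1_C1_real:
  fixes P :: "'e::euclidean_space \<Rightarrow> real"
  assumes "open S" "C1_real F F'" "Ck_on 1 S P"
  shows "Ck_on 1 S (\<lambda>x. F (P x))"
  using Ck_on_compose_real[OF assms(1), of 1 "\<lambda>i. if i = 0 then F else F'" 0 P] assms(2,3)
  by (auto simp: C1_real_def)

text \<open>A transition from 1 on the negative half line to 0 beyond 1. Squares of positive parts are C1, which is
all the smoothness needed here.\<close>
definition step_down :: "real \<Rightarrow> real" where
  "step_down y = (max 0 (1 - (max 0 y)\<^sup>2))\<^sup>2"

definition step_down' :: "real \<Rightarrow> real" where
  "step_down' y = - 4 * max 0 (1 - (max 0 y)\<^sup>2) * max 0 y"

lemma DERIV_pos_square: "((\<lambda>y. (max 0 y)\<^sup>2) has_real_derivative 2 * max 0 y) (at (y :: real))"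
proof -
  consider "y > 0" | "y < 0" | "y = 0" by linarith
  then show ?thesis
  proof cases
    case 1
    have "((\<lambda>y. y\<^sup>2) has_real_derivative 2 * y) (at y)" by (auto intro!: derivative_eq_intros)
    then have "((\<lambda>y. (max 0 y)\<^sup>2) has_real_derivative 2 * y) (at y)"
      by (rule has_field_derivative_transform_within_open[where S="{0<..}"]) (use 1 in auto)
    then show ?thesis using 1 by simp
  next
    case 2
    have "((\<lambda>y. 0) has_real_derivative 0) (at y)" by simp
    then have "((\<lambda>y. (max 0 y)\<^sup>2) has_real_derivative 0) (at y)"
      by (rule has_field_derivative_transform_within_open[where S="{..<0}"]) (use 2 in auto)
    then show ?thesis using 2 by simp
  next
    case 3
    have "((\<lambda>h::real. max 0 h * (max 0 h / h)) \<longlongrightarrow> 0) (at 0)"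
    proof (rule tendsto_0_le[where K=1])
      show "((\<lambda>h::real. h) \<longlongrightarrow> 0) (at 0)" by (rule tendsto_ident_at)
      show "\<forall>\<^sub>F h::real in at 0. norm (max 0 h * (max 0 h / h)) \<le> norm h * 1"
        by (intro always_eventually) (auto simp: max_def)
    qed
    then show ?thesis using 3 by (simp add: DERIV_def power2_eq_square)
  qed
qed

lemma C1_step_down: "C1_real step_down step_down'"
  unfolding C1_real_def
proof (intro conjI allI)
  fix y
  have "((\<lambda>y. 1 - (max 0 y)\<^sup>2) has_real_derivative - (2 * max 0 y)) (at y)"
    using DERIV_diff[OF DERIV_const[of 1] DERIV_pos_square[of y]] by simp
  from DERIV_chain2[OF DERIV_pos_square this]
  show "(step_down has_real_derivative step_down' y) (at y)"
    by (simp add: step_down_def[abs_def] step_down'_def mult_ac)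
  show "continuous_on UNIV step_down'" unfolding step_down'_def by (intro continuous_intros)
qed

lemma step_down_bounds: "0 \<le> step_down y" "step_down y \<le> 1"
proof -
  show "0 \<le> step_down y" by (simp add: step_down_def)
  have "0 \<le> max 0 (1 - (max 0 y)\<^sup>2)" "max 0 (1 - (max 0 y)\<^sup>2) \<le> 1" by auto
  then show "step_down y \<le> 1" unfolding step_down_def by (simp add: power_le_one)
qed

lemma step_down_left: "y \<le> 0 \<Longrightarrow> step_down y = 1" "y \<le> 0 \<Longrightarrow> step_down' y = 0"
  by (auto simp: step_down_def step_down'_def max_def)

lemma step_down_right:
  assumes y: "1 \<le> y"
  shows "step_down y = 0" "step_down' y = 0"
proof -
  from y have "1 \<le> y\<^sup>2" by (rule one_le_power)
  then have "max 0 (1 - (max 0 y)\<^sup>2) = 0" using y by simp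
  then show "step_down y = 0" "step_down' y = 0" unfolding step_down_def step_down'_def by simp_all
qed

lemma step_down'_bound: "\<bar>step_down' y\<bar> \<le> 4"
proof (cases "y \<le> 0 \<or> 1 \<le> y")
  case True then show ?thesis using step_down_left(2)[of y] step_down_right(2)[of y] by auto
next
  case False
  then have y: "0 < y" "y < 1" by auto
  have "\<bar>step_down' y\<bar> = 4 * (max 0 (1 - (max 0 y)\<^sup>2) * max 0 y)" by (simp add: step_down'_def abs_mult)
  also have "\<dots> \<le> 4 * (1 * 1)" using y by (intro mult_left_mono mult_mono) auto
  finally show ?thesis by simp
qed

section \<open>Functions of class C1 on the manifold\<close>

context riemannian_manifold
begin

definition C1M :: "('a \<Rightarrow> real) \<Rightarrow> bool" where
  "C1M f \<longleftrightarrow> (\<forall>c\<in>charts M. Ck_on 1 (cmap M c ` cdom M c) (\<lambda>y. f (cinv M c y)))"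

lemma C1M_const: "C1M (\<lambda>_. k)"
  unfolding C1M_def using Ck_on_const by blast

lemma C1M_add: "C1M f \<Longrightarrow> C1M g \<Longrightarrow> C1M (\<lambda>x. f x + g x)"
  unfolding C1M_def by (intro ballI Ck_on_add open_cmap_image) auto

lemma C1M_mult: "C1M f \<Longrightarrow> C1M g \<Longrightarrow> C1M (\<lambda>x. f x * g x)"
  unfolding C1M_def by (intro ballI Ck_on_mult open_cmap_image) auto

lemma C1M_compose: "C1_real F F' \<Longrightarrow> C1M f \<Longrightarrow> C1M (\<lambda>x. F (f x))"
  unfolding C1M_def by (intro ballI Ck1_C1_real[of _ F F'] open_cmap_image) auto

text \<open>Extension by zero. The preimage of K is compact, hence closed in the whole manifold; the chart domain and the complement
of this preimage are two open sets that cover the manifold, and the extension is C1 on each.\<close>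
lemma C1M_from_chart:
  assumes c: "c \<in> charts M" and h: "Ck_on 1 (cmap M c ` cdom M c) h"
    and K: "compact K" "K \<subseteq> cmap M c ` cdom M c" and h0: "\<And>y. y \<in> cmap M c ` cdom M c \<Longrightarrow> y \<notin> K \<Longrightarrow> h y = 0"
  shows "C1M (\<lambda>x. if x \<in> cdom M c then h (cmap M c x) else 0)"
  unfolding C1M_def
proof (intro ballI)
  fix d assume d: "d \<in> charts M"
  let ?f = "\<lambda>x. if x \<in> cdom M c then h (cmap M c x) else 0"
  let ?W = "cmap M d ` (cdom M d \<inter> cdom M c)"
  have K': "closed (cinv M c ` K)"
    using compact_continuous_image[OF continuous_on_subset[OF continuous_cinv[OF c] K(2)] K(1)] by (rule compact_imp_closed)
  let ?W' = "cmap M d ` (cdom M d - cinv M c ` K)"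
  have W: "open ?W" by (rule open_overlap[OF d c])
  have W': "open ?W'" by (intro open_cmap_image_sub[OF d] open_Diff open_cdom K' d) auto
  have f0: "?f x = 0" if "x \<notin> cinv M c ` K" for x
  proof (cases "x \<in> cdom M c")
    case True
    then have "cmap M c x \<notin> K" using that c by (metis cinv_cmap image_eqI)
    then show ?thesis using True h0[of "cmap M c x"] by auto
  qed auto
  have 1: "Ck_on 1 ?W (\<lambda>y. ?f (cinv M d y))"
  proof (rule Ck_on_cong_imp[OF W])
    show "Ck_on 1 ?W (\<lambda>y. h (transition M d c y))"
      by (rule Ck1_compose[OF transition_Ck1[OF d c] _ h]) (use c d in \<open>auto simp: transition_def\<close>)
    show "h (transition M d c y) = ?f (cinv M d y)" if "y \<in> ?W" for y using that c d by (auto simp: transition_def)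
  qed
  have 2: "Ck_on 1 ?W' (\<lambda>y. ?f (cinv M d y))"
  proof (rule Ck_on_cong_imp[OF W' _ Ck_on_const[of 1 ?W' 0]])
    fix y assume "y \<in> ?W'"
    then show "0 = ?f (cinv M d y)" using f0[of "cinv M d y"] d by auto
  qed
  have "cinv M c ` K \<subseteq> cdom M c" using K(2) c by auto
  then have "cmap M d ` cdom M d = ?W \<union> ?W'" by blast
  then show "Ck_on 1 (cmap M d ` cdom M d) (\<lambda>y. ?f (cinv M d y))" using Ck1_Un[OF W W' 1 2] by simp
qed

text \<open>Differentiability at x with gradient of length at most L, expressed through the differential in
charts so that no gradient vector is needed.\<close>
definition has_grad_le :: "('a \<Rightarrow> real) \<Rightarrow> 'a \<Rightarrow> real \<Rightarrow> bool" where
  "has_grad_le f x L \<longleftrightarrow> (\<forall>c\<in>charts M. x \<in> cdom M c \<longrightarrow>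
     (\<exists>D. ((\<lambda>y. f (cinv M c y)) has_derivative D) (at (cmap M c x)) \<and> (\<forall>v. \<bar>D v\<bar> \<le> L * sqrt (gform c x v))))"

lemma derivative_other_chart:
  assumes c: "c \<in> charts M" "x \<in> cdom M c" and d: "d \<in> charts M" "x \<in> cdom M d"
    and D: "((\<lambda>y. f (cinv M c y)) has_derivative D) (at (cmap M c x))"
  shows "((\<lambda>y. f (cinv M d y)) has_derivative (\<lambda>v. D (jacobian M d c x *v v))) (at (cmap M d x))"
proof -
  have "transition M d c (cmap M d x) = cmap M c x" using d by (simp add: transition_def)
  then have "((\<lambda>y. f (cinv M c (transition M d c y))) has_derivative (\<lambda>v. D (jacobian M d c x *v v))) (at (cmap M d x))"
    using has_derivative_compose[OF transition_has_derivative[OF d(1) c(1) d(2) c(2)], of "\<lambda>y. f (cinv M c y)" D] D by simp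
  then show ?thesis
    by (rule has_derivative_transform_within_open[OF _ open_overlap[OF d(1) c(1)]])
       (use c d in \<open>auto simp: transition_def\<close>)
qed

text \<open>One chart suffices, since both sides of the estimate transform by the Jacobian matrix.\<close>
lemma has_grad_leI:
  assumes c: "c \<in> charts M" "x \<in> cdom M c"
    and D: "((\<lambda>y. f (cinv M c y)) has_derivative D) (at (cmap M c x))" "\<And>v. \<bar>D v\<bar> \<le> L * sqrt (gform c x v)"
  shows "has_grad_le f x L"
  unfolding has_grad_le_def
proof (intro ballI impI)
  fix d assume d: "d \<in> charts M" "x \<in> cdom M d"
  show "\<exists>D. ((\<lambda>y. f (cinv M d y)) has_derivative D) (at (cmap M d x)) \<and> (\<forall>v. \<bar>D v\<bar> \<le> L * sqrt (gform d x v))"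
    using derivative_other_chart[OF c d D(1)] D(2) gform_pullback[OF d(1) c(1) d(2) c(2)] by auto
qed

lemma has_grad_leD:
  assumes "has_grad_le f x L" "c \<in> charts M" "x \<in> cdom M c"
  obtains D where "((\<lambda>y. f (cinv M c y)) has_derivative D) (at (cmap M c x))" "\<And>v. \<bar>D v\<bar> \<le> L * sqrt (gform c x v)"
  using assms unfolding has_grad_le_def by blast

lemma has_grad_le_mono: "has_grad_le f x L \<Longrightarrow> L \<le> L' \<Longrightarrow> has_grad_le f x L'"
proof -
  assume h: "has_grad_le f x L" and L: "L \<le> L'"
  obtain D where D: "((\<lambda>y. f (cinv M (chart_at M x) y)) has_derivative D) (at (cmap M (chart_at M x) x))" "\<And>v. \<bar>D v\<bar> \<le> L * sqrt (gform (chart_at M x) x v)"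
    using has_grad_leD[OF h chart_at] by blast
  show ?thesis
  proof (rule has_grad_leI[OF chart_at D(1)])
    fix v
    have "L * sqrt (gform (chart_at M x) x v) \<le> L' * sqrt (gform (chart_at M x) x v)"
      using L gform_nonneg[OF chart_at] by (intro mult_right_mono) auto
    then show "\<bar>D v\<bar> \<le> L' * sqrt (gform (chart_at M x) x v)" using D(2)[of v] by linarith
  qed
qed

lemma has_grad_le_cong:
  assumes f: "has_grad_le f x L" and U: "open U" "x \<in> U" "\<And>z. z \<in> U \<Longrightarrow> f z = g z"
  shows "has_grad_le g x L"
proof -
  define c where "c = chart_at M x"
  have c: "c \<in> charts M" "x \<in> cdom M c" using chart_at by (auto simp: c_def)
  obtain D where D: "((\<lambda>y. f (cinv M c y)) has_derivative D) (at (cmap M c x))" "\<And>v. \<bar>D v\<bar> \<le> L * sqrt (gform c x v)"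
    using has_grad_leD[OF f c] by blast
  have "((\<lambda>y. g (cinv M c y)) has_derivative D) (at (cmap M c x))"
  proof (rule has_derivative_transform_within_open[OF D(1)])
    show "open (cmap M c ` (U \<inter> cdom M c))" by (intro open_cmap_image_sub open_Int U open_cdom c) auto
  qed (use U c in auto)
  then show ?thesis using D(2) by (rule has_grad_leI[OF c])
qed

lemma has_grad_le_const: "has_grad_le (\<lambda>_. k) x 0"
  by (rule has_grad_leI[OF chart_at, of _ _ "\<lambda>_. 0"]) auto

text \<open>The differential of ch contributes only through the difference f - g.\<close>
lemma has_grad_le_mix:
  assumes ch: "has_grad_le ch x B" and f: "has_grad_le f x L" and g: "has_grad_le g x L" and ch01: "0 \<le> ch x" "ch x \<le> 1"
  shows "has_grad_le (\<lambda>z. ch z * f z + (1 - ch z) * g z) x (L + \<bar>f x - g x\<bar> * B)"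
proof -
  define c where "c = chart_at M x"
  have c: "c \<in> charts M" "x \<in> cdom M c" using chart_at by (auto simp: c_def)
  have xx: "cinv M c (cmap M c x) = x" using c by simp
  obtain D1 where D1: "((\<lambda>y. ch (cinv M c y)) has_derivative D1) (at (cmap M c x))" "\<And>v. \<bar>D1 v\<bar> \<le> B * sqrt (gform c x v)"
    using has_grad_leD[OF ch c] by blast
  obtain D2 where D2: "((\<lambda>y. f (cinv M c y)) has_derivative D2) (at (cmap M c x))" "\<And>v. \<bar>D2 v\<bar> \<le> L * sqrt (gform c x v)"
    using has_grad_leD[OF f c] by blast
  obtain D3 where D3: "((\<lambda>y. g (cinv M c y)) has_derivative D3) (at (cmap M c x))" "\<And>v. \<bar>D3 v\<bar> \<le> L * sqrt (gform c x v)"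
    using has_grad_leD[OF g c] by blast
  have "((\<lambda>y. ch (cinv M c y) * f (cinv M c y) + (1 - ch (cinv M c y)) * g (cinv M c y)) has_derivative
     (\<lambda>v. (ch x * D2 v + D1 v * f x) + ((1 - ch x) * D3 v + (0 - D1 v) * g x))) (at (cmap M c x))"
    using has_derivative_add[OF has_derivative_mult[OF D1(1) D2(1)] has_derivative_mult[OF has_derivative_diff[OF has_derivative_const[of 1] D1(1)] D3(1)]]
    unfolding xx .
  then show ?thesis
  proof (rule has_grad_leI[OF c])
    fix v
    let ?s = "sqrt (gform c x v)"
    have "(ch x * D2 v + D1 v * f x) + ((1 - ch x) * D3 v + (0 - D1 v) * g x) = ch x * D2 v + (1 - ch x) * D3 v + (f x - g x) * D1 v"
      by (simp add: algebra_simps)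
    also have "\<bar>\<dots>\<bar> \<le> \<bar>ch x * D2 v\<bar> + \<bar>(1 - ch x) * D3 v\<bar> + \<bar>(f x - g x) * D1 v\<bar>" by linarith
    also have "\<dots> \<le> ch x * (L * ?s) + (1 - ch x) * (L * ?s) + \<bar>f x - g x\<bar> * (B * ?s)"
      unfolding abs_mult using ch01 D1(2)[of v] D2(2)[of v] D3(2)[of v] by (intro add_mono mult_mono) auto
    also have "\<dots> = (L + \<bar>f x - g x\<bar> * B) * ?s" by (simp add: algebra_simps)
    finally show "\<bar>(ch x * D2 v + D1 v * f x) + ((1 - ch x) * D3 v + (0 - D1 v) * g x)\<bar> \<le> (L + \<bar>f x - g x\<bar> * B) * ?s" .
  qed
qed

lemma has_grad_le_compose:
  assumes F: "(F has_real_derivative F') (at (f x))" and f: "has_grad_le f x L"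
  shows "has_grad_le (\<lambda>z. F (f z)) x (\<bar>F'\<bar> * L)"
proof -
  define c where "c = chart_at M x"
  have c: "c \<in> charts M" "x \<in> cdom M c" using chart_at by (auto simp: c_def)
  have xx: "cinv M c (cmap M c x) = x" using c by simp
  obtain D where D: "((\<lambda>y. f (cinv M c y)) has_derivative D) (at (cmap M c x))" "\<And>v. \<bar>D v\<bar> \<le> L * sqrt (gform c x v)"
    using has_grad_leD[OF f c] by blast
  have "((\<lambda>y. F (f (cinv M c y))) has_derivative (\<lambda>v. D v * F')) (at (cmap M c x))"
    using DERIV_compose_FDERIV[of F F' "\<lambda>y. f (cinv M c y)" "cmap M c x" D UNIV] F D(1) xx by simp
  then show ?thesis
  proof (rule has_grad_leI[OF c])
    fix v
    have "\<bar>D v * F'\<bar> = \<bar>F'\<bar> * \<bar>D v\<bar>" by (simp add: abs_mult)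
    also have "\<dots> \<le> \<bar>F'\<bar> * (L * sqrt (gform c x v))" using D(2)[of v] by (intro mult_left_mono) auto
    finally show "\<bar>D v * F'\<bar> \<le> \<bar>F'\<bar> * L * sqrt (gform c x v)" by (simp add: mult.assoc)
  qed
qed

lemma gform_scaleR: "gform c x (k *\<^sub>R v) = k\<^sup>2 * gform c x v"
  by (simp add: gform_def matrix_vector_mult_scaleR power2_eq_square)

text \<open>The minimum of the form over the product of K with the unit sphere.\<close>
lemma metric_eigenvalue:
  assumes c: "c \<in> charts M" and K: "compact K" "K \<subseteq> cmap M c ` cdom M c"
  obtains l0 where "l0 > 0" "\<And>y v. y \<in> K \<Longrightarrow> l0 * (norm v)\<^sup>2 \<le> gform c (cinv M c y) v"
proof (cases "K = {}")
  case True then show ?thesis using that[of 1] by auto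
next
  case False
  let ?S = "sphere (0::real^'n) 1"
  have S: "?S \<noteq> {}" using norm_axis_1 by (metis dist_0_norm empty_iff mem_sphere)
  have "compact (K \<times> ?S)" using K(1) by (intro compact_Times compact_sphere)
  moreover have "continuous_on (K \<times> ?S) (\<lambda>(y, v). gform c (cinv M c y) v)"
    unfolding split_beta
  proof (rule continuous_gform[OF c])
    show "continuous_on (K \<times> ?S) (\<lambda>p. cinv M c (fst p))"
      by (rule continuous_on_compose2[OF continuous_cinv[OF c]]) (use K in \<open>auto intro!: continuous_intros\<close>)
    show "(\<lambda>p. cinv M c (fst p)) ` (K \<times> ?S) \<subseteq> cdom M c" using K c by (auto intro!: cinv_in)
  qed (intro continuous_intros)
  moreover have "K \<times> ?S \<noteq> {}" using False S by auto
  ultimately obtain p where p: "p \<in> K \<times> ?S" "\<forall>p'\<in>K \<times> ?S. (\<lambda>(y, v). gform c (cinv M c y) v) p \<le> (\<lambda>(y, v). gform c (cinv M c y) v) p'"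
    using continuous_attains_inf by blast
  obtain y0 v0 where p0: "p = (y0, v0)" by (cases p)
  define l0 where "l0 = gform c (cinv M c y0) v0"
  have "cinv M c y0 \<in> cdom M c" using p p0 K c by (intro cinv_in) auto
  moreover have "v0 \<noteq> 0" using p p0 by auto
  ultimately have "l0 > 0" unfolding l0_def gform_def using c by (intro metric_positive)
  moreover have "l0 * (norm v)\<^sup>2 \<le> gform c (cinv M c y) v" if y: "y \<in> K" for y v
  proof (cases "v = 0")
    case True then show ?thesis by (simp add: gform_def)
  next
    case False
    define u where "u = v /\<^sub>R norm v"
    have u: "u \<in> ?S" "v = norm v *\<^sub>R u" using False by (auto simp: u_def)
    have "l0 \<le> gform c (cinv M c y) u" using p(2) y u(1) unfolding p0 l0_def by auto
    then have "l0 * (norm v)\<^sup>2 \<le> gform c (cinv M c y) u * (norm v)\<^sup>2" by (intro mult_right_mono) auto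
    also have "\<dots> = gform c (cinv M c y) (norm v *\<^sub>R u)"
      by (simp add: gform_def matrix_vector_mult_scaleR power2_eq_square)
    finally show ?thesis using u(2) by simp
  qed
  ultimately show ?thesis by (rule that)
qed

text \<open>By uniform continuity the form varies by at most \<eta> l0 on unit vectors, where l0 is the lower bound of
\<open>metric_eigenvalue\<close>; this turns the additive error into a factor.\<close>
lemma metric_almost_constant:
  assumes c: "c \<in> charts M" and K: "cball a (\<rho> + \<rho>') \<subseteq> cmap M c ` cdom M c" and \<rho>: "0 < \<rho>'" and \<eta>: "0 < \<eta>"
  obtains \<delta> where "0 < \<delta>" "\<delta> \<le> \<rho>'"
    "\<And>y y' v. y \<in> cball a \<rho> \<Longrightarrow> dist y y' \<le> \<delta> \<Longrightarrow> gform c (cinv M c y') v \<le> (1 + \<eta>)\<^sup>2 * gform c (cinv M c y) v"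
proof -
  let ?K = "cball a (\<rho> + \<rho>')" and ?S = "sphere (0::real^'n) 1"
  let ?G = "\<lambda>p. gform c (cinv M c (fst p)) (snd p)"
  obtain l0 where l0: "l0 > 0" "\<And>y v. y \<in> ?K \<Longrightarrow> l0 * (norm v)\<^sup>2 \<le> gform c (cinv M c y) v"
    using metric_eigenvalue[OF c compact_cball K] by blast
  have "continuous_on (?K \<times> ?S) ?G"
  proof (rule continuous_gform[OF c])
    show "continuous_on (?K \<times> ?S) (\<lambda>p. cinv M c (fst p))"
      by (rule continuous_on_compose2[OF continuous_cinv[OF c]]) (use K in \<open>auto intro!: continuous_intros\<close>)
    show "(\<lambda>p. cinv M c (fst p)) ` (?K \<times> ?S) \<subseteq> cdom M c" using K c by (auto intro!: cinv_in)
  qed (intro continuous_intros)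
  then have "uniformly_continuous_on (?K \<times> ?S) ?G"
    by (rule compact_uniformly_continuous) (intro compact_Times compact_cball compact_sphere)
  moreover have "0 < \<eta> * l0" using \<eta> l0 by simp
  ultimately obtain d where d: "d > 0" "\<And>p p'. p \<in> ?K \<times> ?S \<Longrightarrow> p' \<in> ?K \<times> ?S \<Longrightarrow> dist p' p < d \<Longrightarrow> dist (?G p') (?G p) < \<eta> * l0"
    unfolding uniformly_continuous_on_def by meson
  define \<delta> where "\<delta> = min \<rho>' (d / 2)"
  show ?thesis
  proof (rule that[of \<delta>])
    show "0 < \<delta>" "\<delta> \<le> \<rho>'" using d(1) \<rho> by (auto simp: \<delta>_def)
    fix y y' v assume y: "y \<in> cball a \<rho>" "dist y y' \<le> \<delta>"
    have yK: "y \<in> ?K" "y' \<in> ?K" using y \<rho> dist_triangle[of a y' y] by (auto simp: \<delta>_def)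
    show "gform c (cinv M c y') v \<le> (1 + \<eta>)\<^sup>2 * gform c (cinv M c y) v"
    proof (cases "v = 0")
      case True then show ?thesis by (simp add: gform_def)
    next
      case False
      define u where "u = v /\<^sub>R norm v"
      have u: "u \<in> ?S" "norm u = 1" "v = norm v *\<^sub>R u" using False by (auto simp: u_def)
      have "dist (y', u) (y, u) < d" using y d(1) by (auto simp: dist_Pair_Pair \<delta>_def dist_commute)
      then have "dist (?G (y', u)) (?G (y, u)) < \<eta> * l0" using yK u(1) by (intro d(2)) auto
      then have "gform c (cinv M c y') u \<le> gform c (cinv M c y) u + \<eta> * l0" by (simp add: dist_real_def)
      also have "\<eta> * l0 \<le> \<eta> * gform c (cinv M c y) u" using l0(2)[OF yK(1), of u] u(2) \<eta> by (intro mult_left_mono) auto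
      also have "gform c (cinv M c y) u + \<eta> * gform c (cinv M c y) u \<le> (1 + \<eta>)\<^sup>2 * gform c (cinv M c y) u"
      proof -
        have g0: "0 \<le> gform c (cinv M c y) u" using yK K c by (intro gform_nonneg cinv_in) auto
        have "(1 + \<eta>) * gform c (cinv M c y) u \<le> (1 + \<eta>)\<^sup>2 * gform c (cinv M c y) u"
          using g0 \<eta> by (intro mult_right_mono) (auto simp: power2_eq_square)
        then show ?thesis by (simp add: algebra_simps)
      qed
      finally have "gform c (cinv M c y') u \<le> (1 + \<eta>)\<^sup>2 * gform c (cinv M c y) u" by simp
      then have "(norm v)\<^sup>2 * gform c (cinv M c y') u \<le> (norm v)\<^sup>2 * ((1 + \<eta>)\<^sup>2 * gform c (cinv M c y) u)" by (intro mult_left_mono) auto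
      moreover have "gform c x v = (norm v)\<^sup>2 * gform c x u" for x
        unfolding gform_scaleR[symmetric] u(3)[symmetric] ..
      ultimately show ?thesis by (simp add: mult_ac)
    qed
  qed
qed
end

section \<open>Smoothing Lipschitz functions\<close>

text \<open>A mollification is an average with respect to a probability density carried by the ball of radius \<epsilon>.
Choosing a constant for b compares it with a value of g, choosing a translate of g yields its Lipschitz constant.\<close>
lemma mollify_average_le:
  fixes g :: "'e::euclidean_space \<Rightarrow> real"
  assumes g: "integrable lborel g" and \<epsilon>: "0 < \<epsilon>" and B: "\<And>w. norm w < \<epsilon> \<Longrightarrow> \<bar>g (x + w) - b w\<bar> \<le> B"
    and b: "integrable lborel (\<lambda>w. b w * bump_kernel \<epsilon> w)"
  shows "\<bar>mollify \<epsilon> g x - (\<integral>w. b w * bump_kernel \<epsilon> w \<partial>lborel)\<bar> \<le> B"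
proof -
  note k = bump_kernel_facts[OF \<epsilon>, where 'e='e] and m = mollify_shift[OF g \<epsilon>, of x]
  have "\<bar>mollify \<epsilon> g x - (\<integral>w. b w * bump_kernel \<epsilon> w \<partial>lborel)\<bar> = norm (\<integral>w. g (x + w) * bump_kernel \<epsilon> w - b w * bump_kernel \<epsilon> w \<partial>lborel)"
    unfolding m(1) Bochner_Integration.integral_diff[OF m(2) b] by simp
  also have "\<dots> \<le> (\<integral>w. B * bump_kernel \<epsilon> w \<partial>(lborel :: 'e measure))"
  proof (rule Bochner_Integration.integral_norm_bound_integral)
    show "integrable lborel (\<lambda>w. g (x + w) * bump_kernel \<epsilon> w - b w * bump_kernel \<epsilon> w)"
      using m(2) b by (rule Bochner_Integration.integrable_diff)
    show "integrable lborel (\<lambda>w :: 'e. B * bump_kernel \<epsilon> w)" using k(2) by simp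
    fix w :: 'e
    have "norm (g (x + w) * bump_kernel \<epsilon> w - b w * bump_kernel \<epsilon> w) = \<bar>g (x + w) - b w\<bar> * bump_kernel \<epsilon> w"
      unfolding left_diff_distrib[symmetric] using k(1)[of w] by (simp add: abs_mult)
    also have "\<dots> \<le> B * bump_kernel \<epsilon> w"
    proof (cases "norm w < \<epsilon>")
      case True then show ?thesis using B k(1) by (intro mult_right_mono) auto
    next
      case False then show ?thesis using k(4)[of w] by simp
    qed
    finally show "norm (g (x + w) * bump_kernel \<epsilon> w - b w * bump_kernel \<epsilon> w) \<le> B * bump_kernel \<epsilon> w" .
  qed
  also have "\<dots> = B" using k(3) by simp
  finally show ?thesis .
qed

context riemannian_manifold
begin

text \<open>Mollification in a chart preserves the Lipschitz constant up to a factor 1 + \<eta>. Indeed the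
mollification averages the translates of r by small vectors w, and the coordinate segment from y + w to y + t v + w has
length at most t (1 + \<eta>) times the length of v at y, because the metric is almost constant near y.\<close>
lemma local_smoothing:
  fixes r :: "'a \<Rightarrow> real"
  assumes c: "c \<in> charts M" and K: "cball a (2 * \<rho>) \<subseteq> cmap M c ` cdom M c" and \<rho>: "0 < \<rho>" and \<eta>: "0 < \<eta>"
    and r: "\<And>x y. \<bar>r x - r y\<bar> \<le> dist x y"
  obtains h where "Ck_on 1 UNIV h" "\<And>y. y \<in> cball a \<rho> \<Longrightarrow> \<bar>h y - r (cinv M c y)\<bar> \<le> \<eta>"
    "\<And>y. y \<in> cball a \<rho> \<Longrightarrow> \<exists>D. (h has_derivative D) (at y) \<and> (\<forall>v. \<bar>D v\<bar> \<le> (1 + \<eta>) * sqrt (gform c (cinv M c y) v))"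
proof -
  have K': "cball a (\<rho> + \<rho>) \<subseteq> cmap M c ` cdom M c" using K unfolding mult_2 .
  obtain \<delta> where \<delta>: "0 < \<delta>" "\<delta> \<le> \<rho>"
    "\<And>y y' v. y \<in> cball a \<rho> \<Longrightarrow> dist y y' \<le> \<delta> \<Longrightarrow> gform c (cinv M c y') v \<le> (1 + \<eta>)\<^sup>2 * gform c (cinv M c y) v"
    using metric_almost_constant[OF c K' \<rho> \<eta>] by blast
  let ?K = "cball a (2 * \<rho>)"
  have rc: "continuous_on UNIV r" unfolding continuous_on_iff
  proof (intro ballI allI impI)
    fix x :: 'a and e :: real assume "0 < e"
    then show "\<exists>d>0. \<forall>x'\<in>UNIV. dist x' x < d \<longrightarrow> dist (r x') (r x) < e"
      by (intro exI[of _ e] conjI ballI impI) (auto simp: dist_real_def intro: le_less_trans[OF r])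
  qed
  have gc: "continuous_on ?K (\<lambda>y. r (cinv M c y))"
    by (rule continuous_on_compose2[OF rc continuous_on_subset[OF continuous_cinv[OF c] K]]) auto
  then have "uniformly_continuous_on ?K (\<lambda>y. r (cinv M c y))" by (rule compact_uniformly_continuous[OF _ compact_cball])
  then obtain d1 where d1: "d1 > 0" "\<And>y y'. y \<in> ?K \<Longrightarrow> y' \<in> ?K \<Longrightarrow> dist y' y < d1 \<Longrightarrow> dist (r (cinv M c y')) (r (cinv M c y)) < \<eta>"
    using \<eta> unfolding uniformly_continuous_on_def by meson
  define \<epsilon> where "\<epsilon> = min \<delta> d1 / 2"
  have \<epsilon>: "0 < \<epsilon>" "\<epsilon> < \<delta>" "\<epsilon> < d1" using \<delta>(1) d1(1) by (auto simp: \<epsilon>_def min_def)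
  define g where "g y = indicator ?K y *\<^sub>R r (cinv M c y)" for y
  have gm: "g \<in> borel_measurable borel" unfolding g_def[abs_def] by (intro borel_measurable_continuous_on_indicator gc) simp
  obtain B where B0: "\<forall>z\<in>(\<lambda>y. r (cinv M c y)) ` ?K. norm z \<le> B"
    using compact_imp_bounded[OF compact_continuous_image[OF gc compact_cball]] unfolding bounded_iff by blast
  have B: "norm (r (cinv M c y)) \<le> B" if "y \<in> ?K" for y using B0 that by blast
  have gi: "integrable lborel g"
  proof (rule integrable_compact_support[OF gm, of "max 0 B" "norm a + 2 * \<rho>"])
    show "norm (g x) \<le> max 0 B" for x using B[of x] by (cases "x \<in> ?K") (auto simp: g_def)
    fix x :: "real^'n" assume "norm x > norm a + 2 * \<rho>"
    then have "x \<notin> ?K" using norm_triangle_sub[of x a] by (auto simp: dist_norm norm_minus_commute)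
    then show "g x = 0" by (simp add: g_def)
  qed
  note k = bump_kernel_facts[OF \<epsilon>(1), where 'e="real^'n"]
  have mD: "(mollify \<epsilon> g has_derivative (\<lambda>v. mollify_grad \<epsilon> g x \<bullet> v)) (at x)" for x
    by (rule mollify_has_derivative[OF gi \<epsilon>(1)])
  have inK: "z \<in> ?K" if "y \<in> cball a \<rho>" "dist y z \<le> \<delta>" for y z
    using dist_triangle[of a z y] that \<delta>(2) by auto
  show ?thesis
  proof (rule that[of "mollify \<epsilon> g"])
    have "continuous_on UNIV (\<lambda>x. mollify_grad \<epsilon> g x \<bullet> b)" for b
      by (intro continuous_intros mollify_grad_continuous[OF gi \<epsilon>(1)])
    then show "Ck_on 1 UNIV (mollify \<epsilon> g)"
      using mD frechet_derivative_at[OF mD, symmetric] by (auto simp: differentiable_def)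
    fix y assume y: "y \<in> cball a \<rho>"
    have "\<bar>mollify \<epsilon> g y - (\<integral>w. r (cinv M c y) * bump_kernel \<epsilon> w \<partial>(lborel :: (real^'n) measure))\<bar> \<le> \<eta>"
    proof (rule mollify_average_le[OF gi \<epsilon>(1)])
      show "integrable lborel (\<lambda>w :: real^'n. r (cinv M c y) * bump_kernel \<epsilon> w)" using k(2) by simp
      fix w :: "real^'n" assume w: "norm w < \<epsilon>"
      have 1: "y + w \<in> ?K" "y \<in> ?K" using w \<epsilon> \<delta>(1) inK[OF y, of "y + w"] inK[OF y, of y] by (auto simp: dist_norm)
      have "dist (r (cinv M c (y + w))) (r (cinv M c y)) < \<eta>" using w \<epsilon> 1 by (intro d1(2)) (auto simp: dist_norm)
      then show "\<bar>g (y + w) - r (cinv M c y)\<bar> \<le> \<eta>" using 1 by (simp add: g_def dist_real_def)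
    qed
    then show "\<bar>mollify \<epsilon> g y - r (cinv M c y)\<bar> \<le> \<eta>" using k(3) by simp
    show "\<exists>D. (mollify \<epsilon> g has_derivative D) (at y) \<and> (\<forall>v. \<bar>D v\<bar> \<le> (1 + \<eta>) * sqrt (gform c (cinv M c y) v))"
    proof (intro exI[of _ "\<lambda>v. mollify_grad \<epsilon> g y \<bullet> v"] conjI allI)
      show "(mollify \<epsilon> g has_derivative (\<lambda>v. mollify_grad \<epsilon> g y \<bullet> v)) (at y)" by (rule mD)
      fix v
      define S where "S = sqrt (gform c (cinv M c y) v)"
      have y0: "cinv M c y \<in> cdom M c" using inK[OF y, of y] \<delta>(1) K c by (intro cinv_in) auto
      have S: "0 \<le> S" "S\<^sup>2 = gform c (cinv M c y) v" unfolding S_def using gform_nonneg[OF c y0] by auto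
      \<comment> \<open>The difference quotients obey the bound, so the derivative does.\<close>
      have step: "\<bar>(mollify \<epsilon> g (y + t *\<^sub>R v) - mollify \<epsilon> g y) / t\<bar> \<le> (1 + \<eta>) * S" if t: "0 < t" "t * norm v \<le> \<delta> - \<epsilon>" for t
      proof -
        have "\<bar>mollify \<epsilon> g (y + t *\<^sub>R v) - (\<integral>w. g (y + w) * bump_kernel \<epsilon> w \<partial>lborel)\<bar> \<le> t * ((1 + \<eta>) * S)"
        proof (rule mollify_average_le[OF gi \<epsilon>(1) _ mollify_shift(2)[OF gi \<epsilon>(1)]])
          fix w :: "real^'n" assume w: "norm w < \<epsilon>"
          let ?p = "y + w" and ?q = "y + t *\<^sub>R v + w"
          have pd: "dist y ?p \<le> \<delta>" using w \<epsilon> by (simp add: dist_norm)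
          have qd: "dist y ?q \<le> \<delta>"
          proof -
            have "dist y ?q = norm (- (t *\<^sub>R v + w))" by (simp add: dist_norm add.assoc)
            also have "\<dots> \<le> norm (t *\<^sub>R v) + norm w" unfolding norm_minus_cancel by (rule norm_triangle_ineq)
            finally show ?thesis using w t by simp
          qed
          have seg: "dist y z \<le> \<delta>" if "z \<in> closed_segment ?p ?q" for z
            using closed_segment_subset[of ?p "cball y \<delta>" ?q] pd qd that by auto
          have segO: "closed_segment ?p ?q \<subseteq> cmap M c ` cdom M c" using seg inK[OF y] K by blast
          have "dist (cinv M c ?p) (cinv M c ?q) \<le> t * ((1 + \<eta>) * S)"
          proof (rule dist_segment_le[OF c segO])
            show "0 \<le> t * ((1 + \<eta>) * S)" using t S \<eta> by simp
            fix z assume z: "z \<in> closed_segment ?p ?q"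
            have "gform c (cinv M c z) (?q - ?p) = t\<^sup>2 * gform c (cinv M c z) v"
              by (simp add: gform_scaleR)
            also have "\<dots> \<le> t\<^sup>2 * ((1 + \<eta>)\<^sup>2 * gform c (cinv M c y) v)"
              using \<delta>(3)[OF y seg[OF z]] by (intro mult_left_mono) auto
            also have "\<dots> = (t * ((1 + \<eta>) * S))\<^sup>2" using S(2) by (simp add: power_mult_distrib)
            finally show "gform c (cinv M c z) (?q - ?p) \<le> (t * ((1 + \<eta>) * S))\<^sup>2" .
          qed
          then have "\<bar>r (cinv M c ?q) - r (cinv M c ?p)\<bar> \<le> t * ((1 + \<eta>) * S)"
            using r[of "cinv M c ?q" "cinv M c ?p"] by (simp add: dist_commute)
          moreover have "?p \<in> ?K" "?q \<in> ?K" using inK[OF y pd] inK[OF y qd] by auto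
          ultimately show "\<bar>g ?q - g ?p\<bar> \<le> t * ((1 + \<eta>) * S)" by (simp add: g_def)
        qed
        then have "\<bar>mollify \<epsilon> g (y + t *\<^sub>R v) - mollify \<epsilon> g y\<bar> \<le> t * ((1 + \<eta>) * S)"
          using mollify_shift(1)[OF gi \<epsilon>(1), of y] by simp
        then show ?thesis using t by (simp add: field_simps)
      qed
      have "((\<lambda>t. mollify \<epsilon> g (y + t *\<^sub>R v)) has_derivative (\<lambda>h. mollify_grad \<epsilon> g (y + 0 *\<^sub>R v) \<bullet> (h *\<^sub>R v))) (at 0)"
        by (rule has_derivative_compose[OF _ mD]) (auto intro!: derivative_eq_intros)
      then have "((\<lambda>t. mollify \<epsilon> g (y + t *\<^sub>R v)) has_real_derivative (mollify_grad \<epsilon> g y \<bullet> v)) (at 0)"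
        by (simp add: has_field_derivative_def mult.commute[of _ "mollify_grad \<epsilon> g y \<bullet> v"])
      then have "((\<lambda>t. (mollify \<epsilon> g (y + t *\<^sub>R v) - mollify \<epsilon> g y) / t) \<longlongrightarrow> mollify_grad \<epsilon> g y \<bullet> v) (at 0)"
        by (simp add: DERIV_def)
      then have "((\<lambda>t. \<bar>(mollify \<epsilon> g (y + t *\<^sub>R v) - mollify \<epsilon> g y) / t\<bar>) \<longlongrightarrow> \<bar>mollify_grad \<epsilon> g y \<bullet> v\<bar>) (at_right 0)"
        by (intro tendsto_rabs) (rule tendsto_mono[OF at_le], auto)
      then show "\<bar>mollify_grad \<epsilon> g y \<bullet> v\<bar> \<le> (1 + \<eta>) * sqrt (gform c (cinv M c y) v)"
        unfolding S_def[symmetric]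
      proof (rule tendsto_upperbound)
        define t0 where "t0 = (\<delta> - \<epsilon>) / (norm v + 1)"
        have t0: "0 < t0" using \<epsilon> by (simp add: t0_def add_nonneg_pos)
        have "t * norm v \<le> \<delta> - \<epsilon>" if "0 < t" "t < t0" for t
        proof -
          have "t * norm v \<le> t * (norm v + 1)" using that by (intro mult_left_mono) auto
          also have "\<dots> \<le> t0 * (norm v + 1)" using that by (intro mult_right_mono) auto
          also have "\<dots> = \<delta> - \<epsilon>" unfolding t0_def using norm_ge_zero[of v] by (simp add: add_nonneg_eq_0_iff)
          finally show ?thesis .
        qed
        then show "\<forall>\<^sub>F t in at_right 0. \<bar>(mollify \<epsilon> g (y + t *\<^sub>R v) - mollify \<epsilon> g y) / t\<bar> \<le> (1 + \<eta>) * S"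
          using t0 step unfolding eventually_at_right_field by (intro exI[of _ t0]) auto
      qed auto
    qed
  qed
qed

subsection \<open>Patching\<close>

text \<open>A patch is a coordinate ball, given by chart, centre and radius, whose double still lies in the chart;
the doubling leaves room for mollification.\<close>
definition patch_ok :: "'i \<times> (real^'n) \<times> real \<Rightarrow> bool" where
  "patch_ok p \<longleftrightarrow> (case p of (c, a, \<rho>) \<Rightarrow> c \<in> charts M \<and> 0 < \<rho> \<and> cball a (2 * \<rho>) \<subseteq> cmap M c ` cdom M c)"

definition patch_core :: "'i \<times> (real^'n) \<times> real \<Rightarrow> 'a set" where
  "patch_core p = (case p of (c, a, \<rho>) \<Rightarrow> cinv M c ` ball a (\<rho> / 2))"

text \<open>The constants make the argument of \<open>step_down\<close> at most 0 on the core, of half the radius, and at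
least 1 outside the patch.\<close>
definition patch_bump :: "'i \<times> (real^'n) \<times> real \<Rightarrow> 'a \<Rightarrow> real" where
  "patch_bump p x = (case p of (c, a, \<rho>) \<Rightarrow>
     if x \<in> cdom M c then step_down (2 / \<rho>\<^sup>2 * (norm (cmap M c x - a))\<^sup>2 - 1) else 0)"

lemma patch_profile_C1: "Ck_on 1 S (\<lambda>y. step_down (2 / \<rho>\<^sup>2 * (norm (y - a))\<^sup>2 - 1))" for a :: "real^'n"
proof -
  have "Ck_on 1 UNIV (\<lambda>y. step_down (2 / \<rho>\<^sup>2 * (norm (y - a))\<^sup>2 + (- 1)))"
    by (intro Ck1_C1_real[OF open_UNIV C1_step_down] Ck_on_add open_UNIV Ck_on_mult Ck_on_const Ck_on_norm_square)
  then show ?thesis unfolding diff_conv_add_uminus by (rule Ck_on_subset[OF _ subset_UNIV])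
qed

lemma patch_profile_zero: "0 < \<rho> \<Longrightarrow> y \<notin> cball a \<rho> \<Longrightarrow> step_down (2 / \<rho>\<^sup>2 * (norm (y - a))\<^sup>2 - 1) = 0" for a :: "real^'n"
proof (rule step_down_right)
  assume \<rho>: "0 < \<rho>" and y: "y \<notin> cball a \<rho>"
  then have "\<rho>\<^sup>2 \<le> (norm (y - a))\<^sup>2" by (intro power_mono) (auto simp: dist_norm norm_minus_commute)
  then show "1 \<le> 2 / \<rho>\<^sup>2 * (norm (y - a))\<^sup>2 - 1" using \<rho> by (simp add: field_simps)
qed

lemma patch_profile_one: "0 < \<rho> \<Longrightarrow> y \<in> ball a (\<rho> / 2) \<Longrightarrow> step_down (2 / \<rho>\<^sup>2 * (norm (y - a))\<^sup>2 - 1) = 1" for a :: "real^'n"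
proof (rule step_down_left)
  assume \<rho>: "0 < \<rho>" and y: "y \<in> ball a (\<rho> / 2)"
  then have "(norm (y - a))\<^sup>2 \<le> (\<rho> / 2)\<^sup>2" by (intro power_mono) (auto simp: dist_norm norm_minus_commute)
  then have "2 / \<rho>\<^sup>2 * (norm (y - a))\<^sup>2 \<le> 2 / \<rho>\<^sup>2 * (\<rho> / 2)\<^sup>2" by (intro mult_left_mono) auto
  also have "\<dots> \<le> 1" using \<rho> by (simp add: power_divide)
  finally show "2 / \<rho>\<^sup>2 * (norm (y - a))\<^sup>2 - 1 \<le> 0" by simp
qed

lemma patch_facts:
  assumes "patch_ok (c, a, \<rho>)"
  shows "c \<in> charts M" "0 < \<rho>" "cball a (2 * \<rho>) \<subseteq> cmap M c ` cdom M c" "cball a \<rho> \<subseteq> cmap M c ` cdom M c"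
    "closed (cinv M c ` cball a \<rho>)" "open (patch_core (c, a, \<rho>))"
    "\<And>x. x \<notin> cinv M c ` cball a \<rho> \<Longrightarrow> patch_bump (c, a, \<rho>) x = 0"
    "\<And>x. x \<in> patch_core (c, a, \<rho>) \<Longrightarrow> patch_bump (c, a, \<rho>) x = 1"
    "patch_core (c, a, \<rho>) \<subseteq> cinv M c ` cball a \<rho>"
    "cinv M c ` cball a \<rho> \<subseteq> cdom M c"
proof -
  show c: "c \<in> charts M" and \<rho>: "0 < \<rho>" and K2: "cball a (2 * \<rho>) \<subseteq> cmap M c ` cdom M c"
    using assms by (auto simp: patch_ok_def)
  have "cball a \<rho> \<subseteq> cball a (2 * \<rho>)" using \<rho> by auto
  then show K: "cball a \<rho> \<subseteq> cmap M c ` cdom M c" using K2 by blast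
  show "closed (cinv M c ` cball a \<rho>)"
    by (intro compact_imp_closed compact_continuous_image continuous_on_subset[OF continuous_cinv[OF c] K] compact_cball)
  have b: "ball a (\<rho> / 2) \<subseteq> cball a \<rho>" using \<rho> by auto
  then show "open (patch_core (c, a, \<rho>))" unfolding patch_core_def prod.case
    using K by (intro open_cinv_image[OF c]) auto
  show "patch_core (c, a, \<rho>) \<subseteq> cinv M c ` cball a \<rho>" using b by (auto simp: patch_core_def)
  show "cinv M c ` cball a \<rho> \<subseteq> cdom M c" using K c by (auto intro!: cinv_in)
  show "patch_bump (c, a, \<rho>) x = 0" if "x \<notin> cinv M c ` cball a \<rho>" for x
  proof (cases "x \<in> cdom M c")
    case True
    then have "cmap M c x \<notin> cball a \<rho>" using that c by (metis cinv_cmap image_eqI)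
    then show ?thesis using True patch_profile_zero[OF \<rho>] by (simp add: patch_bump_def)
  qed (simp add: patch_bump_def)
  show "patch_bump (c, a, \<rho>) x = 1" if x: "x \<in> patch_core (c, a, \<rho>)" for x
  proof -
    obtain y where y: "y \<in> ball a (\<rho> / 2)" "x = cinv M c y" using x unfolding patch_core_def by auto
    then have "y \<in> cmap M c ` cdom M c" using b K by blast
    then have "cmap M c x = y" "x \<in> cdom M c" using y c by auto
    then show ?thesis using y patch_profile_one[OF \<rho>] by (simp add: patch_bump_def)
  qed
qed

lemma patch_bump_range: "0 \<le> patch_bump p x" "patch_bump p x \<le> 1"
  using step_down_bounds by (auto simp: patch_bump_def split: prod.split)

lemma patch_bump_mult_C1M:
  assumes p: "patch_ok (c, a, \<rho>)" and h: "Ck_on 1 UNIV h"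
  shows "C1M (\<lambda>x. patch_bump (c, a, \<rho>) x * (if x \<in> cdom M c then h (cmap M c x) else 0))"
proof -
  note pf = patch_facts[OF p]
  have "C1M (\<lambda>x. if x \<in> cdom M c then (\<lambda>y. step_down (2 / \<rho>\<^sup>2 * (norm (y - a))\<^sup>2 - 1) * h y) (cmap M c x) else 0)"
  proof (rule C1M_from_chart[OF pf(1)])
    show "Ck_on 1 (cmap M c ` cdom M c) (\<lambda>y. step_down (2 / \<rho>\<^sup>2 * (norm (y - a))\<^sup>2 - 1) * h y)"
      by (intro Ck_on_mult open_cmap_image pf patch_profile_C1 Ck_on_subset[OF h]) auto
    show "compact (cball a \<rho>)" by simp
    show "cball a \<rho> \<subseteq> cmap M c ` cdom M c" by (rule pf(4))
  qed (use patch_profile_zero[OF pf(2)] in auto)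
  moreover have "(\<lambda>x. patch_bump (c, a, \<rho>) x * (if x \<in> cdom M c then h (cmap M c x) else 0))
    = (\<lambda>x. if x \<in> cdom M c then (\<lambda>y. step_down (2 / \<rho>\<^sup>2 * (norm (y - a))\<^sup>2 - 1) * h y) (cmap M c x) else 0)"
    by (auto simp: patch_bump_def)
  ultimately show ?thesis by simp
qed

lemma patch_bump_C1M: "patch_ok p \<Longrightarrow> C1M (patch_bump p)"
proof (cases p)
  case (fields c a \<rho>)
  assume "patch_ok p"
  then have "C1M (\<lambda>x. patch_bump p x * (if x \<in> cdom M c then 1 else 0))"
    unfolding fields by (rule patch_bump_mult_C1M) (rule Ck_on_const)
  moreover have "(\<lambda>x. patch_bump p x * (if x \<in> cdom M c then 1 else 0)) = patch_bump p"
    by (auto simp: fields patch_bump_def)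
  ultimately show ?thesis by simp
qed

text \<open>The coordinate gradient of the bump is at most 16 / \<rho>, and the metric dominates a multiple of
the Euclidean norm on the patch.\<close>
lemma patch_bump_grad:
  assumes p: "patch_ok (c, a, \<rho>)"
  shows "\<exists>B\<ge>0. \<forall>x. has_grad_le (patch_bump (c, a, \<rho>)) x B"
proof -
  note pf = patch_facts[OF p]
  obtain l0 where l0: "l0 > 0" "\<And>y v. y \<in> cball a \<rho> \<Longrightarrow> l0 * (norm v)\<^sup>2 \<le> gform c (cinv M c y) v"
    using metric_eigenvalue[OF pf(1) compact_cball pf(4)] by blast
  define B where "B = 16 / \<rho> / sqrt l0"
  have B: "0 \<le> B" using pf(2) l0(1) by (simp add: B_def)
  have "has_grad_le (patch_bump (c, a, \<rho>)) x B" for x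
  proof (cases "x \<in> cinv M c ` cball a \<rho>")
    case False
    show ?thesis
    proof (rule has_grad_le_cong[OF has_grad_le_mono[OF has_grad_le_const[of 0 x] B]])
      show "open (- cinv M c ` cball a \<rho>)" using pf(5) by auto
    qed (use False pf(7) in auto)
  next
    case True
    then obtain y where y: "y \<in> cball a \<rho>" "x = cinv M c y" by blast
    have x: "x \<in> cdom M c" "cmap M c x = y" using y pf by auto
    let ?P = "\<lambda>y. 2 / \<rho>\<^sup>2 * (norm (y - a))\<^sup>2 - 1"
    have "((\<lambda>y. k * (norm (y - a))\<^sup>2 - 1) has_derivative (\<lambda>v. k * (2 * (v \<bullet> (y - a))))) (at y)" for k
      unfolding power2_norm_eq_inner by (auto intro!: derivative_eq_intros simp: inner_commute algebra_simps)
    then have P: "(?P has_derivative (\<lambda>v. 2 / \<rho>\<^sup>2 * (2 * (v \<bullet> (y - a))))) (at y)" .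
    have "(step_down has_real_derivative step_down' (?P y)) (at (?P y))" using C1_step_down by (simp add: C1_real_def)
    from DERIV_compose_FDERIV[OF this P]
    have D: "((\<lambda>y. step_down (?P y)) has_derivative (\<lambda>v. 2 / \<rho>\<^sup>2 * (2 * (v \<bullet> (y - a))) * step_down' (?P y))) (at y)" .
    then have "((\<lambda>y. patch_bump (c, a, \<rho>) (cinv M c y)) has_derivative (\<lambda>v. 2 / \<rho>\<^sup>2 * (2 * (v \<bullet> (y - a))) * step_down' (?P y))) (at (cmap M c x))"
      unfolding x(2)
    proof (rule has_derivative_transform_within_open)
      show "open (cmap M c ` cdom M c)" by (rule open_cmap_image[OF pf(1)])
      show "y \<in> cmap M c ` cdom M c" using y pf by auto
    qed (use pf(1) in \<open>auto simp: patch_bump_def\<close>)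
    then show ?thesis
    proof (rule has_grad_leI[OF pf(1) x(1)])
      fix v
      have "\<bar>2 / \<rho>\<^sup>2 * (2 * (v \<bullet> (y - a))) * step_down' (?P y)\<bar> = 2 / \<rho>\<^sup>2 * (2 * \<bar>v \<bullet> (y - a)\<bar>) * \<bar>step_down' (?P y)\<bar>"
        by (simp add: abs_mult)
      also have "\<dots> \<le> 2 / \<rho>\<^sup>2 * (2 * (norm v * \<rho>)) * 4"
      proof (intro mult_mono step_down'_bound mult_left_mono)
        have "\<bar>v \<bullet> (y - a)\<bar> \<le> norm v * norm (y - a)" by (rule Cauchy_Schwarz_ineq2)
        also have "\<dots> \<le> norm v * \<rho>" using y by (intro mult_left_mono) (auto simp: dist_norm norm_minus_commute)
        finally show "\<bar>v \<bullet> (y - a)\<bar> \<le> norm v * \<rho>" .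
      qed (use pf(2) in auto)
      also have "\<dots> = 16 / \<rho> * norm v" using pf(2) by (simp add: power2_eq_square field_simps)
      also have "\<dots> \<le> 16 / \<rho> * (sqrt (gform c x v) / sqrt l0)"
      proof (intro mult_left_mono)
        have "sqrt l0 * norm v = sqrt (l0 * (norm v)\<^sup>2)" by (simp add: real_sqrt_mult)
        also have "\<dots> \<le> sqrt (gform c x v)" using l0(2)[OF y(1)] y(2) by simp
        finally show "norm v \<le> sqrt (gform c x v) / sqrt l0" using l0(1) by (simp add: field_simps)
      qed (use pf(2) in auto)
      also have "\<dots> = B * sqrt (gform c x v)" by (simp add: B_def)
      finally show "\<bar>2 / \<rho>\<^sup>2 * (2 * (v \<bullet> (y - a))) * step_down' (?P y)\<bar> \<le> B * sqrt (gform c x v)" .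
    qed
  qed
  then show ?thesis using B by blast
qed

text \<open>Induction on the number of patches. The constant T serves as the start, where no patch
imposes a condition. A new patch replaces the function f0 built so far by a convex combination with a local
smoothing f1; where both approximate r to accuracy e, the bump adds at most \<bar>f1 - f0\<bar> B \<le> 2 e B to
the gradient. Hence e is chosen with e (1 + 2 B) = \<eta>. The lower bound by min T r holds even where no patch reaches
and will make cutoffs vanish far away.\<close>
lemma smoothing:
  fixes r :: "'a \<Rightarrow> real"
  assumes r: "\<And>x y. \<bar>r x - r y\<bar> \<le> dist x y" and ps: "\<And>p. p \<in> set ps \<Longrightarrow> patch_ok p" and \<eta>: "0 < \<eta>"
  shows "\<exists>f. C1M f \<and> (\<forall>x. min T (r x) - \<eta> \<le> f x) \<and>
     (\<forall>x. (\<exists>p\<in>set ps. x \<in> patch_core p) \<longrightarrow> \<bar>f x - r x\<bar> \<le> \<eta> \<and> has_grad_le f x (1 + \<eta>))"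
  using ps \<eta>
proof (induction ps arbitrary: \<eta>)
  case Nil
  then show ?case by (intro exI[of _ "\<lambda>_. T"] conjI C1M_const) auto
next
  case (Cons p ps)
  obtain c a \<rho> where p: "p = (c, a, \<rho>)" by (cases p) auto
  have ok: "patch_ok (c, a, \<rho>)" using Cons.prems(1)[of p] p by simp
  note pf = patch_facts[OF ok]
  obtain B where B: "B \<ge> 0" "\<And>x. has_grad_le (patch_bump (c, a, \<rho>)) x B" using patch_bump_grad[OF ok] by blast
  define e where "e = \<eta> / (1 + 2 * B)"
  have e: "0 < e" "e * (1 + 2 * B) = \<eta>" using Cons.prems(2) B(1) by (auto simp: e_def)
  have e\<eta>: "e \<le> \<eta>" using e B(1) mult_left_mono[of 1 "1 + 2 * B" e] by simp
  have "\<exists>f. C1M f \<and> (\<forall>x. min T (r x) - e \<le> f x) \<and>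
     (\<forall>x. (\<exists>p\<in>set ps. x \<in> patch_core p) \<longrightarrow> \<bar>f x - r x\<bar> \<le> e \<and> has_grad_le f x (1 + e))"
    by (rule Cons.IH[OF _ e(1)]) (use Cons.prems(1) in simp)
  then obtain f0 where f0: "C1M f0" "\<And>x. min T (r x) - e \<le> f0 x"
    and f0': "\<forall>x. (\<exists>p\<in>set ps. x \<in> patch_core p) \<longrightarrow> \<bar>f0 x - r x\<bar> \<le> e \<and> has_grad_le f0 x (1 + e)"
    by (elim exE conjE) (rule that, assumption, erule spec, assumption)
  obtain h where h: "Ck_on 1 UNIV h" "\<And>y. y \<in> cball a \<rho> \<Longrightarrow> \<bar>h y - r (cinv M c y)\<bar> \<le> e"
    "\<And>y. y \<in> cball a \<rho> \<Longrightarrow> \<exists>D. (h has_derivative D) (at y) \<and> (\<forall>v. \<bar>D v\<bar> \<le> (1 + e) * sqrt (gform c (cinv M c y) v))"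
    using local_smoothing[OF pf(1,3,2) e(1) r] by blast
  define ch where "ch = patch_bump (c, a, \<rho>)"
  define f1 where "f1 x = (if x \<in> cdom M c then h (cmap M c x) else 0)" for x
  define f where "f x = ch x * f1 x + (1 - ch x) * f0 x" for x
  let ?K = "cinv M c ` cball a \<rho>"
  have f1: "\<bar>f1 x - r x\<bar> \<le> e" "has_grad_le f1 x (1 + e)" if x: "x \<in> ?K" for x
  proof -
    obtain y where y: "y \<in> cball a \<rho>" "x = cinv M c y" using x by blast
    have xd: "x \<in> cdom M c" "cmap M c x = y" using y pf by auto
    show "\<bar>f1 x - r x\<bar> \<le> e" using h(2)[OF y(1)] xd y(2) by (simp add: f1_def)
    obtain D where D: "(h has_derivative D) (at y)" "\<And>v. \<bar>D v\<bar> \<le> (1 + e) * sqrt (gform c (cinv M c y) v)"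
      using h(3)[OF y(1)] by blast
    have "((\<lambda>y. f1 (cinv M c y)) has_derivative D) (at (cmap M c x))"
      unfolding xd(2)
    proof (rule has_derivative_transform_within_open[OF D(1)])
      show "open (cmap M c ` cdom M c)" by (rule open_cmap_image[OF pf(1)])
      show "y \<in> cmap M c ` cdom M c" using y pf by auto
    qed (use pf(1) in \<open>auto simp: f1_def\<close>)
    then show "has_grad_le f1 x (1 + e)" using D(2) y(2) by (intro has_grad_leI[OF pf(1) xd(1)]) auto
  qed
  have ch: "0 \<le> ch x" "ch x \<le> 1" for x unfolding ch_def by (rule patch_bump_range)+
  have C1: "C1M f"
  proof -
    have "C1M (\<lambda>x. ch x * f1 x)" unfolding ch_def f1_def by (rule patch_bump_mult_C1M[OF ok h(1)])
    moreover have "C1M (\<lambda>x. (1 + (- 1) * ch x) * f0 x)"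
      unfolding ch_def by (intro C1M_mult C1M_add C1M_const patch_bump_C1M ok f0(1))
    ultimately have "C1M (\<lambda>x. ch x * f1 x + (1 + (- 1) * ch x) * f0 x)" by (rule C1M_add)
    then show ?thesis by (simp add: f_def[abs_def])
  qed
  have low: "min T (r x) - \<eta> \<le> f x" for x
  proof -
    have "min T (r x) - e \<le> f x"
    proof (cases "x \<in> ?K")
      case True
      then have "min T (r x) - e \<le> f1 x" using f1(1)[OF True] by linarith
      then have "ch x * (min T (r x) - e) + (1 - ch x) * (min T (r x) - e) \<le> f x"
        unfolding f_def using ch[of x] f0(2)[of x] by (intro add_mono mult_left_mono) auto
      then show ?thesis by (simp add: algebra_simps)
    next
      case False
      then have "f x = f0 x" using pf(7) by (simp add: f_def ch_def)
      then show ?thesis using f0(2)[of x] by simp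
    qed
    then show ?thesis using e\<eta> by linarith
  qed
  have good: "\<bar>f x - r x\<bar> \<le> \<eta> \<and> has_grad_le f x (1 + \<eta>)" if q: "q \<in> set (p # ps)" "x \<in> patch_core q" for x q
  proof (cases "x \<in> patch_core p")
    case True
    have eq: "f z = f1 z" if "z \<in> patch_core (c, a, \<rho>)" for z using pf(8)[OF that] by (simp add: f_def ch_def)
    have xK: "x \<in> ?K" using True pf(9) p by auto
    have "has_grad_le f x (1 + e)"
      by (rule has_grad_le_cong[OF f1(2)[OF xK] pf(6)]) (use True p eq in auto)
    then show ?thesis using has_grad_le_mono[of f x "1 + e" "1 + \<eta>"] e\<eta> f1(1)[OF xK] eq[of x] True p by auto
  next
    case False
    then have q': "q \<in> set ps" using q by auto
    have f0x: "\<bar>f0 x - r x\<bar> \<le> e \<and> has_grad_le f0 x (1 + e)" using f0' q' q(2) by blast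
    show ?thesis
    proof (cases "x \<in> ?K")
      case True
      have "f x - r x = ch x * (f1 x - r x) + (1 - ch x) * (f0 x - r x)" by (simp add: f_def algebra_simps)
      also have "\<bar>\<dots>\<bar> \<le> \<bar>ch x * (f1 x - r x)\<bar> + \<bar>(1 - ch x) * (f0 x - r x)\<bar>" by (rule abs_triangle_ineq)
      also have "\<dots> \<le> ch x * e + (1 - ch x) * e"
        unfolding abs_mult using ch[of x] f0x f1(1)[OF True] by (intro add_mono mult_mono) auto
      also have "\<dots> \<le> \<eta>" using e\<eta> by (simp add: algebra_simps)
      finally have 1: "\<bar>f x - r x\<bar> \<le> \<eta>" .
      have "has_grad_le f x ((1 + e) + \<bar>f1 x - f0 x\<bar> * B)"
        unfolding f_def[abs_def] by (rule has_grad_le_mix) (use B(2) f1(2)[OF True] f0x ch in \<open>auto simp: ch_def\<close>)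
      moreover have "(1 + e) + \<bar>f1 x - f0 x\<bar> * B \<le> 1 + \<eta>"
      proof -
        have "\<bar>f1 x - f0 x\<bar> \<le> 2 * e" using f1(1)[OF True] f0x by linarith
        then have "\<bar>f1 x - f0 x\<bar> * B \<le> 2 * e * B" using B(1) by (intro mult_right_mono) auto
        also have "\<dots> = \<eta> - e" using e(2) by (simp add: algebra_simps)
        finally show ?thesis by simp
      qed
      ultimately show ?thesis using 1 has_grad_le_mono by blast
    next
      case False
      have eq: "f z = f0 z" if "z \<notin> ?K" for z using pf(7)[OF that] by (simp add: f_def ch_def)
      have "has_grad_le f x (1 + e)"
        by (rule has_grad_le_cong[of f0 x _ "- ?K"]) (use f0x pf(5) False eq in auto)
      then show ?thesis using has_grad_le_mono[of f x "1 + e" "1 + \<eta>"] e\<eta> f0x eq[OF False] by auto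
    qed
  qed
  show ?case using C1 low good by blast
qed
end

section \<open>Logarithmic cutoff functions\<close>

text \<open>The transition from 1 to 0 as y passes from A to B, at constant speed in ln y up to the shape of
\<open>step_down\<close>.\<close>
definition log_step :: "real \<Rightarrow> real \<Rightarrow> real \<Rightarrow> real" where
  "log_step A B y = (if y > 0 then step_down ((ln y - ln A) / (ln B - ln A)) else 1)"

definition log_step' :: "real \<Rightarrow> real \<Rightarrow> real \<Rightarrow> real" where
  "log_step' A B y = (if y > 0 then step_down' ((ln y - ln A) / (ln B - ln A)) / (y * (ln B - ln A)) else 0)"

lemma log_step_facts:
  assumes A: "0 < A" "A < B"
  shows "C1_real (log_step A B) (log_step' A B)" "0 \<le> log_step A B y" "log_step A B y \<le> 1"
    "y \<le> A \<Longrightarrow> log_step A B y = 1" "B \<le> y \<Longrightarrow> log_step A B y = 0"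
    "log_step' A B y \<noteq> 0 \<Longrightarrow> A < y \<and> y < B"
    "0 < y \<Longrightarrow> \<bar>log_step' A B y\<bar> \<le> 4 / (y * (ln B - ln A))"
proof -
  define l where "l = ln B - ln A"
  have l: "0 < l" using A by (simp add: l_def)
  show "0 \<le> log_step A B y" "log_step A B y \<le> 1" using step_down_bounds by (auto simp: log_step_def)
  have le: "(ln y - ln A) / l \<le> 0" if "0 < y" "y \<le> A" for y
    using that l A by (simp add: divide_le_0_iff)
  have ge: "1 \<le> (ln y - ln A) / l" if "B \<le> y" for y
    using that l A by (simp add: le_divide_eq l_def)
  show left: "log_step A B y = 1" if "y \<le> A" for y
    using le[of y] that by (simp add: log_step_def l_def[symmetric] step_down_left)
  have left': "log_step' A B y = 0" if "y \<le> A" for y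
    using le[of y] that by (simp add: log_step'_def l_def[symmetric] step_down_left)
  show "B \<le> y \<Longrightarrow> log_step A B y = 0" using ge[of y] A by (simp add: log_step_def l_def[symmetric] step_down_right)
  have right': "B \<le> y \<Longrightarrow> log_step' A B y = 0" using ge[of y] A by (simp add: log_step'_def l_def[symmetric] step_down_right)
  show "log_step' A B y \<noteq> 0 \<Longrightarrow> A < y \<and> y < B" using left'[of y] right' by (meson not_le)
  show "\<bar>log_step' A B y\<bar> \<le> 4 / (y * (ln B - ln A))" if "0 < y"
    using that l step_down'_bound by (simp add: log_step'_def l_def[symmetric] abs_mult divide_right_mono)
  show "C1_real (log_step A B) (log_step' A B)" unfolding C1_real_def
  proof (intro conjI allI)
    fix y
    show "(log_step A B has_real_derivative log_step' A B y) (at y)"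
    proof (cases "y > 0")
      case True
      have "((\<lambda>y. (ln y - ln A) / l) has_real_derivative (1 / y) / l) (at y)"
        using True l by (auto intro!: derivative_eq_intros)
      moreover have "(step_down has_real_derivative step_down' ((ln y - ln A) / l)) (at ((ln y - ln A) / l))"
        using C1_step_down by (simp add: C1_real_def)
      ultimately have "((\<lambda>y. step_down ((ln y - ln A) / l)) has_real_derivative step_down' ((ln y - ln A) / l) * ((1 / y) / l)) (at y)"
        by (rule DERIV_chain2[rotated])
      then have "((\<lambda>y. step_down ((ln y - ln A) / l)) has_real_derivative log_step' A B y) (at y)"
        using True by (simp add: log_step'_def l_def[symmetric])
      then show ?thesis
        by (rule has_field_derivative_transform_within_open[where S="{0<..}"]) (use True in \<open>auto simp: log_step_def l_def\<close>)
    next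
      case False
      have "((\<lambda>y. 1) has_real_derivative 0) (at y)" by simp
      then have "(log_step A B has_real_derivative 0) (at y)"
        by (rule has_field_derivative_transform_within_open[where S="{..<A}"]) (use False A left in auto)
      then show ?thesis using False by (simp add: log_step'_def)
    qed
  next
    have c: "continuous_on UNIV step_down'" using C1_step_down by (simp add: C1_real_def)
    have "continuous_on {0<..} (\<lambda>y. step_down' ((ln y - ln A) / l) / (y * l))"
      using l by (intro continuous_intros continuous_on_compose2[OF c]) auto
    then have 1: "continuous_on {0<..} (log_step' A B)"
      by (rule continuous_on_eq) (simp add: log_step'_def l_def)
    have 2: "continuous_on {..<A} (log_step' A B)"
      by (rule continuous_on_eq[OF continuous_on_const[of _ 0]]) (simp add: left')
    have "{0<..} \<union> {..<A} = UNIV" using A by auto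
    then show "continuous_on UNIV (log_step' A B)"
      using continuous_on_open_Un[OF _ _ 1 2] by simp
  qed
qed

text \<open>The smoothed distance is off by at most 1. The profile therefore runs from 2^N + 1 to 2^(2N) - 1,
and its logarithmic length is still of order N.\<close>
lemma dyadic_log_gap:
  assumes "4 \<le> N"
  shows "2 ^ N + 1 < (2::real) ^ (2 * N) - 1" "real N / 4 \<le> ln (2 ^ (2 * N) - 1) - ln (2 ^ N + 1)"
proof -
  define a where "a = (2::real) ^ (N - 2)"
  have a: "4 \<le> a" unfolding a_def using power_increasing[of 2 "N - 2" "2::real"] assms by simp
  have N: "(2::real) ^ N = 4 * a"
  proof -
    have "(2::real) ^ N = 2 ^ (2 + (N - 2))" using assms by (simp only: le_add_diff_inverse)
    also have "\<dots> = 4 * a" unfolding power_add a_def by simp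
    finally show ?thesis .
  qed
  have NN: "(2::real) ^ (2 * N) = 16 * a\<^sup>2" by (simp add: power_mult mult.commute[of 2 N] N power_mult_distrib)
  have aa: "4 * a \<le> a\<^sup>2" unfolding power2_eq_square using a by (intro mult_right_mono) auto
  have ge: "a * (2 ^ N + 1) \<le> (2::real) ^ (2 * N) - 1"
  proof -
    have "a * (2 ^ N + 1) = 4 * a\<^sup>2 + a" unfolding N by (simp add: power2_eq_square algebra_simps)
    also have "\<dots> \<le> 16 * a\<^sup>2 - 1" using aa a by linarith
    finally show ?thesis using NN by simp
  qed
  show lt: "2 ^ N + 1 < (2::real) ^ (2 * N) - 1" unfolding N NN using aa a by linarith
  have pos: "0 < (2::real) ^ N + 1" by (simp add: add_pos_pos)
  have "0 < a * (2 ^ N + 1)" using pos a by (intro mult_pos_pos) auto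
  then have "ln (a * (2 ^ N + 1)) \<le> ln (2 ^ (2 * N) - 1)" using ge by (intro ln_le_cancel_iff[THEN iffD2]) auto
  moreover have "ln (a * (2 ^ N + 1)) = ln a + ln (2 ^ N + 1)" using a pos by (intro ln_mult_pos) auto
  moreover have "ln a = (N - 2) * ln 2" unfolding a_def by (simp add: ln_realpow)
  moreover have "real N / 4 \<le> (N - 2) * ln 2"
  proof -
    have "real N / 4 \<le> real (N - 2) * (1 / 2)" using assms by (simp add: of_nat_diff)
    also have "\<dots> \<le> real (N - 2) * ln 2" using ln2_ge_two_thirds by (intro mult_left_mono) auto
    finally show ?thesis .
  qed
  ultimately show "real N / 4 \<le> ln (2 ^ (2 * N) - 1) - ln (2 ^ N + 1)" by linarith
qed

context riemannian_manifold
begin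

text \<open>The closed ball is compact, so the cores of finitely many patches cover it.\<close>
lemma smooth_distance:
  assumes complete: "complete (UNIV :: 'a set)"
  shows "\<exists>f. C1M f \<and> (\<forall>x. min T (dist x0 x) - 1 \<le> f x) \<and>
     (\<forall>x\<in>cball x0 T. \<bar>f x - dist x0 x\<bar> \<le> 1 \<and> has_grad_le f x 2)"
proof -
  have r: "\<bar>dist x0 x - dist x0 y\<bar> \<le> dist x y" for x y :: 'a
    using dist_triangle[of x0 x y] dist_triangle[of x0 y x] by (simp add: dist_commute abs_le_iff)
  have "\<exists>p. patch_ok p \<and> x \<in> patch_core p" for x
  proof -
    define c where "c = chart_at M x"
    have c: "c \<in> charts M" "x \<in> cdom M c" using chart_at by (auto simp: c_def)
    obtain e where e: "e > 0" "cball (cmap M c x) e \<subseteq> cmap M c ` cdom M c" using chart_ball[OF c] .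
    have "patch_ok (c, cmap M c x, e / 2)" using c e by (simp add: patch_ok_def)
    moreover have "x \<in> patch_core (c, cmap M c x, e / 2)" unfolding patch_core_def prod.case
      using c e by (intro image_eqI[of _ _ "cmap M c x"]) auto
    ultimately show ?thesis by blast
  qed
  then have "\<forall>x. \<exists>p. patch_ok p \<and> x \<in> patch_core p" by blast
  from choice[OF this] obtain P where P: "\<forall>x. patch_ok (P x) \<and> x \<in> patch_core (P x)" by (elim exE)
  have op: "open (patch_core (P x))" for x
  proof (cases "P x")
    case (fields c a \<rho>)
    then show ?thesis using patch_facts(6)[of c a \<rho>] P by metis
  qed
  have cover: "cball x0 T \<subseteq> (\<Union>x\<in>cball x0 T. patch_core (P x))" using P by blast
  obtain D where D: "D \<subseteq> cball x0 T" "finite D" "cball x0 T \<subseteq> (\<Union>x\<in>D. patch_core (P x))"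
    by (rule compactE_image[OF compact_cball_complete[OF complete] _ cover]) (use op in auto)
  obtain ds where ds: "set ds = D" using finite_list[OF D(2)] by blast
  have "\<exists>f. C1M f \<and> (\<forall>x. min T (dist x0 x) - 1 \<le> f x) \<and>
     (\<forall>x. (\<exists>p\<in>set (map P ds). x \<in> patch_core p) \<longrightarrow> \<bar>f x - dist x0 x\<bar> \<le> 1 \<and> has_grad_le f x (1 + 1))"
    by (rule smoothing[OF r]) (use P in auto)
  then obtain f where f: "C1M f" "\<forall>x. min T (dist x0 x) - 1 \<le> f x"
    "\<forall>x. (\<exists>p\<in>set (map P ds). x \<in> patch_core p) \<longrightarrow> \<bar>f x - dist x0 x\<bar> \<le> 1 \<and> has_grad_le f x (1 + 1)"
    by (elim exE conjE)
  have "\<exists>p\<in>set (map P ds). x \<in> patch_core p" if "x \<in> cball x0 T" for x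
    using D(3) that ds by auto
  then have "\<forall>x\<in>cball x0 T. \<bar>f x - dist x0 x\<bar> \<le> 1 \<and> has_grad_le f x 2" using f(3) by simp
  then show ?thesis using f(1,2) by blast
qed

text \<open>The profile has slope at most 4 / (g ln(B/A)) at g, where ln(B/A) \<ge> N/4, and g is comparable to the distance.
Where the slope does not vanish, x lies in a dyadic annulus with outer radius 2^j, so that g \<ge> 2^j / 4; together with the
gradient bound 2 for g this gives the constant 128.\<close>
lemma log_cutoff_exists:
  assumes complete: "complete (UNIV :: 'a set)" and N: "4 \<le> N"
  shows "\<exists>f. C1M f \<and> (\<forall>x. 0 \<le> f x \<and> f x \<le> 1 \<and> (x \<in> ball x0 (2 ^ N) \<longrightarrow> f x = 1) \<and> (x \<notin> cball x0 (2 ^ (2 * N)) \<longrightarrow> f x = 0)) \<and>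
     (\<forall>x. \<exists>L\<ge>0. has_grad_le f x L \<and> (L = 0 \<or>
        (\<exists>j\<in>{N+1..2*N}. x \<in> ball x0 (2 ^ j) - ball x0 (2 ^ j / 2) \<and> L \<le> 128 / (real N * 2 ^ j))))"
proof -
  define T :: real where "T = 2 ^ (2 * N)"
  define A :: real where "A = 2 ^ N + 1"
  define B :: real where "B = T - 1"
  have AB: "0 < A" "A < B" "real N / 4 \<le> ln B - ln A"
    using dyadic_log_gap[OF N] by (auto simp: A_def B_def T_def add_pos_pos)
  note ls = log_step_facts[OF AB(1,2)]
  obtain g where g: "C1M g" "\<forall>x. min T (dist x0 x) - 1 \<le> g x"
    "\<forall>x\<in>cball x0 T. \<bar>g x - dist x0 x\<bar> \<le> 1 \<and> has_grad_le g x 2"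
    using smooth_distance[OF complete, of T x0] by blast
  define f where "f x = log_step A B (g x)" for x
  have C1: "C1M f" unfolding f_def[abs_def] by (rule C1M_compose[OF ls(1) g(1)])
  have AT: "A \<le> T" using AB by (simp add: B_def)
  have out: "f x = 0" if "x \<notin> cball x0 T" for x
  proof -
    have "min T (dist x0 x) = T" using that by auto
    then have "B \<le> g x" using spec[OF g(2), of x] by (simp add: B_def)
    then show ?thesis using ls(5) by (simp add: f_def)
  qed
  have one: "f x = 1" if "x \<in> ball x0 (2 ^ N)" for x
  proof -
    have "x \<in> cball x0 T" using that AT by (auto simp: A_def)
    then have "\<bar>g x - dist x0 x\<bar> \<le> 1" using g(3) by blast
    then have "g x \<le> A" using that by (auto simp: A_def)
    then show ?thesis using ls(4) by (simp add: f_def)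
  qed
  have grad: "\<exists>L\<ge>0. has_grad_le f x L \<and> (L = 0 \<or>
        (\<exists>j\<in>{N+1..2*N}. x \<in> ball x0 (2 ^ j) - ball x0 (2 ^ j / 2) \<and> L \<le> 128 / (real N * 2 ^ j)))" for x
  proof (cases "x \<in> cball x0 T")
    case False
    have "has_grad_le f x 0"
      by (rule has_grad_le_cong[OF has_grad_le_const[of 0], of "- cball x0 T"]) (use False out in auto)
    then show ?thesis by blast
  next
    case True
    then have gx: "\<bar>g x - dist x0 x\<bar> \<le> 1" "has_grad_le g x 2" using g(3) by auto
    define L where "L = \<bar>log_step' A B (g x)\<bar> * 2"
    have hL: "has_grad_le f x L" unfolding f_def[abs_def] L_def
      using ls(1) by (intro has_grad_le_compose gx) (simp add: C1_real_def)
    show ?thesis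
    proof (cases "log_step' A B (g x) = 0")
      case True
      then show ?thesis using hL by (intro exI[of _ L]) (simp add: L_def)
    next
      case False
      then have gAB: "A < g x" "g x < B" using ls(6) by auto
      have d: "2 ^ N < dist x0 x" "dist x0 x < 2 ^ (2 * N)" using gAB gx(1) by (auto simp: A_def B_def T_def)
      \<comment> \<open>The dyadic annulus that contains x.\<close>
      define j where "j = (LEAST j. dist x0 x < 2 ^ j)"
      have j1: "dist x0 x < 2 ^ j" unfolding j_def by (rule LeastI[of "\<lambda>j. dist x0 x < 2 ^ j", OF d(2)])
      have j2: "j \<le> 2 * N" unfolding j_def by (rule Least_le[of "\<lambda>j. dist x0 x < 2 ^ j", OF d(2)])
      have j3: "N + 1 \<le> j"
      proof (rule ccontr)
        assume "\<not> N + 1 \<le> j"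
        then have "(2::real) ^ j \<le> 2 ^ N" by (intro power_increasing) auto
        then show False using j1 d(1) by linarith
      qed
      then obtain i where i: "j = Suc i" by (cases j) auto
      have j4: "2 ^ i \<le> dist x0 x"
      proof (rule ccontr)
        assume "\<not> 2 ^ i \<le> dist x0 x"
        then have "dist x0 x < 2 ^ i" by simp
        then have "j \<le> i" unfolding j_def by (rule Least_le)
        then show False using i by simp
      qed
      have i1: "2 \<le> (2::real) ^ i" using i j3 N power_increasing[of 1 i "2::real"] by simp
      have gpos: "2 ^ i / 2 \<le> g x" "0 < g x"
      proof -
        have "2 ^ i - 1 \<le> g x" using gx(1) j4 by linarith
        then show "2 ^ i / 2 \<le> g x" "0 < g x" using i1 by auto
      qed
      have "L \<le> 4 / (g x * (ln B - ln A)) * 2" unfolding L_def using ls(7)[OF gpos(2)] by (intro mult_right_mono) auto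
      also have "\<dots> \<le> 4 / ((2 ^ i / 2) * (real N / 4)) * 2"
        using gpos AB(3) N by (intro mult_right_mono divide_left_mono mult_mono mult_pos_pos) auto
      also have "\<dots> = 128 / (real N * 2 ^ j)" using N unfolding i by (simp add: field_simps)
      finally have "L \<le> 128 / (real N * 2 ^ j)" .
      moreover have "x \<in> ball x0 (2 ^ j) - ball x0 (2 ^ j / 2)" using j1 j4 i by simp
      moreover have "j \<in> {N+1..2*N}" using j2 j3 by simp
      moreover have "0 \<le> L" by (simp add: L_def)
      ultimately show ?thesis using hL by blast
    qed
  qed
  have rng: "0 \<le> f x" "f x \<le> 1" for x unfolding f_def by (rule ls)+
  show ?thesis
    by (intro exI[of _ f] conjI allI impI C1 rng one grad) (use out in \<open>auto simp: T_def\<close>)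
qed
end

section \<open>Gradients and inner products\<close>

lemma weak_derivative_cong:
  assumes \<Omega>: "open \<Omega>" and wd: "weak_derivative \<Omega> f h"
    and eq: "\<And>y. y \<in> \<Omega> \<Longrightarrow> f y = f' y" "\<And>y. y \<in> \<Omega> \<Longrightarrow> h y = h' y"
  shows "weak_derivative \<Omega> f' h'"
proof -
  have 1: "set_integrable lborel K f' = set_integrable lborel K f" "set_integrable lborel K h' = set_integrable lborel K h"
    if "K \<subseteq> \<Omega>" for K
    using that eq unfolding set_integrable_def
    by (auto intro!: Bochner_Integration.integrable_cong simp: indicator_def)
  have 2: "(LINT y:\<Omega>|lborel. f' y * k y) = (LINT y:\<Omega>|lborel. f y * k y)"
    "(LINT y:\<Omega>|lborel. (h' y $ i) * k y) = (LINT y:\<Omega>|lborel. (h y $ i) * k y)" for k i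
    using eq unfolding set_lebesgue_integral_def
    by (auto intro!: Bochner_Integration.integral_cong simp: indicator_def)
  show ?thesis using wd unfolding weak_derivative_def using 1 2 by simp
qed

lemma matrix_inv_right: "invertible A \<Longrightarrow> A ** matrix_inv A = mat 1"
  and matrix_inv_left: "invertible A \<Longrightarrow> matrix_inv A ** A = mat 1"
  for A :: "real^'n^'n"
  unfolding invertible_def matrix_inv_def by (metis (mono_tags, lifting) someI_ex)+

context riemannian_manifold
begin

subsection \<open>Gradients of C1 functions\<close>

definition dvec :: "('a \<Rightarrow> real) \<Rightarrow> 'i \<Rightarrow> 'a \<Rightarrow> real^'n" where
  "dvec f c x = (\<chi> i. frechet_derivative (\<lambda>y. f (cinv M c y)) (at (cmap M c x)) (axis i 1))"

definition gradf :: "('a \<Rightarrow> real) \<Rightarrow> 'i \<Rightarrow> 'a \<Rightarrow> real^'n" where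
  "gradf f c x = matrix_inv (metric M c x) *v dvec f c x"

lemma metric_invertible:
  assumes "c \<in> charts M" "x \<in> cdom M c"
  shows "invertible (metric M c x)"
proof -
  have "inj ((*v) (metric M c x))"
    unfolding linear_injective_0[OF matrix_vector_mul_linear]
  proof (intro allI impI)
    fix v assume "metric M c x *v v = 0"
    then show "v = 0" using metric_positive[OF assms, of v] by fastforce
  qed
  then show ?thesis by (simp add: invertible_left_inverse matrix_left_invertible_injective)
qed

lemma metric_matrix_inv:
  assumes "c \<in> charts M" "x \<in> cdom M c"
  shows "metric M c x *v (matrix_inv (metric M c x) *v w) = w"
  using matrix_inv_right[OF metric_invertible[OF assms]] by (simp add: matrix_vector_mul_assoc)

lemma matrix_inv_metric:
  assumes "c \<in> charts M" "x \<in> cdom M c"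
  shows "matrix_inv (metric M c x) *v (metric M c x *v w) = w"
  using matrix_inv_left[OF metric_invertible[OF assms]] by (simp add: matrix_vector_mul_assoc)

lemma C1M_has_derivative:
  assumes f: "C1M f" and c: "c \<in> charts M" "x \<in> cdom M c"
  shows "((\<lambda>y. f (cinv M c y)) has_derivative (\<lambda>v. dvec f c x \<bullet> v)) (at (cmap M c x))"
proof -
  let ?D = "frechet_derivative (\<lambda>y. f (cinv M c y)) (at (cmap M c x))"
  have "(\<lambda>y. f (cinv M c y)) differentiable (at (cmap M c x))" using f c unfolding C1M_def by simp
  then have D: "((\<lambda>y. f (cinv M c y)) has_derivative ?D) (at (cmap M c x))" by (simp add: frechet_derivative_works)
  have lin: "linear ?D" by (rule has_derivative_linear[OF D])
  have "?D v = dvec f c x \<bullet> v" for v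
  proof -
    have "?D v = ?D (\<Sum>i\<in>UNIV. (v $ i) *\<^sub>R axis i 1)"
      by (simp add: basis_expansion[of v, unfolded scalar_mult_eq_scaleR])
    also have "\<dots> = (\<Sum>i\<in>UNIV. v $ i * ?D (axis i 1))" by (simp add: linear_sum[OF lin] linear_scale[OF lin])
    also have "\<dots> = dvec f c x \<bullet> v" by (simp add: dvec_def inner_vec_def mult.commute)
    finally show ?thesis .
  qed
  then have "?D = (\<lambda>v. dvec f c x \<bullet> v)" by auto
  then show ?thesis using D by simp
qed

lemma dvec_transition:
  assumes f: "C1M f" and c: "c \<in> charts M" "x \<in> cdom M c" and d: "d \<in> charts M" "x \<in> cdom M d"
  shows "dvec f c x \<bullet> v = dvec f d x \<bullet> (jacobian M c d x *v v)"
proof -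
  have "((\<lambda>y. f (cinv M c y)) has_derivative (\<lambda>v. dvec f d x \<bullet> (jacobian M c d x *v v))) (at (cmap M c x))"
    by (rule derivative_other_chart[OF d c C1M_has_derivative[OF f d]])
  from has_derivative_unique[OF C1M_has_derivative[OF f c] this] show ?thesis by meson
qed

lemma jacobian_surj:
  assumes c: "c \<in> charts M" "x \<in> cdom M c" and d: "d \<in> charts M" "x \<in> cdom M d"
  shows "\<exists>v. w = jacobian M c d x *v v"
proof -
  have "inj ((*v) (jacobian M c d x))"
    unfolding linear_injective_0[OF matrix_vector_mul_linear]
  proof (intro allI impI)
    fix v assume "jacobian M c d x *v v = 0"
    then have "gform c x v = 0" using gform_pullback[OF c(1) d(1) c(2) d(2)] by (simp add: gform_def)
    then show "v = 0" using metric_positive[OF c, of v] by (auto simp: gform_def)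
  qed
  then have "surj ((*v) (jacobian M c d x))" by (intro linear_injective_imp_surjective) auto
  then show ?thesis by (metis surjD)
qed

text \<open>Both candidates have the same inner products with all vectors of the form J v, which is every vector since
Jacobian matrices are invertible.\<close>
lemma gradf_vector_field:
  assumes f: "C1M f"
  shows "vector_field M (gradf f)"
  unfolding vector_field_def
proof (intro ballI)
  fix c d x assume c: "c \<in> charts M" and d: "d \<in> charts M" and x: "x \<in> cdom M c \<inter> cdom M d"
  then have xc: "x \<in> cdom M c" and xd: "x \<in> cdom M d" by auto
  let ?J = "jacobian M c d x"
  have "w \<bullet> (metric M d x *v (?J *v gradf f c x)) = w \<bullet> dvec f d x" for w
  proof -
    obtain v where w: "w = ?J *v v" using jacobian_surj[OF c xc d xd] by blast
    have "w \<bullet> (metric M d x *v (?J *v gradf f c x)) = v \<bullet> (metric M c x *v gradf f c x)"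
      unfolding w using metric_pullback[OF c d xc xd] by simp
    also have "\<dots> = v \<bullet> dvec f c x" unfolding gradf_def using metric_matrix_inv[OF c xc] by simp
    also have "\<dots> = w \<bullet> dvec f d x" using dvec_transition[OF f c xc d xd, of v] unfolding w by (simp add: inner_commute)
    finally show ?thesis .
  qed
  then have "metric M d x *v (?J *v gradf f c x) = dvec f d x" using vector_eq_ldot by blast
  then have "matrix_inv (metric M d x) *v (metric M d x *v (?J *v gradf f c x)) = gradf f d x" by (simp add: gradf_def)
  then show "gradf f d x = ?J *v gradf f c x" unfolding matrix_inv_metric[OF d xd] by simp
qed

subsection \<open>Pointwise inner products\<close>

lemma ginner_chart:
  assumes X: "vector_field M X" and Y: "vector_field M Y" and c: "c \<in> charts M" "x \<in> cdom M c"
  shows "ginner M X Y x = X c x \<bullet> (metric M c x *v Y c x)"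
proof -
  define d where "d = chart_at M x"
  have d: "d \<in> charts M" "x \<in> cdom M d" using chart_at by (auto simp: d_def)
  have "X d x = jacobian M c d x *v X c x" "Y d x = jacobian M c d x *v Y c x"
    using X Y c d unfolding vector_field_def by blast+
  then show ?thesis using metric_pullback[OF c(1) d(1) c(2) d(2), of "X c x" "Y c x"]
    by (simp add: ginner_def Let_def d_def[symmetric])
qed

lemma ginner_self_nonneg: "0 \<le> ginner M X X x"
  using gform_nonneg[OF chart_at, of x] by (simp add: ginner_def Let_def gform_def)

lemma gnorm_nonneg: "0 \<le> gnorm M X x"
  by (simp add: gnorm_def ginner_self_nonneg)

lemma gnorm_square: "(gnorm M X x)\<^sup>2 = ginner M X X x"
  by (simp add: gnorm_def ginner_self_nonneg)

lemma metric_sym: "c \<in> charts M \<Longrightarrow> x \<in> cdom M c \<Longrightarrow> v \<bullet> (metric M c x *v w) = w \<bullet> (metric M c x *v v)"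
  using metric_symmetric[of c x] by (metis dot_lmul_matrix inner_commute transpose_matrix_vector)

lemma ginner_Cauchy_Schwarz: "\<bar>ginner M X Y x\<bar> \<le> gnorm M X x * gnorm M Y x"
proof -
  define c where "c = chart_at M x"
  have c: "c \<in> charts M" "x \<in> cdom M c" using chart_at by (auto simp: c_def)
  define A where "A = ginner M X X x"
  define B where "B = ginner M X Y x"
  define C where "C = ginner M Y Y x"
  have A0: "0 \<le> A" "0 \<le> C" by (auto simp: A_def C_def ginner_self_nonneg)
  have defs: "A = X c x \<bullet> (metric M c x *v X c x)" "B = X c x \<bullet> (metric M c x *v Y c x)" "C = Y c x \<bullet> (metric M c x *v Y c x)"
    by (simp_all add: A_def B_def C_def ginner_def Let_def c_def)
  have BB: "B\<^sup>2 \<le> A * C"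
  proof (cases "Y c x = 0")
    case True then show ?thesis by (simp add: defs)
  next
    case False
    then have C: "C > 0" using metric_positive[OF c] by (simp add: defs)
    let ?Z = "X c x - (B / C) *\<^sub>R Y c x"
    have "0 \<le> ?Z \<bullet> (metric M c x *v ?Z)" using gform_nonneg[OF c, of ?Z] by (simp add: gform_def)
    also have "\<dots> = A - 2 * (B / C) * B + (B / C)\<^sup>2 * C"
      unfolding defs using metric_sym[OF c, of "Y c x" "X c x"]
      by (simp add: matrix_vector_mult_diff_distrib matrix_vector_mult_scaleR inner_diff_left inner_diff_right power2_eq_square algebra_simps)
    also have "\<dots> = A - B\<^sup>2 / C" using C by (simp add: power2_eq_square field_simps)
    finally show ?thesis using C by (simp add: field_simps)
  qed
  have "\<bar>B\<bar> = sqrt (B\<^sup>2)" by simp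
  also have "\<dots> \<le> sqrt (A * C)" using BB by (rule real_sqrt_le_mono)
  finally show ?thesis by (simp add: A_def B_def C_def gnorm_def real_sqrt_mult)
qed

text \<open>Applying the differential to the gradient itself gives the square of its length.\<close>
lemma gnorm_gradf_le:
  assumes f: "C1M f" and L: "has_grad_le f x L" "0 \<le> L"
  shows "gnorm M (gradf f) x \<le> L"
proof -
  define c where "c = chart_at M x"
  have c: "c \<in> charts M" "x \<in> cdom M c" using chart_at by (auto simp: c_def)
  obtain D where D: "((\<lambda>y. f (cinv M c y)) has_derivative D) (at (cmap M c x))" "\<And>v. \<bar>D v\<bar> \<le> L * sqrt (gform c x v)"
    using has_grad_leD[OF L(1) c] by blast
  have Dd: "D = (\<lambda>v. dvec f c x \<bullet> v)" using has_derivative_unique[OF D(1) C1M_has_derivative[OF f c]] .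
  let ?X = "gradf f c x"
  define q where "q = gform c x ?X"
  have q0: "0 \<le> q" unfolding q_def by (rule gform_nonneg[OF c])
  have "q = ?X \<bullet> dvec f c x" unfolding q_def gform_def gradf_def using metric_matrix_inv[OF c] by simp
  also have "\<dots> = D ?X" unfolding Dd by (rule inner_commute)
  also have "\<dots> \<le> L * sqrt q" using D(2)[of ?X] by (simp add: q_def)
  finally have "sqrt q * sqrt q \<le> L * sqrt q" using q0 by simp
  then have "sqrt q \<le> L"
  proof (cases "q = 0")
    case False
    then have "0 < sqrt q" using q0 by simp
    with \<open>sqrt q * sqrt q \<le> L * sqrt q\<close> show ?thesis by (rule mult_right_le_imp_le)
  qed (use L(2) in simp)
  then show ?thesis by (simp add: gnorm_def ginner_def Let_def q_def gform_def c_def)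
qed

lemma gradf_compose:
  assumes f: "C1M f" and F: "C1_real F F'" and c: "c \<in> charts M" "x \<in> cdom M c"
  shows "gradf (\<lambda>x. F (f x)) c x = F' (f x) *\<^sub>R gradf f c x"
proof -
  have xx: "cinv M c (cmap M c x) = x" using c by simp
  have "((\<lambda>y. F (f (cinv M c y))) has_derivative (\<lambda>v. (dvec f c x \<bullet> v) * F' (f x))) (at (cmap M c x))"
    using DERIV_compose_FDERIV[of F "F' (f x)" "\<lambda>y. f (cinv M c y)" "cmap M c x" _ UNIV] F C1M_has_derivative[OF f c] xx
    by (auto simp: C1_real_def)
  from has_derivative_unique[OF this C1M_has_derivative[OF C1M_compose[OF F f] c]]
  have "dvec (\<lambda>x. F (f x)) c x \<bullet> v = (F' (f x) *\<^sub>R dvec f c x) \<bullet> v" for v by (simp add: mult.commute fun_eq_iff)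
  then have "dvec (\<lambda>x. F (f x)) c x = F' (f x) *\<^sub>R dvec f c x" using vector_eq_rdot by blast
  then show ?thesis by (simp add: gradf_def matrix_vector_mult_scaleR)
qed

lemma C1M_continuous:
  assumes f: "C1M f" shows "continuous_on UNIV f"
proof (rule continuous_at_imp_continuous_on, rule ballI)
  fix x
  define c where "c = chart_at M x"
  have c: "c \<in> charts M" "x \<in> cdom M c" using chart_at by (auto simp: c_def)
  have "continuous_on (cmap M c ` cdom M c) (\<lambda>y. f (cinv M c y))"
    using Ck_on_Suc_D[of 0 "cmap M c ` cdom M c" "\<lambda>y. f (cinv M c y)"] f c unfolding C1M_def by simp
  then have "continuous_on (cdom M c) (\<lambda>x. f (cinv M c (cmap M c x)))"
    by (rule continuous_on_compose2[OF _ continuous_cmap[OF c(1)]]) auto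
  then have "continuous_on (cdom M c) f" by (rule continuous_on_eq) (use c in auto)
  then show "isCont f x" using open_cdom[OF c(1)] c(2) by (simp add: continuous_on_eq_continuous_at)
qed

subsection \<open>The weak gradient of a product\<close>

text \<open>The right side of the rule \<nabla>(w F(u)) = F(u) \<nabla>w + w F'(u) \<nabla>u.\<close>
definition product_field :: "('a \<Rightarrow> real) \<Rightarrow> (real \<Rightarrow> real) \<Rightarrow> (real \<Rightarrow> real) \<Rightarrow> ('a \<Rightarrow> real) \<Rightarrow> ('i \<Rightarrow> 'a \<Rightarrow> real^'n) \<Rightarrow> 'i \<Rightarrow> 'a \<Rightarrow> real^'n" where
  "product_field w F F' u X c x = F (u x) *\<^sub>R gradf w c x + (w x * F' (u x)) *\<^sub>R X c x"

text \<open>In a chart this is \<open>weak_derivative_chain\<close>: the metric times the vector field is the vector of weak partial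
derivatives.\<close>
lemma weak_gradient_product:
  assumes u: "weak_gradient M u X" and w: "C1M w" and F: "C1_real F F'" and L: "\<And>y. \<bar>F' y\<bar> \<le> L"
  shows "weak_gradient M (\<lambda>x. w x * F (u x)) (product_field w F F' u X)"
  unfolding weak_gradient_def
proof (intro conjI ballI)
  have vX: "vector_field M X" using u by (simp add: weak_gradient_def)
  show "vector_field M (product_field w F F' u X)"
    unfolding vector_field_def
  proof (intro ballI)
    fix c d x assume *: "c \<in> charts M" "d \<in> charts M" "x \<in> cdom M c \<inter> cdom M d"
    have 1: "gradf w d x = jacobian M c d x *v gradf w c x" "X d x = jacobian M c d x *v X c x"
      using gradf_vector_field[OF w] vX * unfolding vector_field_def by blast+
    show "product_field w F F' u X d x = jacobian M c d x *v product_field w F F' u X c x"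
      unfolding product_field_def 1 by (simp only: matrix_vector_right_distrib matrix_vector_mult_scaleR)
  qed
  fix c assume c: "c \<in> charts M"
  let ?\<Omega> = "cmap M c ` cdom M c"
  have wd: "weak_derivative ?\<Omega> (u \<circ> cinv M c) ((\<lambda>x. metric M c x *v X c x) \<circ> cinv M c)" using u c by (simp add: weak_gradient_def)
  have wC: "Ck_on 1 ?\<Omega> (\<lambda>y. w (cinv M c y))" using w c by (simp add: C1M_def del: Ck_on.simps One_nat_def)
  have F12: "(F has_real_derivative F' y) (at y)" "continuous_on UNIV F'" for y using F by (auto simp: C1_real_def)
  have "weak_derivative ?\<Omega> (\<lambda>y. w (cinv M c y) * F ((u \<circ> cinv M c) y))
     (\<lambda>y. F ((u \<circ> cinv M c) y) *\<^sub>R (\<chi> i. frechet_derivative (\<lambda>y. w (cinv M c y)) (at y) (axis i 1))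
       + (w (cinv M c y) * F' ((u \<circ> cinv M c) y)) *\<^sub>R ((\<lambda>x. metric M c x *v X c x) \<circ> cinv M c) y)"
    by (rule weak_derivative_chain[OF open_cmap_image[OF c] wd wC F12 L])
  then show "weak_derivative ?\<Omega> ((\<lambda>x. w x * F (u x)) \<circ> cinv M c) ((\<lambda>x. metric M c x *v product_field w F F' u X c x) \<circ> cinv M c)"
  proof (rule weak_derivative_cong[OF open_cmap_image[OF c]])
    fix y assume y: "y \<in> ?\<Omega>"
    then have x: "cinv M c y \<in> cdom M c" "cmap M c (cinv M c y) = y" using c by auto
    have "metric M c (cinv M c y) *v gradf w c (cinv M c y) = (\<chi> i. frechet_derivative (\<lambda>y. w (cinv M c y)) (at y) (axis i 1))"
      unfolding gradf_def metric_matrix_inv[OF c x(1)] dvec_def x(2) ..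
    then show "F ((u \<circ> cinv M c) y) *\<^sub>R (\<chi> i. frechet_derivative (\<lambda>y. w (cinv M c y)) (at y) (axis i 1))
       + (w (cinv M c y) * F' ((u \<circ> cinv M c) y)) *\<^sub>R ((\<lambda>x. metric M c x *v X c x) \<circ> cinv M c) y
      = ((\<lambda>x. metric M c x *v product_field w F F' u X c x) \<circ> cinv M c) y"
      by (simp add: product_field_def matrix_vector_right_distrib matrix_vector_mult_scaleR)
  qed simp
qed

text \<open>The product rule with F = 1.\<close>
lemma weak_gradient_C1:
  assumes u: "weak_gradient M u X" and w: "C1M w"
  shows "weak_gradient M w (gradf w)"
proof -
  have "weak_gradient M (\<lambda>x. w x * (\<lambda>_. 1) (u x)) (product_field w (\<lambda>_. 1) (\<lambda>_. 0) u X)"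
    by (rule weak_gradient_product[OF u w, where L=0]) (auto simp: C1_real_def)
  moreover have "product_field w (\<lambda>_. 1) (\<lambda>_. 0) u X = gradf w" by (simp add: product_field_def fun_eq_iff)
  ultimately show ?thesis by simp
qed

subsection \<open>Measurability\<close>

text \<open>The partial derivatives are integrable on compact subsets of the chart image, and countably many of these exhaust it.\<close>
lemma weak_gradient_measurable:
  assumes u: "weak_gradient M u X" and c: "c \<in> charts M"
  shows "(\<lambda>x. metric M c x *v X c x) \<in> borel_measurable (restrict_space borel (cdom M c))"
proof -
  let ?\<Omega> = "cmap M c ` cdom M c"
  define h where "h = (\<lambda>x. metric M c x *v X c x) \<circ> cinv M c"
  have wd: "weak_derivative ?\<Omega> (u \<circ> cinv M c) h" using u c by (simp add: weak_gradient_def h_def)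
  obtain C where C: "\<And>n::nat. compact (C n)" "\<And>n. C n \<subseteq> ?\<Omega>" "\<And>n. C n \<subseteq> interior (C (Suc n))" "\<Union>(range C) = ?\<Omega>"
    using open_Union_compact_subsets[OF open_cmap_image[OF c]] by metis
  have inc: "C n \<subseteq> C m" if "n \<le> m" for n m
    using that by (rule lift_Suc_mono_le[of C, rotated]) (use C(3) interior_subset in blast)
  define H where "H y = indicator ?\<Omega> y *\<^sub>R h y" for y
  have "H \<in> borel_measurable borel"
  proof (rule borel_measurable_LIMSEQ_metric)
    show "(\<lambda>y. indicator (C n) y *\<^sub>R h y) \<in> borel_measurable borel" for n
      using wd C(1,2)[of n] unfolding weak_derivative_def set_integrable_def
      by (auto dest!: borel_measurable_integrable)
    show "(\<lambda>n. indicator (C n) y *\<^sub>R h y) \<longlonglongrightarrow> H y" for y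
    proof (cases "y \<in> ?\<Omega>")
      case True
      then obtain n where n: "y \<in> C n" using C(4) by blast
      show ?thesis
      proof (rule tendsto_eventually)
        show "\<forall>\<^sub>F m in sequentially. indicator (C m) y *\<^sub>R h y = H y"
          using eventually_ge_at_top[of n]
        proof eventually_elim
          case (elim m)
          then have "y \<in> C m" using inc n by blast
          then show ?case using True by (simp add: H_def)
        qed
      qed
    next
      case False
      then have "y \<notin> C n" for n using C(2) by blast
      then show ?thesis using False by (simp add: H_def)
    qed
  qed
  moreover have "cmap M c \<in> borel_measurable (restrict_space borel (cdom M c))"
    by (rule borel_measurable_continuous_on_restrict[OF continuous_cmap[OF c]])
  ultimately have "(\<lambda>x. H (cmap M c x)) \<in> borel_measurable (restrict_space borel (cdom M c))"
    by (rule measurable_compose[rotated])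
  then show ?thesis
    by (rule measurable_cong[THEN iffD1, rotated]) (use c in \<open>auto simp: H_def h_def space_restrict_space\<close>)
qed

text \<open>Recovers a vector from its image under the metric by determinants, which depend
measurably on their entries.\<close>
lemma metric_cramer:
  assumes c: "c \<in> charts M" "x \<in> cdom M c"
  shows "v = (\<chi> k. det (\<chi> i j. if j = k then (metric M c x *v v) $ i else metric M c x $ i $ j) / det (metric M c x))"
proof -
  have "det (metric M c x) \<noteq> 0" using metric_invertible[OF c] invertible_det_nz by blast
  then show ?thesis using cramer[of "metric M c x" v "metric M c x *v v"] by simp
qed

lemma measurable_det:
  fixes A :: "'b \<Rightarrow> real^'n^'n"
  assumes "\<And>i j. (\<lambda>x. A x $ i $ j) \<in> borel_measurable N"
  shows "(\<lambda>x. det (A x)) \<in> borel_measurable N"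
  unfolding det_def by (intro borel_measurable_sum borel_measurable_times borel_measurable_prod borel_measurable_const assms)

lemma measurable_vec_comp: "f \<in> borel_measurable N \<Longrightarrow> (\<lambda>x. f x $ i) \<in> borel_measurable N" for f :: "'b \<Rightarrow> 'c::euclidean_space ^ 'n"
proof -
  assume f: "f \<in> borel_measurable N"
  have "(\<lambda>v :: 'c ^ 'n. v $ i) \<in> borel_measurable borel"
    by (intro borel_measurable_continuous_onI continuous_on_component continuous_on_id)
  then show ?thesis by (rule measurable_compose[OF f])
qed

text \<open>The inner product is defined with a chart chosen at each point, without any regularity of the choice.
By Lindelof's theorem countably many charts suffice, and in a fixed chart Cramer's rule expresses the inner product by
the measurable partial derivatives and the metric.\<close>
lemma ginner_measurable_borel:
  assumes u: "weak_gradient M u X" and w: "weak_gradient M w Y"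
  shows "ginner M X Y \<in> borel_measurable borel"
proof -
  have "\<exists>\<C>. \<C> \<subseteq> cdom M ` charts M \<and> countable \<C> \<and> \<Union>\<C> = \<Union>(cdom M ` charts M)"
    using Lindelof[of "cdom M ` charts M"] open_cdom by (metis (no_types, lifting) imageE)
  then obtain \<C> where C: "\<C> \<subseteq> cdom M ` charts M" "countable \<C>" "\<Union>\<C> = UNIV" using charts_cover by auto
  show ?thesis
  proof (rule measurable_piecewise_restrict[OF C(2)])
    show "space borel \<subseteq> \<Union>\<C>" using C(3) by simp
    fix \<Omega> assume "\<Omega> \<in> \<C>"
    then obtain c where c: "c \<in> charts M" "\<Omega> = cdom M c" using C(1) by blast
    show "\<Omega> \<inter> space borel \<in> sets borel" using open_cdom c by simp
    let ?N = "restrict_space borel (cdom M c)"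
    have gX: "(\<lambda>x. metric M c x *v X c x) \<in> borel_measurable ?N" by (rule weak_gradient_measurable[OF u c(1)])
    have gY: "(\<lambda>x. metric M c x *v Y c x) \<in> borel_measurable ?N" by (rule weak_gradient_measurable[OF w c(1)])
    have g: "metric M c \<in> borel_measurable ?N" by (rule borel_measurable_continuous_on_restrict[OF continuous_metric[OF c(1)]])
    have gij: "(\<lambda>x. metric M c x $ i $ j) \<in> borel_measurable ?N" for i j
      by (intro measurable_vec_comp g)
    have gXi: "(\<lambda>x. (metric M c x *v X c x) $ i) \<in> borel_measurable ?N" "(\<lambda>x. (metric M c x *v Y c x) $ i) \<in> borel_measurable ?N" for i
      by (intro measurable_vec_comp gX gY)+
    have "(\<lambda>x. \<Sum>k\<in>UNIV. det (\<chi> i j. if j = k then (metric M c x *v X c x) $ i else metric M c x $ i $ j) / det (metric M c x) * (metric M c x *v Y c x) $ k)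
       \<in> borel_measurable ?N"
    proof (intro borel_measurable_sum borel_measurable_times borel_measurable_divide measurable_det gXi gij)
      fix k i j
      show "(\<lambda>x. (\<chi> i j. if j = k then (metric M c x *v X c x) $ i else metric M c x $ i $ j) $ i $ j) \<in> borel_measurable ?N"
        by (cases "j = k") (simp_all add: gXi gij)
    qed
    then show "ginner M X Y \<in> borel_measurable (restrict_space borel \<Omega>)" unfolding c(2)
    proof (rule measurable_cong[THEN iffD1, rotated])
      fix x assume "x \<in> space ?N"
      then have x: "x \<in> cdom M c" by (simp add: space_restrict_space)
      have "ginner M X Y x = X c x \<bullet> (metric M c x *v Y c x)"
        using u w c(1) x by (intro ginner_chart) (auto simp: weak_gradient_def)
      also have "\<dots> = (\<Sum>k\<in>UNIV. X c x $ k * (metric M c x *v Y c x) $ k)" by (simp add: inner_vec_def)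
      also have "\<dots> = (\<Sum>k\<in>UNIV. det (\<chi> i j. if j = k then (metric M c x *v X c x) $ i else metric M c x $ i $ j) / det (metric M c x) * (metric M c x *v Y c x) $ k)"
        by (subst metric_cramer[OF c(1) x, of "X c x"]) simp
      finally show "(\<Sum>k\<in>UNIV. det (\<chi> i j. if j = k then (metric M c x *v X c x) $ i else metric M c x $ i $ j) / det (metric M c x) * (metric M c x *v Y c x) $ k) = ginner M X Y x" by simp
    qed
  qed
qed

lemma gnorm_measurable:
  assumes w: "weak_gradient M w Y" and sets: "sets \<mu> = sets borel"
  shows "gnorm M Y \<in> borel_measurable \<mu>"
proof -
  have "ginner M Y Y \<in> borel_measurable \<mu>"
    using ginner_measurable_borel[OF w w] by (simp cong: measurable_cong_sets add: sets)
  then show ?thesis unfolding gnorm_def[abs_def] by (rule measurable_compose) measurable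
qed

subsection \<open>The measure of compact sets\<close>

text \<open>In a chart the measure has a continuous density, so small coordinate balls have finite measure.\<close>
lemma emeasure_compact_finite:
  assumes \<mu>: "riemannian_measure M \<mu>" and K: "compact K"
  shows "emeasure \<mu> K < \<infinity>"
proof -
  have sets: "sets \<mu> = sets borel" using \<mu> by (simp add: riemannian_measure_def)
  have "\<exists>U. open U \<and> x \<in> U \<and> emeasure \<mu> U < \<infinity>" for x
  proof -
    define c where "c = chart_at M x"
    have c: "c \<in> charts M" "x \<in> cdom M c" using chart_at by (auto simp: c_def)
    obtain e where e: "e > 0" "cball (cmap M c x) e \<subseteq> cmap M c ` cdom M c" using chart_ball[OF c] .
    let ?B = "ball (cmap M c x) e" and ?Q = "cball (cmap M c x) e"
    define U where "U = cinv M c ` ?B"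
    have B: "?B \<subseteq> cmap M c ` cdom M c" using e by auto
    have U: "open U" unfolding U_def by (rule open_cinv_image[OF c(1) open_ball B])
    have xU: "x \<in> U" unfolding U_def using c e(1) by (intro image_eqI[of _ _ "cmap M c x"]) auto
    have Uc: "U \<subseteq> cdom M c" unfolding U_def using B c by (auto intro!: cinv_in)
    have cU: "cmap M c ` U = ?B" unfolding U_def image_image using B c(1) by (force simp: image_iff subset_iff)
    let ?d = "\<lambda>y. sqrt (det (metric M c (cinv M c y)))"
    have gc: "continuous_on ?Q (\<lambda>y. metric M c (cinv M c y))"
      by (rule continuous_on_subset[OF continuous_metric_cinv[OF c(1)] e(2)])
    have dc: "continuous_on ?Q ?d" unfolding det_def
      by (intro continuous_intros gc)
    obtain b where b: "\<forall>z\<in>?d ` ?Q. norm z \<le> b"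
      using compact_imp_bounded[OF compact_continuous_image[OF dc compact_cball]] unfolding bounded_iff by blast
    have "emeasure \<mu> U = (\<integral>\<^sup>+y\<in>?B. ennreal (?d y) \<partial>lborel)"
      using \<mu> c(1) Uc U unfolding riemannian_measure_def cU[symmetric] by auto
    also have "\<dots> \<le> (\<integral>\<^sup>+y. ennreal b * indicator ?B y \<partial>lborel)"
    proof (rule nn_integral_mono)
      fix y
      show "ennreal (?d y) * indicator ?B y \<le> ennreal b * indicator ?B y"
      proof (cases "y \<in> ?B")
        case True
        then have "norm (?d y) \<le> b" using b by auto
        then have "?d y \<le> b" by simp
        then show ?thesis using True by (simp add: ennreal_leI)
      qed simp
    qed
    also have "\<dots> = ennreal b * emeasure lborel ?B" by (simp add: nn_integral_cmult_indicator)
    also have "\<dots> < \<infinity>" using emeasure_lborel_ball_finite[of "cmap M c x" e] by (simp add: ennreal_mult_less_top)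
    finally show ?thesis using U xU by blast
  qed
  then obtain U where U: "\<And>x. open (U x)" "\<And>x. x \<in> U x" "\<And>x. emeasure \<mu> (U x) < \<infinity>" by metis
  have cover: "K \<subseteq> (\<Union>x\<in>K. U x)" using U(2) by blast
  obtain D where D: "D \<subseteq> K" "finite D" "K \<subseteq> (\<Union>x\<in>D. U x)"
    by (rule compactE_image[OF K _ cover]) (use U(1) in auto)
  have "open (\<Union>x\<in>D. U x)" using U(1) by blast
  then have "emeasure \<mu> K \<le> emeasure \<mu> (\<Union>x\<in>D. U x)" using D(3) sets by (intro emeasure_mono) auto
  also have "\<dots> \<le> (\<Sum>x\<in>D. emeasure \<mu> (U x))" using D(2) U(1) sets by (intro emeasure_subadditive_finite) auto
  also have "\<dots> < \<infinity>" using D(2) U(3) by (auto simp: less_top)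
  finally show ?thesis .
qed
end

section \<open>Interpolation inequalities\<close>

text \<open>Young's inequality in a form with constants equal to 1: if H \<le> y x^(\<gamma>-\<beta>), the first term
dominates; otherwise x^(\<gamma>-\<beta>) < H/y, and the second one does.\<close>
lemma powr_interpolation:
  fixes x y H \<beta> \<gamma> :: real
  assumes "0 \<le> x" "0 \<le> H" "0 < y" "0 \<le> \<beta>" "\<beta> < \<gamma>"
  shows "H * x powr \<beta> \<le> y * x powr \<gamma> + y powr (- (\<beta> / (\<gamma> - \<beta>))) * H powr (1 + \<beta> / (\<gamma> - \<beta>))"
proof (cases "x = 0 \<or> H = 0")
  case True then show ?thesis using assms by auto
next
  case False
  then have x: "x > 0" and H: "H > 0" using assms by auto
  show ?thesis
  proof (cases "H \<le> y * x powr (\<gamma> - \<beta>)")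
    case True
    then have "H * x powr \<beta> \<le> (y * x powr (\<gamma> - \<beta>)) * x powr \<beta>" by (intro mult_right_mono) auto
    also have "\<dots> = y * x powr \<gamma>" using x by (simp add: powr_add[symmetric])
    finally show ?thesis using assms by (simp add: add_increasing2)
  next
    case False
    then have le: "x powr (\<gamma> - \<beta>) \<le> H / y" using assms by (simp add: field_simps)
    have "x powr \<beta> = (x powr (\<gamma> - \<beta>)) powr (\<beta> / (\<gamma> - \<beta>))" using assms by (simp add: powr_powr)
    also have "\<dots> \<le> (H / y) powr (\<beta> / (\<gamma> - \<beta>))" using le assms by (intro powr_mono2) auto
    finally have "H * x powr \<beta> \<le> H * (H / y) powr (\<beta> / (\<gamma> - \<beta>))" using H by simp
    also have "\<dots> = y powr (- (\<beta> / (\<gamma> - \<beta>))) * H powr (1 + \<beta> / (\<gamma> - \<beta>))"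
      using H assms by (simp add: powr_divide powr_add powr_minus_divide)
    finally show ?thesis using assms by (simp add: add_increasing)
  qed
qed

text \<open>Interpolation in x = G, the length of \<nabla>u, between the exponents z - 1 and z. Here v stands for 1 + u, f for the cutoff and
D for the length of its gradient.\<close>
lemma gradient_term_split:
  fixes f v G D a t \<alpha> z :: real and m :: nat
  assumes f: "0 \<le> f" and v: "1 \<le> v" and G: "0 \<le> G" and D: "0 \<le> D" and z: "1 < z"
    and m: "2 \<le> m" and \<alpha>: "0 < \<alpha>"
  shows "m * f ^ (m - 1) * v powr (- a) * G powr (z - 1) * D
    \<le> \<alpha> * (G powr z * v powr (- t - 1) * f ^ m)
      + \<alpha> powr (1 - z) * m powr z * v powr ((t + 1) * (z - 1) - a * z) * f powr (m - z) * D powr z"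
proof (cases "f = 0 \<or> D = 0")
  case True then show ?thesis using assms by (auto simp: zero_power)
next
  case False
  then have f: "f > 0" and D: "D > 0" using f D by auto
  have fm: "f ^ m = f powr m" "f ^ (m - 1) = f powr (m - 1)"
    using f m by (simp_all add: powr_realpow[symmetric] of_nat_diff)
  have m1: "real (m - 1) = real m - 1" using m by auto
  have "(m * f powr (m - 1) * v powr (- a) * D) * G powr (z - 1)
    \<le> (\<alpha> * v powr (- t - 1) * f powr m) * G powr z
     + (\<alpha> * v powr (- t - 1) * f powr m) powr (- ((z - 1) / (z - (z - 1))))
      * (m * f powr (m - 1) * v powr (- a) * D) powr (1 + (z - 1) / (z - (z - 1)))"
    using assms f D by (intro powr_interpolation) auto
  also have "(\<alpha> * v powr (- t - 1) * f powr m) powr (- ((z - 1) / (z - (z - 1))))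
      * (m * f powr (m - 1) * v powr (- a) * D) powr (1 + (z - 1) / (z - (z - 1)))
    = \<alpha> powr (1 - z) * m powr z * (v powr ((- t - 1) * (1 - z)) * v powr (- a * z))
       * (f powr (real m * (1 - z)) * f powr (real (m - 1) * z)) * D powr z"
    using f D v \<alpha> m by (simp add: powr_mult powr_powr mult_ac)
  also have "\<dots> = \<alpha> powr (1 - z) * m powr z * v powr ((t + 1) * (z - 1) - a * z) * f powr (m - z) * D powr z"
    unfolding m1 powr_add[symmetric] by (simp add: algebra_simps)
  finally show ?thesis unfolding fm by (simp add: mult_ac)
qed

text \<open>Interpolation in x = v between the exponents \<beta> and \<gamma>. The indicator of D \<noteq> 0 records that nothing happens
where the cutoff is constant; m is large enough for the surplus power of f to be at most 1.\<close>
lemma weight_term_split: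
  fixes f v D W \<beta> \<gamma> \<eta> \<tau> z :: real and m :: nat
  assumes f: "0 \<le> f" "f \<le> 1" and v: "1 \<le> v" and D: "0 \<le> D" and z: "1 < z" and W: "0 < W"
    and \<eta>: "0 < \<eta>" and \<tau>: "0 \<le> \<tau>" and \<beta>: "0 \<le> \<beta>" "\<beta> < \<gamma>"
    and \<sigma>: "\<sigma> = \<beta> / (\<gamma> - \<beta>)" and m: "z * (1 + \<sigma>) \<le> m" "2 \<le> m"
  shows "\<tau> * v powr \<beta> * f powr (m - z) * D powr z
    \<le> \<eta> * (W * v powr \<gamma> * f ^ m * (if D = 0 then 0 else 1))
      + \<eta> powr (- \<sigma>) * (W powr (- \<sigma>) * (\<tau> * D powr z) powr (1 + \<sigma>))"
proof (cases "f = 0 \<or> D = 0")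
  case True then show ?thesis using assms by (auto simp: zero_power)
next
  case False
  then have f0: "f > 0" and D: "D > 0" using f D by auto
  have fm: "f ^ m = f powr m" using f0 by (simp add: powr_realpow)
  have "(\<tau> * f powr (m - z) * D powr z) * v powr \<beta>
    \<le> (\<eta> * W * f powr m) * v powr \<gamma>
     + (\<eta> * W * f powr m) powr (- (\<beta> / (\<gamma> - \<beta>))) * (\<tau> * f powr (m - z) * D powr z) powr (1 + \<beta> / (\<gamma> - \<beta>))"
    using assms f0 D by (intro powr_interpolation) auto
  also have "(\<eta> * W * f powr m) powr (- (\<beta> / (\<gamma> - \<beta>))) * (\<tau> * f powr (m - z) * D powr z) powr (1 + \<beta> / (\<gamma> - \<beta>))
    = \<eta> powr (- \<sigma>) * (W powr (- \<sigma>) * (\<tau> * D powr z) powr (1 + \<sigma>)) * (f powr (m * (- \<sigma>)) * f powr ((m - z) * (1 + \<sigma>)))"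
    unfolding \<sigma>[symmetric] using f0 D W \<eta> \<tau> by (simp add: powr_mult powr_powr mult_ac)
  also have "f powr (m * (- \<sigma>)) * f powr ((m - z) * (1 + \<sigma>)) = f powr (m - z * (1 + \<sigma>))"
    unfolding powr_add[symmetric] by (simp add: algebra_simps)
  also have "\<eta> powr (- \<sigma>) * (W powr (- \<sigma>) * (\<tau> * D powr z) powr (1 + \<sigma>)) * f powr (m - z * (1 + \<sigma>))
     \<le> \<eta> powr (- \<sigma>) * (W powr (- \<sigma>) * (\<tau> * D powr z) powr (1 + \<sigma>)) * 1"
    using f f0 m by (intro mult_left_mono powr_le1) auto
  finally show ?thesis unfolding fm using D by (simp add: mult_ac)
qed

section \<open>Critical scaling on dyadic annuli\<close>

text \<open>An exponent of size c/N costs only a constant, as ln N \<le> N.\<close>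
lemma powr_dist_one_bound:
  assumes "N \<ge> (1::real)" "\<bar>e\<bar> \<le> c / N"
  shows "N powr (- e) \<le> exp c"
proof -
  have "- e * ln N \<le> \<bar>e\<bar> * ln N" using assms by (intro mult_right_mono) auto
  also have "\<dots> \<le> c / N * ln N" using assms by (intro mult_right_mono) auto
  also have "\<dots> \<le> c / N * N"
    using assms ln_le_minus_one[of N] by (intro mult_left_mono) (auto intro: order_trans[OF abs_ge_zero])
  finally have "- e * ln N \<le> c" using assms by simp
  then show ?thesis using assms by (simp add: powr_def)
qed

text \<open>The contribution of the annulus with outer radius 2^j. For e = 0 the powers of 2^j cancel, and N^(-1-k) meets
(j ln 2)^k \<le> (2N)^k, which leaves 1/N. For \<bar>e\<bar> \<le> c/N the powers N^(-e) and 2^(j e) stay bounded since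
j \<le> 2 N.\<close>
lemma annulus_scaling:
  fixes N j :: nat and k z e c C0 C3 :: real
  assumes N: "N \<ge> 1" and j: "N + 1 \<le> j" "j \<le> 2 * N" and k: "0 \<le> k" and z: "1 < z"
    and e: "\<bar>e\<bar> \<le> c / N" "\<bar>e\<bar> \<le> 1" and C0: "0 \<le> C0" and C3: "0 \<le> C3" and k': "0 \<le> 1 + k + e"
  shows "(C3 / N * 2 powr (- z * j)) powr (1 + k + e) * (2 powr (j * (z * (1 + k) + C0 * \<bar>e\<bar>)) * (j * ln 2) powr k)
     \<le> (max 1 C3 powr (2 + k) * exp c * 2 powr (2 * c * (C0 + z)) * 2 powr k) / N"
proof -
  let ?N = "real N"
  have N0: "?N \<ge> 1" using N by simp
  have c0: "0 \<le> c" 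
  proof -
    have "0 \<le> c / ?N" using e(1) by linarith
    then show ?thesis using N0 by (simp add: zero_le_divide_iff)
  qed
  have 1: "(C3 / N * 2 powr (- z * j)) powr (1 + k + e)
     = C3 powr (1 + k + e) * (?N powr (-1 - k) * ?N powr (- e)) * 2 powr (- z * j * (1 + k + e))"
  proof -
    have "?N powr (-1 - k) * ?N powr (- e) = 1 / ?N powr (1 + k + e)"
      unfolding powr_add[symmetric] by (simp add: powr_minus[symmetric] divide_inverse)
    then show ?thesis using N0 C3 by (simp add: powr_mult powr_divide powr_powr)
  qed
  have 2: "C3 powr (1 + k + e) \<le> max 1 C3 powr (2 + k)"
  proof -
    have "C3 powr (1 + k + e) \<le> max 1 C3 powr (1 + k + e)" using C3 k' by (intro powr_mono2) auto
    also have "\<dots> \<le> max 1 C3 powr (2 + k)" using e by (intro powr_mono) auto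
    finally show ?thesis .
  qed
  have 3: "?N powr (- e) \<le> exp c" using powr_dist_one_bound[OF N0 e(1)] .
  have 4: "(j * ln 2) powr k \<le> 2 powr k * ?N powr k"
  proof -
    have "j * ln 2 \<le> 2 * ?N" using j ln_2_less_1 mult_mono[of "real j" "2 * ?N" "ln 2" 1] by simp
    then have "(j * ln 2) powr k \<le> (2 * ?N) powr k" using k by (intro powr_mono2) auto
    then show ?thesis by (simp add: powr_mult)
  qed
  have 5: "2 powr (- z * j * (1 + k + e)) * 2 powr (j * (z * (1 + k) + C0 * \<bar>e\<bar>)) \<le> 2 powr (2 * c * (C0 + z))"
  proof -
    have "- z * j * (1 + k + e) + j * (z * (1 + k) + C0 * \<bar>e\<bar>) = j * (C0 * \<bar>e\<bar> - z * e)" by (simp add: algebra_simps)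
    also have "\<dots> \<le> j * ((C0 + z) * \<bar>e\<bar>)"
    proof (intro mult_left_mono)
      have "- (z * e) \<le> z * \<bar>e\<bar>" using z by (metis abs_ge_minus_self abs_mult abs_of_pos less_trans zero_less_one)
      then show "C0 * \<bar>e\<bar> - z * e \<le> (C0 + z) * \<bar>e\<bar>" by (simp add: algebra_simps)
    qed simp
    also have "\<dots> \<le> (2 * ?N) * ((C0 + z) * (c / ?N))"
      using j e z C0 by (intro mult_mono mult_left_mono) auto
    also have "\<dots> = 2 * c * (C0 + z)" using N0 by simp
    finally show ?thesis unfolding powr_add[symmetric] by (intro powr_mono) auto
  qed
  have "(C3 / N * 2 powr (- z * j)) powr (1 + k + e) * (2 powr (j * (z * (1 + k) + C0 * \<bar>e\<bar>)) * (j * ln 2) powr k)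
     = C3 powr (1 + k + e) * ?N powr (-e) * (2 powr (- z * j * (1 + k + e)) * 2 powr (j * (z * (1 + k) + C0 * \<bar>e\<bar>)))
        * ((j * ln 2) powr k) * ?N powr (-1 - k)" unfolding 1 by (simp add: mult_ac)
  also have "\<dots> \<le> max 1 C3 powr (2 + k) * exp c * 2 powr (2 * c * (C0 + z)) * (2 powr k * ?N powr k) * ?N powr (-1 - k)"
    by (intro mult_right_mono mult_mono 2 3 4 5) auto
  also have "\<dots> = max 1 C3 powr (2 + k) * exp c * 2 powr (2 * c * (C0 + z)) * 2 powr k * (?N powr k * ?N powr (-1 - k))"
    by (simp add: mult_ac)
  also have "?N powr k * ?N powr (-1 - k) = 1 / ?N" unfolding powr_add[symmetric] using N0 by (simp add: powr_minus_divide)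
  finally show ?thesis by simp
qed

lemma sum_powr_le:
  assumes "0 \<le> (a::real)" "0 \<le> b" "0 \<le> r"
  shows "(a + b) powr r \<le> 2 powr r * (a powr r + b powr r)"
proof -
  have "(a + b) powr r \<le> (2 * max a b) powr r" using assms by (intro powr_mono2) auto
  also have "\<dots> = 2 powr r * max a b powr r" using assms by (simp add: powr_mult)
  also have "\<dots> \<le> 2 powr r * (a powr r + b powr r)" by (intro mult_left_mono) (auto simp: max_def)
  finally show ?thesis .
qed

text \<open>The pointwise bound satisfied by the gradient of a logarithmic cutoff between the radii 2^N and
2^(2N): it is at most C1 / (N R) on a dyadic annulus of outer radius R and vanishes elsewhere.\<close>
definition log_slope :: "'a::metric_space \<Rightarrow> real \<Rightarrow> nat \<Rightarrow> ('a \<Rightarrow> real) \<Rightarrow> bool" where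
  "log_slope x0 C1 N D \<longleftrightarrow> (\<forall>x. 0 \<le> D x \<and> (D x = 0 \<or>
     (\<exists>j\<in>{N+1..2*N}. x \<in> ball x0 (2 ^ j) - ball x0 (2 ^ j / 2) \<and> D x \<le> C1 / (real N * 2 ^ j))))"

lemma log_slope_le:
  assumes D: "log_slope x0 C1 N D" and N: "1 \<le> N" and C1: "0 \<le> C1"
  shows "D x \<le> C1"
proof -
  have "D x = 0 \<or> (\<exists>j\<in>{N+1..2*N}. x \<in> ball x0 (2 ^ j) - ball x0 (2 ^ j / 2) \<and> D x \<le> C1 / (real N * 2 ^ j))"
    using D unfolding log_slope_def by blast
  then show ?thesis
  proof (elim disjE bexE conjE)
    fix j :: nat assume le: "D x \<le> C1 / (real N * 2 ^ j)"
    have "1 * 1 \<le> real N * 2 ^ j" using N by (intro mult_mono) auto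
    then have "C1 / (real N * 2 ^ j) \<le> C1 / 1" using C1 by (intro divide_left_mono) auto
    then show ?thesis using le by simp
  qed (use C1 in simp)
qed

text \<open>Each of the N annuli contributes O(1/N). The factor N^(z-1) is \<alpha>^(1-z) for \<alpha> of order 1/N; the sign of e is free, so that
exponents on both sides of k are covered.\<close>
lemma weighted_slope_bounded:
  fixes \<mu> :: "'a::metric_space measure" and z k C0 C R0 \<epsilon>0 C1 c \<tau> :: real
  assumes sets: "sets \<mu> = sets borel" and V[measurable]: "V \<in> borel_measurable \<mu>"
    and growth: "\<And>R e. R \<ge> R0 \<Longrightarrow> 0 < \<bar>e\<bar> \<Longrightarrow> \<bar>e\<bar> \<le> \<epsilon>0 \<Longrightarrow>
       (\<integral>\<^sup>+x\<in>ball x0 R - ball x0 (R / 2). ennreal (V x powr (- (k + e))) \<partial>\<mu>)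
          \<le> ennreal (C * R powr (z * (1 + k) + C0 * \<bar>e\<bar>) * ln R powr k)"
    and k: "0 \<le> k" and z: "1 < z" and C: "0 \<le> C" "0 \<le> C0" and \<epsilon>0: "0 < \<epsilon>0"
    and C1: "0 \<le> C1" and \<tau>: "0 \<le> \<tau>" and c: "0 \<le> c"
  shows "\<exists>B\<ge>0. \<exists>N0\<ge>1. \<forall>N\<ge>N0. \<forall>D e. log_slope x0 C1 N D \<and> 0 < \<bar>e\<bar> \<and> \<bar>e\<bar> \<le> c / real N \<longrightarrow>
     (\<integral>\<^sup>+x. ennreal (V x powr (- (k + e)) * (\<tau> * N powr (z - 1) * D x powr z) powr (1 + (k + e))) \<partial>\<mu>) \<le> ennreal B"
proof -
  define C3 where "C3 = \<tau> * C1 powr z"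
  have C3: "0 \<le> C3" using \<tau> by (simp add: C3_def)
  define B0 where "B0 = max 1 C3 powr (2 + k) * exp c * 2 powr (2 * c * (C0 + z)) * 2 powr k"
  have B0: "0 \<le> B0" by (simp add: B0_def)
  obtain N1 :: nat where N1: "R0 \<le> 2 ^ N1" using real_arch_pow[of 2 R0] less_imp_le by auto
  define N0 where "N0 = Suc (N1 + nat \<lceil>c / \<epsilon>0\<rceil> + nat \<lceil>c\<rceil>)"
  have "(\<integral>\<^sup>+x. ennreal (V x powr (- (k + e)) * (\<tau> * N powr (z - 1) * D x powr z) powr (1 + (k + e))) \<partial>\<mu>) \<le> ennreal (C * B0)"
    if N: "N \<ge> N0" and D: "log_slope x0 C1 N D" and e: "0 < \<bar>e\<bar>" "\<bar>e\<bar> \<le> c / real N" for N D e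
  proof -
    have N': "N \<ge> 1" "N \<ge> N1" "real N \<ge> c / \<epsilon>0" "real N \<ge> c" using N unfolding N0_def by linarith+
    have Npos: "0 < real N" using N' by simp
    have "c / N \<le> \<epsilon>0" using N' Npos \<epsilon>0 by (simp add: field_simps)
    then have e0: "\<bar>e\<bar> \<le> \<epsilon>0" using e by simp
    have "c / N \<le> 1" using N' Npos by (simp add: field_simps)
    then have e1: "\<bar>e\<bar> \<le> 1" using e by simp
    define A where "A j = ball x0 (2 ^ j) - ball x0 (2 ^ j / 2)" for j :: nat
    have A[measurable]: "A j \<in> sets \<mu>" for j using sets by (simp add: A_def)
    define b where "b j = (C3 / N * 2 powr (- z * real j)) powr (1 + k + e)" for j :: nat
    have slope: "(\<tau> * N powr (z - 1) * (D x) powr z) powr (1 + (k + e)) \<le> b j"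
      if "D x \<le> C1 / (real N * 2 ^ j)" for j x
    proof -
      have Dx: "0 \<le> D x" using D by (simp add: log_slope_def)
      have "D x powr z \<le> (C1 / (real N * 2 ^ j)) powr z" using that Dx z by (intro powr_mono2) auto
      also have "\<dots> = C1 powr z * N powr (- z) * 2 powr (- z * real j)"
      proof -
        have "(2 ^ j) powr z = (2::real) powr (z * real j)"
          by (simp add: powr_powr mult.commute flip: powr_realpow)
        then show ?thesis using Npos C1 by (simp add: powr_divide powr_mult powr_minus_divide)
      qed
      finally have "\<tau> * N powr (z - 1) * (D x) powr z \<le> \<tau> * N powr (z - 1) * (C1 powr z * N powr (- z) * 2 powr (- z * real j))"
        using \<tau> by (intro mult_left_mono) auto
      also have "\<dots> = C3 * (N powr (z - 1) * N powr (- z)) * 2 powr (- z * real j)" by (simp add: C3_def mult_ac)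
      also have "N powr (z - 1) * N powr (- z) = 1 / N" unfolding powr_add[symmetric] using Npos by (simp add: powr_minus_divide)
      finally show ?thesis unfolding b_def add.assoc using \<tau> k e1 by (intro powr_mono2) auto
    qed
    have "(\<integral>\<^sup>+x. ennreal (V x powr (- (k + e)) * (\<tau> * N powr (z - 1) * D x powr z) powr (1 + (k + e))) \<partial>\<mu>)
       \<le> (\<integral>\<^sup>+x. (\<Sum>j\<in>{N+1..2*N}. ennreal (b j) * (ennreal (V x powr (- (k + e))) * indicator (A j) x)) \<partial>\<mu>)"
    proof (intro nn_integral_mono)
      fix x
      show "ennreal (V x powr (- (k + e)) * (\<tau> * N powr (z - 1) * D x powr z) powr (1 + (k + e)))
        \<le> (\<Sum>j\<in>{N+1..2*N}. ennreal (b j) * (ennreal (V x powr (- (k + e))) * indicator (A j) x))"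
      proof (cases "D x = 0")
        case True then show ?thesis by simp
      next
        case False
        then obtain j where j: "j\<in>{N+1..2*N}" "x \<in> A j" "D x \<le> C1 / (real N * 2 ^ j)"
          using D unfolding log_slope_def A_def by blast
        have "ennreal (V x powr (- (k + e)) * (\<tau> * N powr (z - 1) * D x powr z) powr (1 + (k + e)))
           \<le> ennreal (b j * V x powr (- (k + e)))"
          unfolding mult.commute[of "b j"] by (intro ennreal_leI mult_left_mono slope j) auto
        also have "\<dots> = ennreal (b j) * (ennreal (V x powr (- (k + e))) * indicator (A j) x)"
          using j by (simp add: ennreal_mult b_def)
        also have "\<dots> \<le> (\<Sum>j\<in>{N+1..2*N}. ennreal (b j) * (ennreal (V x powr (- (k + e))) * indicator (A j) x))"
          using j(1) by (intro member_le_sum) auto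
        finally show ?thesis .
      qed
    qed
    also have "\<dots> = (\<Sum>j\<in>{N+1..2*N}. ennreal (b j) * (\<integral>\<^sup>+x\<in>A j. ennreal (V x powr (- (k + e))) \<partial>\<mu>))"
      by (subst nn_integral_sum) (auto simp: nn_integral_cmult)
    also have "\<dots> \<le> (\<Sum>j\<in>{N+1..2*N}. ennreal (C * B0 / N))"
    proof (intro sum_mono)
      fix j assume j: "j \<in> {N+1..2*N}"
      have "R0 \<le> 2 ^ N1" by fact
      also have "(2::real) ^ N1 \<le> 2 ^ j" using j N' by (intro power_increasing) auto
      finally have "(\<integral>\<^sup>+x\<in>A j. ennreal (V x powr (- (k + e))) \<partial>\<mu>)
        \<le> ennreal (C * (2 ^ j) powr (z * (1 + k) + C0 * \<bar>e\<bar>) * ln (2 ^ j) powr k)"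
        unfolding A_def using e e0 by (intro growth) auto
      also have "(2 ^ j) powr (z * (1 + k) + C0 * \<bar>e\<bar>) = 2 powr (j * (z * (1 + k) + C0 * \<bar>e\<bar>))"
        by (simp add: powr_powr flip: powr_realpow)
      also have "ln (2 ^ j) = j * ln 2" by (simp add: ln_realpow)
      finally have "ennreal (b j) * (\<integral>\<^sup>+x\<in>A j. ennreal (V x powr (- (k + e))) \<partial>\<mu>)
         \<le> ennreal (b j) * ennreal (C * 2 powr (j * (z * (1 + k) + C0 * \<bar>e\<bar>)) * (j * ln 2) powr k)"
        by (intro mult_left_mono) auto
      also have "\<dots> = ennreal (C * (b j * (2 powr (j * (z * (1 + k) + C0 * \<bar>e\<bar>)) * (j * ln 2) powr k)))"
        using C by (subst ennreal_mult[symmetric]) (auto simp: b_def mult_ac)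
      also have "\<dots> \<le> ennreal (C * (B0 / N))"
        unfolding b_def B0_def using j N' k z e e1 C C3 by (intro ennreal_leI mult_left_mono annulus_scaling) auto
      finally show "ennreal (b j) * (\<integral>\<^sup>+x\<in>A j. ennreal (V x powr (- (k + e))) \<partial>\<mu>) \<le> ennreal (C * B0 / N)" by simp
    qed
    also have "\<dots> = ennreal (C * B0)"
      using Npos C B0 by (simp add: ennreal_of_nat_eq_real_of_nat ennreal_mult[symmetric])
    finally show ?thesis .
  qed
  then show ?thesis using C B0 by (intro exI[of _ "C * B0"] conjI exI[of _ N0]) (auto simp: N0_def)
qed

section \<open>Vanishing of the energy\<close>

lemma integrable_sandwich:
  fixes f g :: "'a \<Rightarrow> real"
  assumes "integrable \<mu> g" "f \<in> borel_measurable \<mu>" "AE x in \<mu>. 0 \<le> f x \<and> f x \<le> g x"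
  shows "integrable \<mu> f"
proof (rule Bochner_Integration.integrable_bound[OF assms(1,2)])
  show "AE x in \<mu>. norm (f x) \<le> norm (g x)" using assms(3) by eventually_elim auto
qed

text \<open>The two interpolations, integrated. The parameter a is the power of 1 + u in the test function and t the one in
the gradient term; they coincide in the proof of \<open>energy_bound\<close>, while \<open>energy_small\<close> has a = 0 < t.\<close>
lemma flux_bound:
  fixes \<mu> :: "'a measure" and f D G v V :: "'a \<Rightarrow> real"
    and a t \<alpha> z \<eta> \<beta> \<gamma> \<sigma> B :: real and m :: nat
  assumes meas[measurable]: "f \<in> borel_measurable \<mu>" "D \<in> borel_measurable \<mu>" "v \<in> borel_measurable \<mu>" "V \<in> borel_measurable \<mu>"
    and f: "\<And>x. 0 \<le> f x" "\<And>x. f x \<le> 1" and D: "\<And>x. 0 \<le> D x" and G: "\<And>x. 0 \<le> G x"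
    and v: "AE x in \<mu>. 1 \<le> v x" and V: "AE x in \<mu>. 0 < V x"
    and z: "1 < z" and m: "2 \<le> m" "z * (1 + \<sigma>) \<le> m" and \<alpha>: "0 < \<alpha>" and \<eta>: "0 < \<eta>"
    and \<beta>: "\<beta> = (t + 1) * (z - 1) - a * z" "0 \<le> \<beta>" "\<beta> < \<gamma>" and \<sigma>: "\<sigma> = \<beta> / (\<gamma> - \<beta>)"
    and int1: "integrable \<mu> (\<lambda>x. f x ^ (m - 1) * v x powr (- a) * G x powr (z - 1) * D x)"
    and int2: "integrable \<mu> (\<lambda>x. G x powr z * v x powr (- t - 1) * f x ^ m)"
    and int3: "integrable \<mu> (\<lambda>x. V x * v x powr \<gamma> * f x ^ m * (if D x = 0 then 0 else 1))"
    and E: "(\<integral>\<^sup>+x. ennreal (V x powr (- \<sigma>) * (\<alpha> powr (1 - z) * m powr z * D x powr z) powr (1 + \<sigma>)) \<partial>\<mu>) \<le> ennreal B"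
    and B: "0 \<le> B"
  shows "m * (\<integral>x. f x ^ (m - 1) * v x powr (- a) * G x powr (z - 1) * D x \<partial>\<mu>)
    \<le> \<alpha> * (\<integral>x. G x powr z * v x powr (- t - 1) * f x ^ m \<partial>\<mu>)
     + \<eta> * (\<integral>x. V x * v x powr \<gamma> * f x ^ m * (if D x = 0 then 0 else 1) \<partial>\<mu>) + \<eta> powr (- \<sigma>) * B"
proof -
  let ?E = "\<lambda>x. V x powr (- \<sigma>) * (\<alpha> powr (1 - z) * m powr z * D x powr z) powr (1 + \<sigma>)"
  have intE: "integrable \<mu> ?E"
    using E by (intro integrableI_bounded) (auto simp: le_less_trans[OF E])
  have EB: "(\<integral>x. ?E x \<partial>\<mu>) \<le> B"
    using E B by (subst integral_eq_nn_integral) (auto simp: enn2real_leI)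
  have "(\<integral>x. m * (f x ^ (m - 1) * v x powr (- a) * G x powr (z - 1) * D x) \<partial>\<mu>)
    \<le> (\<integral>x. \<alpha> * (G x powr z * v x powr (- t - 1) * f x ^ m)
       + \<eta> * (V x * v x powr \<gamma> * f x ^ m * (if D x = 0 then 0 else 1)) + \<eta> powr (- \<sigma>) * ?E x \<partial>\<mu>)"
  proof (rule integral_mono_AE)
    show "AE x in \<mu>. m * (f x ^ (m - 1) * v x powr (- a) * G x powr (z - 1) * D x)
       \<le> \<alpha> * (G x powr z * v x powr (- t - 1) * f x ^ m)
       + \<eta> * (V x * v x powr \<gamma> * f x ^ m * (if D x = 0 then 0 else 1)) + \<eta> powr (- \<sigma>) * ?E x"
      using v V
    proof eventually_elim
      case (elim x)
      have "m * f x ^ (m - 1) * v x powr (- a) * G x powr (z - 1) * D x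
        \<le> \<alpha> * (G x powr z * v x powr (- t - 1) * f x ^ m)
          + \<alpha> powr (1 - z) * m powr z * v x powr \<beta> * f x powr (m - z) * D x powr z"
        unfolding \<beta>(1) using elim f D G z m \<alpha> by (intro gradient_term_split) auto
      also have "\<alpha> powr (1 - z) * m powr z * v x powr \<beta> * f x powr (m - z) * D x powr z
         \<le> \<eta> * (V x * v x powr \<gamma> * f x ^ m * (if D x = 0 then 0 else 1)) + \<eta> powr (- \<sigma>) * ?E x"
        using elim f D z m \<eta> \<beta> \<sigma> by (intro weight_term_split) auto
      finally show ?case by (simp add: mult_ac)
    qed
  qed (intro Bochner_Integration.integrable_add integrable_mult_right int1 int2 int3 intE)+
  also have "\<dots> = \<alpha> * (\<integral>x. G x powr z * v x powr (- t - 1) * f x ^ m \<partial>\<mu>)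
     + \<eta> * (\<integral>x. V x * v x powr \<gamma> * f x ^ m * (if D x = 0 then 0 else 1) \<partial>\<mu>) + \<eta> powr (- \<sigma>) * (\<integral>x. ?E x \<partial>\<mu>)"
    using int2 int3 intE by (simp add: Bochner_Integration.integral_add)
  also have "\<dots> \<le> \<alpha> * (\<integral>x. G x powr z * v x powr (- t - 1) * f x ^ m \<partial>\<mu>)
     + \<eta> * (\<integral>x. V x * v x powr \<gamma> * f x ^ m * (if D x = 0 then 0 else 1) \<partial>\<mu>) + \<eta> powr (- \<sigma>) * B"
    using EB by (simp add: mult_left_mono)
  finally show ?thesis using int1 by simp
qed

definition log_cutoff :: "'a::metric_space measure \<Rightarrow> 'a \<Rightarrow> real \<Rightarrow> nat \<Rightarrow> ('a \<Rightarrow> real) \<Rightarrow> ('a \<Rightarrow> real) \<Rightarrow> bool" where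
  "log_cutoff \<mu> x0 C1 N f D \<longleftrightarrow> f \<in> borel_measurable \<mu> \<and> D \<in> borel_measurable \<mu> \<and>
     (\<forall>x. 0 \<le> f x \<and> f x \<le> 1 \<and> (x \<in> ball x0 (2 ^ N) \<longrightarrow> f x = 1)) \<and> log_slope x0 C1 N D"

text \<open>What testing with f^m (1 + u)^(-t) yields, where G and D stand for the lengths of \<nabla>u and \<nabla>f. From here on the
manifold enters only through this inequality and the slope bound on D.\<close>
definition energy_inequality ::
    "'a measure \<Rightarrow> real \<Rightarrow> real \<Rightarrow> real \<Rightarrow> ('a \<Rightarrow> real) \<Rightarrow> ('a \<Rightarrow> real) \<Rightarrow> ('a \<Rightarrow> real) \<Rightarrow> nat \<Rightarrow> real \<Rightarrow>
     ('a \<Rightarrow> real) \<Rightarrow> ('a \<Rightarrow> real) \<Rightarrow> bool" where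
  "energy_inequality \<mu> p q s V u G m t f D \<longleftrightarrow>
     integrable \<mu> (\<lambda>x. V x * u x powr s * (1 + u x) powr (- t) * f x ^ m) \<and>
     (\<forall>z\<in>{p, q}. integrable \<mu> (\<lambda>x. G x powr z * (1 + u x) powr (- t - 1) * f x ^ m) \<and>
        integrable \<mu> (\<lambda>x. f x ^ (m - 1) * (1 + u x) powr (- t) * G x powr (z - 1) * D x)) \<and>
     (\<integral>x. V x * u x powr s * (1 + u x) powr (- t) * f x ^ m \<partial>\<mu>)
       + t * ((\<integral>x. G x powr p * (1 + u x) powr (- t - 1) * f x ^ m \<partial>\<mu>)
            + (\<integral>x. G x powr q * (1 + u x) powr (- t - 1) * f x ^ m \<partial>\<mu>))
     \<le> m * (\<integral>x. f x ^ (m - 1) * (1 + u x) powr (- t) * G x powr (p - 1) * D x \<partial>\<mu>)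
       + m * (\<integral>x. f x ^ (m - 1) * (1 + u x) powr (- t) * G x powr (q - 1) * D x \<partial>\<mu>)"

text \<open>The growth condition combines the two given ones into a single one with an exponent error e of either
sign. The cutoff power m exceeds the critical exponents by 1, which absorbs the deviation of \<sigma> from k.\<close>
locale critical_growth =
  fixes \<mu> :: "'a::metric_space measure" and x0 :: 'a and p q s C1 :: real and V u G :: "'a \<Rightarrow> real" and m :: nat
  assumes sets: "sets \<mu> = sets borel"
    and exponents: "1 < q" "q \<le> p" "p - 1 < s"
    and V_integrable: "integrable \<mu> V" and V_pos: "AE x in \<mu>. 0 < V x"
    and u_measurable [measurable]: "u \<in> borel_measurable \<mu>" and u_nonneg: "AE x in \<mu>. 0 \<le> u x"
    and G_nonneg: "\<And>x. 0 \<le> G x"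
    and C1: "0 \<le> C1"
    and m_ge: "2 \<le> m" "\<And>z. z \<in> {p, q} \<Longrightarrow> s_exp s z + 1 \<le> m"
    and growth: "\<And>z. z \<in> {p, q} \<Longrightarrow> \<exists>C0\<ge>0. \<exists>C\<ge>0. \<exists>R0. \<exists>\<epsilon>0>0. \<forall>R e. R \<ge> R0 \<longrightarrow> 0 < \<bar>e\<bar> \<longrightarrow> \<bar>e\<bar> \<le> \<epsilon>0 \<longrightarrow>
       (\<integral>\<^sup>+x\<in>ball x0 R - ball x0 (R / 2). ennreal (V x powr (- (k_exp s z + e))) \<partial>\<mu>)
          \<le> ennreal (C * R powr (s_exp s z + C0 * \<bar>e\<bar>) * ln R powr k_exp s z)"
begin

lemma V_measurable [measurable]: "V \<in> borel_measurable \<mu>"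
  using V_integrable by auto

lemma exponent_facts:
  assumes "z \<in> {p, q}"
  shows "1 < z" "0 < s - z + 1" "0 < k_exp s z" "s_exp s z = z * (1 + k_exp s z)" "0 < s"
  using assms exponents by (auto simp: k_exp_def s_exp_def field_simps)

lemma v_ge_1: "AE x in \<mu>. 1 \<le> 1 + u x"
  using u_nonneg by eventually_elim auto

definition slope_bound :: "real \<Rightarrow> real \<Rightarrow> real \<Rightarrow> real \<Rightarrow> nat \<Rightarrow> bool" where
  "slope_bound z \<tau> c B N0 \<longleftrightarrow> 0 \<le> B \<and> 1 \<le> N0 \<and>
     (\<forall>N\<ge>N0. \<forall>D e. log_slope x0 C1 N D \<and> 0 < \<bar>e\<bar> \<and> \<bar>e\<bar> \<le> c / real N \<longrightarrow>
     (\<integral>\<^sup>+x. ennreal (V x powr (- (k_exp s z + e)) * (\<tau> * N powr (z - 1) * D x powr z) powr (1 + (k_exp s z + e))) \<partial>\<mu>) \<le> ennreal B)"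

lemma slope_bound_exists:
  assumes z: "z \<in> {p, q}" and "0 \<le> \<tau>" "0 \<le> c"
  shows "\<exists>B N0. slope_bound z \<tau> c B N0"
proof -
  obtain C0 C R0 \<epsilon>0 where *: "C0 \<ge> 0" "C \<ge> 0" "\<epsilon>0 > 0"
    "\<And>R e. R \<ge> R0 \<Longrightarrow> 0 < \<bar>e\<bar> \<Longrightarrow> \<bar>e\<bar> \<le> \<epsilon>0 \<Longrightarrow>
       (\<integral>\<^sup>+x\<in>ball x0 R - ball x0 (R / 2). ennreal (V x powr (- (k_exp s z + e))) \<partial>\<mu>)
          \<le> ennreal (C * R powr (z * (1 + k_exp s z) + C0 * \<bar>e\<bar>) * ln R powr k_exp s z)"
    using growth[OF z] unfolding exponent_facts(4)[OF z] by (elim exE conjE) blast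
  have "\<exists>B\<ge>0. \<exists>N0\<ge>1. \<forall>N\<ge>N0. \<forall>D e. log_slope x0 C1 N D \<and> 0 < \<bar>e\<bar> \<and> \<bar>e\<bar> \<le> c / real N \<longrightarrow>
     (\<integral>\<^sup>+x. ennreal (V x powr (- (k_exp s z + e)) * (\<tau> * N powr (z - 1) * D x powr z) powr (1 + (k_exp s z + e))) \<partial>\<mu>) \<le> ennreal B"
  proof (rule weighted_slope_bounded[OF sets V_measurable, where ?R0.0=R0 and ?\<epsilon>0.0=\<epsilon>0 and C=C and ?C0.0=C0])
    show "(\<integral>\<^sup>+x\<in>ball x0 R - ball x0 (R / 2). ennreal (V x powr (- (k_exp s z + e))) \<partial>\<mu>)
          \<le> ennreal (C * R powr (z * (1 + k_exp s z) + C0 * \<bar>e\<bar>) * ln R powr k_exp s z)"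
      if "R \<ge> R0" "0 < \<bar>e\<bar>" "\<bar>e\<bar> \<le> \<epsilon>0" for R e using that by (rule *(4))
  qed (use *(1-3) exponent_facts(1,3)[OF z] C1 assms in auto)
  then show ?thesis unfolding slope_bound_def by blast
qed

text \<open>The choice a = t = 1/N, \<alpha> = t/2, \<beta> = z - 1 - t, \<gamma> = s - t gives \<sigma> = k - t/(s - z + 1). The term with \<eta> is estimated by
(1 + u)^s \<le> 2^s (1 + u^s), which produces the integral of V; with \<eta> = 2^(-s)/4 it is at most a quarter of the
V-integral on the left plus a constant, for each of the two exponents. So half of the left side remains.\<close>
lemma energy_bound:
  "\<exists>K\<ge>0. \<exists>N1\<ge>1. \<forall>N\<ge>N1. \<forall>f D. log_cutoff \<mu> x0 C1 N f D \<and> energy_inequality \<mu> p q s V u G m (1 / real N) f D \<longrightarrow>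
     (\<integral>x. V x * u x powr s * (1 + u x) powr (- (1 / real N)) * f x ^ m \<partial>\<mu>) \<le> K \<and>
     (\<forall>z\<in>{p, q}. (\<integral>x. G x powr z * (1 + u x) powr (- (1 / real N) - 1) * f x ^ m \<partial>\<mu>) \<le> K * N)"
proof -
  define \<eta> :: real where "\<eta> = (1/4) * 2 powr (- s)"
  have \<eta>: "0 < \<eta>" "\<eta> \<le> 1"
  proof -
    have "2 powr (- s) \<le> (2::real) powr 0" using exponent_facts(5)[of p] by (intro powr_mono) auto
    then show "0 < \<eta>" "\<eta> \<le> 1" by (auto simp: \<eta>_def)
  qed
  have "\<forall>z\<in>{p,q}. \<exists>B N0. slope_bound z (2 powr (z - 1) * m powr z) (1 / (s - z + 1)) B N0"
    using exponent_facts(2) by (intro ballI slope_bound_exists) (auto intro: less_imp_le)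
  then obtain B N0 where SB: "\<And>z. z\<in>{p,q} \<Longrightarrow> slope_bound z (2 powr (z - 1) * m powr z) (1 / (s - z + 1)) (B z) (N0 z)"
    by metis
  have B: "0 \<le> B z" if "z \<in> {p,q}" for z using SB[OF that] by (simp add: slope_bound_def)
  have E: "(\<integral>\<^sup>+x. ennreal (V x powr (- (k_exp s z + e)) * ((2 powr (z - 1) * m powr z) * N powr (z - 1) * D x powr z) powr (1 + (k_exp s z + e))) \<partial>\<mu>) \<le> ennreal (B z)"
    if "z\<in>{p,q}" "N \<ge> N0 z" "log_slope x0 C1 N D" "0 < \<bar>e\<bar>" "\<bar>e\<bar> \<le> (1 / (s - z + 1)) / real N" for z N D e
    using SB[OF that(1)] that(2-) unfolding slope_bound_def by blast
  define K0 where "K0 = (\<integral>x. V x \<partial>\<mu>) / 2 + \<eta> powr (- k_exp s p) * B p + \<eta> powr (- k_exp s q) * B q"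
  define N1 where "N1 = Suc (N0 p + N0 q + nat \<lceil>1 / (q - 1)\<rceil>)"
  have IV: "0 \<le> (\<integral>x. V x \<partial>\<mu>)" using V_pos by (intro integral_nonneg_AE) auto
  have K0: "0 \<le> K0" using IV B by (simp add: K0_def)
  have "(\<integral>x. V x * u x powr s * (1 + u x) powr (- (1 / real N)) * f x ^ m \<partial>\<mu>) \<le> 2 * K0 \<and>
     (\<forall>z\<in>{p, q}. (\<integral>x. G x powr z * (1 + u x) powr (- (1 / real N) - 1) * f x ^ m \<partial>\<mu>) \<le> (2 * K0) * N)"
    if N: "N \<ge> N1" and cut: "log_cutoff \<mu> x0 C1 N f D" and en: "energy_inequality \<mu> p q s V u G m (1 / real N) f D" for N f D
  proof -
    define t where "t = 1 / real N"
    have Np: "0 < real N" "N \<ge> N0 p" "N \<ge> N0 q" "real N \<ge> 1 / (q - 1)" using N unfolding N1_def by linarith+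
    have t: "0 < t" using Np by (simp add: t_def)
    have tq: "t \<le> q - 1" using Np exponents by (simp add: t_def field_simps)
    note en = en[folded t_def]
    have cutm[measurable]: "f \<in> borel_measurable \<mu>" "D \<in> borel_measurable \<mu>"
      and f: "\<And>x. 0 \<le> f x" "\<And>x. f x \<le> 1" and D: "log_slope x0 C1 N D"
      using cut by (auto simp: log_cutoff_def)
    have D0: "0 \<le> D x" for x using D by (simp add: log_slope_def)
    define I where "I = (\<integral>x. V x * u x powr s * (1 + u x) powr (- t) * f x ^ m \<partial>\<mu>)"
    define A where "A z = (\<integral>x. G x powr z * (1 + u x) powr (- t - 1) * f x ^ m \<partial>\<mu>)" for z
    have intI: "integrable \<mu> (\<lambda>x. V x * u x powr s * (1 + u x) powr (- t) * f x ^ m)"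
      using en by (simp add: energy_inequality_def)
    have A0: "0 \<le> A z" for z unfolding A_def using f by (intro Bochner_Integration.integral_nonneg) auto
    have flux: "m * (\<integral>x. f x ^ (m - 1) * (1 + u x) powr (- t) * G x powr (z - 1) * D x \<partial>\<mu>)
       \<le> (t / 2) * A z + (I + (\<integral>x. V x \<partial>\<mu>)) / 4 + \<eta> powr (- k_exp s z) * B z" if z: "z \<in> {p, q}" for z
    proof -
      note ez = exponent_facts[OF z]
      define e where "e = - t / (s - z + 1)"
      define \<sigma> where "\<sigma> = k_exp s z + e"
      have \<sigma>: "\<sigma> = (z - 1 - t) / (s - t - (z - 1 - t))" 
      proof -
        have "s - t - (z - 1 - t) = s - z + 1" by simp
        then show ?thesis unfolding \<sigma>_def e_def k_exp_def
          by (metis add_divide_distrib diff_conv_add_uminus minus_divide_left)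
      qed
      have e: "e < 0" "0 < \<bar>e\<bar>" "\<bar>e\<bar> \<le> (1 / (s - z + 1)) / real N" 
      proof -
        define r where "r = t / (s - z + 1)"
        have "0 < r" using ez t by (simp add: r_def)
        moreover have "e = - r" by (simp add: e_def r_def)
        ultimately show "e < 0" "0 < \<bar>e\<bar>" by auto
        then have "\<bar>e\<bar> = t / (s - z + 1)" using \<open>e = - r\<close> unfolding r_def[symmetric] by simp
        then show "\<bar>e\<bar> \<le> (1 / (s - z + 1)) / real N" by (simp add: t_def mult.commute)
      qed
      have z1: "t \<le> z - 1" using z tq exponents by auto
      let ?F = "\<lambda>x. V x * (1 + u x) powr (s - t) * f x ^ m * (if D x = 0 then 0 else 1)"
      have AEF: "AE x in \<mu>. 0 \<le> ?F x \<and> ?F x \<le> 2 powr s * (V x * u x powr s * (1 + u x) powr (- t) * f x ^ m + V x)"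
        using u_nonneg V_pos
      proof eventually_elim
        case (elim x)
        have "?F x \<le> V x * (1 + u x) powr (s - t) * f x ^ m * 1"
          using elim f by (intro mult_left_mono) auto
        also have "\<dots> = V x * (1 + u x) powr s * ((1 + u x) powr (- t) * f x ^ m)"
          by (simp add: powr_diff powr_minus_divide)
        also have "\<dots> \<le> V x * (2 powr s * (1 powr s + u x powr s)) * ((1 + u x) powr (- t) * f x ^ m)"
          using elim f ez by (intro mult_right_mono mult_left_mono sum_powr_le) auto
        also have "\<dots> = 2 powr s * (V x * u x powr s * (1 + u x) powr (- t) * f x ^ m + V x * ((1 + u x) powr (- t) * f x ^ m))"
          by (simp add: algebra_simps)
        also have "\<dots> \<le> 2 powr s * (V x * u x powr s * (1 + u x) powr (- t) * f x ^ m + V x * 1)"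
        proof -
          have "(1 + u x) powr (- t) \<le> (1 + u x) powr 0" using elim t by (intro powr_mono) auto
          then have "(1 + u x) powr (- t) * f x ^ m \<le> 1 * 1"
            using f elim by (intro mult_mono) (auto simp: power_le_one)
          then show ?thesis using elim by (intro mult_left_mono add_left_mono) auto
        qed
        finally show ?case using elim f by simp
      qed
      have intF: "integrable \<mu> ?F"
        using intI V_integrable by (intro integrable_sandwich[OF _ _ AEF]) auto
      have "(\<integral>x. ?F x \<partial>\<mu>) \<le> (\<integral>x. 2 powr s * (V x * u x powr s * (1 + u x) powr (- t) * f x ^ m + V x) \<partial>\<mu>)"
        using AEF intI V_integrable intF by (intro integral_mono_AE) auto
      also have "\<dots> = 2 powr s * (I + (\<integral>x. V x \<partial>\<mu>))" using intI V_integrable by (simp add: I_def)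
      finally have F: "\<eta> * (\<integral>x. ?F x \<partial>\<mu>) \<le> \<eta> * (2 powr s * (I + (\<integral>x. V x \<partial>\<mu>)))" using \<eta> by (intro mult_left_mono) auto
      also have "\<dots> = (I + (\<integral>x. V x \<partial>\<mu>)) / 4" by (simp add: \<eta>_def powr_minus field_simps)
      finally have F: "\<eta> * (\<integral>x. ?F x \<partial>\<mu>) \<le> (I + (\<integral>x. V x \<partial>\<mu>)) / 4" .
      have al: "(t / 2) powr (1 - z) * m powr z = (2 powr (z - 1) * m powr z) * N powr (z - 1)"
      proof -
        have "(t / 2) powr (1 - z) = 1 / (2 * real N) powr (1 - z)"
          using Np powr_divide[of 1 "2 * real N" "1 - z"] by (simp add: t_def mult.commute)
        also have "\<dots> = (2 * real N) powr (z - 1)" using powr_minus_divide[of "2 * real N" "1 - z"] by simp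
        finally show ?thesis by (simp add: powr_mult)
      qed
      have "m * (\<integral>x. f x ^ (m - 1) * (1 + u x) powr (- t) * G x powr (z - 1) * D x \<partial>\<mu>)
        \<le> (t / 2) * (\<integral>x. G x powr z * (1 + u x) powr (- t - 1) * f x ^ m \<partial>\<mu>)
         + \<eta> * (\<integral>x. ?F x \<partial>\<mu>) + \<eta> powr (- \<sigma>) * B z"
      proof (rule flux_bound[where \<beta>="z - 1 - t" and \<sigma>=\<sigma>])
        show "z * (1 + \<sigma>) \<le> m"
        proof -
          have "z * (1 + \<sigma>) \<le> s_exp s z" unfolding ez(4) \<sigma>_def using ez e by (intro mult_left_mono) auto
          then show ?thesis using m_ge(2)[OF z] by simp
        qed
        show "(\<integral>\<^sup>+x. ennreal (V x powr (- \<sigma>) * ((t / 2) powr (1 - z) * m powr z * D x powr z) powr (1 + \<sigma>)) \<partial>\<mu>) \<le> ennreal (B z)"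
          unfolding al \<sigma>_def using Np z by (intro E D e) auto
        show "integrable \<mu> (\<lambda>x. f x ^ (m - 1) * (1 + u x) powr (- t) * G x powr (z - 1) * D x)"
          "integrable \<mu> (\<lambda>x. G x powr z * (1 + u x) powr (- t - 1) * f x ^ m)"
          using en z by (auto simp: energy_inequality_def)
        show "z - 1 - t < s - t" using ez by simp
        show "z - 1 - t = (t + 1) * (z - 1) - t * z" by (simp add: algebra_simps)
      qed (use f D0 G_nonneg v_ge_1 V_pos ez m_ge t \<eta> z1 intF B z \<sigma> in \<open>auto\<close>)
      moreover have "\<eta> powr (- \<sigma>) * B z \<le> \<eta> powr (- k_exp s z) * B z"
        using \<eta> e B[OF z] unfolding \<sigma>_def by (intro mult_right_mono powr_mono') auto
      ultimately show ?thesis using F unfolding A_def by linarith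
    qed
    have "I + t * (A p + A q) \<le> m * (\<integral>x. f x ^ (m - 1) * (1 + u x) powr (- t) * G x powr (p - 1) * D x \<partial>\<mu>)
       + m * (\<integral>x. f x ^ (m - 1) * (1 + u x) powr (- t) * G x powr (q - 1) * D x \<partial>\<mu>)"
      using en by (simp add: energy_inequality_def I_def A_def)
    moreover have "i / 2 + a / 2 + b / 2 \<le> w / 2 + c + d"
      if "i + (a + b) \<le> x + y" "x \<le> a / 2 + (i + w) / 4 + c" "y \<le> b / 2 + (i + w) / 4 + d"
      for i a b w c d x y :: real using that by argo
    ultimately have main: "I / 2 + t / 2 * A p + t / 2 * A q \<le> K0"
      using flux[of p] flux[of q] unfolding K0_def distrib_left times_divide_eq_left by blast
    have I0: "0 \<le> I" unfolding I_def using f V_pos by (intro integral_nonneg_AE) (auto elim!: eventually_mono)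
    have tA: "0 \<le> t / 2 * A z" for z using A0[of z] t by simp
    have "I \<le> 2 * K0" using main tA[of p] tA[of q] by simp
    moreover have "A z \<le> (2 * K0) * N" if "z \<in> {p, q}" for z
    proof -
      have "t / 2 * A z \<le> K0" using main I0 tA[of p] tA[of q] that by auto
      then show ?thesis using Np by (simp add: t_def field_simps)
    qed
    ultimately show ?thesis unfolding I_def A_def t_def by auto
  qed
  then show ?thesis using K0 by (intro exI[of _ "2 * K0"] conjI exI[of _ N1]) (auto simp: N1_def)
qed

text \<open>Fatou's lemma for N \<rightarrow> \<infinity>.\<close>
lemma energy_finite:
  assumes cut: "\<And>N. N \<ge> N2 \<Longrightarrow> log_cutoff \<mu> x0 C1 N (f N) (D N) \<and>
      (\<forall>t. 0 \<le> t \<and> t \<le> 1 \<longrightarrow> energy_inequality \<mu> p q s V u G m t (f N) (D N))"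
  shows "integrable \<mu> (\<lambda>x. V x * u x powr s)"
proof -
  obtain K N1 where K: "0 \<le> K" "1 \<le> N1" and raw: "\<forall>N\<ge>N1. \<forall>f D. log_cutoff \<mu> x0 C1 N f D \<and> energy_inequality \<mu> p q s V u G m (1 / real N) f D \<longrightarrow>
     (\<integral>x. V x * u x powr s * (1 + u x) powr (- (1 / real N)) * f x ^ m \<partial>\<mu>) \<le> K \<and>
     (\<forall>z\<in>{p, q}. (\<integral>x. G x powr z * (1 + u x) powr (- (1 / real N) - 1) * f x ^ m \<partial>\<mu>) \<le> K * N)"
    using energy_bound by (elim exE conjE) (rule that)
  have bnd: "(\<integral>x. V x * u x powr s * (1 + u x) powr (- (1 / real N)) * f x ^ m \<partial>\<mu>) \<le> K"
    if "N \<ge> N1" "log_cutoff \<mu> x0 C1 N f D" "energy_inequality \<mu> p q s V u G m (1 / real N) f D" for N f D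
    using raw[rule_format, OF that(1) conjI[OF that(2,3)]] by simp
  define N3 where "N3 = N1 + N2 + 1"
  define F where "F n x = V x * u x powr s * (1 + u x) powr (- (1 / real (n + N3))) * f (n + N3) x ^ m" for n x
  have N3: "n + N3 \<ge> N2" "n + N3 \<ge> N1" "n + N3 \<ge> 1" for n by (auto simp: N3_def)
  have c: "log_cutoff \<mu> x0 C1 (n + N3) (f (n + N3)) (D (n + N3))"
     "energy_inequality \<mu> p q s V u G m (1 / real (n + N3)) (f (n + N3)) (D (n + N3))" for n
    using cut[OF N3(1)[of n]] N3(3)[of n] by auto
  have fm[measurable]: "f (n + N3) \<in> borel_measurable \<mu>" and f0: "0 \<le> f (n + N3) x" for n x
    using c[of n] by (auto simp: log_cutoff_def)
  have lim: "AE x in \<mu>. (\<lambda>n. ennreal (F n x)) \<longlonglongrightarrow> ennreal (V x * u x powr s)"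
    using u_nonneg
  proof eventually_elim
    case (elim x)
    have "(\<lambda>n. 1 / real (n + N3)) \<longlonglongrightarrow> 0" 
      by (rule LIMSEQ_ignore_initial_segment[OF lim_const_over_n[of 1]])
    then have "(\<lambda>n. (1 + u x) powr (- (1 / real (n + N3)))) \<longlonglongrightarrow> (1 + u x) powr (- 0)"
      using elim by (intro tendsto_powr tendsto_const tendsto_minus) auto
    moreover have "(\<lambda>n. f (n + N3) x ^ m) \<longlonglongrightarrow> 1"
    proof (rule tendsto_eventually)
      obtain M :: nat where M: "dist x0 x < 2 ^ M" using real_arch_pow[of 2 "dist x0 x"] by auto
      show "\<forall>\<^sub>F n in sequentially. f (n + N3) x ^ m = 1"
        using eventually_ge_at_top[of M]
      proof eventually_elim
        case (elim n)
        have "(2::real) ^ M \<le> 2 ^ (n + N3)" using elim by (intro power_increasing) auto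
        then have "x \<in> ball x0 (2 ^ (n + N3))" unfolding mem_ball by (rule less_le_trans[OF M])
        then show ?case using c(1)[of n] by (simp add: log_cutoff_def)
      qed
    qed
    ultimately have "(\<lambda>n. F n x) \<longlonglongrightarrow> V x * u x powr s * (1 + u x) powr (- 0) * 1"
      unfolding F_def by (intro tendsto_mult tendsto_const)
    then show ?case using elim by (intro tendsto_ennrealI) (simp add: algebra_simps)
  qed
  have "(\<integral>\<^sup>+x. ennreal (V x * u x powr s) \<partial>\<mu>) = (\<integral>\<^sup>+x. liminf (\<lambda>n. ennreal (F n x)) \<partial>\<mu>)"
    using lim by (intro nn_integral_cong_AE) (auto elim!: eventually_mono dest!: lim_imp_Liminf[rotated])
  also have "\<dots> \<le> liminf (\<lambda>n. \<integral>\<^sup>+x. ennreal (F n x) \<partial>\<mu>)"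
    by (intro nn_integral_liminf) (auto simp: F_def)
  also have "\<dots> \<le> liminf (\<lambda>n. ennreal K)"
  proof (intro Liminf_mono always_eventually allI)
    fix n
    have int: "integrable \<mu> (F n)" unfolding F_def using c(2)[of n] by (simp add: energy_inequality_def)
    have "(\<integral>\<^sup>+x. ennreal (F n x) \<partial>\<mu>) = ennreal (\<integral>x. F n x \<partial>\<mu>)"
    proof (rule nn_integral_eq_integral[OF int])
      show "AE x in \<mu>. 0 \<le> F n x" using V_pos by eventually_elim (simp add: F_def f0)
    qed
    also have "\<dots> \<le> ennreal K" unfolding F_def using N3 c by (intro ennreal_leI bnd) auto
    finally show "(\<integral>\<^sup>+x. ennreal (F n x) \<partial>\<mu>) \<le> ennreal K" .
  qed
  also have "\<dots> = ennreal K" by (simp add: Liminf_const)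
  finally have "(\<integral>\<^sup>+x. ennreal (V x * u x powr s) \<partial>\<mu>) \<le> ennreal K" .
  then show ?thesis using V_pos
    by (intro integrableI_nonneg) (auto elim!: eventually_mono intro: le_less_trans)
qed

text \<open>Here the test function has t = 0, while the gradient term is the one bounded by K N in \<open>energy_bound\<close>,
with t = 1/N. The choice a = 0, \<alpha> = \<kappa>/N, \<beta> = (t + 1)(z - 1), \<gamma> = s gives \<sigma> = k + e with 0 < e = O(1/N).
The function H dominates V (1 + u)^s, and T N is its integral outside the ball of radius 2^N; it controls both the \<eta>-term and
the part of \<integral> V u^s that the cutoff misses.\<close>
lemma energy_small:
  assumes cut: "\<And>N. N \<ge> N2 \<Longrightarrow> log_cutoff \<mu> x0 C1 N (f N) (D N) \<and>
      (\<forall>t. 0 \<le> t \<and> t \<le> 1 \<longrightarrow> energy_inequality \<mu> p q s V u G m t (f N) (D N))"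
  shows "\<exists>K\<ge>0. \<forall>\<kappa>>0. \<exists>Bp Bq. \<forall>\<eta>\<ge>1.
     (\<integral>x. V x * u x powr s \<partial>\<mu>) \<le> 2 * \<kappa> * K + \<eta> powr (- k_exp s p) * Bp + \<eta> powr (- k_exp s q) * Bq"
proof -
  obtain K N1 where K: "0 \<le> K" "1 \<le> N1" and raw: "\<forall>N\<ge>N1. \<forall>f D. log_cutoff \<mu> x0 C1 N f D \<and> energy_inequality \<mu> p q s V u G m (1 / real N) f D \<longrightarrow>
     (\<integral>x. V x * u x powr s * (1 + u x) powr (- (1 / real N)) * f x ^ m \<partial>\<mu>) \<le> K \<and>
     (\<forall>z\<in>{p, q}. (\<integral>x. G x powr z * (1 + u x) powr (- (1 / real N) - 1) * f x ^ m \<partial>\<mu>) \<le> K * N)"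
    using energy_bound by (elim exE conjE) (rule that)
  have bnd: "(\<integral>x. G x powr z * (1 + u x) powr (- (1 / real N) - 1) * f x ^ m \<partial>\<mu>) \<le> K * N"
    if "N \<ge> N1" "log_cutoff \<mu> x0 C1 N f D" "energy_inequality \<mu> p q s V u G m (1 / real N) f D" "z \<in> {p, q}" for N f D z
    using raw[rule_format, OF that(1) conjI[OF that(2,3)]] that(4) by blast
  note int = energy_finite[of N2 f D, OF cut]
  define H where "H x = 2 powr s * (V x * u x powr s + V x)" for x
  have intH: "integrable \<mu> H" unfolding H_def using int V_integrable by simp
  have H0: "AE x in \<mu>. 0 \<le> H x \<and> V x * u x powr s \<le> H x"
    using V_pos u_nonneg
  proof eventually_elim
    case (elim x)
    have "1 * (V x * u x powr s) \<le> 2 powr s * (V x * u x powr s)"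
      using elim exponent_facts(5)[of p] by (intro mult_right_mono ge_one_powr_ge_zero) auto
    moreover have "0 \<le> V x * u x powr s" "0 \<le> 2 powr s * V x" using elim by auto
    ultimately have "V x * u x powr s \<le> H x" unfolding H_def distrib_left by linarith
    moreover have "0 \<le> H x" using elim by (simp add: H_def)
    ultimately show ?case by simp
  qed
  define T where "T N = (\<integral>x. H x * indicator (- ball x0 (2 ^ N)) x \<partial>\<mu>)" for N
  have T: "T \<longlonglongrightarrow> 0"
  proof -
    have "T \<longlonglongrightarrow> (\<integral>x. 0 \<partial>\<mu>)" unfolding T_def
    proof (rule integral_dominated_convergence[where w="\<lambda>x. norm (H x)"])
      show "AE x in \<mu>. (\<lambda>N. H x * indicator (- ball x0 (2 ^ N)) x) \<longlonglongrightarrow> 0"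
      proof (rule AE_I2, rule tendsto_eventually)
        fix x
        obtain M :: nat where M: "dist x0 x < 2 ^ M" using real_arch_pow[of 2 "dist x0 x"] by auto
        show "\<forall>\<^sub>F n in sequentially. H x * indicator (- ball x0 (2 ^ n)) x = 0"
          using eventually_ge_at_top[of M]
        proof eventually_elim
          case (elim n)
          have "(2::real) ^ M \<le> 2 ^ n" using elim by (intro power_increasing) auto
          then have "x \<in> ball x0 (2 ^ n)" unfolding mem_ball by (rule less_le_trans[OF M])
          then show ?case by (simp add: indicator_def)
        qed
      qed
      have [measurable]: "- ball x0 (2 ^ N) \<in> sets \<mu>" for N :: nat using sets by simp
      show "(\<lambda>x. H x * indicator (- ball x0 (2 ^ N)) x) \<in> borel_measurable \<mu>" for N
        using borel_measurable_integrable[OF intH] by measurable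
      show "AE x in \<mu>. norm (H x * indicator (- ball x0 (2 ^ N)) x) \<le> norm (H x)" for N
        by (intro AE_I2) (auto simp: indicator_def)
    qed (use intH in auto)
    then show ?thesis by simp
  qed
  have "\<exists>Bp Bq. \<forall>\<eta>\<ge>1. (\<integral>x. V x * u x powr s \<partial>\<mu>) \<le> 2 * \<kappa> * K + \<eta> powr (- k_exp s p) * Bp + \<eta> powr (- k_exp s q) * Bq"
    if \<kappa>: "0 < \<kappa>" for \<kappa>
  proof -
    \<comment> \<open>For large N one has s - \<beta> \<ge> (s - z + 1) / 2, and then \<sigma> - k \<le> c z / N.\<close>
    define c where "c z = 2 * s * (z - 1) / (s - z + 1)\<^sup>2" for z
    have c0: "0 < c z" if "z \<in> {p,q}" for z using exponent_facts[OF that] by (simp add: c_def)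
    have "\<forall>z\<in>{p,q}. \<exists>B N0. slope_bound z (\<kappa> powr (1 - z) * m powr z) (c z) B N0"
      using c0 by (intro ballI slope_bound_exists) (auto intro: less_imp_le)
    then obtain B N0 where SB: "\<And>z. z\<in>{p,q} \<Longrightarrow> slope_bound z (\<kappa> powr (1 - z) * m powr z) (c z) (B z) (N0 z)"
      by metis
    have B: "0 \<le> B z" if "z \<in> {p,q}" for z using SB[OF that] by (simp add: slope_bound_def)
    have E: "(\<integral>\<^sup>+x. ennreal (V x powr (- (k_exp s z + e)) * ((\<kappa> powr (1 - z) * m powr z) * N powr (z - 1) * D x powr z) powr (1 + (k_exp s z + e))) \<partial>\<mu>) \<le> ennreal (B z)"
      if "z\<in>{p,q}" "N \<ge> N0 z" "log_slope x0 C1 N D" "0 < \<bar>e\<bar>" "\<bar>e\<bar> \<le> c z / real N" for z N D e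
      using SB[OF that(1)] that(2-) unfolding slope_bound_def by blast
    have "(\<integral>x. V x * u x powr s \<partial>\<mu>) \<le> 2 * \<kappa> * K + \<eta> powr (- k_exp s p) * B p + \<eta> powr (- k_exp s q) * B q"
      if \<eta>: "1 \<le> \<eta>" for \<eta>
    proof (rule tendsto_le[OF sequentially_bot _ tendsto_const])
      have "(\<lambda>N. T N + 2 * \<eta> * T N + (2 * \<kappa> * K + \<eta> powr (- k_exp s p) * B p + \<eta> powr (- k_exp s q) * B q))
        \<longlonglongrightarrow> 0 + 2 * \<eta> * 0 + (2 * \<kappa> * K + \<eta> powr (- k_exp s p) * B p + \<eta> powr (- k_exp s q) * B q)"
        by (intro tendsto_add tendsto_mult tendsto_const T)
      then show "(\<lambda>N. T N + 2 * \<eta> * T N + (2 * \<kappa> * K + \<eta> powr (- k_exp s p) * B p + \<eta> powr (- k_exp s q) * B q))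
        \<longlonglongrightarrow> 2 * \<kappa> * K + \<eta> powr (- k_exp s p) * B p + \<eta> powr (- k_exp s q) * B q" by simp
      \<comment> \<open>N \<ge> b z ensures both this lower bound on s - \<beta> and z (\<sigma> - k) \<le> 1, as needed for the power m.\<close>
      define b where "b z = 2 * (z - 1) / (s - z + 1) + z * c z" for z
      show "\<forall>\<^sub>F N in sequentially. (\<integral>x. V x * u x powr s \<partial>\<mu>)
         \<le> T N + 2 * \<eta> * T N + (2 * \<kappa> * K + \<eta> powr (- k_exp s p) * B p + \<eta> powr (- k_exp s q) * B q)"
        using eventually_ge_at_top[of "Suc (N1 + N2 + N0 p + N0 q + nat \<lceil>b p\<rceil> + nat \<lceil>b q\<rceil>)"]
      proof eventually_elim
        case (elim N)
        have N: "N \<ge> N1" "N \<ge> N2" "N \<ge> N0 p" "N \<ge> N0 q" "0 < real N" "real N \<ge> b p" "real N \<ge> b q"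
          using elim by linarith+
        define t where "t = 1 / real N"
        have t: "0 < t" "t \<le> 1" using N by (auto simp: t_def)
        have lc: "log_cutoff \<mu> x0 C1 N (f N) (D N)" and e0: "energy_inequality \<mu> p q s V u G m 0 (f N) (D N)"
          and et: "energy_inequality \<mu> p q s V u G m t (f N) (D N)" using cut[OF N(2)] t by auto
        have cutm[measurable]: "f N \<in> borel_measurable \<mu>" "D N \<in> borel_measurable \<mu>"
          and f: "\<And>x. 0 \<le> f N x" "\<And>x. f N x \<le> 1" and f1: "\<And>x. x \<in> ball x0 (2 ^ N) \<Longrightarrow> f N x = 1"
          and D: "log_slope x0 C1 N (D N)"
          using lc by (auto simp: log_cutoff_def)
        have D0: "0 \<le> D N x" for x using D by (simp add: log_slope_def)
        have Dball: "D N x = 0" if x: "x \<in> ball x0 (2 ^ N)" for x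
        proof (rule ccontr)
          assume "D N x \<noteq> 0"
          then obtain j where j: "j \<in> {N+1..2*N}" "x \<notin> ball x0 (2 ^ j / 2)" using D unfolding log_slope_def by blast
          then obtain i where i: "j = Suc i" "N \<le> i" by (cases j) auto
          have "(2::real) ^ N \<le> 2 ^ i" using i by (intro power_increasing) auto
          moreover have "dist x0 x < 2 ^ N" using x by simp
          ultimately have "x \<in> ball x0 (2 ^ i)" unfolding mem_ball by (rule less_le_trans[rotated])
          then show False using j i by simp
        qed
        have flux: "m * (\<integral>x. f N x ^ (m - 1) * (1 + u x) powr (- 0) * G x powr (z - 1) * D N x \<partial>\<mu>)
           \<le> \<kappa> * K + \<eta> * T N + \<eta> powr (- k_exp s z) * B z" if z: "z \<in> {p, q}" for z
        proof -
          note ez = exponent_facts[OF z]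
          define \<beta> where "\<beta> = (t + 1) * (z - 1)"
          define e where "e = t * s * (z - 1) / ((s - z + 1) * (s - \<beta>))"
          have bz: "real N \<ge> b z" "N \<ge> N0 z" using N z by auto
          have zc: "0 \<le> z * c z" "0 \<le> 2 * (z - 1) / (s - z + 1)" using c0[OF z] ez by auto
          have "2 * (z - 1) / (s - z + 1) \<le> N" using bz zc unfolding b_def by linarith
          then have "t * (z - 1) \<le> (s - z + 1) / 2" using ez N by (simp add: t_def field_simps)
          then have "(s - z + 1) - (s - z + 1) / 2 \<le> (s - z + 1) - t * (z - 1)" by (rule diff_left_mono)
          also have "\<dots> = s - \<beta>" by (simp add: \<beta>_def algebra_simps)
          finally have sb: "s - \<beta> \<ge> (s - z + 1) / 2" by argo
          have "0 < (s - z + 1) / 2" using ez by simp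
          then have sb0: "0 < s - \<beta>" using sb by (rule less_le_trans)
          have \<beta>0: "0 \<le> \<beta>" using ez t by (simp add: \<beta>_def)
          have e: "0 < e" unfolding e_def using ez t sb0 by (intro divide_pos_pos mult_pos_pos) auto
          have ec: "e \<le> c z / N"
          proof -
            have "e \<le> t * s * (z - 1) / ((s - z + 1) * ((s - z + 1) / 2))"
              unfolding e_def using ez t sb sb0 by (intro divide_left_mono mult_left_mono mult_pos_pos) auto
            also have "\<dots> = c z / N" by (simp add: c_def t_def power2_eq_square mult_ac)
            finally show ?thesis .
          qed
          define \<sigma> where "\<sigma> = k_exp s z + e"
          have \<sigma>: "\<sigma> = \<beta> / (s - \<beta>)"
          proof -
            have "(z - 1) / (s - z + 1) = (z - 1) * (s - \<beta>) / ((s - z + 1) * (s - \<beta>))" using sb0 by simp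
            then have "\<sigma> = ((z - 1) * (s - \<beta>) + t * s * (z - 1)) / ((s - z + 1) * (s - \<beta>))"
              unfolding \<sigma>_def k_exp_def e_def by (simp only: add_divide_distrib)
            also have "(z - 1) * (s - \<beta>) + t * s * (z - 1) = (s - z + 1) * \<beta>" unfolding \<beta>_def by (simp add: algebra_simps)
            also have "\<dots> / ((s - z + 1) * (s - \<beta>)) = \<beta> / (s - \<beta>)" using ez by simp
            finally show ?thesis .
          qed
          let ?F = "\<lambda>x. V x * (1 + u x) powr s * f N x ^ m * (if D N x = 0 then 0 else 1)"
          have AEF: "AE x in \<mu>. 0 \<le> ?F x \<and> ?F x \<le> H x * indicator (- ball x0 (2 ^ N)) x"
            using u_nonneg V_pos H0
          proof eventually_elim
            case (elim x)
            show ?case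
            proof (cases "x \<in> ball x0 (2 ^ N)")
              case True then show ?thesis using Dball[OF True] by simp
            next
              case False
              have "?F x \<le> V x * (1 + u x) powr s * 1 * 1"
                using elim f by (intro mult_mono) (auto simp: power_le_one)
              also have "\<dots> \<le> V x * (2 powr s * (1 powr s + u x powr s))"
                using mult_left_mono[OF sum_powr_le[of 1 "u x" s], of "V x"] elim ez by simp
              also have "\<dots> = H x" by (simp add: H_def algebra_simps)
              finally show ?thesis using False elim f by simp
            qed
          qed
          have intHi: "integrable \<mu> (\<lambda>x. H x * indicator (- ball x0 (2 ^ N)) x)"
            using intH sets by (intro integrable_real_mult_indicator) auto
          have intF: "integrable \<mu> ?F"
            by (intro integrable_sandwich[OF intHi _ AEF]) auto
          have "(\<integral>x. ?F x \<partial>\<mu>) \<le> T N" unfolding T_def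
            using AEF intF intHi by (intro integral_mono_AE) auto
          then have F: "\<eta> * (\<integral>x. ?F x \<partial>\<mu>) \<le> \<eta> * T N" using \<eta> by (intro mult_left_mono) auto
          have al: "(\<kappa> / N) powr (1 - z) * m powr z = (\<kappa> powr (1 - z) * m powr z) * N powr (z - 1)"
          proof -
            have "(\<kappa> / N) powr (1 - z) = \<kappa> powr (1 - z) * (1 / real N powr (1 - z))"
              using N \<kappa> by (simp add: powr_divide)
            also have "1 / real N powr (1 - z) = N powr (z - 1)" using powr_minus_divide[of "real N" "1 - z"] by simp
            finally show ?thesis by simp
          qed
          have "m * (\<integral>x. f N x ^ (m - 1) * (1 + u x) powr (- 0) * G x powr (z - 1) * D N x \<partial>\<mu>)
            \<le> (\<kappa> / N) * (\<integral>x. G x powr z * (1 + u x) powr (- t - 1) * f N x ^ m \<partial>\<mu>)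
             + \<eta> * (\<integral>x. ?F x \<partial>\<mu>) + \<eta> powr (- \<sigma>) * B z"
          proof (rule flux_bound[where \<beta>=\<beta> and \<sigma>=\<sigma>])
            have "z * c z \<le> N" using bz zc unfolding b_def by linarith
            moreover have "z * e \<le> z * (c z / N)" using ec ez by (intro mult_left_mono) auto
            moreover have "z * (c z / N) \<le> 1" using \<open>z * c z \<le> N\<close> N by (simp add: field_simps)
            ultimately have "z * e \<le> 1" by linarith
            then have "z * (1 + \<sigma>) \<le> s_exp s z + 1" unfolding ez(4) \<sigma>_def by (simp add: algebra_simps)
            then show "z * (1 + \<sigma>) \<le> m" using m_ge(2)[OF z] by simp
            show "(\<integral>\<^sup>+x. ennreal (V x powr (- \<sigma>) * ((\<kappa> / N) powr (1 - z) * m powr z * D N x powr z) powr (1 + \<sigma>)) \<partial>\<mu>) \<le> ennreal (B z)"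
              unfolding al \<sigma>_def using bz z e ec by (intro E D) auto
            show "integrable \<mu> (\<lambda>x. f N x ^ (m - 1) * (1 + u x) powr (- 0) * G x powr (z - 1) * D N x)"
              using e0 z unfolding energy_inequality_def by blast
            show "integrable \<mu> (\<lambda>x. G x powr z * (1 + u x) powr (- t - 1) * f N x ^ m)"
              using et z unfolding energy_inequality_def by blast
            show "\<beta> < s" using sb0 by simp
            show "\<beta> = (t + 1) * (z - 1) - 0 * z" by (simp add: \<beta>_def)
            show "0 < \<kappa> / N" using \<kappa> N by simp
          qed (use f D0 G_nonneg v_ge_1 V_pos ez m_ge \<eta> \<beta>0 intF B z \<sigma> in \<open>auto\<close>)
          moreover have "\<eta> powr (- \<sigma>) * B z \<le> \<eta> powr (- k_exp s z) * B z"
            using \<eta> e B[OF z] unfolding \<sigma>_def by (intro mult_right_mono powr_mono) auto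
          moreover have "(\<kappa> / N) * (\<integral>x. G x powr z * (1 + u x) powr (- t - 1) * f N x ^ m \<partial>\<mu>) \<le> (\<kappa> / N) * (K * N)"
            using \<kappa> N lc et z unfolding t_def by (intro mult_left_mono bnd) auto
          moreover have "(\<kappa> / N) * (K * N) = \<kappa> * K" using N by simp
          ultimately show ?thesis using F by linarith
        qed
        have "(\<integral>x. V x * u x powr s \<partial>\<mu>) - T N = (\<integral>x. V x * u x powr s - H x * indicator (- ball x0 (2 ^ N)) x \<partial>\<mu>)"
          unfolding T_def using int intH sets
          by (intro Bochner_Integration.integral_diff[symmetric] integrable_real_mult_indicator) auto
        also have "\<dots> \<le> (\<integral>x. V x * u x powr s * (1 + u x) powr (- 0) * f N x ^ m \<partial>\<mu>)"
        proof (rule integral_mono_AE)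
          show "AE x in \<mu>. V x * u x powr s - H x * indicator (- ball x0 (2 ^ N)) x \<le> V x * u x powr s * (1 + u x) powr (- 0) * f N x ^ m"
            using u_nonneg V_pos H0
          proof eventually_elim
            case (elim x)
            have "0 \<le> V x * u x powr s * f N x ^ m" using elim f by simp
            then show ?case using elim f1[of x] by (cases "x \<in> ball x0 (2 ^ N)") (auto split: if_splits)
          qed
          show "integrable \<mu> (\<lambda>x. V x * u x powr s - H x * indicator (- ball x0 (2 ^ N)) x)"
            using int intH sets by (intro Bochner_Integration.integrable_diff integrable_real_mult_indicator) auto
          show "integrable \<mu> (\<lambda>x. V x * u x powr s * (1 + u x) powr (- 0) * f N x ^ m)"
            using e0 unfolding energy_inequality_def by blast
        qed
        also have "\<dots> \<le> m * (\<integral>x. f N x ^ (m - 1) * (1 + u x) powr (- 0) * G x powr (p - 1) * D N x \<partial>\<mu>)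
            + m * (\<integral>x. f N x ^ (m - 1) * (1 + u x) powr (- 0) * G x powr (q - 1) * D N x \<partial>\<mu>)"
          using e0 unfolding energy_inequality_def by (simp only: mult_zero_left add_0_right)
        finally have *: "(\<integral>x. V x * u x powr s \<partial>\<mu>) - T N \<le> \<dots>" .
        moreover have "i \<le> w + 2 * \<eta> * w + (2 * k + c + d)"
          if "i - w \<le> x + y" "x \<le> k + \<eta> * w + c" "y \<le> k + \<eta> * w + d"
          for i w k c d x y :: real using that by (simp add: algebra_simps)
        ultimately show ?case using flux[of p] flux[of q] unfolding mult.assoc[of 2 \<kappa> K] by blast
      qed
    qed
    then show ?thesis by blast
  qed
  then show ?thesis using K by blast
qed

text \<open>First \<eta> \<rightarrow> \<infinity> for fixed \<kappa>, then \<kappa> \<rightarrow> 0.\<close>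
lemma vanishing:
  assumes cut: "\<And>N. N \<ge> N2 \<Longrightarrow> log_cutoff \<mu> x0 C1 N (f N) (D N) \<and>
      (\<forall>t. 0 \<le> t \<and> t \<le> 1 \<longrightarrow> energy_inequality \<mu> p q s V u G m t (f N) (D N))"
  shows "AE x in \<mu>. u x = 0"
proof -
  let ?X = "\<integral>x. V x * u x powr s \<partial>\<mu>"
  obtain K where K: "0 \<le> K" and *: "\<And>\<kappa>. 0 < \<kappa> \<Longrightarrow> \<exists>Bp Bq. \<forall>\<eta>\<ge>1.
     ?X \<le> 2 * \<kappa> * K + \<eta> powr (- k_exp s p) * Bp + \<eta> powr (- k_exp s q) * Bq"
    using energy_small[of N2 f D, OF cut] by blast
  have le: "?X \<le> 2 * \<kappa> * K" if \<kappa>: "0 < \<kappa>" for \<kappa>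
  proof -
    obtain Bp Bq where B: "\<And>\<eta>. \<eta> \<ge> 1 \<Longrightarrow> ?X \<le> 2 * \<kappa> * K + \<eta> powr (- k_exp s p) * Bp + \<eta> powr (- k_exp s q) * Bq"
      using *[OF \<kappa>] by blast
    have lim: "((\<lambda>\<eta>::real. \<eta> powr (- k_exp s z)) \<longlongrightarrow> 0) at_top" if "z \<in> {p,q}" for z
      using exponent_facts(3)[OF that] by (intro tendsto_neg_powr filterlim_ident) auto
    have "((\<lambda>\<eta>. 2 * \<kappa> * K + \<eta> powr (- k_exp s p) * Bp + \<eta> powr (- k_exp s q) * Bq)
       \<longlongrightarrow> 2 * \<kappa> * K + 0 * Bp + 0 * Bq) at_top"
      by (intro tendsto_add tendsto_mult tendsto_const lim) auto
    then have "?X \<le> 2 * \<kappa> * K + 0 * Bp + 0 * Bq"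
      using B by (intro tendsto_lowerbound[where F="at_top :: real filter"]) (auto intro: eventually_at_top_linorderI)
    then show ?thesis by simp
  qed
  have "?X \<le> 0"
  proof (rule field_le_epsilon)
    fix e :: real assume "0 < e"
    have "?X \<le> 2 * (e / (2 * K + 1)) * K" using \<open>0 < e\<close> K by (intro le) auto
    also have "\<dots> = e * (2 * K / (2 * K + 1))" by simp
    also have "\<dots> \<le> e * 1" using \<open>0 < e\<close> K by (intro mult_left_mono) auto
    finally show "?X \<le> 0 + e" by simp
  qed
  moreover have nn: "AE x in \<mu>. 0 \<le> V x * u x powr s" using V_pos by eventually_elim auto
  ultimately have "?X = 0" using integral_nonneg_AE[OF nn] by simp
  then have "AE x in \<mu>. V x * u x powr s = 0"
    using integral_nonneg_eq_0_iff_AE[OF energy_finite[of N2 f D, OF cut] nn] by simp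
  then show ?thesis using V_pos by eventually_elim auto
qed
end

section \<open>Testing the inequality\<close>

text \<open>The power (1 + y)^(-t), continued linearly to negative y. The chain rule asks for a C1 function on the whole
line with bounded derivative, whereas u is nonnegative only almost everywhere.\<close>
definition decay :: "real \<Rightarrow> real \<Rightarrow> real" where
  "decay t y = (if 0 \<le> y then (1 + y) powr (- t) else 1 - t * y)"

definition decay' :: "real \<Rightarrow> real \<Rightarrow> real" where
  "decay' t y = - t * (1 + max 0 y) powr (- t - 1)"

lemma C1_decay: "C1_real (decay t) (decay' t)"
  unfolding C1_real_def
proof (intro conjI allI)
  have P: "((\<lambda>y. (1 + y) powr (- t)) has_real_derivative - t * (1 + y) powr (- t - 1)) (at y)" if "0 \<le> y" for y
    using that by (auto intro!: derivative_eq_intros)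
  have N: "((\<lambda>y. 1 - t * y) has_real_derivative - t) (at y)" for y
    by (auto intro!: derivative_eq_intros)
  fix y :: real
  consider "0 < y" | "y < 0" | "y = 0" by linarith
  then show "(decay t has_real_derivative decay' t y) (at y)"
  proof cases
    case 1
    then have "((\<lambda>y. (1 + y) powr (- t)) has_real_derivative decay' t y) (at y)" using P[of y] by (simp add: decay'_def)
    then show ?thesis
      by (rule has_field_derivative_transform_within_open[where S="{0<..}"]) (use 1 in \<open>auto simp: decay_def\<close>)
  next
    case 2
    then have "((\<lambda>y. 1 - t * y) has_real_derivative decay' t y) (at y)" using N[of y] by (simp add: decay'_def)
    then show ?thesis
      by (rule has_field_derivative_transform_within_open[where S="{..<0}"]) (use 2 in \<open>auto simp: decay_def\<close>)
  next
    case 3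
    have "((\<lambda>h. ((1 + h) powr (- t) - 1) / h) \<longlongrightarrow> - t) (at 0)" using P[of 0] by (simp add: DERIV_def)
    then have "((\<lambda>h. ((1 + h) powr (- t) - 1) / h) \<longlongrightarrow> - t) (at_right 0)" by (rule tendsto_mono[OF at_le, rotated]) simp
    then have r: "((\<lambda>h. (decay t h - 1) / h) \<longlongrightarrow> - t) (at_right 0)"
      by (rule Lim_transform_eventually) (auto simp: eventually_at_right_field decay_def intro!: exI[of _ 1])
    have l: "((\<lambda>h. (decay t h - 1) / h) \<longlongrightarrow> - t) (at_left 0)"
      by (rule Lim_transform_eventually[OF tendsto_const]) (auto simp: eventually_at_left_field decay_def intro!: exI[of _ "- 1"])
    have "((\<lambda>h. (decay t h - 1) / h) \<longlongrightarrow> - t) (at 0)" using filterlim_split_at[OF l r] .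
    then show ?thesis using 3 by (simp add: DERIV_def decay_def decay'_def)
  qed
next
  show "continuous_on UNIV (decay' t)" unfolding decay'_def
    by (intro continuous_intros) (auto simp: max_def)
qed

lemma decay'_bound: "0 \<le> t \<Longrightarrow> \<bar>decay' t y\<bar> \<le> t"
proof -
  assume t: "0 \<le> t"
  have "(1 + max 0 y) powr (- t - 1) \<le> (1 + max 0 y) powr 0" using t by (intro powr_mono) auto
  also have "\<dots> = 1" by (simp add: max_def)
  finally show ?thesis using t mult_left_mono[of "(1 + max 0 y) powr (- t - 1)" 1 t] by (simp add: decay'_def abs_mult)
qed

text \<open>Integrability of |\<nabla>u|^p on compact sets thus controls all smaller powers, in particular those with q.\<close>
lemma powr_le_one_plus:
  fixes x :: real assumes "0 \<le> x" "0 \<le> e" "e \<le> r"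
  shows "x powr e \<le> 1 + x powr r"
proof (cases "x \<le> 1")
  case True
  then have "x powr e \<le> 1" using assms by (simp add: powr_le1)
  then show ?thesis by (simp add: add_increasing2)
next
  case False
  then have "x powr e \<le> x powr r" using assms by (intro powr_mono) auto
  then show ?thesis by simp
qed

context riemannian_manifold
begin

lemma ginner_combination:
  "ginner M Z (\<lambda>c x. a x *\<^sub>R Y c x + b x *\<^sub>R X c x) x = a x * ginner M Z Y x + b x * ginner M Z X x"
  by (simp add: ginner_def Let_def matrix_vector_right_distrib matrix_vector_mult_scaleR inner_add_right)

lemma gnorm_combination_le:
  "gnorm M (\<lambda>c x. a x *\<^sub>R Y c x + b x *\<^sub>R X c x) x \<le> \<bar>a x\<bar> * gnorm M Y x + \<bar>b x\<bar> * gnorm M X x"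
proof -
  let ?W = "\<lambda>c x. a x *\<^sub>R Y c x + b x *\<^sub>R X c x"
  let ?n = "gnorm M ?W x" and ?S = "\<bar>a x\<bar> * gnorm M Y x + \<bar>b x\<bar> * gnorm M X x"
  have "?n * ?n = a x * ginner M ?W Y x + b x * ginner M ?W X x"
    using gnorm_square[of ?W x] ginner_combination[of ?W a Y b X x] by (simp add: power2_eq_square)
  also have "\<dots> \<le> \<bar>a x\<bar> * \<bar>ginner M ?W Y x\<bar> + \<bar>b x\<bar> * \<bar>ginner M ?W X x\<bar>"
    unfolding abs_mult[symmetric] by (intro add_mono abs_ge_self)
  also have "\<dots> \<le> \<bar>a x\<bar> * (?n * gnorm M Y x) + \<bar>b x\<bar> * (?n * gnorm M X x)"
    by (intro add_mono mult_left_mono ginner_Cauchy_Schwarz) auto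
  also have "\<dots> = ?S * ?n" by (simp add: algebra_simps)
  finally have le: "?n * ?n \<le> ?S * ?n" .
  show ?thesis
  proof (cases "?n = 0")
    case True then show ?thesis by (simp add: gnorm_nonneg)
  next
    case False
    then have "0 < ?n" using gnorm_nonneg[of ?W x] by simp
    with le show ?thesis by (rule mult_right_le_imp_le)
  qed
qed

text \<open>The test function is \<phi>^m \<open>decay\<close>(u). Its gradient is a \<nabla>\<phi> + b \<nabla>u; the part with b
produces the gradient terms, with the sign of \<open>decay'\<close>, and Cauchy-Schwarz bounds the part with a. All integrals converge
because the integrands are bounded by multiples of 1 + |\<nabla>u|^p on a compact set.\<close>
lemma cutoff_energy_inequality:
  assumes \<mu>: "riemannian_measure M \<mu>" and pq: "1 < q" "q \<le> p"
    and X: "weak_gradient M u X" "Lp_loc \<mu> p (gnorm M X)"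
    and um: "u \<in> borel_measurable \<mu>" and sol: "nonneg_weak_solution M \<mu> p q s V u"
    and \<phi>: "C1M \<phi>" "\<And>x. 0 \<le> \<phi> x" "\<And>x. \<phi> x \<le> 1" and K: "compact K" "\<And>x. x \<notin> K \<Longrightarrow> \<phi> x = 0"
    and B: "\<And>x. gnorm M (gradf \<phi>) x \<le> B" and m: "2 \<le> m" and t: "0 \<le> t"
  shows "energy_inequality \<mu> p q s V u (gnorm M X) m t \<phi> (gnorm M (gradf \<phi>))"
proof -
  define G where "G = gnorm M X"
  define D where "D = gnorm M (gradf \<phi>)"
  define w where "w x = \<phi> x ^ m" for x
  define a where "a x = decay t (u x) * (m * \<phi> x ^ (m - 1))" for x
  define b where "b x = w x * decay' t (u x)" for x
  define Y where "Y = (\<lambda>c x. a x *\<^sub>R gradf \<phi> c x + b x *\<^sub>R X c x)"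
  have sets: "sets \<mu> = sets borel" using \<mu> by (simp add: riemannian_measure_def)
  have u0: "AE x in \<mu>. 0 \<le> u x" using sol by (simp add: nonneg_weak_solution_def)
  have G0: "0 \<le> G x" and D0: "0 \<le> D x" for x by (auto simp: G_def D_def gnorm_nonneg)
  have B0: "0 \<le> B" using order_trans[OF gnorm_nonneg B] .
  have DB: "D x \<le> B" for x using B by (simp add: D_def)
  note um[measurable]
  have Gm[measurable]: "G \<in> borel_measurable \<mu>" using X(2) by (simp add: Lp_loc_def G_def)
  have \<phi>m[measurable]: "\<phi> \<in> borel_measurable \<mu>"
    using borel_measurable_continuous_onI[OF C1M_continuous[OF \<phi>(1)]] by (simp cong: measurable_cong_sets add: sets)
  have Dm[measurable]: "D \<in> borel_measurable \<mu>"
    unfolding D_def by (rule gnorm_measurable[OF weak_gradient_C1[OF X(1) \<phi>(1)] sets])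
  have Km[measurable]: "K \<in> sets \<mu>" using K(1) sets by (simp add: borel_closed compact_imp_closed)
  have pow: "C1_real (\<lambda>y. y ^ m) (\<lambda>y. m * y ^ (m - 1))"
    unfolding C1_real_def by (auto intro!: derivative_eq_intros continuous_intros)
  have wC1: "C1M w" unfolding w_def[abs_def] by (rule C1M_compose[OF pow \<phi>(1)])
  have psi: "weak_gradient M (\<lambda>x. w x * decay t (u x)) (product_field w (decay t) (decay' t) u X)"
    by (rule weak_gradient_product[OF X(1) wC1 C1_decay decay'_bound[OF t]])
  have Yeq: "product_field w (decay t) (decay' t) u X c x = Y c x" if "c \<in> charts M" "x \<in> cdom M c" for c x
    unfolding product_field_def Y_def w_def[abs_def] gradf_compose[OF \<phi>(1) pow that] a_def b_def w_def by simp
  \<comment> \<open>Y is a combination of the two gradients at every index; Z agrees with it on charts only, but is the weak gradient.\<close>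
  define Z where "Z = product_field w (decay t) (decay' t) u X"
  have gZ: "ginner M W Z x = ginner M W Y x" "gnorm M Z x = gnorm M Y x" for W x
    using Yeq[OF chart_at, of x] by (simp_all add: Z_def gnorm_def ginner_def Let_def)
  have wgZ: "weak_gradient M (\<lambda>x. w x * decay t (u x)) Z" using psi by (simp add: Z_def)
  have XZ: "ginner M X Z x = a x * ginner M X (gradf \<phi>) x + b x * (G x)\<^sup>2" for x
    unfolding gZ Y_def ginner_combination using gnorm_square[of X x] by (simp add: G_def)
  have nZ: "gnorm M Z x \<le> \<bar>a x\<bar> * D x + \<bar>b x\<bar> * G x" for x
    unfolding gZ Y_def D_def G_def by (rule gnorm_combination_le)
  have off: "w x = 0" "a x = 0" "b x = 0" if "x \<notin> K" for x
    using K(2)[OF that] m by (auto simp: w_def a_def b_def)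
  have w01: "0 \<le> w x" "w x \<le> 1" for x using \<phi> by (auto simp: w_def power_le_one)
  have phim: "0 \<le> \<phi> x ^ (m - 1)" "\<phi> x ^ (m - 1) \<le> 1" for x using \<phi> by (auto simp: power_le_one)
  have decay: "decay t (u x) = (1 + u x) powr (- t)" "decay' t (u x) = - t * (1 + u x) powr (- t - 1)"
    "0 \<le> (1 + u x) powr (- t)" "(1 + u x) powr (- t) \<le> 1" "0 \<le> (1 + u x) powr (- t - 1)" "(1 + u x) powr (- t - 1) \<le> 1"
    if "0 \<le> u x" for x
  proof -
    show "decay t (u x) = (1 + u x) powr (- t)" "decay' t (u x) = - t * (1 + u x) powr (- t - 1)"
      using that by (auto simp: decay_def decay'_def)
    have "(1 + u x) powr (- t) \<le> (1 + u x) powr 0" "(1 + u x) powr (- t - 1) \<le> (1 + u x) powr 0"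
      using that t by (intro powr_mono; simp)+
    then show "(1 + u x) powr (- t) \<le> 1" "(1 + u x) powr (- t - 1) \<le> 1" using that by auto
  qed auto
  have abb: "\<bar>a x\<bar> \<le> m" "\<bar>b x\<bar> \<le> t" if "0 \<le> u x" for x
  proof -
    have "\<bar>a x\<bar> = (1 + u x) powr (- t) * (m * \<phi> x ^ (m - 1))"
      using decay[OF that] phim[of x] by (simp add: a_def abs_mult)
    also have "\<dots> \<le> 1 * (real m * 1)" using decay[OF that] phim[of x] by (intro mult_mono mult_left_mono) auto
    finally show "\<bar>a x\<bar> \<le> m" by simp
    have "\<bar>b x\<bar> = w x * \<bar>decay' t (u x)\<bar>" using w01[of x] by (simp add: b_def abs_mult)
    also have "\<dots> \<le> 1 * t" using w01[of x] decay'_bound[OF t, of "u x"] t by (intro mult_mono) auto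
    finally show "\<bar>b x\<bar> \<le> t" by simp
  qed
  have Kfin: "emeasure \<mu> K < \<infinity>" by (rule emeasure_compact_finite[OF \<mu> K(1)])
  have dom: "integrable \<mu> (\<lambda>x. indicator K x * (1 + G x powr p))"
  proof -
    have "set_integrable \<mu> K (\<lambda>x. \<bar>gnorm M X x\<bar> powr p)" using X(2) K(1) by (simp add: Lp_loc_def)
    then have "integrable \<mu> (\<lambda>x. indicator K x * G x powr p)" by (simp add: set_integrable_def G_def gnorm_nonneg)
    moreover have "integrable \<mu> (indicator K :: 'a \<Rightarrow> real)" using Kfin by (intro integrable_real_indicator) auto
    ultimately have "integrable \<mu> (\<lambda>x. indicator K x + indicator K x * G x powr p)" by (intro Bochner_Integration.integrable_add)
    then show ?thesis by (simp add: distrib_left)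
  qed
  have intI: "integrable \<mu> f"
    if fm: "f \<in> borel_measurable \<mu>" and fb: "AE x in \<mu>. \<bar>f x\<bar> \<le> C * (indicator K x * (1 + G x powr p))" for f :: "'a \<Rightarrow> real" and C
  proof (rule Bochner_Integration.integrable_bound[OF integrable_mult_right[OF dom, of C] fm])
    show "AE x in \<mu>. norm (f x) \<le> norm (C * (indicator K x * (1 + G x powr p)))" using fb by eventually_elim auto
  qed
  have Zm[measurable]: "gnorm M Z \<in> borel_measurable \<mu>"
    by (rule gnorm_measurable[OF wgZ sets])
  have XZm[measurable]: "ginner M X Z \<in> borel_measurable \<mu>"
    using ginner_measurable_borel[OF X(1) wgZ] by (simp cong: measurable_cong_sets add: sets)
  have dm[measurable]: "decay t \<in> borel_measurable borel"
    using C1_decay[of t] by (intro borel_measurable_continuous_onI continuous_at_imp_continuous_on) (auto simp: C1_real_def intro: DERIV_isCont)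
  have wm[measurable]: "w \<in> borel_measurable \<mu>" unfolding w_def by measurable
  have psib: "AE x in \<mu>. 0 \<le> w x * decay t (u x) \<and> w x * decay t (u x) \<le> 1"
    using u0
  proof eventually_elim
    case (elim x)
    have "w x * (1 + u x) powr (- t) \<le> 1 * 1" using w01[of x] decay[OF elim] by (intro mult_mono) auto
    then show ?case using w01[of x] decay[OF elim] by simp
  qed
  have W1p: "W1p M \<mu> p (\<lambda>x. w x * decay t (u x))"
    unfolding W1p_def
  proof (intro conjI exI[of _ Z] wgZ)
    show "Lp \<mu> p (\<lambda>x. w x * decay t (u x))" unfolding Lp_def
    proof
      show "(\<lambda>x. w x * decay t (u x)) \<in> borel_measurable \<mu>" by measurable
      show "integrable \<mu> (\<lambda>x. \<bar>w x * decay t (u x)\<bar> powr p)"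
      proof (rule intI[where C=1])
        show "AE x in \<mu>. \<bar>\<bar>w x * decay t (u x)\<bar> powr p\<bar> \<le> 1 * (indicator K x * (1 + G x powr p))"
          using psib
        proof eventually_elim
          case (elim x)
          show ?case
          proof (cases "x \<in> K")
            case True
            have "\<bar>w x * decay t (u x)\<bar> powr p \<le> 1" using elim pq by (intro powr_le1) auto
            then show ?thesis using True by (simp add: add_increasing2)
          qed (simp add: off)
        qed
      qed measurable
    qed
    show "Lp \<mu> p (gnorm M Z)" unfolding Lp_def
    proof (intro conjI Zm)
      define C where "C = 2 powr p * ((m * B) powr p + t powr p)"
      show "integrable \<mu> (\<lambda>x. \<bar>gnorm M Z x\<bar> powr p)"
      proof (rule intI[where C=C])
        show "AE x in \<mu>. \<bar>\<bar>gnorm M Z x\<bar> powr p\<bar> \<le> C * (indicator K x * (1 + G x powr p))"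
          using u0
        proof eventually_elim
          case (elim x)
          show ?case
          proof (cases "x \<in> K")
            case True
            have "gnorm M Z x \<le> m * B + t * G x"
              using nZ[of x] abb[OF elim] DB[of x] G0[of x] D0[of x] mult_mono[of "\<bar>a x\<bar>" m "D x" B] mult_right_mono[of "\<bar>b x\<bar>" t "G x"] by simp
            then have "\<bar>gnorm M Z x\<bar> powr p \<le> (m * B + t * G x) powr p" using pq by (intro powr_mono2) (auto simp: gnorm_nonneg)
            also have "\<dots> \<le> 2 powr p * ((m * B) powr p + (t * G x) powr p)" using B0 t G0[of x] pq by (intro sum_powr_le) auto
            also have "\<dots> = 2 powr p * ((m * B) powr p * 1 + t powr p * G x powr p)" using t G0[of x] by (simp add: powr_mult)
            also have "\<dots> \<le> 2 powr p * ((m * B) powr p * (1 + G x powr p) + t powr p * (1 + G x powr p))"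
              by (intro mult_left_mono add_mono) auto
            also have "\<dots> = C * (1 + G x powr p)" by (simp add: C_def algebra_simps)
            finally show ?thesis using True by simp
          next
            case False
            have "gnorm M Z x \<le> 0" using nZ[of x] off[OF False] by simp
            then have "gnorm M Z x = 0" using gnorm_nonneg[of Z x] by simp
            then show ?thesis using False by simp
          qed
        qed
      qed measurable
    qed
  qed
  have Linf: "L_infinity \<mu> (\<lambda>x. w x * decay t (u x))" unfolding L_infinity_def
  proof (intro conjI exI[of _ 1])
    show "(\<lambda>x. w x * decay t (u x)) \<in> borel_measurable \<mu>" by measurable
    show "AE x in \<mu>. \<bar>w x * decay t (u x)\<bar> \<le> 1" using psib by eventually_elim auto
  qed
  have cs: "compactly_supported \<mu> (\<lambda>x. w x * decay t (u x))"
    unfolding compactly_supported_def using K(1) off by (intro exI[of _ K]) auto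
  have psi0: "AE x in \<mu>. 0 \<le> w x * decay t (u x)" using psib by eventually_elim auto
  have weak: "integrable \<mu> (\<lambda>x. V x * u x powr s * (w x * decay t (u x)))"
    "- (\<integral>x. G x powr (p - 2) * ginner M X Z x \<partial>\<mu>) - (\<integral>x. G x powr (q - 2) * ginner M X Z x \<partial>\<mu>)
        + (\<integral>x. V x * u x powr s * (w x * decay t (u x)) \<partial>\<mu>) \<le> 0"
    using sol W1p Linf cs psi0 X(1) wgZ unfolding nonneg_weak_solution_def G_def by blast+
  have intA: "integrable \<mu> (\<lambda>x. G x powr z * (1 + u x) powr (- t - 1) * \<phi> x ^ m)" if z: "z \<in> {p, q}" for z
  proof (rule intI[where C=1])
    show "AE x in \<mu>. \<bar>G x powr z * (1 + u x) powr (- t - 1) * \<phi> x ^ m\<bar> \<le> 1 * (indicator K x * (1 + G x powr p))"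
      using u0
    proof eventually_elim
      case (elim x)
      show ?case
      proof (cases "x \<in> K")
        case True
        have "\<bar>G x powr z * (1 + u x) powr (- t - 1) * \<phi> x ^ m\<bar> = G x powr z * ((1 + u x) powr (- t - 1) * w x)"
          using w01[of x] by (simp add: w_def abs_mult \<phi>)
        also have "\<dots> \<le> (1 + G x powr p) * (1 * 1)"
          using decay[OF elim] w01[of x] G0[of x] z pq by (intro mult_mono powr_le_one_plus) auto
        finally show ?thesis using True by simp
      next
        case False
        have z: "\<phi> x ^ m = 0" using off(1)[OF False] unfolding w_def .
        show ?thesis unfolding z using False by simp
      qed
    qed
  qed measurable
  have intF: "integrable \<mu> (\<lambda>x. \<phi> x ^ (m - 1) * (1 + u x) powr (- t) * G x powr (z - 1) * D x)" if z: "z \<in> {p, q}" for z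
  proof (rule intI[where C=B])
    show "AE x in \<mu>. \<bar>\<phi> x ^ (m - 1) * (1 + u x) powr (- t) * G x powr (z - 1) * D x\<bar> \<le> B * (indicator K x * (1 + G x powr p))"
      using u0
    proof eventually_elim
      case (elim x)
      show ?case
      proof (cases "x \<in> K")
        case True
        have "\<bar>\<phi> x ^ (m - 1) * (1 + u x) powr (- t) * G x powr (z - 1) * D x\<bar> = D x * (\<phi> x ^ (m - 1) * (1 + u x) powr (- t) * G x powr (z - 1))"
          using phim[of x] D0[of x] by (simp add: abs_mult \<phi>)
        also have "\<dots> \<le> B * (1 * 1 * (1 + G x powr p))"
          using decay[OF elim] phim[of x] G0[of x] DB[of x] D0[of x] B0 z pq by (intro mult_mono powr_le_one_plus) auto
        finally show ?thesis using True by simp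
      next
        case False
        have z: "\<phi> x ^ (m - 1) = 0" using K(2)[OF False] m by simp
        show ?thesis unfolding z using False by simp
      qed
    qed
  qed measurable
  \<comment> \<open>The powers are to be combined also where the gradient vanishes, since 0 powr r = 0.\<close>
  have Gz: "G x powr (z - 2) * G x = G x powr (z - 1)" "G x powr (z - 2) * (G x)\<^sup>2 = G x powr z" for x z
  proof -
    show "G x powr (z - 2) * G x = G x powr (z - 1)"
    proof (cases "G x = 0")
      case False
      then have "G x powr (z - 2) * G x powr 1 = G x powr (z - 2 + 1)" by (simp only: powr_add)
      then show ?thesis using G0[of x] by simp
    qed simp
    show "G x powr (z - 2) * (G x)\<^sup>2 = G x powr z"
    proof (cases "G x = 0")
      case False
      then have "G x powr (z - 2) * G x powr 2 = G x powr (z - 2 + 2)" by (simp only: powr_add)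
      then show ?thesis using G0[of x] False by simp
    qed simp
  qed
  have flux: "(\<integral>x. G x powr (z - 2) * ginner M X Z x \<partial>\<mu>)
     \<le> m * (\<integral>x. \<phi> x ^ (m - 1) * (1 + u x) powr (- t) * G x powr (z - 1) * D x \<partial>\<mu>)
       - t * (\<integral>x. G x powr z * (1 + u x) powr (- t - 1) * \<phi> x ^ m \<partial>\<mu>)" if z: "z \<in> {p, q}" for z
  proof -
    let ?F = "\<lambda>x. \<phi> x ^ (m - 1) * (1 + u x) powr (- t) * G x powr (z - 1) * D x"
    let ?A = "\<lambda>x. G x powr z * (1 + u x) powr (- t - 1) * \<phi> x ^ m"
    have AEb: "AE x in \<mu>. G x powr (z - 2) * ginner M X Z x \<le> m * ?F x - t * ?A x
       \<and> \<bar>G x powr (z - 2) * ginner M X Z x\<bar> \<le> m * ?F x + t * ?A x"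
      using u0
    proof eventually_elim
      case (elim x)
      define J where "J = G x powr (z - 2) * (a x * ginner M X (gradf \<phi>) x)"
      have eq: "G x powr (z - 2) * ginner M X Z x = J - t * ?A x"
      proof -
        have "G x powr (z - 2) * ginner M X Z x = J + b x * (G x powr (z - 2) * (G x)\<^sup>2)"
          unfolding XZ J_def by (simp add: algebra_simps)
        also have "b x * (G x powr (z - 2) * (G x)\<^sup>2) = - t * ?A x"
          unfolding Gz using decay(2)[OF elim] by (simp add: b_def w_def)
        finally show ?thesis by simp
      qed
      have J: "\<bar>J\<bar> \<le> m * ?F x"
      proof -
        have a0: "0 \<le> a x" using decay[OF elim] phim[of x] by (simp add: a_def)
        have "\<bar>J\<bar> = G x powr (z - 2) * (a x * \<bar>ginner M X (gradf \<phi>) x\<bar>)" using a0 by (simp add: J_def abs_mult)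
        also have "\<dots> \<le> G x powr (z - 2) * (a x * (G x * D x))"
          unfolding G_def D_def using a0 by (intro mult_left_mono ginner_Cauchy_Schwarz) auto
        also have "\<dots> = a x * (G x powr (z - 2) * G x) * D x" by (simp add: mult_ac)
        also have "\<dots> = m * ?F x" unfolding Gz a_def decay(1)[OF elim] by (simp add: mult_ac)
        finally show ?thesis .
      qed
      have "0 \<le> t * ?A x" using t \<phi> by simp
      then show ?case unfolding eq using J by linarith
    qed
    have int0: "integrable \<mu> (\<lambda>x. m * ?F x + t * ?A x)"
      by (intro Bochner_Integration.integrable_add integrable_mult_right intF[OF z] intA[OF z])
    have int1: "integrable \<mu> (\<lambda>x. G x powr (z - 2) * ginner M X Z x)"
    proof (rule Bochner_Integration.integrable_bound[OF int0])
      show "AE x in \<mu>. norm (G x powr (z - 2) * ginner M X Z x) \<le> norm (m * ?F x + t * ?A x)"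
        using AEb by eventually_elim auto
    qed measurable
    have "(\<integral>x. G x powr (z - 2) * ginner M X Z x \<partial>\<mu>) \<le> (\<integral>x. m * ?F x - t * ?A x \<partial>\<mu>)"
    proof (rule integral_mono_AE[OF int1])
      show "integrable \<mu> (\<lambda>x. m * ?F x - t * ?A x)"
        by (intro Bochner_Integration.integrable_diff integrable_mult_right intF[OF z] intA[OF z])
      show "AE x in \<mu>. G x powr (z - 2) * ginner M X Z x \<le> m * ?F x - t * ?A x" using AEb by eventually_elim auto
    qed
    also have "\<dots> = m * (\<integral>x. ?F x \<partial>\<mu>) - t * (\<integral>x. ?A x \<partial>\<mu>)"
      using intF[OF z] intA[OF z] by (subst Bochner_Integration.integral_diff) auto
    finally show ?thesis .
  qed
  have Veq: "AE x in \<mu>. V x * u x powr s * (w x * decay t (u x)) = V x * u x powr s * (1 + u x) powr (- t) * \<phi> x ^ m"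
    using u0 by eventually_elim (simp add: decay w_def)
  show ?thesis unfolding energy_inequality_def G_def[symmetric] D_def[symmetric]
  proof (intro conjI ballI intA intF)
    have Vm: "(\<lambda>x. V x * u x powr s * (w x * decay t (u x))) \<in> borel_measurable \<mu>" using weak(1) by auto
    \<comment> \<open>Only the product V u^s \<psi> is known to be measurable; dividing by the positive decay factor gives the integrand with (1 + u)^(-t).\<close>
    have key: "(\<lambda>x. V x * u x powr s * (1 + u x) powr (- t) * \<phi> x ^ m) = (\<lambda>x. (V x * u x powr s * (w x * decay t (u x))) * ((1 + u x) powr (- t) / decay t (u x)))"
      if "\<And>x. decay t (u x) \<noteq> 0" using that by (auto simp: w_def fun_eq_iff)
    have dnz: "decay t y \<noteq> 0" for y
    proof (cases "0 \<le> y")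
      case True
      then have "0 < (1 + y) powr (- t)" by simp
      then show ?thesis using True by (simp add: decay_def)
    next
      case False
      then have "t * y \<le> 0" using t by (simp add: mult_nonneg_nonpos)
      then show ?thesis using False by (simp add: decay_def)
    qed
    have Vm2: "(\<lambda>x. V x * u x powr s * (1 + u x) powr (- t) * \<phi> x ^ m) \<in> borel_measurable \<mu>"
      unfolding key[OF dnz] by (intro borel_measurable_times Vm) measurable
    show "integrable \<mu> (\<lambda>x. V x * u x powr s * (1 + u x) powr (- t) * \<phi> x ^ m)"
      using integrable_cong_AE[OF Vm Vm2 Veq] weak(1) by simp
    have "(\<integral>x. V x * u x powr s * (w x * decay t (u x)) \<partial>\<mu>) = (\<integral>x. V x * u x powr s * (1 + u x) powr (- t) * \<phi> x ^ m \<partial>\<mu>)"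
      by (rule integral_cong_AE[OF Vm Vm2 Veq])
    then show "(\<integral>x. V x * u x powr s * (1 + u x) powr (- t) * \<phi> x ^ m \<partial>\<mu>)
       + t * ((\<integral>x. G x powr p * (1 + u x) powr (- t - 1) * \<phi> x ^ m \<partial>\<mu>)
            + (\<integral>x. G x powr q * (1 + u x) powr (- t - 1) * \<phi> x ^ m \<partial>\<mu>))
     \<le> m * (\<integral>x. \<phi> x ^ (m - 1) * (1 + u x) powr (- t) * G x powr (p - 1) * D x \<partial>\<mu>)
       + m * (\<integral>x. \<phi> x ^ (m - 1) * (1 + u x) powr (- t) * G x powr (q - 1) * D x \<partial>\<mu>)"
      using weak(2) flux[of p] flux[of q] by (simp add: distrib_left)
  qed
qed

text \<open>The differential bounds of \<open>log_cutoff_exists\<close>, restated for the gradient field.\<close>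
lemma log_slope_cutoff:
  fixes x0 :: 'a
  assumes complete: "complete (UNIV :: 'a set)" and N: "4 \<le> N"
  shows "\<exists>f. C1M f \<and> (\<forall>x. 0 \<le> f x \<and> f x \<le> 1 \<and> (x \<in> ball x0 (2 ^ N) \<longrightarrow> f x = 1) \<and>
     (x \<notin> cball x0 (2 ^ (2 * N)) \<longrightarrow> f x = 0)) \<and> log_slope x0 128 N (gnorm M (gradf f))"
proof -
  obtain f where f: "C1M f" and range: "\<forall>x. 0 \<le> f x \<and> f x \<le> 1 \<and> (x \<in> ball x0 (2 ^ N) \<longrightarrow> f x = 1) \<and>
      (x \<notin> cball x0 (2 ^ (2 * N)) \<longrightarrow> f x = 0)"
    and gr: "\<forall>x. \<exists>L\<ge>0. has_grad_le f x L \<and> (L = 0 \<or>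
      (\<exists>j\<in>{N+1..2*N}. x \<in> ball x0 (2 ^ j) - ball x0 (2 ^ j / 2) \<and> L \<le> 128 / (real N * 2 ^ j)))"
    using log_cutoff_exists[OF complete N, of x0] by (elim exE conjE) (rule that)
  have "log_slope x0 128 N (gnorm M (gradf f))"
    unfolding log_slope_def
  proof (rule allI, rule conjI[OF gnorm_nonneg])
    fix x
    obtain L where L: "L \<ge> 0" "has_grad_le f x L" and
      Lj: "L = 0 \<or> (\<exists>j\<in>{N+1..2*N}. x \<in> ball x0 (2 ^ j) - ball x0 (2 ^ j / 2) \<and> L \<le> 128 / (real N * 2 ^ j))"
      using spec[OF gr, of x] by (elim exE conjE) (rule that)
    have le: "gnorm M (gradf f) x \<le> L" by (rule gnorm_gradf_le[OF f L(2,1)])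
    from Lj show "gnorm M (gradf f) x = 0 \<or>
       (\<exists>j\<in>{N+1..2*N}. x \<in> ball x0 (2 ^ j) - ball x0 (2 ^ j / 2) \<and> gnorm M (gradf f) x \<le> 128 / (real N * 2 ^ j))"
    proof
      assume "L = 0"
      then show ?thesis using le gnorm_nonneg[of "gradf f" x] by simp
    next
      assume "\<exists>j\<in>{N+1..2*N}. x \<in> ball x0 (2 ^ j) - ball x0 (2 ^ j / 2) \<and> L \<le> 128 / (real N * 2 ^ j)"
      then obtain j where "j\<in>{N+1..2*N}" "x \<in> ball x0 (2 ^ j) - ball x0 (2 ^ j / 2)" "L \<le> 128 / (real N * 2 ^ j)"
        by (elim bexE conjE) (rule that)
      then show ?thesis using le by (intro disjI2 bexI[of _ j] conjI) auto
    qed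
  qed
  then show ?thesis using f range by (intro exI[of _ f] conjI)
qed

text \<open>The cutoff vanishes outside a closed ball, which is compact by completeness, so it can be tested with.\<close>
lemma log_cutoff_energy:
  fixes x0 :: 'a
  assumes complete: "complete (UNIV :: 'a set)" and \<mu>: "riemannian_measure M \<mu>" and pq: "1 < q" "q \<le> p"
    and X: "weak_gradient M u X" "Lp_loc \<mu> p (gnorm M X)"
    and um: "u \<in> borel_measurable \<mu>" and sol: "nonneg_weak_solution M \<mu> p q s V u"
    and m: "2 \<le> m" and N: "4 \<le> N"
  shows "\<exists>f. log_cutoff \<mu> x0 128 N f (gnorm M (gradf f)) \<and>
     (\<forall>t. 0 \<le> t \<and> t \<le> 1 \<longrightarrow> energy_inequality \<mu> p q s V u (gnorm M X) m t f (gnorm M (gradf f)))"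
proof -
  obtain f where f: "C1M f" and range: "\<forall>x. 0 \<le> f x \<and> f x \<le> 1 \<and> (x \<in> ball x0 (2 ^ N) \<longrightarrow> f x = 1) \<and>
      (x \<notin> cball x0 (2 ^ (2 * N)) \<longrightarrow> f x = 0)"
    and slope: "log_slope x0 128 N (gnorm M (gradf f))"
    using log_slope_cutoff[OF complete N, of x0] by (elim exE conjE) (rule that)
  have f01: "\<And>x. 0 \<le> f x" "\<And>x. f x \<le> 1" and supp: "\<And>x. x \<notin> cball x0 (2 ^ (2 * N)) \<Longrightarrow> f x = 0"
    using range by blast+
  have sets: "sets \<mu> = sets borel" using \<mu> by (simp add: riemannian_measure_def)
  have bound: "gnorm M (gradf f) x \<le> 128" for x by (rule log_slope_le[OF slope]) (use N in auto)
  have "f \<in> borel_measurable \<mu>"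
    using borel_measurable_continuous_onI[OF C1M_continuous[OF f]] by (simp cong: measurable_cong_sets add: sets)
  moreover have "gnorm M (gradf f) \<in> borel_measurable \<mu>"
    by (rule gnorm_measurable[OF weak_gradient_C1[OF X(1) f] sets])
  ultimately have "log_cutoff \<mu> x0 128 N f (gnorm M (gradf f))"
    unfolding log_cutoff_def using range slope by simp
  moreover have "energy_inequality \<mu> p q s V u (gnorm M X) m t f (gnorm M (gradf f))" if "0 \<le> t" for t
    by (rule cutoff_energy_inequality[OF \<mu> pq X um sol f f01 compact_cball_complete[OF complete] supp bound m that])
  ultimately show ?thesis by (intro exI[of _ f] conjI allI impI) simp_all
qed
end

section \<open>The vanishing theorem\<close>

theorem theorem1p6:
  fixes M :: "('i, 'a::{metric_space, second_countable_topology}, 'n::finite) riem"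
    and \<mu> :: "'a measure" and x0 :: 'a
    and p q s :: real and V u :: "'a \<Rightarrow> real"
  assumes "riemannian_manifold M"
    and "riemannian_measure M \<mu>"
    and "complete (UNIV :: 'a set)"
    and "\<not> compact (UNIV :: 'a set)"
    and "p \<ge> q" and "q > 1" and "s > p - 1"
    and "integrable \<mu> V" and "AE x in \<mu>. V x > 0"
    and "\<And>z. z \<in> {p, q} \<Longrightarrow>
      \<exists>C0 C. C0 > 0 \<and> C > 0 \<and> (\<exists>R0 \<epsilon>0. \<epsilon>0 > 0 \<and> (\<forall>R \<epsilon>. R \<ge> R0 \<and> 0 < \<epsilon> \<and> \<epsilon> \<le> \<epsilon>0 \<longrightarrow>
        (\<integral>\<^sup>+x\<in>ball x0 R - ball x0 (R / 2). ennreal (V x powr (- k_exp s z + \<epsilon>)) \<partial>\<mu>)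
          \<le> ennreal (C * R powr (s_exp s z + C0 * \<epsilon>) * ln R powr k_exp s z) \<and>
        (\<integral>\<^sup>+x\<in>ball x0 R - ball x0 (R / 2). ennreal (V x powr (- k_exp s z - \<epsilon>)) \<partial>\<mu>)
          \<le> ennreal (C * R powr (s_exp s z + C0 * \<epsilon>) * ln R powr k_exp s z)))"
    and "nonneg_weak_solution M \<mu> p q s V u"
  shows "AE x in \<mu>. u x = 0"
proof -
  interpret riemannian_manifold M by fact
  note \<mu> = assms(2) and complete = assms(3) and pq = assms(5-7) and V = assms(8,9) and growth = assms(10) and sol = assms(11)
  have sets: "sets \<mu> = sets borel" using \<mu> by (simp add: riemannian_measure_def)
  obtain X where X: "weak_gradient M u X" "Lp_loc \<mu> p (gnorm M X)"
    using sol unfolding nonneg_weak_solution_def W1p_loc_def by (elim exE conjE) (rule that)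
  have um: "u \<in> borel_measurable \<mu>" and u0: "AE x in \<mu>. 0 \<le> u x"
    using sol unfolding nonneg_weak_solution_def W1p_loc_def Lp_loc_def by - (elim conjE; assumption)+
  \<comment> \<open>The power m has to exceed both critical exponents by one; the summand 3 also ensures 2 \<le> m.\<close>
  define m where "m = nat \<lceil>max (s_exp s p) (s_exp s q)\<rceil> + 3"
  have m: "2 \<le> m" "s_exp s p + 1 \<le> m" "s_exp s q + 1 \<le> m"
    unfolding m_def by (auto simp: max_def) linarith+
  interpret critical_growth \<mu> x0 p q s 128 V u "gnorm M X" m
  proof
    show "0 \<le> gnorm M X x" for x by (rule gnorm_nonneg)
    show "s_exp s z + 1 \<le> m" if "z \<in> {p, q}" for z using that m by auto
    fix z assume "z \<in> {p, q}"
    from growth[OF this] obtain C0 C R0 \<epsilon>0 where g: "C0 > 0" "C > 0" "\<epsilon>0 > 0" and gr: "\<forall>R \<epsilon>. R \<ge> R0 \<and> 0 < \<epsilon> \<and> \<epsilon> \<le> \<epsilon>0 \<longrightarrow>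
        (\<integral>\<^sup>+x\<in>ball x0 R - ball x0 (R / 2). ennreal (V x powr (- k_exp s z + \<epsilon>)) \<partial>\<mu>)
          \<le> ennreal (C * R powr (s_exp s z + C0 * \<epsilon>) * ln R powr k_exp s z) \<and>
        (\<integral>\<^sup>+x\<in>ball x0 R - ball x0 (R / 2). ennreal (V x powr (- k_exp s z - \<epsilon>)) \<partial>\<mu>)
          \<le> ennreal (C * R powr (s_exp s z + C0 * \<epsilon>) * ln R powr k_exp s z)"
      by (elim exE conjE) (rule that)
    \<comment> \<open>The sign of e decides which of the two growth conditions applies.\<close>
    have *: "(\<integral>\<^sup>+x\<in>ball x0 R - ball x0 (R / 2). ennreal (V x powr (- (k_exp s z + e))) \<partial>\<mu>)
          \<le> ennreal (C * R powr (s_exp s z + C0 * \<bar>e\<bar>) * ln R powr k_exp s z)"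
      if R: "R \<ge> R0" and e: "0 < \<bar>e\<bar>" "\<bar>e\<bar> \<le> \<epsilon>0" for R e
    proof (cases "0 < e")
      case True
      then have *: "- (k_exp s z + e) = - k_exp s z - \<bar>e\<bar>" by simp
      show ?thesis unfolding * using gr[rule_format, of R "\<bar>e\<bar>", OF conjI[OF R conjI[OF e]]] by (rule conjunct2)
    next
      case False
      then have *: "- (k_exp s z + e) = - k_exp s z + \<bar>e\<bar>" by simp
      show ?thesis unfolding * using gr[rule_format, of R "\<bar>e\<bar>", OF conjI[OF R conjI[OF e]]] by (rule conjunct1)
    qed
    show "\<exists>C0\<ge>0. \<exists>C\<ge>0. \<exists>R0. \<exists>\<epsilon>0>0. \<forall>R e. R \<ge> R0 \<longrightarrow> 0 < \<bar>e\<bar> \<longrightarrow> \<bar>e\<bar> \<le> \<epsilon>0 \<longrightarrow>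
       (\<integral>\<^sup>+x\<in>ball x0 R - ball x0 (R / 2). ennreal (V x powr (- (k_exp s z + e))) \<partial>\<mu>)
          \<le> ennreal (C * R powr (s_exp s z + C0 * \<bar>e\<bar>) * ln R powr k_exp s z)"
      by (rule exI[of _ C0], rule conjI[OF less_imp_le[OF g(1)]], rule exI[of _ C], rule conjI[OF less_imp_le[OF g(2)]],
          rule exI[of _ R0], rule exI[of _ \<epsilon>0], rule conjI[OF g(3)]) (intro allI impI *)
  qed (fact sets pq V um u0 m | simp)+
  define good where "good N f \<longleftrightarrow> log_cutoff \<mu> x0 128 N f (gnorm M (gradf f)) \<and>
     (\<forall>t. 0 \<le> t \<and> t \<le> 1 \<longrightarrow> energy_inequality \<mu> p q s V u (gnorm M X) m t f (gnorm M (gradf f)))"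
    for N :: nat and f :: "'a \<Rightarrow> real"
  define f where "f N = (SOME g. good N g)" for N
  have "good N (f N)" if "4 \<le> N" for N
    unfolding f_def
    by (rule someI_ex[of "good N"], unfold good_def)
       (rule log_cutoff_energy[OF complete \<mu> pq(2,1) X um sol m(1) that])
  then show ?thesis unfolding good_def by (rule vanishing[where ?N2.0=4 and f=f])
qed

end
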